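(* There exist an absolute constant $c>0$ and $n_0\in\mathbb N$ such that for every $n\ge n_0$ and every set $P\subset\mathbb R^2$ of cardinality $n$, either there exists $q\in P$ such that $|\mathcal A_q(P)|\ge n^{1+c}$, or $P$ is of one of the following forms: 1. all of the points of $P$ are contained on a single line; 2. $n-1$ points of $P$ are on a single line; 3. $n-2$ points of $P$ are on a single line, and the other two points are symmetric with respect to that line (i.e. are reflections of each other in the line); 4. all of the points of $P$ are contained on a single circle; 5. $n-1$ points of $P$ are on a circle and the other point is the centre of that circle.
   Context: For three distinct points $p,q,r\in\mathbb R^2$, $\mathcal A(p,q,r)\in[0,\pi]$ denotes the (unoriented) angle at $q$ determined by the three points, i.e. the angle between the vectors $p-q$ and $r-q$. For a finite set $P\subset\mathbb R^2$ and a point $q\in\mathbb R^2$, the set of angles pinned at $q$ is $$\mathcal A_q(P):=\{\mathcal A(p,q,r): p,r\in P\setminus\{q\},\ p\neq r\}.$$ *)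

theory Defs
  imports "HOL-Analysis.Analysis"
begin

text \<open>Unoriented angle at \<open>q\<close>; meaningful only for \<open>p \<noteq> q\<close> and \<open>r \<noteq> q\<close>.\<close>

definition angle_at :: "real^2 \<Rightarrow> real^2 \<Rightarrow> real^2 \<Rightarrow> real" where
  "angle_at p q r = arccos (((p - q) \<bullet> (r - q)) / (norm (p - q) * norm (r - q)))"

definition pinned_angles :: "real^2 \<Rightarrow> (real^2) set \<Rightarrow> real set" where
  "pinned_angles q P = {angle_at p q r | p r. p \<in> P - {q} \<and> r \<in> P - {q} \<and> p \<noteq> r}"

definition is_line :: "(real^2) set \<Rightarrow> bool" where
  "is_line L \<longleftrightarrow> affine L \<and> aff_dim L = 1"

text \<open>On a line, \<open>closest_point\<close> is the orthogonal projection, so the midpoint of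
  \<open>x\<close> and its image is the foot of the perpendicular from \<open>x\<close>.\<close>

definition reflection_in :: "(real^2) set \<Rightarrow> real^2 \<Rightarrow> real^2" where
  "reflection_in L x = 2 *\<^sub>R closest_point L x - x"

end

theory Submission
  imports Defs "HOL-Library.Set_Algebras" "HOL-Computational_Algebra.Polynomial_Factorial" "HOL-Computational_Algebra.Field_as_Ring" "HOL-Real_Asymp.Real_Asymp"
begin

text \<open>
  Suppose that every pin \<open>q \<in> P\<close> sees fewer than \<open>n powr (1 + c)\<close> angles. The directions from a typical pin then form a set of
  almost \<open>n\<close> reals whose difference set is not much larger, so by the Pluennecke--Ruzsa inequalities all bounded sumsets of it are
  small. Consequently a pin cannot see a long lacunary sequence of angles with a fixed direction, as the subset sums would be distinct.

  Take a small ball with \<open>n powr \<beta>\<close> points and pins at a much larger distance. For an \<open>l\<close>-tuple of points in the ball, the sum of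
  its directions from a pin lies in a small sumset. Since the directions are analytic functions of the pin, they are determined up to
  a tiny error by their values at a few pins, and by the pigeonhole principle two tuples have the same sum at many pins. This puts
  many pins on an algebraic curve of bounded degree, which turns out to be a line or circle, unless the directions at most pins are
  poorly separated. In that case a robust version of Beck's theorem shows that almost all points lie in a thin strip. Iterating, the
  strips become thinner and thinner, and points outside the successive strips provide a forbidden lacunary sequence. Hence
  some line or circle contains \<open>n powr 0.92\<close> points of \<open>P\<close>.

  If two pins see the points of this line or circle under directions \<open>\<phi>(t)\<close> and \<open>\<psi>(t)\<close> such that \<open>\<phi>' / \<psi>'\<close> takes every value at most
  twice, then a squeezing argument for consecutive points contradicts the small doubling of the directions. This excludes
  pins off the line, apart from one point or a mirror pair, and pins off the circle, apart from its centre.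
\<close>

section \<open>Small doubling\<close>

text \<open>Nothing is known about the distances between the points, so no fixed scale is available.
  All estimates are relative to two radii, that of a smallest ball with more than \<open>b\<close>
  points and that of a well-populated shell around it, and every loss is a power of their ratio
  \<open>R / r\<close>. The robust Beck theorem loses the power \<open>2 * J\<close>; the logarithm
  series is cut at order \<open>d = 2 * J + 10\<close>, so that its error, with a factor
  \<open>(r / R) ^ (d - 1)\<close>, still gains after this loss. As the imaginary part of the
  expansion variable is bounded separately, the error also carries the width of the current strip as
  a factor: only so does a new strip come out thinner than the old one. This fixes the order of the
  choices: \<open>J\<close>, then \<open>d\<close>, then the tuple length \<open>l\<close> for which
  the tuples outnumber the possible values of \<open>2 * d\<close> observed sums, then the Bezout
  bound \<open>N\<close>, and \<open>c\<close> so small that sums of \<open>l + 1\<close> directions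
  stay controlled. The exponent 0.92 suits the final squeezing: with difference sets of size about
  \<open>n powr 1.01\<close> it works once a line or circle has clearly more than
  \<open>n powr (6.06 / 7)\<close> points.\<close>

primrec nsum :: "nat \<Rightarrow> 'a::comm_monoid_add set \<Rightarrow> 'a set" where
  "nsum 0 D = {0}"
| "nsum (Suc m) D = D + nsum m D"

lemma finite_nsum: "finite D \<Longrightarrow> finite (nsum m D)"
  by (induction m) (auto simp: finite_set_plus)

lemma sum_in_nsum:
  assumes "finite T" "\<And>t. t \<in> T \<Longrightarrow> f t \<in> D"
  shows "sum f T \<in> nsum (card T) D"
  using assms by (induction T rule: finite_induct) (auto simp: set_plus_intro)

lemma card_translate: "card ((+) (c::'a::cancel_semigroup_add) ` A) = card A"
  by (intro card_image inj_onI) simp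

lemma card_le_card_plus:
  fixes A B :: "'a::cancel_ab_semigroup_add set"
  assumes "finite A" "finite B" "x \<in> A"
  shows "card B \<le> card (A + B)"
proof -
  have "(+) x ` B \<subseteq> A + B" using assms by (auto simp: set_plus_def)
  then show ?thesis using card_mono[OF finite_set_plus[OF assms(1,2)]] card_translate[of x B] by metis
qed

text \<open>Petridis' argument: minimising the ratio makes the growth bound stable under adding any set.\<close>

lemma petridis:
  fixes X B :: "'a::ab_group_add set" and K :: real
  assumes X: "finite X" and B: "finite B" and card_XB: "card (X + B) \<le> K * card X"
    and minimal: "\<And>Y. Y \<subseteq> X \<Longrightarrow> Y \<noteq> {} \<Longrightarrow> K * card Y \<le> card (Y + B)"
    and C: "finite C"
  shows "card (X + B + C) \<le> K * card (X + C)"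
  using C
proof (induction C rule: finite_induct)
  case empty
  then show ?case by (simp add: set_plus_def)
next
  case (insert c C)
  \<comment> \<open>For \<open>x\<close> in \<open>Xc\<close> the translate of \<open>x + B\<close>
    by \<open>c\<close> is already covered, so new elements come only from sums outside
    \<open>Xc + B\<close>. Minimality bounds \<open>Xc + B\<close> from below, and \<open>W\<close>,
    the part of \<open>X\<close> whose translate by \<open>c\<close> adds nothing to
    \<open>X + C\<close>, lies inside \<open>Xc\<close>.\<close>
  define Xc where "Xc = {x \<in> X. \<forall>b\<in>B. x + b + c \<in> X + B + C}"
  define W where "W = {x \<in> X. x + c \<in> X + C}"
  have fin: "finite (X + B + C)" "finite (X + C)" "finite (X + B)" "finite Xc" "finite W"
    using X B insert.hyps by (auto simp: finite_set_plus Xc_def W_def)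
  have WXc: "W \<subseteq> Xc"
  proof
    fix x assume "x \<in> W"
    then obtain y d where "x \<in> X" "y \<in> X" "d \<in> C" "x + c = y + d"
      unfolding W_def set_plus_def by blast
    moreover from this have "x + b + c = y + b + d" for b by (metis add.assoc add.commute)
    ultimately have "x + b + c \<in> X + B + C" if "b \<in> B" for b
      using that by (metis set_plus_intro)
    then show "x \<in> Xc" using \<open>x \<in> X\<close> unfolding Xc_def by auto
  qed
  have "X + B + insert c C \<subseteq> (X + B + C) \<union> (\<lambda>z. z + c) ` ((X + B) - (Xc + B))"
  proof
    fix z assume "z \<in> X + B + insert c C"
    then obtain x b e where z: "z = x + b + e" "x \<in> X" "b \<in> B" "e \<in> insert c C"
      by (auto simp: set_plus_def)
    show "z \<in> (X + B + C) \<union> (\<lambda>z. z + c) ` ((X + B) - (Xc + B))"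
    proof (cases "e = c \<and> x + b \<notin> Xc + B")
      case True
      then have "x + b \<in> (X + B) - (Xc + B)" using z by (auto intro: set_plus_intro)
      then show ?thesis using z True by blast
    next
      case False
      show ?thesis
      proof (cases "e = c")
        case True
        with False obtain x' b' where "x + b = x' + b'" "x' \<in> Xc" "b' \<in> B"
          by (auto simp: set_plus_def)
        then show ?thesis using z True unfolding Xc_def by auto
      qed (use z in \<open>auto simp: set_plus_def\<close>)
    qed
  qed
  then have "card (X + B + insert c C) \<le> card ((X + B + C) \<union> (\<lambda>z. z + c) ` ((X + B) - (Xc + B)))"
    using fin by (intro card_mono) auto
  also have "\<dots> \<le> card (X + B + C) + card ((\<lambda>z. z + c) ` ((X + B) - (Xc + B)))"
    by (rule card_Un_le)
  also have "card ((\<lambda>z. z + c) ` ((X + B) - (Xc + B))) \<le> card ((X + B) - (Xc + B))"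
    using fin by (intro card_image_le) auto
  also have "card ((X + B) - (Xc + B)) = card (X + B) - card (Xc + B)"
    using fin B by (intro card_Diff_subset finite_set_plus set_plus_mono2) (auto simp: Xc_def)
  finally have 1: "card (X + B + insert c C) \<le> card (X + B + C) + (card (X + B) - card (Xc + B))"
    by simp
  have "card (Xc + B) \<le> card (X + B)"
    using fin by (intro card_mono set_plus_mono2) (auto simp: Xc_def)
  with 1 have 1: "real (card (X + B + insert c C)) \<le> real (card (X + B + C)) + real (card (X + B)) - real (card (Xc + B))"
    by linarith
  have "K * card Xc \<le> card (Xc + B)"
  proof (cases "Xc = {}")
    case False
    then show ?thesis by (intro minimal) (auto simp: Xc_def)
  qed simp
  with 1 insert.IH card_XB
  have 2: "real (card (X + B + insert c C)) \<le> K * (real (card (X + C)) + real (card X) - real (card Xc))"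
    by (simp add: algebra_simps)
  have "(X + C) \<union> (\<lambda>x. x + c) ` (X - W) \<subseteq> X + insert c C"
    by (auto simp: set_plus_def)
  then have "card ((X + C) \<union> (\<lambda>x. x + c) ` (X - W)) \<le> card (X + insert c C)"
    using X insert.hyps by (intro card_mono) (auto simp: finite_set_plus)
  moreover have "card ((X + C) \<union> (\<lambda>x. x + c) ` (X - W)) = card (X + C) + card ((\<lambda>x. x + c) ` (X - W))"
    using fin X by (intro card_Un_disjoint) (auto simp: W_def)
  moreover have "card ((\<lambda>x. x + c) ` (X - W)) = card X - card W"
    using fin by (subst card_image) (auto simp: inj_on_def card_Diff_subset W_def)
  moreover have "card W \<le> card Xc" "card Xc \<le> card X"
    using WXc fin X by (auto intro!: card_mono simp: Xc_def)
  ultimately have 3: "real (card (X + C)) + real (card X) - real (card Xc) \<le> card (X + insert c C)"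
    by linarith
  have "K \<ge> 0 \<or> X = {}"
  proof (rule disjCI)
    assume "X \<noteq> {}"
    then have "0 < card X" using X by (simp add: card_gt_0_iff)
    moreover have "0 \<le> K * card X" using card_XB by linarith
    ultimately show "K \<ge> 0" by (simp add: zero_le_mult_iff)
  qed
  then show ?case
  proof
    assume "K \<ge> 0"
    then show ?thesis using mult_left_mono[OF 3, of K] 2 by linarith
  qed (simp add: set_plus_def)
qed

text \<open>\<open>X\<close> minimises the ratio \<open>card (Y + B) / card Y\<close> over the
  nonempty subsets of \<open>A\<close>; \<open>petridis\<close> with \<open>C = nsum m B\<close>
  then adds one more copy of \<open>B\<close> at the cost of one factor \<open>K\<close>.\<close>

lemma pluennecke:
  fixes A B :: "'a::ab_group_add set" and K :: real
  assumes A: "finite A" "A \<noteq> {}" and B: "finite B" and "card (A + B) \<le> K * card A"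
  shows "\<exists>X\<subseteq>A. X \<noteq> {} \<and> (\<forall>m. card (X + nsum m B) \<le> K ^ m * card X)"
proof -
  define \<rho> where "\<rho> Y = card (Y + B) / card Y" for Y
  have "finite (Pow A - {{}})" "Pow A - {{}} \<noteq> {}" using A by auto
  then obtain X where X: "X \<in> Pow A - {{}}" and le: "\<And>Y. Y \<in> Pow A - {{}} \<Longrightarrow> \<rho> X \<le> \<rho> Y"
    by (metis (no_types, lifting) arg_min_if_finite(1) arg_min_least)
  have fX: "finite X" using X A finite_subset by blast
  have pos: "card Y > 0" if "Y \<subseteq> A" "Y \<noteq> {}" for Y
    using that A finite_subset by (metis card_gt_0_iff)
  have min: "\<rho> X * card Y \<le> card (Y + B)" if "Y \<subseteq> X" "Y \<noteq> {}" for Y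
  proof -
    have "Y \<subseteq> A" using that X by auto
    then have "\<rho> X \<le> \<rho> Y" "card Y > 0" using le that pos by auto
    then show ?thesis by (simp add: \<rho>_def pos_le_divide_eq)
  qed
  have "\<rho> X \<le> \<rho> A" using A le by auto
  also have "\<rho> A \<le> K" using assms(4) pos[of A] A by (simp add: \<rho>_def divide_le_eq)
  finally have \<rho>K: "\<rho> X \<le> K" .
  have "0 \<le> \<rho> X" by (simp add: \<rho>_def)
  have "card (X + nsum m B) \<le> K ^ m * card X" for m
  proof (induction m)
    case (Suc m)
    have "card X > 0" using X pos by auto
    then have "card (X + B) \<le> \<rho> X * card X" by (simp add: \<rho>_def)
    then have "card (X + B + nsum m B) \<le> \<rho> X * card (X + nsum m B)"
      using fX B min by (intro petridis) (auto simp: finite_nsum)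
    also have "\<dots> \<le> K * (K ^ m * card X)"
      using Suc \<rho>K \<open>0 \<le> \<rho> X\<close> by (intro mult_mono) auto
    finally show ?case by (simp add: add.assoc mult.assoc)
  qed (simp add: set_plus_def)
  then show ?thesis using X by blast
qed

text \<open>Fix one representation \<open>u - v\<close> of every difference \<open>d\<close>. The
  map sending \<open>(x, d)\<close> to \<open>(x - u, x - v)\<close> is injective: its two
  coordinates differ by \<open>d\<close>, and \<open>d\<close> gives back \<open>u\<close> and then
  \<open>x\<close>.\<close>

lemma ruzsa_triangle:
  fixes X U V :: "'a::ab_group_add set"
  assumes "finite X" "finite U" "finite V"
  shows "card X * card (U + uminus ` V) \<le> card (X + uminus ` U) * card (X + uminus ` V)"
proof -
  have "\<exists>g. \<forall>d\<in>U + uminus ` V. fst (g d) \<in> U \<and> snd (g d) \<in> V \<and> d = fst (g d) - snd (g d)"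
    by (rule bchoice[rule_format]) (auto simp: set_plus_def)
  then obtain g where g: "\<And>d. d \<in> U + uminus ` V \<Longrightarrow> fst (g d) \<in> U \<and> snd (g d) \<in> V \<and> d = fst (g d) - snd (g d)"
    by blast
  define h where "h = (\<lambda>(x, d). (x - fst (g d), x - snd (g d)))"
  have "inj_on h (X \<times> (U + uminus ` V))"
  proof (rule inj_onI, clarify)
    fix x d x' d' assume a: "x \<in> X" "x' \<in> X" and d: "d \<in> U + uminus ` V" "d' \<in> U + uminus ` V"
      and eq: "h (x, d) = h (x', d')"
    have "(x - snd (g d)) - (x - fst (g d)) = (x' - snd (g d')) - (x' - fst (g d'))"
      using eq by (simp add: h_def)
    then have "d = d'" using g d by simp
    then show "x = x' \<and> d = d'" using eq by (simp add: h_def)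
  qed
  moreover have "h ` (X \<times> (U + uminus ` V)) \<subseteq> (X + uminus ` U) \<times> (X + uminus ` V)"
    using g by (fastforce simp: h_def set_plus_def)
  moreover have "finite ((X + uminus ` U) \<times> (X + uminus ` V))"
    using assms by (auto simp: finite_set_plus)
  ultimately have "card (X \<times> (U + uminus ` V)) \<le> card ((X + uminus ` U) \<times> (X + uminus ` V))"
    by (metis card_inj_on_le)
  then show ?thesis by (simp add: card_cartesian_product)
qed

lemma nsum_uminus: "nsum m (uminus ` D) = uminus ` nsum m (D :: 'a::ab_group_add set)"
proof (induction m)
  case (Suc m)
  have "uminus ` A + uminus ` B = uminus ` (A + B)" for A B :: "'a set"
    by (force simp: set_plus_def image_iff)
  then show ?case using Suc by simp
qed simp

text \<open>The hypothesis is on the difference set because that is what a count of angles controls.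
  \<open>pluennecke\<close> with \<open>B = - D\<close> bounds \<open>X - m D\<close>, hence
  \<open>m D\<close> after a reflection; for \<open>D + D - D\<close> the Ruzsa triangle inequality
  combines \<open>X - 2 D\<close> and \<open>X - D\<close>, with losses \<open>K ^ 2\<close> and
  \<open>K\<close>.\<close>

lemma small_doubling_nsum:
  fixes D :: "'a::ab_group_add set" and K :: real
  assumes D: "finite D" "D \<noteq> {}" and "card (D + uminus ` D) \<le> K * card D"
  shows "card (nsum m D) \<le> K ^ m * card D" and "card (D + D + uminus ` D) \<le> K ^ 3 * card D"
proof -
  have "card (nsum m D) \<le> K ^ m * card D \<and> card (D + D + uminus ` D) \<le> K ^ 3 * card D"
  proof -
    obtain X where X: "X \<subseteq> D" "X \<noteq> {}"
      and le: "\<And>m. card (X + nsum m (uminus ` D)) \<le> K ^ m * card X"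
      using pluennecke[of D "uminus ` D" K] assms by auto
    have fX: "finite X" using X D finite_subset by auto
    have cX: "card X > 0" using X fX by (simp add: card_gt_0_iff)
    have K: "K \<ge> 0"
    proof -
      have "0 \<le> K * card X" using le[of 1] by (smt (verit) of_nat_0_le_iff power_one_right)
      then show ?thesis using cX by (simp add: zero_le_mult_iff)
    qed
    have XD: "card X \<le> card D" using X D card_mono by blast
    obtain x where "x \<in> X" using X by blast
    then have "card (nsum m (uminus ` D)) \<le> card (X + nsum m (uminus ` D))"
      using fX D by (intro card_le_card_plus) (auto simp: finite_nsum)
    moreover have "card (nsum m (uminus ` D)) = card (nsum m D)"
      by (simp add: nsum_uminus card_image)
    ultimately have "card (nsum m D) \<le> K ^ m * card X" using le[of m] by linarith
    also have "\<dots> \<le> K ^ m * card D" using XD K by (intro mult_left_mono) auto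
    finally have 1: "card (nsum m D) \<le> K ^ m * card D" .
    have D2: "nsum 2 D = D + D" by (simp add: numeral_2_eq_2)
    have "card X * card (nsum 2 D + uminus ` D) \<le> card (X + uminus ` nsum 2 D) * card (X + uminus ` D)"
      by (rule ruzsa_triangle) (use fX D in \<open>auto simp: finite_nsum\<close>)
    also have "real \<dots> \<le> (K ^ 2 * card X) * (K ^ 1 * card X)"
      unfolding of_nat_mult using le[of 2] le[of 1] K
      by (intro mult_mono) (auto simp: nsum_uminus)
    finally have "real (card X) * card (D + D + uminus ` D) \<le> card X * (K ^ 3 * card X)"
      by (simp add: D2 power2_eq_square power3_eq_cube mult_ac)
    then have "card (D + D + uminus ` D) \<le> K ^ 3 * card X" using cX by (simp add: field_simps)
    also have "\<dots> \<le> K ^ 3 * card D" using XD K by (intro mult_left_mono) auto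
    finally show ?thesis using 1 by simp
  qed
  then show "card (nsum m D) \<le> K ^ m * card D" and "card (D + D + uminus ` D) \<le> K ^ 3 * card D" by auto
qed

section \<open>A robust form of Beck's theorem\<close>

text \<open>The planar cross product: the norms times the signed sine of the angle from
  \<open>a\<close> to \<open>b\<close>. For a unit vector \<open>e\<close>,
  \<open>cr e (z - p)\<close> is the signed distance of \<open>z\<close> from the line through
  \<open>p\<close> along \<open>e\<close>.\<close>

definition cr :: "complex \<Rightarrow> complex \<Rightarrow> real" where
  "cr a b = Im (cnj a * b)"

lemma cr_eq: "cr a b = Re a * Im b - Im a * Re b"
  by (simp add: cr_def)

lemma cr_add_right: "cr a (b + c) = cr a b + cr a c"
  and cr_diff_right: "cr a (b - c) = cr a b - cr a c"
  and cr_add_left: "cr (a + b) c = cr a c + cr b c"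
  and cr_diff_left: "cr (a - b) c = cr a c - cr b c"
  and cr_self [simp]: "cr a a = 0"
  and cr_zero [simp]: "cr 0 a = 0" "cr a 0 = 0"
  and cr_minus_left [simp]: "cr (- a) b = - cr a b"
  and cr_minus_right [simp]: "cr a (- b) = - cr a b"
  and cr_scale_left: "cr (of_real t * a) b = t * cr a b"
  and cr_scale_right: "cr a (of_real t * b) = t * cr a b"
  by (simp_all add: cr_eq algebra_simps)

lemma cr_commute: "cr b a = - cr a b"
  by (simp add: cr_eq)

lemma abs_cr_le: "\<bar>cr a b\<bar> \<le> norm a * norm b"
  unfolding cr_def by (metis abs_Im_le_cmod complex_mod_cnj norm_mult)

section \<open>Quantiles, median slopes and three blocks that no transversal line can meet\<close>

lemma quantile_exists:
  fixes f :: "'a \<Rightarrow> real"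
  assumes S: "finite S" and k: "1 \<le> k" "k \<le> card S"
  shows "\<exists>v. k \<le> card {x \<in> S. f x \<le> v} \<and> card {x \<in> S. f x < v} < k"
proof -
  define V where "V = {u \<in> f ` S. k \<le> card {x \<in> S. f x \<le> u}}"
  have S0: "S \<noteq> {}" using k by auto
  have "{x \<in> S. f x \<le> Max (f ` S)} = S" using S by auto
  then have "Max (f ` S) \<in> V" using S S0 k by (simp add: V_def)
  then have V: "finite V" "V \<noteq> {}" using S by (auto simp: V_def)
  define v where "v = Min V"
  have vV: "v \<in> V" using V v_def by simp
  have "card {x \<in> S. f x < v} < k"
  proof (rule ccontr)
    assume "\<not> ?thesis"
    then have ge: "k \<le> card {x \<in> S. f x < v}" by simp
    define W where "W = {x \<in> S. f x < v}"
    have "card W \<ge> 1" using ge k by (simp add: W_def)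
    then have W: "finite W" "W \<noteq> {}" using card_gt_0_iff[of W] by auto
    define u where "u = Max (f ` W)"
    have u: "u \<in> f ` W" using W by (simp add: u_def)
    have "W \<subseteq> {x \<in> S. f x \<le> u}" using W by (auto simp: u_def W_def)
    then have "card W \<le> card {x \<in> S. f x \<le> u}" using S by (intro card_mono) auto
    then have "u \<in> V" using u ge by (auto simp: V_def W_def)
    then have "v \<le> u" using V v_def by simp
    then show False using u by (auto simp: W_def)
  qed
  then show ?thesis using vV by (auto simp: V_def)
qed

lemma split_three:
  fixes t :: "'a \<Rightarrow> real"
  assumes Q: "finite Q" and inj: "inj_on t Q" and k: "3 * k \<le> card Q"
  shows "\<exists>T1 T2 T3. T1 \<subseteq> Q \<and> T2 \<subseteq> Q \<and> T3 \<subseteq> Q \<and> card T1 = k \<and> card T3 = k \<and> k \<le> card T2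
    \<and> (\<forall>a\<in>T1. \<forall>b\<in>T2. t a < t b) \<and> (\<forall>b\<in>T2. \<forall>c\<in>T3. t b < t c)"
proof (cases "k = 0")
  case True
  then show ?thesis by (intro exI[of _ "{}"]) simp
next
  case False
  have half: "\<exists>L. L \<subseteq> R \<and> card L = k \<and> (\<forall>a\<in>L. \<forall>b\<in>R - L. s a < s b)"
    if R: "R \<subseteq> Q" "k \<le> card R" and s: "inj_on s R" for R and s :: "'a \<Rightarrow> real"
  proof -
    have fR: "finite R" using R Q finite_subset by blast
    obtain v where v: "k \<le> card {x \<in> R. s x \<le> v}" "card {x \<in> R. s x < v} < k"
      using quantile_exists[of R k s] fR R False by auto
    have "card {x \<in> R. s x = v} \<le> 1"
      using s by (auto simp: card_le_Suc0_iff_eq inj_on_def fR)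
    moreover have "{x \<in> R. s x \<le> v} = {x \<in> R. s x < v} \<union> {x \<in> R. s x = v}" by auto
    then have "card {x \<in> R. s x \<le> v} \<le> card {x \<in> R. s x < v} + card {x \<in> R. s x = v}"
      by (metis card_Un_le)
    ultimately have "card {x \<in> R. s x \<le> v} = k" using v by linarith
    then show ?thesis by (intro exI[of _ "{x \<in> R. s x \<le> v}"]) auto
  qed
  obtain T1 where T1: "T1 \<subseteq> Q" "card T1 = k" "\<forall>a\<in>T1. \<forall>b\<in>Q - T1. t a < t b"
    using half[of Q t] k inj by auto
  have c: "card (Q - T1) = card Q - k"
    using T1 Q by (metis card_Diff_subset finite_subset)
  obtain T3 where T3: "T3 \<subseteq> Q - T1" "card T3 = k" "\<forall>a\<in>T3. \<forall>b\<in>(Q - T1) - T3. - t a < - t b"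
  proof -
    have "k \<le> card (Q - T1)" "inj_on (\<lambda>x. - t x) (Q - T1)" using k c inj by (auto simp: inj_on_def)
    then show ?thesis using half[of "Q - T1" "\<lambda>x. - t x"] that by blast
  qed
  have "card (Q - T1 - T3) = card Q - k - k"
    using T3 Q c by (metis card_Diff_subset finite_subset finite_Diff)
  then show ?thesis using T1 T3 k
    by (intro exI[of _ T1] exI[of _ "Q - T1 - T3"] exI[of _ T3]) auto
qed

text \<open>The median slope \<open>s\<close> between the two outer sets makes the two distributions of
  \<open>y - s t\<close> overlap, so that some threshold splits both of them evenly enough.\<close>

lemma median_line:
  fixes t y :: "'a \<Rightarrow> real"
  assumes fin: "finite T1" "finite T3" and card: "card T1 = 4 * a" "card T3 = 4 * a" and a: "a > 0"
    and less: "\<And>p q. p \<in> T1 \<Longrightarrow> q \<in> T3 \<Longrightarrow> t p < t q"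
  shows "\<exists>s \<tau>. a \<le> card {p \<in> T1. y p - s * t p \<le> \<tau>} \<and> a \<le> card {p \<in> T1. \<tau> \<le> y p - s * t p}
    \<and> a \<le> card {p \<in> T3. y p - s * t p \<le> \<tau>} \<and> a \<le> card {p \<in> T3. \<tau> \<le> y p - s * t p}"
proof -
  \<comment> \<open>\<open>sl\<close> is the slope of the line joining a point of \<open>T1\<close>
    to one of \<open>T3\<close>. With \<open>s\<close> a median slope, each of the two orders of
    \<open>g p\<close> and \<open>g q\<close> holds for at least half of the
    \<open>16 * a\<^sup>2\<close> pairs.\<close>
  define sl where "sl = (\<lambda>(p, q). (y q - y p) / (t q - t p))"
  have cP: "card (T1 \<times> T3) = 16 * a\<^sup>2"
    using card by (simp add: card_cartesian_product power2_eq_square)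
  have "a\<^sup>2 \<ge> 1" using a by (simp add: power2_eq_square Suc_leI)
  then obtain s where s: "8 * a\<^sup>2 \<le> card {x \<in> T1 \<times> T3. sl x \<le> s}" "card {x \<in> T1 \<times> T3. sl x < s} < 8 * a\<^sup>2"
    using quantile_exists[of "T1 \<times> T3" "8 * a\<^sup>2" sl] fin cP by auto
  define g where "g p = y p - s * t p" for p
  have sl_le: "sl (p, q) \<le> s \<longleftrightarrow> g q \<le> g p" and sl_ge: "s \<le> sl (p, q) \<longleftrightarrow> g p \<le> g q"
    if "p \<in> T1" "q \<in> T3" for p q
    using less[OF that] by (auto simp: sl_def g_def field_simps)
  have le: "8 * a\<^sup>2 \<le> card {(p, q) \<in> T1 \<times> T3. g q \<le> g p}"
  proof -
    have "{x \<in> T1 \<times> T3. sl x \<le> s} = {(p, q) \<in> T1 \<times> T3. g q \<le> g p}" using sl_le by auto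
    then show ?thesis using s(1) by simp
  qed
  have ge: "8 * a\<^sup>2 \<le> card {(p, q) \<in> T1 \<times> T3. g p \<le> g q}"
  proof -
    have eq: "T1 \<times> T3 - {x \<in> T1 \<times> T3. sl x < s} = {(p, q) \<in> T1 \<times> T3. g p \<le> g q}"
    proof (intro set_eqI iffI; clarsimp)
      show "g p \<le> g q" if "p \<in> T1" "q \<in> T3" "\<not> sl (p, q) < s" for p q
        using that sl_ge[of p q] by (metis not_less)
      show False if "p \<in> T1" "q \<in> T3" "g p \<le> g q" "sl (p, q) < s" for p q
        using that sl_ge[of p q] by auto
    qed
    have "card (T1 \<times> T3 - {x \<in> T1 \<times> T3. sl x < s}) = 16 * a\<^sup>2 - card {x \<in> T1 \<times> T3. sl x < s}"
      using fin cP by (subst card_Diff_subset) auto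
    then show ?thesis using s(2) eq by simp
  qed
  \<comment> \<open>\<open>lo\<close> and \<open>hi\<close> are the outer quartiles of
    \<open>g\<close> on \<open>T\<close>. Strictly more than \<open>3 * a\<close> points lie above
    \<open>lo\<close>, and as many below \<open>hi\<close>, so that a product of two such sets, with
    over \<open>9 * a\<^sup>2\<close> pairs, cannot avoid the half guaranteed by the median.\<close>
  have q: "\<exists>lo hi. a \<le> card {p \<in> T. g p \<le> lo} \<and> 3 * a < card {p \<in> T. lo \<le> g p} \<and>
       a \<le> card {p \<in> T. hi \<le> g p} \<and> 3 * a < card {p \<in> T. g p \<le> hi} \<and> lo \<le> hi"
    if T: "finite T" "card T = 4 * a" for T
  proof -
    have compl: "card {p \<in> T. v \<le> h p} = 4 * a - card {p \<in> T. h p < v}" for h and v :: real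
    proof -
      have "{p \<in> T. v \<le> h p} = T - {p \<in> T. h p < v}" by auto
      then show ?thesis using T by (simp add: card_Diff_subset)
    qed
    obtain lo where lo: "a \<le> card {p \<in> T. g p \<le> lo}" "card {p \<in> T. g p < lo} < a"
      using quantile_exists[of T a g] T a by auto
    obtain h where h: "a \<le> card {p \<in> T. - g p \<le> h}" "card {p \<in> T. - g p < h} < a"
      using quantile_exists[of T a "\<lambda>p. - g p"] T a by auto
    have 1: "3 * a < card {p \<in> T. lo \<le> g p}" using compl[of lo g] lo a by linarith
    have e: "{p \<in> T. h \<le> - g p} = {p \<in> T. g p \<le> - h}" "{p \<in> T. - g p \<le> h} = {p \<in> T. - h \<le> g p}"
      by auto
    have 2: "3 * a < card {p \<in> T. g p \<le> - h}" "a \<le> card {p \<in> T. - h \<le> g p}"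
      using compl[of h "\<lambda>p. - g p"] h a e by auto
    have "lo \<le> - h"
    proof (rule ccontr)
      assume "\<not> lo \<le> - h"
      then have "{p \<in> T. g p \<le> - h} \<subseteq> {p \<in> T. g p < lo}" by auto
      then have "card {p \<in> T. g p \<le> - h} \<le> card {p \<in> T. g p < lo}" using T by (intro card_mono) auto
      then show False using 2 lo a by linarith
    qed
    then show ?thesis using lo 1 2 by blast
  qed
  obtain lo1 hi1 where 1: "a \<le> card {p \<in> T1. g p \<le> lo1}" "3 * a < card {p \<in> T1. lo1 \<le> g p}"
      "a \<le> card {p \<in> T1. hi1 \<le> g p}" "3 * a < card {p \<in> T1. g p \<le> hi1}" "lo1 \<le> hi1"
    using q[OF fin(1) card(1)] by blast
  obtain lo3 hi3 where 3: "a \<le> card {p \<in> T3. g p \<le> lo3}" "3 * a < card {p \<in> T3. lo3 \<le> g p}"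
      "a \<le> card {p \<in> T3. hi3 \<le> g p}" "3 * a < card {p \<in> T3. g p \<le> hi3}" "lo3 \<le> hi3"
    using q[OF fin(2) card(2)] by blast
  have big: False if "3 * a < card A" "3 * a < card B" "A \<subseteq> T1" "B \<subseteq> T3" "\<And>p q. p \<in> A \<Longrightarrow> q \<in> B \<Longrightarrow> (p, q) \<notin> R"
    "8 * a\<^sup>2 \<le> card R" "R \<subseteq> T1 \<times> T3" for A B R
  proof -
    have "finite A" "finite B" using that fin finite_subset by blast+
    have "card R \<le> card (T1 \<times> T3 - A \<times> B)" using that fin by (intro card_mono) auto
    also have "\<dots> = 16 * a\<^sup>2 - card A * card B"
      using that fin cP \<open>finite A\<close> \<open>finite B\<close>
      by (subst card_Diff_subset) (auto simp: card_cartesian_product)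
    finally have "8 * a\<^sup>2 + card A * card B \<le> 16 * a\<^sup>2"
      using that(6) a by (cases "card A * card B \<le> 16 * a\<^sup>2") auto
    moreover have "(3 * a) * (3 * a) \<le> card A * card B" using that by (intro mult_mono) auto
    moreover have "0 < a * a" using a by simp
    ultimately show False unfolding power2_eq_square by linarith
  qed
  have l13: "lo1 \<le> hi3"
  proof (rule ccontr)
    assume "\<not> lo1 \<le> hi3"
    then show False using 1 3 ge
      by (intro big[of "{p \<in> T1. lo1 \<le> g p}" "{p \<in> T3. g p \<le> hi3}" "{(p, q) \<in> T1 \<times> T3. g p \<le> g q}"]) auto
  qed
  have l31: "lo3 \<le> hi1"
  proof (rule ccontr)
    assume "\<not> lo3 \<le> hi1"
    then show False using 1 3 le
      by (intro big[of "{p \<in> T1. g p \<le> hi1}" "{p \<in> T3. lo3 \<le> g p}" "{(p, q) \<in> T1 \<times> T3. g q \<le> g p}"]) auto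
  qed
  define \<tau> where "\<tau> = max lo1 lo3"
  have t: "lo1 \<le> \<tau>" "lo3 \<le> \<tau>" "\<tau> \<le> hi1" "\<tau> \<le> hi3" using 1 3 l13 l31 by (auto simp: \<tau>_def)
  have "card {p \<in> T1. g p \<le> lo1} \<le> card {p \<in> T1. g p \<le> \<tau>}" "card {p \<in> T1. hi1 \<le> g p} \<le> card {p \<in> T1. \<tau> \<le> g p}"
    "card {p \<in> T3. g p \<le> lo3} \<le> card {p \<in> T3. g p \<le> \<tau>}" "card {p \<in> T3. hi3 \<le> g p} \<le> card {p \<in> T3. \<tau> \<le> g p}"
    using fin t by (auto intro!: card_mono)
  then show ?thesis using 1 3 unfolding g_def by (intro exI[of _ s] exI[of _ \<tau>]) linarith
qed

text \<open>All chords, not just the distances to a line, are controlled: the order of any two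
  points along \<open>v\<close> can then be read off from any transversal coordinate.\<close>

definition aligned :: "complex set \<Rightarrow> complex \<Rightarrow> real \<Rightarrow> bool" where
  "aligned L v \<eta> \<longleftrightarrow> (\<forall>p\<in>L. \<forall>q\<in>L. \<bar>cr v (p - q)\<bar> \<le> \<eta> * norm (p - q))"

text \<open>If \<open>w\<close> points along \<open>\<plusminus>v\<close> up to a small error, then the sign of \<open>cr e w\<close> for a
  transversal \<open>e\<close> tells which of the two signs it is.\<close>

lemma sign_cr_aligned:
  assumes v: "norm v = 1" and e: "norm e = 1" and w: "\<bar>cr v w\<bar> \<le> \<eta> * norm w" "w \<noteq> 0"
    and tr: "2 * \<eta> < \<bar>cr e v\<bar>"
  shows "Re (cnj v * w) * cr e v * cr e w > 0"
proof -
  define \<alpha> \<beta> where "\<alpha> = Re (cnj v * w)" and "\<beta> = Im (cnj v * w)"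
  have nv: "Re v * Re v + Im v * Im v = 1"
    using v by (metis cmod_power2 power2_eq_square power_one)
  have decomp: "cr e w = \<alpha> * cr e v + \<beta> * Re (cnj e * v)"
  proof -
    have "cr e w * (Re v * Re v + Im v * Im v) = \<alpha> * cr e v + \<beta> * Re (cnj e * v)"
      by (simp add: \<alpha>_def \<beta>_def cr_eq algebra_simps)
    then show ?thesis using nv by simp
  qed
  have nw: "(norm w)\<^sup>2 = \<alpha>\<^sup>2 + \<beta>\<^sup>2"
    using v by (metis \<alpha>_def \<beta>_def cmod_power2 complex_mod_cnj norm_mult mult_1)
  have wpos: "norm w > 0" using w by simp
  have b: "\<bar>\<beta>\<bar> \<le> \<eta> * norm w" using w by (simp add: \<beta>_def cr_def)
  have c1: "\<bar>cr e v\<bar> \<le> 1" using abs_cr_le[of e v] v e by simp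
  have r1: "\<bar>Re (cnj e * v)\<bar> \<le> 1"
    using abs_Re_le_cmod[of "cnj e * v"] v e by (simp add: norm_mult)
  have eta: "\<eta> < 1/2" using tr c1 by linarith
  have "\<eta> * norm w \<le> 1/2 * norm w" using eta wpos by (intro mult_right_mono) auto
  then have "\<bar>\<beta>\<bar> \<le> norm w / 2" using b by simp
  then have "\<beta>\<^sup>2 \<le> (norm w / 2)\<^sup>2" by (metis abs_ge_zero power2_abs power_mono)
  then have "(norm w / 2)\<^sup>2 < \<alpha>\<^sup>2" using nw zero_less_power[OF wpos, of 2] by (simp add: power_divide)
  then have a: "\<bar>\<alpha>\<bar> > norm w / 2" using wpos by (intro power2_less_imp_less[of "norm w / 2" "\<bar>\<alpha>\<bar>"]) auto
  have "\<bar>\<beta> * Re (cnj e * v)\<bar> \<le> \<eta> * norm w"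
    using mult_mono[OF b r1] b by (simp add: abs_mult)
  also have "\<eta> * norm w < \<bar>cr e v\<bar> / 2 * norm w" using tr wpos by simp
  also have "\<dots> \<le> \<bar>\<alpha>\<bar> * \<bar>cr e v\<bar>" using mult_right_mono[of "norm w / 2" "\<bar>\<alpha>\<bar>" "\<bar>cr e v\<bar>"] a
    by (simp add: mult_ac)
  finally have "\<bar>\<beta> * Re (cnj e * v)\<bar> < \<bar>\<alpha> * cr e v\<bar>" by (simp add: abs_mult)
  then have "(\<alpha> * cr e v) * (\<alpha> * cr e v + \<beta> * Re (cnj e * v)) > 0"
    by (smt (verit, best) zero_less_mult_iff)
  then show ?thesis unfolding decomp \<alpha>_def .
qed

text \<open>Judged by \<open>u\<close>, the steps from \<open>a\<close> to \<open>b\<close> and from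
  \<open>b\<close> to \<open>c\<close> go the same way along \<open>v\<close>; judged by
  \<open>e\<close>, they go opposite ways, because the level \<open>h\<close> separates
  \<open>b\<close> from \<open>a\<close> and \<open>c\<close>.\<close>

lemma no_aligned_triple:
  assumes v: "norm v = 1" and u: "norm u = 1" and e: "norm e = 1" and al: "aligned L v \<eta>"
    and tr: "2 * \<eta> < \<bar>cr u v\<bar>" "2 * \<eta> < \<bar>cr e v\<bar>"
    and L: "a \<in> L" "b \<in> L" "c \<in> L" and t: "cr u a < cr u b" "cr u b < cr u c"
    and h: "cr e b \<ge> h \<and> cr e a \<le> h \<and> cr e c \<le> h \<or> cr e b \<le> h \<and> cr e a \<ge> h \<and> cr e c \<ge> h"
  shows False
proof -
  have ne: "b - a \<noteq> 0" "c - b \<noteq> 0" using t by auto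
  have al': "\<bar>cr v (b - a)\<bar> \<le> \<eta> * norm (b - a)" "\<bar>cr v (c - b)\<bar> \<le> \<eta> * norm (c - b)"
    using al L by (auto simp: aligned_def)
  have 1: "Re (cnj v * (b - a)) * cr u v * cr u (b - a) > 0" "Re (cnj v * (c - b)) * cr u v * cr u (c - b) > 0"
    "Re (cnj v * (b - a)) * cr e v * cr e (b - a) > 0" "Re (cnj v * (c - b)) * cr e v * cr e (c - b) > 0"
    using sign_cr_aligned[OF v u al'(1) ne(1) tr(1)] sign_cr_aligned[OF v u al'(2) ne(2) tr(1)]
      sign_cr_aligned[OF v e al'(1) ne(1) tr(2)] sign_cr_aligned[OF v e al'(2) ne(2) tr(2)] by auto
  have "cr u (b - a) > 0" "cr u (c - b) > 0" using t by (auto simp: cr_diff_right)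
  moreover have "cr e (b - a) \<ge> 0 \<and> cr e (c - b) \<le> 0 \<or> cr e (b - a) \<le> 0 \<and> cr e (c - b) \<ge> 0"
    using h by (auto simp: cr_diff_right)
  ultimately show False using 1
    by (smt (verit) zero_less_mult_iff)
qed

text \<open>Of three slabs across \<open>u\<close>, the outer ones have \<open>4 * a\<close> points,
  and the line of \<open>median_line\<close> leaves at least \<open>a\<close> of them on either
  side. \<open>B\<close> is taken from the middle slab on a side where it has \<open>a\<close>
  points, \<open>A\<close> and \<open>C\<close> from the other side.\<close>

lemma three_blocks:
  assumes Q: "finite Q" and u: "norm u = 1" and gen: "inj_on (cr u) Q" and a: "a > 0" "12 * a \<le> card Q"
  shows "\<exists>A B C e h. A \<subseteq> Q \<and> B \<subseteq> Q \<and> C \<subseteq> Q \<and> card A = a \<and> card B = a \<and> card C = a \<and> norm e = 1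
    \<and> (\<forall>p\<in>A. \<forall>q\<in>B. cr u p < cr u q) \<and> (\<forall>p\<in>B. \<forall>q\<in>C. cr u p < cr u q)
    \<and> ((\<forall>p\<in>B. cr e p \<ge> h) \<and> (\<forall>p\<in>A \<union> C. cr e p \<le> h) \<or> (\<forall>p\<in>B. cr e p \<le> h) \<and> (\<forall>p\<in>A \<union> C. cr e p \<ge> h))"
proof -
  obtain T1 T2 T3 where T: "T1 \<subseteq> Q" "T2 \<subseteq> Q" "T3 \<subseteq> Q" "card T1 = 4 * a" "card T3 = 4 * a" "4 * a \<le> card T2"
    and l12: "\<forall>p\<in>T1. \<forall>q\<in>T2. cr u p < cr u q" and l23: "\<forall>p\<in>T2. \<forall>q\<in>T3. cr u p < cr u q"
    using split_three[OF Q gen, of "4 * a"] a by auto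
  have fin: "finite T1" "finite T2" "finite T3" using T Q finite_subset by blast+
  have "T2 \<noteq> {}" using T a by auto
  then have l13: "cr u p < cr u q" if "p \<in> T1" "q \<in> T3" for p q
    using l12 l23 that by (meson ex_in_conv order.strict_trans)
  define y where "y z = - cr (\<i> * u) z" for z
  obtain s \<tau> where st: "a \<le> card {p \<in> T1. y p - s * cr u p \<le> \<tau>}" "a \<le> card {p \<in> T1. \<tau> \<le> y p - s * cr u p}"
    "a \<le> card {p \<in> T3. y p - s * cr u p \<le> \<tau>}" "a \<le> card {p \<in> T3. \<tau> \<le> y p - s * cr u p}"
    using median_line[OF fin(1,3) T(4,5) a(1), of "cr u" y] l13 by blast
  \<comment> \<open>\<open>cr e0\<close> is the linear form \<open>y - s * cr u\<close>, so the line
    found by \<open>median_line\<close> becomes a line along the unit vector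
    \<open>e\<close>.\<close>
  define e0 where "e0 = - (\<i> * u) - of_real s * u"
  have g: "y p - s * cr u p = cr e0 p" for p
    by (simp add: y_def e0_def cr_diff_left cr_scale_left)
  have "e0 \<noteq> 0"
  proof
    assume "e0 = 0"
    then have "(- \<i> - of_real s) * u = 0" by (simp add: e0_def algebra_simps)
    then have "- \<i> - of_real s = 0" using u by auto
    then have "Im (- \<i> - of_real s) = 0" by (simp only: zero_complex.sel)
    then show False by simp
  qed
  define e where "e = of_real (1 / norm e0) * e0"
  have e1: "norm e = 1" using \<open>e0 \<noteq> 0\<close> by (simp add: e_def norm_divide)
  have cre: "cr e p = cr e0 p / norm e0" for p by (simp add: e_def cr_scale_left del: of_real_divide)
  have le: "cr e p \<le> \<tau> / norm e0 \<longleftrightarrow> cr e0 p \<le> \<tau>" and ge: "cr e p \<ge> \<tau> / norm e0 \<longleftrightarrow> cr e0 p \<ge> \<tau>" for p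
    using \<open>e0 \<noteq> 0\<close> by (auto simp: cre divide_le_cancel)
  have "T2 = {p \<in> T2. cr e0 p \<le> \<tau>} \<union> {p \<in> T2. \<tau> \<le> cr e0 p}" by auto
  then have "card T2 \<le> card {p \<in> T2. cr e0 p \<le> \<tau>} + card {p \<in> T2. \<tau> \<le> cr e0 p}"
    by (metis card_Un_le)
  then consider "a \<le> card {p \<in> T2. \<tau> \<le> cr e0 p}" | "a \<le> card {p \<in> T2. cr e0 p \<le> \<tau>}"
    using T a by linarith
  then show ?thesis
  proof cases
    case 1
    obtain B where B: "B \<subseteq> {p \<in> T2. \<tau> \<le> cr e0 p}" "card B = a"
      using 1 by (meson obtain_subset_with_card_n)
    obtain A where A: "A \<subseteq> {p \<in> T1. cr e0 p \<le> \<tau>}" "card A = a"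
      using st(1) unfolding g by (meson obtain_subset_with_card_n)
    obtain C where C: "C \<subseteq> {p \<in> T3. cr e0 p \<le> \<tau>}" "card C = a"
      using st(3) unfolding g by (meson obtain_subset_with_card_n)
    show ?thesis
      by (rule exI[of _ A], rule exI[of _ B], rule exI[of _ C], rule exI[of _ e], rule exI[of _ "\<tau> / norm e0"])
        (use A B C T l12 l23 e1 in \<open>auto simp: le ge subset_iff\<close>)
  next
    case 2
    obtain B where B: "B \<subseteq> {p \<in> T2. cr e0 p \<le> \<tau>}" "card B = a"
      using 2 by (meson obtain_subset_with_card_n)
    obtain A where A: "A \<subseteq> {p \<in> T1. \<tau> \<le> cr e0 p}" "card A = a"
      using st(2) unfolding g by (meson obtain_subset_with_card_n)
    obtain C where C: "C \<subseteq> {p \<in> T3. \<tau> \<le> cr e0 p}" "card C = a"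
      using st(4) unfolding g by (meson obtain_subset_with_card_n)
    show ?thesis
      by (rule exI[of _ A], rule exI[of _ B], rule exI[of _ C], rule exI[of _ e], rule exI[of _ "\<tau> / norm e0"])
        (use A B C T l12 l23 e1 in \<open>auto simp: le ge subset_iff\<close>)
  qed
qed

section \<open>Weights on pairs, small in total but large on every transversal line\<close>

lemma sum_sum_indicator:
  fixes f :: "'a \<Rightarrow> 'a \<Rightarrow> real"
  assumes "finite S"
  shows "(\<Sum>p\<in>S. \<Sum>q\<in>S. of_bool (p \<in> A \<and> q \<in> A) * f p q) = (\<Sum>p\<in>S \<inter> A. \<Sum>q\<in>S \<inter> A. f p q)"
proof -
  have inner: "(\<Sum>q\<in>S. of_bool (q \<in> A) * g q) = sum g (S \<inter> A)" for g :: "'a \<Rightarrow> real"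
    unfolding sum.inter_restrict[OF assms] by (intro sum.cong) auto
  have "(\<Sum>p\<in>S. \<Sum>q\<in>S. of_bool (p \<in> A \<and> q \<in> A) * f p q)
    = (\<Sum>p\<in>S. of_bool (p \<in> A) * (\<Sum>q\<in>S. of_bool (q \<in> A) * f p q))"
    by (simp add: sum_distrib_left of_bool_conj mult.assoc)
  then show ?thesis unfolding inner .
qed

text \<open>Cauchy--Schwarz with the weights 1/12, 1/12 and 5/6, which sum to 1. The small blocks
  are penalised heavily so that the large remainder costs little more than a factor 1.\<close>

lemma square_sum_le_weighted:
  fixes a b c d :: real
  assumes "a = 0 \<or> b = 0 \<or> c = 0"
  shows "(a + b + c + d)\<^sup>2 \<le> 12 * a\<^sup>2 + 12 * b\<^sup>2 + 12 * c\<^sup>2 + 6/5 * d\<^sup>2"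
proof -
  have two: "(x + y + d)\<^sup>2 \<le> 12 * x\<^sup>2 + 12 * y\<^sup>2 + 6/5 * d\<^sup>2" for x y :: real
  proof -
    have "12 * x\<^sup>2 + 12 * y\<^sup>2 + 6/5 * d\<^sup>2 - (x + y + d)\<^sup>2 = (x - y)\<^sup>2 + (10 * x - d)\<^sup>2 / 10 + (10 * y - d)\<^sup>2 / 10"
      by (simp add: power2_eq_square field_simps)
    then show ?thesis by (smt (verit) zero_le_power2 divide_nonneg_pos)
  qed
  show ?thesis using assms two[of b c] two[of a c] two[of a b] by auto
qed

text \<open>At \<open>q = 12 * a\<close> the left side is 37/40 of the square of \<open>q\<close>;
  the slack up to 93/100 pays for the rounding in \<open>a\<close> once \<open>q\<close> is at least
  200.\<close>

lemma block_sizes_contract: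
  fixes a q :: nat
  assumes "a = q div 12" "200 \<le> q"
  shows "36 * (real a)\<^sup>2 + 6/5 * (real q - 3 * real a)\<^sup>2 \<le> 93/100 * (real q)\<^sup>2"
proof -
  have 1: "12 * real a \<le> q" using assms(1) by linarith
  have "q < 12 * a + 12" using assms(1) by linarith
  then have "real q < 12 * real a + 12" by linarith
  then have 2: "39/500 * real q \<le> a" using assms(2) by linarith
  define x y where "x = real a" and "y = real q"
  have "(y - 12 * x) * (500 * x - 39 * y) \<ge> 0" "y * (y - 12 * x) \<ge> 0" "x * y \<ge> 0"
    using 1 2 by (auto simp: x_def y_def intro!: mult_nonneg_nonneg)
  moreover have "36 * x\<^sup>2 + 6/5 * (y - 3 * x)\<^sup>2 + 78/10000 * ((y - 12 * x) * (500 * x - 39 * y))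
      + 342/10000 * (y * (y - 12 * x)) + 6/100 * (x * y) = 93/100 * y\<^sup>2"
    by (simp add: power2_eq_square field_simps)
  ultimately show ?thesis unfolding x_def y_def by linarith
qed

text \<open>A line meets at most two of the blocks \<open>A\<close>, \<open>B\<close>, \<open>C\<close>, so by Cauchy--Schwarz it suffices
  to charge pairs inside the same block, with weights whose total over all pairs is smaller than the
  number of pairs. Iterating inside the blocks gives an exponential gain.\<close>

lemma contracting_weights:
  assumes u: "norm u = 1" and "finite Q" "inj_on (cr u) Q"
  shows "\<exists>\<omega> E. finite E \<and> card E \<le> 5 ^ t \<and> (\<forall>e\<in>E. norm e = 1)
    \<and> (\<forall>p q. 0 \<le> \<omega> p q \<and> \<omega> p q \<le> (12::real) ^ t)
    \<and> (\<Sum>p\<in>Q. \<Sum>q\<in>Q. \<omega> p q) \<le> (93/100) ^ t * (real (card Q))\<^sup>2 + 200 * 12 ^ t * card Q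
    \<and> (\<forall>L v \<eta>. L \<subseteq> Q \<longrightarrow> norm v = 1 \<longrightarrow> aligned L v \<eta> \<longrightarrow> (\<forall>e\<in>insert u E. 2 * \<eta> < \<bar>cr e v\<bar>)
        \<longrightarrow> (real (card L))\<^sup>2 \<le> (\<Sum>p\<in>L. \<Sum>q\<in>L. \<omega> p q))"
  using assms(2,3)
proof (induction t arbitrary: Q)
  case 0
  show ?case
    by (intro exI[of _ "\<lambda>_ _. 1"] exI[of _ "{}"]) (auto simp: power2_eq_square)
next
  case (Suc t)
  define q where "q = card Q"
  define a where "a = q div 12"
  show ?case
  proof (cases "q < 200")
    \<comment> \<open>Small sets get weight 1 on all pairs; the linear term of the bound on the
      total absorbs them.\<close>
    case True
    have "(real q)\<^sup>2 \<le> 200 * real q"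
      using True unfolding power2_eq_square by (intro mult_right_mono) auto
    also have "\<dots> \<le> 200 * 12 ^ Suc t * real q"
    proof -
      have "(1::real) \<le> 12 ^ Suc t" by (intro one_le_power) auto
      then show ?thesis by (intro mult_right_mono) auto
    qed
    finally have "(real q)\<^sup>2 \<le> 200 * 12 ^ Suc t * real q" .
    moreover have "0 \<le> (93/100::real) ^ Suc t * (real q)\<^sup>2" by simp
    ultimately have "(real q)\<^sup>2 \<le> (93/100) ^ Suc t * (real q)\<^sup>2 + 200 * 12 ^ Suc t * real q"
      by linarith
    moreover have "(1::real) \<le> 12 ^ Suc t" by (intro one_le_power) auto
    ultimately show ?thesis
      by (intro exI[of _ "\<lambda>_ _. 1"] exI[of _ "{}"]) (simp add: power2_eq_square flip: q_def)
  next
    case False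
    then have a: "a > 0" "12 * a \<le> card Q" by (auto simp: a_def q_def)
    obtain A B C e h where Q: "A \<subseteq> Q" "B \<subseteq> Q" "C \<subseteq> Q" and card: "card A = a" "card B = a" "card C = a"
      and e: "norm e = 1" and AB: "\<forall>p\<in>A. \<forall>q\<in>B. cr u p < cr u q" and BC: "\<forall>p\<in>B. \<forall>q\<in>C. cr u p < cr u q"
      and h: "(\<forall>p\<in>B. cr e p \<ge> h) \<and> (\<forall>p\<in>A \<union> C. cr e p \<le> h) \<or> (\<forall>p\<in>B. cr e p \<le> h) \<and> (\<forall>p\<in>A \<union> C. cr e p \<ge> h)"
      using three_blocks[OF Suc.prems(1) u Suc.prems(2) a] by blast
    define D where "D = Q - A - B - C"
    have fin: "finite A" "finite B" "finite C" "finite D" using Q Suc.prems finite_subset by (auto simp: D_def)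
    obtain b0 where "b0 \<in> B" using card a by fastforce
    have AC: "\<forall>p\<in>A. \<forall>q\<in>C. cr u p < cr u q"
      using AB BC \<open>b0 \<in> B\<close> by (meson order.strict_trans)
    have disj: "A \<inter> B = {}" "B \<inter> C = {}" "A \<inter> C = {}" "(A \<union> B \<union> C) \<inter> D = {}"
      using AB BC AC by (force simp: D_def)+
    have un: "Q = A \<union> B \<union> C \<union> D" using Q by (auto simp: D_def)
    have card4: "card S = card (S \<inter> A) + card (S \<inter> B) + card (S \<inter> C) + card (S \<inter> D)"
      if "S \<subseteq> Q" for S
    proof -
      have fS: "finite S" using that Suc.prems finite_subset by blast
      have "S = ((S \<inter> A \<union> S \<inter> B) \<union> S \<inter> C) \<union> S \<inter> D" using that un by blast
      then have "card S = card (((S \<inter> A \<union> S \<inter> B) \<union> S \<inter> C) \<union> S \<inter> D)" by simp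
      also have "\<dots> = card ((S \<inter> A \<union> S \<inter> B) \<union> S \<inter> C) + card (S \<inter> D)"
        using fS disj by (intro card_Un_disjoint) auto
      also have "card ((S \<inter> A \<union> S \<inter> B) \<union> S \<inter> C) = card (S \<inter> A \<union> S \<inter> B) + card (S \<inter> C)"
        using fS disj by (intro card_Un_disjoint) auto
      also have "card (S \<inter> A \<union> S \<inter> B) = card (S \<inter> A) + card (S \<inter> B)"
        using fS disj by (intro card_Un_disjoint) auto
      finally show ?thesis .
    qed
    have cD: "real (card D) = real q - 3 * real a"
    proof -
      have "Q \<inter> A = A" "Q \<inter> B = B" "Q \<inter> C = C" "Q \<inter> D = D" using un by auto
      then show ?thesis using card4[of Q] card by (simp add: q_def)
    qed
    have inj: "inj_on (cr u) A" "inj_on (cr u) B" "inj_on (cr u) C" "inj_on (cr u) D"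
      using Suc.prems(2) un by (auto intro: inj_on_subset)
    define good where "good X \<omega> E \<longleftrightarrow> finite E \<and> card E \<le> 5 ^ t \<and> (\<forall>e\<in>E. norm e = 1)
      \<and> (\<forall>p q. 0 \<le> \<omega> p q \<and> \<omega> p q \<le> (12::real) ^ t)
      \<and> (\<Sum>p\<in>X. \<Sum>q\<in>X. \<omega> p q) \<le> (93/100) ^ t * (real (card X))\<^sup>2 + 200 * 12 ^ t * card X
      \<and> (\<forall>L v \<eta>. L \<subseteq> X \<longrightarrow> norm v = 1 \<longrightarrow> aligned L v \<eta> \<longrightarrow> (\<forall>e\<in>insert u E. 2 * \<eta> < \<bar>cr e v\<bar>)
        \<longrightarrow> (real (card L))\<^sup>2 \<le> (\<Sum>p\<in>L. \<Sum>q\<in>L. \<omega> p q))" for X \<omega> and E :: "complex set"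
    have ex: "\<exists>\<omega> E. good X \<omega> E" if "finite X" "inj_on (cr u) X" for X
      unfolding good_def using Suc.IH[OF that] .
    obtain \<omega>A EA where gA: "good A \<omega>A EA" using ex[OF fin(1) inj(1)] by blast
    obtain \<omega>B EB where gB: "good B \<omega>B EB" using ex[OF fin(2) inj(2)] by blast
    obtain \<omega>C EC where gC: "good C \<omega>C EC" using ex[OF fin(3) inj(3)] by blast
    obtain \<omega>D ED where gD: "good D \<omega>D ED" using ex[OF fin(4) inj(4)] by blast
    \<comment> \<open>The new direction \<open>e\<close> lets \<open>no_aligned_triple\<close>
      exclude lines through all three blocks; four recursive families and one more direction stay
      within \<open>5 ^ Suc t\<close>.\<close>
    define E where "E = insert e (EA \<union> EB \<union> EC \<union> ED)"
    \<comment> \<open>Pairs from different parts get weight 0; the coefficients are those of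
      \<open>square_sum_le_weighted\<close>.\<close>
    define \<omega> where "\<omega> p q = 12 * (of_bool (p \<in> A \<and> q \<in> A) * \<omega>A p q) + 12 * (of_bool (p \<in> B \<and> q \<in> B) * \<omega>B p q)
      + 12 * (of_bool (p \<in> C \<and> q \<in> C) * \<omega>C p q) + 6/5 * (of_bool (p \<in> D \<and> q \<in> D) * \<omega>D p q)" for p q
    define SS where "SS X f = (\<Sum>p\<in>X. \<Sum>q\<in>X. f p q)" for X and f :: "complex \<Rightarrow> complex \<Rightarrow> real"
    have sum4: "SS S \<omega> = 12 * SS (S \<inter> A) \<omega>A + 12 * SS (S \<inter> B) \<omega>B + 12 * SS (S \<inter> C) \<omega>C + 6/5 * SS (S \<inter> D) \<omega>D"
      if "S \<subseteq> Q" for S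
    proof -
      have fS: "finite S" using that Suc.prems finite_subset by blast
      show ?thesis unfolding SS_def \<omega>_def sum.distrib
        by (simp only: sum_sum_indicator[OF fS] sum_distrib_left[symmetric])
    qed
    have nn: "0 \<le> \<omega>A p q" "0 \<le> \<omega>B p q" "0 \<le> \<omega>C p q" "0 \<le> \<omega>D p q"
      "\<omega>A p q \<le> 12 ^ t" "\<omega>B p q \<le> 12 ^ t" "\<omega>C p q \<le> 12 ^ t" "\<omega>D p q \<le> 12 ^ t" for p q
      using gA gB gC gD by (auto simp: good_def)
    have E: "finite E" "\<forall>e\<in>E. norm e = 1" "card E \<le> 5 ^ Suc t"
    proof -
      show "finite E" "\<forall>e\<in>E. norm e = 1" using gA gB gC gD e by (auto simp: good_def E_def)
      have "card E \<le> Suc (card (EA \<union> EB \<union> EC \<union> ED))" unfolding E_def by (rule card_insert_le_m1) auto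
      also have "card (EA \<union> EB \<union> EC \<union> ED) \<le> card EA + card EB + card EC + card ED"
        by (meson card_Un_le le_trans add_le_mono le_refl)
      also have "Suc (card EA + card EB + card EC + card ED) \<le> 5 ^ Suc t"
      proof -
        have "(1::nat) \<le> 5 ^ t" by simp
        moreover have "card EA \<le> 5 ^ t" "card EB \<le> 5 ^ t" "card EC \<le> 5 ^ t" "card ED \<le> 5 ^ t"
          using gA gB gC gD by (auto simp: good_def)
        ultimately show ?thesis unfolding power_Suc by linarith
      qed
      finally show "card E \<le> 5 ^ Suc t" by simp
    qed
    have w: "0 \<le> \<omega> p q \<and> \<omega> p q \<le> 12 ^ Suc t" for p q
    proof -
      have "\<omega> p q \<in> {0, 12 * \<omega>A p q, 12 * \<omega>B p q, 12 * \<omega>C p q, 6/5 * \<omega>D p q}"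
        using disj unfolding \<omega>_def by (cases "p \<in> A"; cases "p \<in> B"; cases "p \<in> C"; cases "p \<in> D") auto
      moreover have "6/5 * \<omega>D p q \<le> 12 * 12 ^ t" using nn(4,8)[of p q] by linarith
      ultimately show ?thesis using nn[of p q] by auto
    qed
    have tot: "SS Q \<omega> \<le> (93/100) ^ Suc t * (real q)\<^sup>2 + 200 * 12 ^ Suc t * q"
    proof -
      have Qi: "Q \<inter> A = A" "Q \<inter> B = B" "Q \<inter> C = C" "Q \<inter> D = D" using un by auto
      define x y where "x = real a" and "y = real q"
      have comb: "12 * sA + 12 * sB + 12 * sC + 6/5 * sD \<le> 36 * m + 6/5 * n"
        if "sA \<le> m" "sB \<le> m" "sC \<le> m" "sD \<le> n" for sA sB sC sD m n :: real
        using that by linarith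
      have "SS A \<omega>A \<le> (93/100) ^ t * x\<^sup>2 + 200 * 12 ^ t * x"
        "SS B \<omega>B \<le> (93/100) ^ t * x\<^sup>2 + 200 * 12 ^ t * x"
        "SS C \<omega>C \<le> (93/100) ^ t * x\<^sup>2 + 200 * 12 ^ t * x"
        "SS D \<omega>D \<le> (93/100) ^ t * (y - 3 * x)\<^sup>2 + 200 * 12 ^ t * (y - 3 * x)"
        using gA gB gC gD card cD by (auto simp: good_def SS_def x_def y_def)
      then have "SS Q \<omega> \<le> 36 * ((93/100) ^ t * x\<^sup>2 + 200 * 12 ^ t * x)
          + 6/5 * ((93/100) ^ t * (y - 3 * x)\<^sup>2 + 200 * 12 ^ t * (y - 3 * x))"
        unfolding sum4[OF order_refl] Qi by (rule comb)
      also have "\<dots> = (93/100) ^ t * (36 * x\<^sup>2 + 6/5 * (y - 3 * x)\<^sup>2)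
          + 200 * 12 ^ t * (36 * x + 6/5 * (y - 3 * x))"
        by (simp only: distrib_left mult_ac)
      also have "\<dots> \<le> (93/100) ^ t * (93/100 * y\<^sup>2) + 200 * 12 ^ t * (12 * y)"
      proof -
        have "12 * x \<le> y" using a(2) by (simp add: x_def y_def q_def)
        moreover have "0 \<le> x" by (simp add: x_def)
        ultimately have "36 * x + 6/5 * (y - 3 * x) \<le> 12 * y" by argo
        moreover have "36 * x\<^sup>2 + 6/5 * (y - 3 * x)\<^sup>2 \<le> 93/100 * y\<^sup>2"
          using block_sizes_contract[OF a_def] False by (simp only: x_def y_def not_less)
        ultimately show ?thesis by (intro add_mono mult_left_mono) auto
      qed
      finally show ?thesis by (simp add: x_def y_def)
    qed
    have lines: "(real (card L))\<^sup>2 \<le> SS L \<omega>"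
      if L: "L \<subseteq> Q" and v: "norm v = 1" and al: "aligned L v \<eta>" and tr: "\<forall>e\<in>insert u E. 2 * \<eta> < \<bar>cr e v\<bar>" for L v \<eta>
    proof -
      have sub: "aligned (L \<inter> X) v \<eta>" for X using al by (auto simp: aligned_def)
      have part: "(real (card (L \<inter> X)))\<^sup>2 \<le> SS (L \<inter> X) f" if "good X f F" "F \<subseteq> E" for X f F
      proof -
        have "\<forall>e\<in>insert u F. 2 * \<eta> < \<bar>cr e v\<bar>" using tr that(2) by blast
        then show ?thesis using that(1) v sub[of X] unfolding good_def SS_def by blast
      qed
      have "L \<inter> A = {} \<or> L \<inter> B = {} \<or> L \<inter> C = {}"
      proof (rule ccontr)
        assume "\<not> ?thesis"
        then obtain x y z where xyz: "x \<in> L" "x \<in> A" "y \<in> L" "y \<in> B" "z \<in> L" "z \<in> C" by blast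
        show False
          by (rule no_aligned_triple[OF v u e al _ _ xyz(1,3,5), of h])
            (use tr AB BC xyz h in \<open>auto simp: E_def\<close>)
      qed
      then have "(real (card L))\<^sup>2 \<le> 12 * (real (card (L \<inter> A)))\<^sup>2 + 12 * (real (card (L \<inter> B)))\<^sup>2
          + 12 * (real (card (L \<inter> C)))\<^sup>2 + 6/5 * (real (card (L \<inter> D)))\<^sup>2"
        unfolding card4[OF L] of_nat_add by (intro square_sum_le_weighted) auto
      also have "\<dots> \<le> SS L \<omega>"
        unfolding sum4[OF L]
        by (intro add_mono mult_left_mono part[OF gA] part[OF gB] part[OF gC] part[OF gD]) (auto simp: E_def)
      finally show ?thesis .
    qed
    show ?thesis
      unfolding q_def[symmetric] SS_def[symmetric]
    proof (rule exI[of _ \<omega>], rule exI[of _ E], intro conjI)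
      show "\<forall>L v \<eta>. L \<subseteq> Q \<longrightarrow> norm v = 1 \<longrightarrow> aligned L v \<eta> \<longrightarrow> (\<forall>e\<in>insert u E. 2 * \<eta> < \<bar>cr e v\<bar>)
        \<longrightarrow> (real (card L))\<^sup>2 \<le> SS L \<omega>"
        using lines by blast
    qed (use E w tot in auto)
  qed
qed

text \<open>The addition formula for the sine of the angle from \<open>a\<close> to \<open>c\<close>
  by way of \<open>b\<close>, multiplied by the norms.\<close>

lemma norm_sq_mult_cr:
  "(norm b)\<^sup>2 * cr a c = cr a b * Re (cnj b * c) + Re (cnj a * b) * cr b c"
  by (simp add: cr_eq cmod_def algebra_simps power2_eq_square)

lemma norm_mult_abs_cr_le: "norm b * \<bar>cr a c\<bar> \<le> \<bar>cr a b\<bar> * norm c + norm a * \<bar>cr b c\<bar>"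
proof (cases "b = 0")
  case False
  have "norm b * (norm b * \<bar>cr a c\<bar>) = \<bar>(norm b)\<^sup>2 * cr a c\<bar>"
    by (simp add: abs_mult power2_eq_square)
  also have "\<dots> \<le> \<bar>cr a b\<bar> * \<bar>Re (cnj b * c)\<bar> + \<bar>Re (cnj a * b)\<bar> * \<bar>cr b c\<bar>"
    unfolding norm_sq_mult_cr by (metis abs_mult abs_triangle_ineq)
  also have "\<dots> \<le> \<bar>cr a b\<bar> * (norm b * norm c) + (norm a * norm b) * \<bar>cr b c\<bar>"
    using abs_Re_le_cmod[of "cnj b * c"] abs_Re_le_cmod[of "cnj a * b"]
    by (intro add_mono mult_left_mono mult_right_mono) (auto simp: norm_mult)
  also have "\<dots> = norm b * (\<bar>cr a b\<bar> * norm c + norm a * \<bar>cr b c\<bar>)" by (simp add: algebra_simps)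
  finally show ?thesis using False by simp
qed simp

lemma abs_cr_trans:
  assumes "b \<noteq> 0" "\<bar>cr a b\<bar> \<le> \<delta> * norm a * norm b" "\<bar>cr b c\<bar> \<le> \<epsilon> * norm b * norm c"
  shows "\<bar>cr a c\<bar> \<le> (\<delta> + \<epsilon>) * norm a * norm c"
proof -
  have "norm b * \<bar>cr a c\<bar> \<le> \<bar>cr a b\<bar> * norm c + norm a * \<bar>cr b c\<bar>" by (rule norm_mult_abs_cr_le)
  also have "\<dots> \<le> (\<delta> * norm a * norm b) * norm c + norm a * (\<epsilon> * norm b * norm c)"
    using assms by (intro add_mono mult_left_mono mult_right_mono) auto
  also have "\<dots> = norm b * ((\<delta> + \<epsilon>) * norm a * norm c)" by (simp add: algebra_simps)
  finally show ?thesis using assms by simp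
qed

lemma cr_triangle: "cr (q - p) (y - p) = cr (p - y) (q - y)"
  by (simp add: cr_eq algebra_simps)

text \<open>Replaces the line through \<open>x\<close> and \<open>z\<close> in Beck's theorem: a
  double cone with apex \<open>x\<close>, axis through \<open>z\<close> and aperture
  \<open>\<delta>\<close>. The apex is left out so that cones with the same apex can be
  disjoint.\<close>

definition nb :: "complex set \<Rightarrow> real \<Rightarrow> complex \<Rightarrow> complex \<Rightarrow> complex set" where
  "nb Y \<delta> x z = {w \<in> Y - {x}. \<bar>cr (z - x) (w - x)\<bar> \<le> \<delta> * norm (z - x) * norm (w - x)}"

section \<open>Counting cones at a scale where they hardly grow\<close>

lemma card_le_colours:
  fixes s :: real
  assumes "finite S" "\<And>z. z \<in> S \<Longrightarrow> real (card {w \<in> S. c w = c z}) \<le> s"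
  shows "real (card S) \<le> card (c ` S) * s"
proof -
  have "real (card S) = (\<Sum>x\<in>S. 1)" by simp
  also have "\<dots> = (\<Sum>y\<in>c ` S. \<Sum>x\<in>{x \<in> S. c x = y}. 1)"
    using assms(1) by (rule sum.image_gen)
  also have "\<dots> \<le> (\<Sum>y\<in>c ` S. s)" using assms(2) by (intro sum_mono) auto
  finally show ?thesis by simp
qed

lemma maximal_disjoint_subfamily:
  assumes "finite Z" and ne: "\<And>z. z \<in> Z \<Longrightarrow> F z \<noteq> {}"
  shows "\<exists>I\<subseteq>Z. (\<forall>i\<in>I. \<forall>j\<in>I. i \<noteq> j \<longrightarrow> F i \<inter> F j = {}) \<and> (\<forall>z\<in>Z. \<exists>i\<in>I. F z \<inter> F i \<noteq> {})"
proof -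
  define \<I> where "\<I> = {I. I \<subseteq> Z \<and> (\<forall>i\<in>I. \<forall>j\<in>I. i \<noteq> j \<longrightarrow> F i \<inter> F j = {})}"
  have "finite \<I>" using assms(1) by (auto simp: \<I>_def)
  moreover have "{} \<in> \<I>" by (auto simp: \<I>_def)
  ultimately obtain I where I: "I \<in> \<I>" and max: "\<And>J. J \<in> \<I> \<Longrightarrow> I \<subseteq> J \<Longrightarrow> I = J"
    using finite_has_maximal[of \<I>] by blast
  have "\<exists>i\<in>I. F z \<inter> F i \<noteq> {}" if z: "z \<in> Z" for z
  proof (rule ccontr)
    assume *: "\<not> ?thesis"
    then have "insert z I \<in> \<I>" using I z by (auto simp: \<I>_def)
    then have "z \<in> I" using max[of "insert z I"] by auto
    then show False using * ne[OF z] by auto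
  qed
  then show ?thesis using I by (auto simp: \<I>_def)
qed

text \<open>Every jump multiplies \<open>K\<close> by more than \<open>G\<close>, starting from at
  least 1, and \<open>K\<close> never exceeds \<open>N\<close>. Applied to the number of points in a
  cone of growing aperture, this yields a scale at which few cones jump.\<close>

lemma few_jumps:
  fixes K :: "nat \<Rightarrow> real"
  assumes K: "K 0 \<ge> 1" "\<And>j. K j \<le> K (Suc j)" "\<And>j. K j \<le> N" and G: "G \<ge> 1" "G ^ m > N"
  shows "card {j. j < J \<and> G * K j < K (Suc j)} \<le> m"
proof (rule ccontr)
  assume c: "\<not> ?thesis"
  have "G ^ card {i. i < j \<and> G * K i < K (Suc i)} \<le> K j" for j
  proof (induction j)
    case (Suc j)
    have eq: "{i. i < Suc j \<and> G * K i < K (Suc i)}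
        = (if G * K j < K (Suc j) then insert j {i. i < j \<and> G * K i < K (Suc i)} else {i. i < j \<and> G * K i < K (Suc i)})"
      by (auto simp: less_Suc_eq)
    show ?case
    proof (cases "G * K j < K (Suc j)")
      case True
      have "G * G ^ card {i. i < j \<and> G * K i < K (Suc i)} \<le> G * K j"
        using Suc G by (intro mult_left_mono) auto
      then show ?thesis unfolding eq using True by simp
    next
      case False
      then show ?thesis unfolding eq using Suc K(2)[of j] by simp
    qed
  qed (use K in simp)
  then have "G ^ card {j. j < J \<and> G * K j < K (Suc j)} \<le> K J" by blast
  moreover have "G ^ m \<le> G ^ card {j. j < J \<and> G * K j < K (Suc j)}"
    using c G by (intro power_increasing) auto
  ultimately show False using K(3)[of J] G by linarith
qed

lemma generic_direction:
  assumes "finite (Y :: complex set)"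
  shows "\<exists>u. norm u = 1 \<and> inj_on (cr u) Y"
proof -
  define A where "A = (\<lambda>(p, q). Arg (p - q)) ` (Y \<times> Y) \<union> (\<lambda>(p, q). Arg (p - q) + pi) ` (Y \<times> Y)
     \<union> (\<lambda>(p, q). Arg (p - q) - pi) ` (Y \<times> Y)"
  have "finite A" using assms by (auto simp: A_def)
  moreover have "infinite {0<..<(1::real)}" by (simp add: infinite_Ioo)
  ultimately obtain \<theta> where \<theta>: "\<theta> \<in> {0<..<1}" "\<theta> \<notin> A" by (meson finite_subset subsetI)
  have "inj_on (cr (cis \<theta>)) Y"
  proof (rule inj_onI, rule ccontr)
    fix p q assume pq: "p \<in> Y" "q \<in> Y" "cr (cis \<theta>) p = cr (cis \<theta>) q" "p \<noteq> q"
    define \<phi> where "\<phi> = Arg (p - q)"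
    have "p - q = of_real (norm (p - q)) * cis \<phi>"
      using pq by (metis \<phi>_def rcis_cmod_Arg rcis_def)
    then have "cr (cis \<theta>) (p - q) = norm (p - q) * cr (cis \<theta>) (cis \<phi>)" by (metis cr_scale_right)
    then have "cr (cis \<theta>) (cis \<phi>) = 0" using pq by (simp add: cr_diff_right)
    then have "sin (\<phi> - \<theta>) = 0" by (simp add: cr_eq sin_diff algebra_simps)
    then obtain i :: int where i: "\<phi> - \<theta> = i * pi" by (metis sin_zero_iff_int2)
    have "- pi < \<phi>" "\<phi> \<le> pi" using Arg_bounded by (auto simp: \<phi>_def)
    moreover have "0 < \<theta>" "\<theta> < 1" "pi > 3" using \<theta> pi_gt3 by auto
    ultimately have "i * pi < 1 * pi" "-2 * pi < i * pi" using i by linarith+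
    then have "real_of_int i < 1" "-2 < real_of_int i" by (simp_all only: mult_less_cancel_right_pos pi_gt_zero)
    then have "i = 0 \<or> i = -1" by linarith
    then have "\<theta> = \<phi> \<or> \<theta> = \<phi> + pi" using i by auto
    then show False using \<theta> pq unfolding A_def \<phi>_def by force
  qed
  then show ?thesis by (intro exI[of _ "cis \<theta>"]) simp
qed

text \<open>The points \<open>p\<close> and \<open>q\<close>, at least \<open>r\<close> apart, lie
  near the line through \<open>x\<close> along \<open>v\<close>, so their own line makes a sine of
  at most \<open>2 * \<delta> * D / r\<close> with \<open>v\<close>. A point \<open>y\<close> that
  sees them almost aligned is close to their line, and hence to the first one.\<close>

lemma near_line_of_two:
  assumes D: "0 < r" "r \<le> D" and \<delta>: "\<delta> \<ge> 0" and v: "norm v = 1"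
    and p: "\<bar>cr v (p - x)\<bar> \<le> \<delta> * D" and q: "\<bar>cr v (q - x)\<bar> \<le> \<delta> * D"
    and pq: "r \<le> norm (p - q)" and y: "\<bar>cr (p - y) (q - y)\<bar> \<le> 2 * \<delta> * D\<^sup>2" and py: "norm (y - p) \<le> D"
  shows "\<bar>cr v (y - x)\<bar> \<le> 5 * \<delta> * D\<^sup>2 / r"
proof -
  define b where "b = q - p"
  have b: "norm b \<ge> r" using pq by (simp add: b_def norm_minus_commute)
  have bp: "norm b > 0" using b D by linarith
  have "norm b * \<bar>cr v (y - p)\<bar> \<le> \<bar>cr v b\<bar> * norm (y - p) + norm v * \<bar>cr b (y - p)\<bar>"
    by (rule norm_mult_abs_cr_le)
  also have "\<dots> \<le> (2 * \<delta> * D) * D + 1 * (2 * \<delta> * D\<^sup>2)"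
  proof (intro add_mono mult_mono)
    have "cr v b = cr v (q - x) - cr v (p - x)" by (simp add: b_def cr_diff_right)
    then show "\<bar>cr v b\<bar> \<le> 2 * \<delta> * D" using p q by linarith
    show "\<bar>cr b (y - p)\<bar> \<le> 2 * \<delta> * D\<^sup>2" using y by (simp add: b_def cr_triangle)
  qed (use py v D \<delta> in auto)
  finally have "norm b * \<bar>cr v (y - p)\<bar> \<le> 4 * \<delta> * D\<^sup>2" by (simp add: power2_eq_square mult_ac)
  then have "\<bar>cr v (y - p)\<bar> \<le> 4 * \<delta> * D\<^sup>2 / norm b" using bp by (simp add: field_simps)
  also have "\<dots> \<le> 4 * \<delta> * D\<^sup>2 / r" using b bp D \<delta> by (intro divide_left_mono mult_pos_pos) auto
  finally have 1: "\<bar>cr v (y - p)\<bar> \<le> 4 * \<delta> * D\<^sup>2 / r" .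
  have "\<delta> * D * r \<le> \<delta> * D * D" using D \<delta> by (intro mult_left_mono) auto
  then have "\<delta> * D \<le> \<delta> * D\<^sup>2 / r" using D by (simp add: field_simps power2_eq_square)
  moreover have "cr v (y - x) = cr v (y - p) + cr v (p - x)" by (simp add: cr_diff_right)
  ultimately have "\<bar>cr v (y - x)\<bar> \<le> 4 * (\<delta> * D\<^sup>2 / r) + \<delta> * D\<^sup>2 / r"
    using 1 p by (simp add: mult.assoc)
  then show ?thesis by simp
qed

text \<open>At a scale where most cones grow by at most a factor \<open>G\<close>, each apex keeps a
  maximal disjoint family of cones. Those transversal to all directions in \<open>insert u E\<close>
  are charged to pairs of points through the weights; no pair of distinct points is charged more
  than about \<open>G\<close> times its weight, and since the weights are small in total, such cones
  cover few pairs. Hence most pairs point along one of at most \<open>5 ^ t + 1\<close> directions,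
  and averaging gives one apex and one direction.\<close>

lemma robust_beck_core:
  fixes Y :: "complex set" and r D \<delta> G s N :: real and M m t :: nat
  assumes fin: "finite Y" and N: "N = card Y" "N \<ge> 16" and r: "r > 0"
    and sep: "\<And>p q. p \<in> Y \<Longrightarrow> q \<in> Y \<Longrightarrow> p \<noteq> q \<Longrightarrow> r \<le> norm (p - q)"
    and diam: "\<And>p q. p \<in> Y \<Longrightarrow> q \<in> Y \<Longrightarrow> norm (p - q) \<le> D" and \<delta>: "\<delta> \<ge> 0"
    and col: "\<And>x. x \<in> Y \<Longrightarrow> \<exists>c::complex \<Rightarrow> real. card (c ` (Y - {x})) \<le> M \<and>
      (\<forall>z\<in>Y - {x}. \<forall>w\<in>Y - {x}. c z = c w \<longrightarrow> \<bar>cr (z - x) (w - x)\<bar> \<le> \<delta> * norm (z - x) * norm (w - x))"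
    and s: "s \<ge> 1" "16 * M * s \<le> N" and G: "G \<ge> 1" "G ^ m > N"
    and ineq: "G * (2 * G * ((93/100) ^ t * N\<^sup>2 + 200 * 12 ^ t * N) + 12 ^ t * N\<^sup>2 / s) < N\<^sup>2 / 4"
  shows "\<exists>e Z. norm e = 1 \<and> Z \<subseteq> Y \<and> N \<le> 2 * (5 ^ t + 1) * real (card Z) \<and>
    (\<forall>p\<in>Z. \<forall>q\<in>Z. \<bar>cr e (p - q)\<bar> \<le> 4 * D * (8 * (D / r)\<^sup>2) ^ (16 * m) * \<delta>)"
proof -
  \<comment> \<open>The next scale must dominate the loss in \<open>near_line_of_two\<close>, a
    displacement \<open>5 * d j * D\<^sup>2 / r\<close> read as an angle at distance at least
    \<open>r\<close>.\<close>
  define \<Lambda> where "\<Lambda> = 8 * (D / r)\<^sup>2"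
  define d where "d j = \<Lambda> ^ j * \<delta>" for j
  define K where "K j x z = card (nb Y (d j) x z)" for j x z
  have "\<exists>p\<in>Y. \<exists>q\<in>Y. p \<noteq> q"
  proof (rule ccontr)
    assume "\<not> ?thesis"
    then have "card Y \<le> 1" using fin by (auto simp: card_le_Suc0_iff_eq)
    then show False using N by simp
  qed
  then have rD: "r \<le> D" using sep diam by (meson order_trans)
  have Dr: "1 \<le> D / r" using rD r by simp
  have "1 \<le> (D / r)\<^sup>2" using Dr by (simp add: one_le_power)
  then have \<Lambda>: "\<Lambda> \<ge> 8" by (simp add: \<Lambda>_def)
  have d0: "d j \<ge> 0" for j using \<Lambda> \<delta> by (simp add: d_def)
  have dSuc: "d (Suc j) = \<Lambda> * d j" for j by (simp add: d_def)
  have d2: "2 * d j \<le> d (Suc j)" for j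
    unfolding dSuc using \<Lambda> d0 by (intro mult_right_mono) auto
  have fnb: "finite (nb Y \<epsilon> x z)" "nb Y \<epsilon> x z \<subseteq> Y - {x}" for \<epsilon> x z using fin by (auto simp: nb_def)
  have nb_mono: "nb Y \<epsilon> x z \<subseteq> nb Y \<epsilon>' x z" if "\<epsilon> \<le> \<epsilon>'" for \<epsilon> \<epsilon>' x z
    using mult_right_mono[OF that, of "norm (z - x) * norm (w - x)" for w]
    unfolding nb_def mult.assoc by (auto intro: order_trans)
  have dmono: "d i \<le> d j" if "i \<le> j" for i j
    unfolding d_def using that \<Lambda> \<delta> by (intro mult_right_mono power_increasing) auto
  have KN: "real (K j x z) \<le> N" for j x z
    unfolding K_def N using fnb fin by (metis Diff_subset card_mono of_nat_mono order_trans)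
  have Kmono: "K i x z \<le> K j x z" if "i \<le> j" for i j x z
    unfolding K_def by (intro card_mono fnb nb_mono dmono that)
  have self: "z \<in> nb Y (d j) x z" if "z \<in> Y" "z \<noteq> x" for z x j
    using that d0 by (simp add: nb_def)
  have Npos: "N > 0" using N by linarith

  \<comment> \<open>A colour class lies in one cone, so the points whose cones have fewer than
    \<open>s\<close> members number at most \<open>M * s\<close>.\<close>
  have small: "16 * card {z \<in> Y - {x}. K 0 x z < s} \<le> N" if x: "x \<in> Y" for x
  proof -
    obtain c :: "complex \<Rightarrow> real" where c: "card (c ` (Y - {x})) \<le> M"
      "\<And>z w. z \<in> Y - {x} \<Longrightarrow> w \<in> Y - {x} \<Longrightarrow> c z = c w \<Longrightarrow> \<bar>cr (z - x) (w - x)\<bar> \<le> \<delta> * norm (z - x) * norm (w - x)"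
      using col[OF x] by blast
    define S where "S = {z \<in> Y - {x}. K 0 x z < s}"
    have "real (card {w \<in> S. c w = c z}) \<le> s" if "z \<in> S" for z
    proof -
      have "{w \<in> S. c w = c z} \<subseteq> nb Y (d 0) x z"
        using that c(2)[of z] unfolding S_def nb_def d_def by auto
      then have "card {w \<in> S. c w = c z} \<le> K 0 x z" unfolding K_def by (intro card_mono fnb)
      then show ?thesis using that by (simp add: S_def)
    qed
    then have "real (card S) \<le> card (c ` S) * s" using fin by (intro card_le_colours) (auto simp: S_def)
    also have "\<dots> \<le> M * s"
    proof -
      have "card (c ` S) \<le> card (c ` (Y - {x}))" using fin by (intro card_mono image_mono) (auto simp: S_def)
      then show ?thesis using c(1) s by (intro mult_right_mono) auto
    qed
    finally show ?thesis using s by (simp add: S_def)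
  qed

  define jump where "jump j x = {z \<in> Y - {x}. G * K j x z < K (Suc j) x z}" for j x
  \<comment> \<open>A pair jumps at most \<open>m\<close> times, so among \<open>16 * m\<close>
    scales one has at most \<open>N\<^sup>2 / 16\<close> jumping pairs.\<close>
  have "\<exists>j<16 * m. 16 * (\<Sum>x\<in>Y. real (card (jump j x))) \<le> N\<^sup>2"
  proof (rule ccontr)
    assume "\<not> ?thesis"
    then have gt: "N\<^sup>2 < 16 * (\<Sum>x\<in>Y. real (card (jump j x)))" if "j < 16 * m" for j using that by force
    have "m \<noteq> 0" using G N by (intro notI) auto
    then have "{..<16 * m} \<noteq> {}" by (auto simp: lessThan_empty_iff)
    then have "16 * m * N\<^sup>2 < (\<Sum>j<16*m. 16 * (\<Sum>x\<in>Y. real (card (jump j x))))"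
      using sum_strict_mono[of "{..<16*m}" "\<lambda>_. N\<^sup>2" "\<lambda>j. 16 * (\<Sum>x\<in>Y. real (card (jump j x)))"] gt by auto
    also have "\<dots> = 16 * (\<Sum>x\<in>Y. \<Sum>j<16*m. real (card (jump j x)))"
      by (simp add: sum_distrib_left[symmetric]) (rule sum.swap)
    also have "\<dots> = 16 * (\<Sum>x\<in>Y. \<Sum>z\<in>Y - {x}. real (card {j. j < 16*m \<and> G * K j x z < K (Suc j) x z}))"
    proof -
      have "(\<Sum>j<16*m. real (card (jump j x))) = (\<Sum>z\<in>Y - {x}. real (card {j. j < 16*m \<and> G * K j x z < K (Suc j) x z}))" for x
      proof -
        have "(\<Sum>j<16*m. real (card (jump j x))) = (\<Sum>j<16*m. \<Sum>z\<in>Y - {x}. of_bool (G * K j x z < K (Suc j) x z))"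
        proof (intro sum.cong refl)
          fix j
          have "jump j x = (Y - {x}) \<inter> {z. G * K j x z < K (Suc j) x z}" by (auto simp: jump_def)
          then show "real (card (jump j x)) = (\<Sum>z\<in>Y - {x}. of_bool (G * K j x z < K (Suc j) x z))"
            using fin by simp
        qed
        also have "\<dots> = (\<Sum>z\<in>Y - {x}. \<Sum>j<16*m. of_bool (G * K j x z < K (Suc j) x z))" by (rule sum.swap)
        also have "\<dots> = (\<Sum>z\<in>Y - {x}. real (card {j. j < 16*m \<and> G * K j x z < K (Suc j) x z}))"
          by (simp add: Int_def)
        finally show ?thesis .
      qed
      then show ?thesis by simp
    qed
    also have "\<dots> \<le> 16 * (\<Sum>x\<in>Y. \<Sum>z\<in>Y - {x}. real m)"
    proof (intro mult_left_mono sum_mono)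
      fix x z assume "x \<in> Y" "z \<in> Y - {x}"
      have "card {j. j < 16*m \<and> G * (\<lambda>j. real (K j x z)) j < (\<lambda>j. real (K j x z)) (Suc j)} \<le> m"
      proof (rule few_jumps[where N = N])
        have "K 0 x z \<noteq> 0" using self[of z x 0] \<open>z \<in> Y - {x}\<close> fnb(1) by (auto simp: K_def)
        then show "1 \<le> real (K 0 x z)" by simp
        show "real (K j x z) \<le> real (K (Suc j) x z)" for j
          using Kmono[of j "Suc j" x z] by simp
      qed (use KN G in auto)
      then show "real (card {j. j < 16*m \<and> G * K j x z < K (Suc j) x z}) \<le> real m" by simp
    qed simp
    also have "\<dots> \<le> 16 * (\<Sum>x\<in>Y. N * m)"
    proof (intro mult_left_mono sum_mono)
      fix x
      have "card (Y - {x}) \<le> card Y" using fin by (intro card_mono) auto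
      then have "real (card (Y - {x})) * real m \<le> N * m" using N by (intro mult_right_mono) auto
      then show "(\<Sum>z\<in>Y - {x}. real m) \<le> N * m" by simp
    qed simp
    also have "\<dots> = 16 * m * N\<^sup>2" by (simp add: N(1)[symmetric] power2_eq_square)
    finally show False by simp
  qed
  then obtain j where j: "j < 16 * m" and jmp: "16 * (\<Sum>x\<in>Y. real (card (jump j x))) \<le> N\<^sup>2" by blast

  define gd where "gd x = {z \<in> Y - {x}. s \<le> K j x z \<and> K (Suc j) x z \<le> G * K j x z}" for x
  have fgd: "finite (gd x)" for x using fin by (simp add: gd_def)
  have gd_count: "3/4 * N\<^sup>2 \<le> (\<Sum>x\<in>Y. real (card (gd x)))"
  proof -
    have "N - 1 - N / 16 - card (jump j x) \<le> card (gd x)" if x: "x \<in> Y" for x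
    proof -
      have "Y - {x} \<subseteq> gd x \<union> {z \<in> Y - {x}. K 0 x z < s} \<union> jump j x"
      proof
        fix z assume z: "z \<in> Y - {x}"
        have "real (K 0 x z) \<le> real (K j x z)" using Kmono[of 0 j x z] by simp
        then consider "real (K 0 x z) < s" | "G * real (K j x z) < real (K (Suc j) x z)"
          | "s \<le> real (K j x z)" "real (K (Suc j) x z) \<le> G * real (K j x z)" by linarith
        then show "z \<in> gd x \<union> {z \<in> Y - {x}. K 0 x z < s} \<union> jump j x"
          using z unfolding gd_def jump_def by cases auto
      qed
      then have "card (Y - {x}) \<le> card (gd x \<union> {z \<in> Y - {x}. K 0 x z < s} \<union> jump j x)"
        using fin fgd by (intro card_mono) (auto simp: jump_def)
      also have "\<dots> \<le> card (gd x) + card {z \<in> Y - {x}. K 0 x z < s} + card (jump j x)"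
        by (meson card_Un_le le_trans add_le_mono le_refl)
      finally have "real (card (Y - {x})) \<le> card (gd x) + real (card {z \<in> Y - {x}. K 0 x z < s}) + card (jump j x)"
        by linarith
      moreover have "real (card (Y - {x})) = N - 1"
      proof -
        have "card Y \<ge> 1" using x fin by (auto simp: Suc_le_eq card_gt_0_iff)
        then show ?thesis using x fin by (simp add: N(1) of_nat_diff)
      qed
      ultimately show ?thesis using small[OF x] by linarith
    qed
    then have "(\<Sum>x\<in>Y. N - 1 - N / 16 - card (jump j x)) \<le> (\<Sum>x\<in>Y. real (card (gd x)))"
      by (intro sum_mono) auto
    moreover have "(\<Sum>x\<in>Y. N - 1 - N / 16 - card (jump j x)) = N * (N - 1 - N / 16) - (\<Sum>x\<in>Y. real (card (jump j x)))"
      by (simp add: sum_subtractf N(1)[symmetric])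
    moreover have "N * (N - 1 - N / 16) = 15/16 * N\<^sup>2 - N" by (simp add: power2_eq_square algebra_simps)
    moreover have "16 * N \<le> N\<^sup>2" using N by (simp add: power2_eq_square)
    ultimately have "15/16 * N\<^sup>2 - N - (\<Sum>x\<in>Y. real (card (jump j x))) \<le> (\<Sum>x\<in>Y. real (card (gd x)))"
      "16 * N \<le> N\<^sup>2" by simp_all
    moreover have "0 \<le> N\<^sup>2" by simp
    ultimately show ?thesis using jmp by argo
  qed

  have "\<exists>I. \<forall>x. I x \<subseteq> gd x \<and> (\<forall>i\<in>I x. \<forall>i'\<in>I x. i \<noteq> i' \<longrightarrow> nb Y (d j) x i \<inter> nb Y (d j) x i' = {})
     \<and> (\<forall>z\<in>gd x. \<exists>i\<in>I x. nb Y (d j) x z \<inter> nb Y (d j) x i \<noteq> {})"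
    by (intro choice allI maximal_disjoint_subfamily[OF fgd]) (use self in \<open>force simp: gd_def\<close>)
  then obtain I where I: "\<And>x. I x \<subseteq> gd x"
    and Idisj: "\<And>x i i'. i \<in> I x \<Longrightarrow> i' \<in> I x \<Longrightarrow> i \<noteq> i' \<Longrightarrow> nb Y (d j) x i \<inter> nb Y (d j) x i' = {}"
    and Imax: "\<And>x z. z \<in> gd x \<Longrightarrow> \<exists>i\<in>I x. nb Y (d j) x z \<inter> nb Y (d j) x i \<noteq> {}" by metis
  have nbD: "\<bar>cr (z - x) (w - x)\<bar> \<le> \<epsilon> * norm (z - x) * norm (w - x)" "w \<in> Y" "w \<noteq> x" if "w \<in> nb Y \<epsilon> x z" for \<epsilon> w x z
    using that by (auto simp: nb_def)
  have cr_sym: "\<bar>cr a b\<bar> = \<bar>cr b a\<bar>" for a b by (metis cr_commute abs_minus_cancel)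
  \<comment> \<open>If two cones share a point, the axis point of one lies in the other at twice the
    aperture, hence at the next scale.\<close>
  have cover: "\<exists>i\<in>I x. z \<in> nb Y (d (Suc j)) x i" if z: "z \<in> gd x" for x z
  proof -
    obtain i w where i: "i \<in> I x" and w: "w \<in> nb Y (d j) x z" "w \<in> nb Y (d j) x i" using Imax[OF z] by blast
    have "\<bar>cr (i - x) (z - x)\<bar> \<le> (d j + d j) * norm (i - x) * norm (z - x)"
      by (rule abs_cr_trans[where b = "w - x"])
        (use nbD[OF w(1)] nbD[OF w(2)] in \<open>auto simp: cr_sym[of "w - x" "z - x"] mult_ac\<close>)
    also have "\<dots> \<le> d (Suc j) * norm (i - x) * norm (z - x)"
      using d2[of j] by (intro mult_right_mono) auto
    finally show ?thesis using i z by (auto simp: nb_def gd_def)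
  qed

  obtain u where u: "norm u = 1" "inj_on (cr u) Y" using generic_direction[OF fin] by blast
  obtain \<omega> E where cw: "finite E \<and> card E \<le> 5 ^ t \<and> (\<forall>e\<in>E. norm e = 1)
    \<and> (\<forall>p q. 0 \<le> \<omega> p q \<and> \<omega> p q \<le> (12::real) ^ t)
    \<and> (\<Sum>p\<in>Y. \<Sum>q\<in>Y. \<omega> p q) \<le> (93/100) ^ t * N\<^sup>2 + 200 * 12 ^ t * N
    \<and> (\<forall>L v \<eta>. L \<subseteq> Y \<longrightarrow> norm v = 1 \<longrightarrow> aligned L v \<eta> \<longrightarrow> (\<forall>e\<in>insert u E. 2 * \<eta> < \<bar>cr e v\<bar>)
        \<longrightarrow> (real (card L))\<^sup>2 \<le> (\<Sum>p\<in>L. \<Sum>q\<in>L. \<omega> p q))"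
    using contracting_weights[OF u(1) fin u(2), of t]
    unfolding of_nat_mult of_nat_power of_nat_numeral N(1)[symmetric] by (elim exE) (rule that)
  have E: "finite E" "card E \<le> 5 ^ t" "\<And>e. e \<in> E \<Longrightarrow> norm e = 1"
    and w0: "\<And>p q. 0 \<le> \<omega> p q" and w1: "\<And>p q. \<omega> p q \<le> 12 ^ t"
    and wsum: "(\<Sum>p\<in>Y. \<Sum>q\<in>Y. \<omega> p q) \<le> (93/100) ^ t * N\<^sup>2 + 200 * 12 ^ t * N"
    and wline: "\<And>L v \<eta>. L \<subseteq> Y \<Longrightarrow> norm v = 1 \<Longrightarrow> aligned L v \<eta> \<Longrightarrow> (\<And>e. e \<in> insert u E \<Longrightarrow> 2 * \<eta> < \<bar>cr e v\<bar>)
        \<Longrightarrow> (real (card L))\<^sup>2 \<le> (\<Sum>p\<in>L. \<Sum>q\<in>L. \<omega> p q)"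
    using cw by blast+
  \<comment> \<open>Two points of a cone are each within \<open>d j * D\<close> of its axis and at
    least \<open>r\<close> apart, so a chord makes a sine of at most \<open>\<eta>\<close> with the
    axis.\<close>
  define \<eta> where "\<eta> = 2 * d j * D / r"
  define tr where "tr x i \<longleftrightarrow> (\<forall>e\<in>insert u E. 2 * \<eta> * norm (i - x) < \<bar>cr e (i - x)\<bar>)" for x i
  define T where "T = Sigma Y (\<lambda>x. {i \<in> I x. tr x i})"
  define L where "L a = nb Y (d j) (fst a) (snd a)" for a
  have TD: "x \<in> Y" "i \<in> I x" "i \<in> Y" "i \<noteq> x" "tr x i" "s \<le> K j x i" "K (Suc j) x i \<le> G * K j x i" if "(x, i) \<in> T" for x i
    using that I[of x] unfolding T_def gd_def by auto
  have fT: "finite T" using fin I fgd unfolding T_def by (intro finite_SigmaI) (auto intro: finite_subset)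
  have Kpos: "K j (fst a) (snd a) > 0" if "a \<in> T" for a
    using TD[of "fst a" "snd a"] that s by (intro gr0I) auto

  have tri: "\<bar>cr (p - y) (q - y)\<bar> \<le> 2 * d j * norm (p - y) * norm (q - y)"
    if "p \<in> nb Y (d j) y i" "q \<in> nb Y (d j) y i" "i \<noteq> y" for p q y i
  proof -
    have "\<bar>cr (p - y) (q - y)\<bar> \<le> (d j + d j) * norm (p - y) * norm (q - y)"
      by (rule abs_cr_trans[where b = "i - y"])
        (use nbD[OF that(1)] nbD[OF that(2)] that(3) in \<open>auto simp: cr_sym[of "p - y" "i - y"] mult_ac\<close>)
    then show ?thesis by simp
  qed
  have unit_le: "\<bar>cr (of_real (1 / norm (i - x)) * (i - x)) (p - x)\<bar> \<le> d j * D"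
    if "p \<in> nb Y (d j) x i" "i \<noteq> x" "x \<in> Y" for p x i
  proof -
    have "\<bar>cr (of_real (1 / norm (i - x)) * (i - x)) (p - x)\<bar> = \<bar>cr (i - x) (p - x)\<bar> / norm (i - x)"
      unfolding cr_scale_left by (simp add: abs_mult)
    also have "\<dots> \<le> d j * norm (p - x)"
      using nbD(1)[OF that(1)] that(2) by (simp add: divide_le_eq mult_ac)
    also have "\<dots> \<le> d j * D"
      using diam[OF nbD(2)[OF that(1)] that(3)] d0 by (intro mult_left_mono) auto
    finally show ?thesis .
  qed
  have unit: "norm (of_real (1 / norm (i - x)) * (i - x)) = 1" if "i \<noteq> x" for i x :: complex
    using that by (simp add: norm_mult norm_divide)
  have L_aligned: "aligned (L (x, i)) (of_real (1 / norm (i - x)) * (i - x)) \<eta>" if "x \<in> Y" "i \<noteq> x" for x i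
    unfolding aligned_def
  proof (intro ballI)
    fix p q assume pq: "p \<in> L (x, i)" "q \<in> L (x, i)"
    let ?v = "of_real (1 / norm (i - x)) * (i - x)"
    have "cr ?v (p - q) = cr ?v (p - x) - cr ?v (q - x)" by (simp add: cr_diff_right)
    then have 1: "\<bar>cr ?v (p - q)\<bar> \<le> 2 * d j * D"
      using unit_le[of p x i] unit_le[of q x i] pq that by (simp add: L_def)
    show "\<bar>cr ?v (p - q)\<bar> \<le> \<eta> * norm (p - q)"
    proof (cases "p = q")
      case False
      have "r \<le> norm (p - q)" using sep False pq nbD(2) by (auto simp: L_def)
      then have "2 * d j * D * 1 \<le> 2 * d j * D * (norm (p - q) / r)"
        using d0 rD r by (intro mult_left_mono) auto
      then show ?thesis using 1 by (simp add: \<eta>_def)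
    qed simp
  qed
  have L_sq: "(real (K j (fst a) (snd a)))\<^sup>2 \<le> (\<Sum>p\<in>L a. \<Sum>q\<in>L a. \<omega> p q)" if a: "a \<in> T" for a
  proof -
    obtain x i where xi: "a = (x, i)" by (cases a)
    have t: "x \<in> Y" "i \<noteq> x" "tr x i" using TD[of x i] a xi by auto
    have sub: "L (x, i) \<subseteq> Y" using fnb(2)[of "d j" x i] by (auto simp: L_def)
    have "2 * \<eta> < \<bar>cr e (of_real (1 / norm (i - x)) * (i - x))\<bar>" if "e \<in> insert u E" for e
    proof -
      have "2 * \<eta> * norm (i - x) < \<bar>cr e (i - x)\<bar>" using t(3) that by (auto simp: tr_def)
      then show ?thesis using t(2) unfolding cr_scale_right by (simp add: abs_mult field_simps)
    qed
    then show ?thesis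
      using wline[OF sub unit[OF t(2)] L_aligned[OF t(1,2)]] by (simp add: xi L_def K_def)
  qed
  define Tpq where "Tpq p q = {a \<in> T. p \<in> L a \<and> q \<in> L a}" for p q
  \<comment> \<open>Dividing \<open>L_sq\<close> by the size of the cone bounds the sum of all
    sizes; \<open>cc p q\<close> collects the factors with which the weight of a pair is then
    counted.\<close>
  define cc where "cc p q = (\<Sum>a\<in>Tpq p q. 1 / real (K j (fst a) (snd a)))" for p q
  have inj: "inj_on fst (Tpq p q)" for p q
  proof (rule inj_onI, clarify)
    fix x i x' i' assume "(x, i) \<in> Tpq p q" "(x', i') \<in> Tpq p q" "fst (x, i) = fst (x', i')"
    then show "x = x' \<and> i = i'" using Idisj[of i x i'] TD(2) by (fastforce simp: Tpq_def L_def)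
  qed
  have fTpq: "finite (Tpq p q)" for p q using fT by (simp add: Tpq_def)
  have cc_diag: "cc p p \<le> N / s" for p
  proof -
    have "cc p p \<le> (\<Sum>a\<in>Tpq p p. 1 / s)"
      unfolding cc_def using TD(6) s by (intro sum_mono frac_le) (auto simp: Tpq_def)
    also have "\<dots> = card (fst ` Tpq p p) / s" using card_image[OF inj] by simp
    also have "card (fst ` Tpq p p) \<le> card Y" using fin TD(1) by (intro card_mono) (auto simp: Tpq_def)
    then have "card (fst ` Tpq p p) / s \<le> N / s" using N s by (intro divide_right_mono) auto
    finally show ?thesis .
  qed
  \<comment> \<open>Take the smallest cone containing the pair. The apex of any other one sees
    \<open>p\<close> and \<open>q\<close> almost aligned, so it lies in the enlargement of the
    smallest cone, which has at most \<open>G\<close> times as many points. There is one cone per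
    apex, and each contributes at most the reciprocal of the smallest size.\<close>
  have cc_off: "cc p q \<le> 2 * G" if pq: "p \<noteq> q" for p q
  proof (cases "Tpq p q = {}")
    case True
    then show ?thesis using G by (simp add: cc_def)
  next
    case False
    define a where "a = arg_min_on (\<lambda>a. K j (fst a) (snd a)) (Tpq p q)"
    have a: "a \<in> Tpq p q" and amin: "\<And>b. b \<in> Tpq p q \<Longrightarrow> K j (fst a) (snd a) \<le> K j (fst b) (snd b)"
      unfolding a_def using arg_min_if_finite(1)[OF fTpq False, of "\<lambda>a. K j (fst a) (snd a)"]
      arg_min_least[OF fTpq False, where f = "\<lambda>a. K j (fst a) (snd a)"] by blast+
    obtain x i where xi: "a = (x, i)" by (cases a)
    have xiT: "(x, i) \<in> T" and pqL: "p \<in> nb Y (d j) x i" "q \<in> nb Y (d j) x i" using a xi by (auto simp: Tpq_def L_def)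
    have Kp: "real (K j x i) > 0" using Kpos[OF xiT] by simp
    have "fst ` Tpq p q \<subseteq> insert x (nb Y (d (Suc j)) x i)"
    proof
      fix y assume "y \<in> fst ` Tpq p q"
      then obtain i' where i': "(y, i') \<in> T" "p \<in> nb Y (d j) y i'" "q \<in> nb Y (d j) y i'" by (auto simp: Tpq_def L_def)
      show "y \<in> insert x (nb Y (d (Suc j)) x i)"
      proof (cases "y = x")
        case False
        let ?v = "of_real (1 / norm (i - x)) * (i - x)"
        have Yy: "y \<in> Y" "p \<in> Y" "q \<in> Y" "x \<in> Y" "i \<noteq> x" using TD[OF i'(1)] TD[OF xiT] nbD(2)[OF i'(2)] nbD(2)[OF i'(3)] by auto
        have "\<bar>cr (p - y) (q - y)\<bar> \<le> 2 * d j * norm (p - y) * norm (q - y)"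
          using tri[OF i'(2,3)] TD(4)[OF i'(1)] by auto
        also have "\<dots> \<le> 2 * d j * D * D"
          using diam[of p y] diam[of q y] Yy d0 rD r by (intro mult_mono) auto
        finally have A: "\<bar>cr (p - y) (q - y)\<bar> \<le> 2 * d j * D\<^sup>2" by (simp add: power2_eq_square mult_ac)
        have "\<bar>cr ?v (y - x)\<bar> \<le> 5 * d j * D\<^sup>2 / r"
          using sep[of p q] diam[of y p] Yy pq unit[of i x] unit_le[OF pqL(1)] unit_le[OF pqL(2)]
          by (intro near_line_of_two[OF r rD d0 _ _ _ _ A]) auto
        also have "\<dots> \<le> d (Suc j) * r"
        proof -
          have "5 * d j * D\<^sup>2 \<le> 8 * d j * D\<^sup>2" using d0[of j] by (intro mult_right_mono) auto
          then show ?thesis using r by (simp add: dSuc \<Lambda>_def field_simps power2_eq_square)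
        qed
        also have "\<dots> \<le> d (Suc j) * norm (y - x)" using sep[of y x] False Yy d0 by (intro mult_left_mono) auto
        finally have "\<bar>cr (i - x) (y - x)\<bar> \<le> d (Suc j) * norm (i - x) * norm (y - x)"
          using \<open>i \<noteq> x\<close> unfolding cr_scale_left by (simp add: abs_mult field_simps)
        then show ?thesis using Yy False by (simp add: nb_def)
      qed simp
    qed
    then have "card (fst ` Tpq p q) \<le> card (insert x (nb Y (d (Suc j)) x i))" using fnb by (intro card_mono) auto
    moreover have "card (insert x (nb Y (d (Suc j)) x i)) \<le> Suc (K (Suc j) x i)"
      by (simp add: K_def card_insert_if fnb)
    ultimately have "card (Tpq p q) \<le> Suc (K (Suc j) x i)" unfolding card_image[OF inj] by linarith
    moreover have "K j x i \<le> K (Suc j) x i" by (rule Kmono) simp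
    moreover have "1 \<le> K j x i" using Kp by simp
    ultimately have "card (Tpq p q) \<le> 2 * K (Suc j) x i" by linarith
    then have "real (card (Tpq p q)) \<le> 2 * real (K (Suc j) x i)" by linarith
    then have c: "real (card (Tpq p q)) \<le> 2 * (G * K j x i)" using TD(7)[OF xiT] by linarith
    have "cc p q \<le> (\<Sum>b\<in>Tpq p q. 1 / real (K j x i))"
      unfolding cc_def using amin Kpos Kp xi by (intro sum_mono divide_left_mono) (auto simp: Tpq_def)
    also have "\<dots> = card (Tpq p q) / K j x i" by simp
    also have "\<dots> \<le> 2 * G" using c Kp by (simp add: divide_le_eq mult_ac)
    finally show ?thesis .
  qed
  have Ksum: "(\<Sum>a\<in>T. real (K j (fst a) (snd a)))
      \<le> 2 * G * ((93/100) ^ t * N\<^sup>2 + 200 * 12 ^ t * N) + 12 ^ t * N\<^sup>2 / s"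
  proof -
    have "(\<Sum>a\<in>T. real (K j (fst a) (snd a))) \<le> (\<Sum>a\<in>T. 1 / real (K j (fst a) (snd a)) * (\<Sum>p\<in>L a. \<Sum>q\<in>L a. \<omega> p q))"
      using L_sq Kpos by (intro sum_mono) (auto simp: field_simps power2_eq_square)
    also have "\<dots> = (\<Sum>a\<in>T. \<Sum>p\<in>Y. \<Sum>q\<in>Y. of_bool (p \<in> L a \<and> q \<in> L a) * (\<omega> p q / real (K j (fst a) (snd a))))"
    proof (intro sum.cong refl)
      fix a assume "a \<in> T"
      have "L a \<subseteq> Y" using fnb(2)[of "d j" "fst a" "snd a"] by (auto simp: L_def)
      then have "Y \<inter> L a = L a" by auto
      then show "1 / real (K j (fst a) (snd a)) * (\<Sum>p\<in>L a. \<Sum>q\<in>L a. \<omega> p q)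
         = (\<Sum>p\<in>Y. \<Sum>q\<in>Y. of_bool (p \<in> L a \<and> q \<in> L a) * (\<omega> p q / real (K j (fst a) (snd a))))"
        unfolding sum_sum_indicator[OF fin] by (simp add: sum_divide_distrib)
    qed
    also have "\<dots> = (\<Sum>p\<in>Y. \<Sum>a\<in>T. \<Sum>q\<in>Y. of_bool (p \<in> L a \<and> q \<in> L a) * (\<omega> p q / real (K j (fst a) (snd a))))"
      by (rule sum.swap)
    also have "\<dots> = (\<Sum>p\<in>Y. \<Sum>q\<in>Y. \<Sum>a\<in>T. of_bool (p \<in> L a \<and> q \<in> L a) * (\<omega> p q / real (K j (fst a) (snd a))))"
      by (intro sum.cong refl) (rule sum.swap)
    also have "\<dots> = (\<Sum>p\<in>Y. \<Sum>q\<in>Y. \<omega> p q * cc p q)"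
    proof (intro sum.cong refl)
      fix p q
      have "(\<Sum>a\<in>T. of_bool (p \<in> L a \<and> q \<in> L a) * (\<omega> p q / real (K j (fst a) (snd a))))
          = (\<Sum>a\<in>T. if p \<in> L a \<and> q \<in> L a then \<omega> p q * (1 / real (K j (fst a) (snd a))) else 0)"
        by (intro sum.cong) auto
      also have "\<dots> = \<omega> p q * cc p q"
        unfolding cc_def Tpq_def sum_distrib_left by (rule sum.inter_filter[OF fT, symmetric])
      finally show "(\<Sum>a\<in>T. of_bool (p \<in> L a \<and> q \<in> L a) * (\<omega> p q / real (K j (fst a) (snd a)))) = \<omega> p q * cc p q" .
    qed
    also have "\<dots> \<le> (\<Sum>p\<in>Y. \<Sum>q\<in>Y. \<omega> p q * (2 * G) + of_bool (p = q) * (12 ^ t * (N / s)))"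
    proof (intro sum_mono)
      fix p q
      have A: "0 \<le> \<omega> p q * (2 * G)" using w0 G by simp
      have B: "\<omega> p p * cc p p \<le> 12 ^ t * (N / s)"
        using w1 w0 cc_diag Npos s by (intro mult_mono) (auto simp: cc_def intro!: sum_nonneg)
      show "\<omega> p q * cc p q \<le> \<omega> p q * (2 * G) + of_bool (p = q) * (12 ^ t * (N / s))"
      proof (cases "p = q")
        case True
        have "\<omega> p q * cc p q \<le> 0 + 12 ^ t * (N / s)" using B True by simp
        also have "\<dots> \<le> \<omega> p q * (2 * G) + of_bool (p = q) * (12 ^ t * (N / s))"
          by (intro add_mono A) (simp add: True)
        finally show ?thesis .
      next
        case False
        then show ?thesis using cc_off[OF False] w0[of p q] by (simp add: mult_left_mono)
      qed
    qed
    also have "\<dots> = 2 * G * (\<Sum>p\<in>Y. \<Sum>q\<in>Y. \<omega> p q) + N * (12 ^ t * (N / s))"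
    proof -
      have "(\<Sum>q\<in>Y. of_bool (p = q) * C) = C" if "p \<in> Y" for p and C :: real
      proof -
        have "(\<Sum>q\<in>Y. of_bool (p = q) * C) = (\<Sum>q\<in>Y. if p = q then C else 0)" by (intro sum.cong) auto
        then show ?thesis using fin that by simp
      qed
      then have "(\<Sum>q\<in>Y. \<omega> p q * (2 * G) + of_bool (p = q) * C) = 2 * G * (\<Sum>q\<in>Y. \<omega> p q) + C" if "p \<in> Y" for p and C :: real
        using that unfolding sum.distrib by (simp add: sum_distrib_left mult_ac)
      then have "(\<Sum>p\<in>Y. \<Sum>q\<in>Y. \<omega> p q * (2 * G) + of_bool (p = q) * (12 ^ t * (N / s)))
        = (\<Sum>p\<in>Y. 2 * G * (\<Sum>q\<in>Y. \<omega> p q) + 12 ^ t * (N / s))" by (intro sum.cong refl)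
      then show ?thesis unfolding sum.distrib by (simp add: sum_distrib_left N(1))
    qed
    also have "\<dots> \<le> 2 * G * ((93/100) ^ t * N\<^sup>2 + 200 * 12 ^ t * N) + 12 ^ t * N\<^sup>2 / s"
      using wsum G by (intro add_mono mult_left_mono) (auto simp: power2_eq_square mult_ac)
    finally show ?thesis .
  qed
  \<comment> \<open>The points that enlarged transversal cones cover, apex by apex; in total fewer
    than \<open>N\<^sup>2 / 4\<close>, against at least \<open>3/4 * N\<^sup>2\<close> good
    pairs.\<close>
  define fr where "fr x = {z \<in> gd x. \<exists>i. (x, i) \<in> T \<and> z \<in> nb Y (d (Suc j)) x i}" for x
  have far: "(\<Sum>x\<in>Y. real (card (fr x))) < N\<^sup>2 / 4"
  proof -
    have "real (card (fr x)) \<le> (\<Sum>i\<in>{i \<in> I x. tr x i}. G * real (K j x i))" if x: "x \<in> Y" for x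
    proof -
      have fI: "finite {i \<in> I x. tr x i}" by (rule finite_subset[OF _ fgd[of x]]) (use I in auto)
      have "fr x \<subseteq> (\<Union>i\<in>{i \<in> I x. tr x i}. nb Y (d (Suc j)) x i)" by (auto simp: fr_def T_def)
      then have "card (fr x) \<le> card (\<Union>i\<in>{i \<in> I x. tr x i}. nb Y (d (Suc j)) x i)" using fI fnb by (intro card_mono) auto
      also have "\<dots> \<le> (\<Sum>i\<in>{i \<in> I x. tr x i}. K (Suc j) x i)" unfolding K_def by (rule card_UN_le[OF fI])
      finally have "real (card (fr x)) \<le> real (\<Sum>i\<in>{i \<in> I x. tr x i}. K (Suc j) x i)" by (rule of_nat_mono)
      then have "real (card (fr x)) \<le> (\<Sum>i\<in>{i \<in> I x. tr x i}. real (K (Suc j) x i))" by simp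
      also have "\<dots> \<le> (\<Sum>i\<in>{i \<in> I x. tr x i}. G * real (K j x i))"
        using TD(7) x by (intro sum_mono) (auto simp: T_def)
      finally show ?thesis .
    qed
    then have "(\<Sum>x\<in>Y. real (card (fr x))) \<le> (\<Sum>x\<in>Y. \<Sum>i\<in>{i \<in> I x. tr x i}. G * real (K j x i))"
      by (intro sum_mono) auto
    also have "\<dots> = (\<Sum>a\<in>T. G * real (K j (fst a) (snd a)))"
      unfolding T_def using fin I fgd
      by (subst sum.Sigma) (auto intro!: sum.cong intro: finite_subset)
    also have "\<dots> = G * (\<Sum>a\<in>T. real (K j (fst a) (snd a)))" by (simp add: sum_distrib_left)
    also have "\<dots> \<le> G * (2 * G * ((93/100) ^ t * N\<^sup>2 + 200 * 12 ^ t * N) + 12 ^ t * N\<^sup>2 / s)"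
      using Ksum G by (intro mult_left_mono) auto
    finally show ?thesis using ineq by linarith
  qed
  define nr where "nr e x = {z \<in> Y. \<bar>cr e (z - x)\<bar> \<le> 2 * d (Suc j) * norm (z - x)}" for e x
  have split: "gd x \<subseteq> fr x \<union> (\<Union>e\<in>insert u E. nr e x)" if x: "x \<in> Y" for x
  proof
    fix z assume z: "z \<in> gd x"
    obtain i where i: "i \<in> I x" "z \<in> nb Y (d (Suc j)) x i" using cover[OF z] by blast
    show "z \<in> fr x \<union> (\<Union>e\<in>insert u E. nr e x)"
    proof (cases "tr x i")
      case True
      then show ?thesis using i x z by (auto simp: fr_def T_def)
    next
      case False
      then obtain e where e: "e \<in> insert u E" "\<bar>cr e (i - x)\<bar> \<le> 2 * \<eta> * norm (i - x)"
        by (auto simp: tr_def not_less)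
      have ne: "norm e = 1" using e u E by auto
      have ix: "i - x \<noteq> 0" using i(1) I by (auto simp: gd_def)
      have "\<bar>cr e (z - x)\<bar> \<le> (2 * \<eta> + d (Suc j)) * norm e * norm (z - x)"
        by (rule abs_cr_trans[OF ix]) (use e ne nbD(1)[OF i(2)] in auto)
      also have "\<dots> \<le> 2 * d (Suc j) * norm (z - x)"
      proof -
        have "2 * \<eta> = 4 * d j * (D / r)" by (simp add: \<eta>_def)
        also have "\<dots> \<le> 4 * d j * (D / r)\<^sup>2"
          using d0 by (intro mult_left_mono self_le_power Dr) auto
        also have "\<dots> \<le> d (Suc j)" using d0[of j] by (simp add: dSuc \<Lambda>_def mult_right_mono)
        finally show ?thesis using ne by (simp add: mult_right_mono)
      qed
      finally show ?thesis using e z by (auto simp: nr_def gd_def)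
    qed
  qed
  \<comment> \<open>The directions in \<open>insert u E\<close> must absorb the remaining half of
    the pairs, so one of them is rich at some apex.\<close>
  have "\<exists>x\<in>Y. \<exists>e\<in>insert u E. N \<le> 2 * (5 ^ t + 1) * real (card (nr e x))"
  proof (rule ccontr)
    assume none: "\<not> ?thesis"
    have lt: "real (card (nr e x)) \<le> N / (2 * (5 ^ t + 1))" if "x \<in> Y" "e \<in> insert u E" for x e
    proof -
      have "\<not> N \<le> 2 * (5 ^ t + 1) * real (card (nr e x))" using that none by blast
      moreover have "0 < 2 * (5 ^ t + 1 :: real)" by (simp add: add_pos_pos)
      ultimately show ?thesis by (subst pos_le_divide_eq) (auto simp: mult_ac)
    qed
    have "real (card (gd x)) \<le> real (card (fr x)) + N / 2" if x: "x \<in> Y" for x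
    proof -
      have fu: "finite (insert u E)" using E by simp
      have "card (gd x) \<le> card (fr x \<union> (\<Union>e\<in>insert u E. nr e x))"
        using split[OF x] fgd fin E by (intro card_mono) (auto simp: fr_def nr_def)
      also have "\<dots> \<le> card (fr x) + (\<Sum>e\<in>insert u E. card (nr e x))"
        by (rule order_trans[OF card_Un_le]) (intro add_left_mono card_UN_le fu)
      finally have "real (card (gd x)) \<le> real (card (fr x) + (\<Sum>e\<in>insert u E. card (nr e x)))" by (rule of_nat_mono)
      then have "real (card (gd x)) \<le> real (card (fr x)) + (\<Sum>e\<in>insert u E. real (card (nr e x)))" by simp
      also have "(\<Sum>e\<in>insert u E. real (card (nr e x))) \<le> (\<Sum>e\<in>insert u E. N / (2 * (5 ^ t + 1)))"
        using lt x by (intro sum_mono) auto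
      also have "\<dots> = real (card (insert u E)) * (N / (2 * (5 ^ t + 1)))" by simp
      also have "\<dots> \<le> (5 ^ t + 1) * (N / (2 * (5 ^ t + 1)))"
      proof (intro mult_right_mono)
        have "card (insert u E) \<le> Suc (card E)" using E by (simp add: card_insert_if)
        then have "card (insert u E) \<le> 5 ^ t + 1" using E by linarith
        then show "real (card (insert u E)) \<le> 5 ^ t + 1" using of_nat_mono[of "card (insert u E)" "5 ^ t + 1", where ?'a = real] by simp
      qed (use Npos in simp)
      also have "\<dots> = N / 2" by (simp add: field_simps add_nonneg_eq_0_iff)
      finally show ?thesis by simp
    qed
    then have "(\<Sum>x\<in>Y. real (card (gd x))) \<le> (\<Sum>x\<in>Y. real (card (fr x)) + N / 2)" by (intro sum_mono) auto
    also have "\<dots> = (\<Sum>x\<in>Y. real (card (fr x))) + N\<^sup>2 / 2" by (simp add: sum.distrib N(1)[symmetric] power2_eq_square)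
    finally show False using far gd_count by linarith
  qed
  then obtain x e where x: "x \<in> Y" and e: "e \<in> insert u E" and big: "N \<le> 2 * (5 ^ t + 1) * real (card (nr e x))" by blast
  have "\<bar>cr e (p - q)\<bar> \<le> 4 * D * \<Lambda> ^ (16 * m) * \<delta>" if pq: "p \<in> nr e x" "q \<in> nr e x" for p q
  proof -
    have le: "\<bar>cr e (z - x)\<bar> \<le> 2 * d (Suc j) * D" if "z \<in> nr e x" for z
    proof -
      have "2 * d (Suc j) * norm (z - x) \<le> 2 * d (Suc j) * D"
        using that diam[of z x] x d0[of "Suc j"] by (intro mult_left_mono) (auto simp: nr_def)
      then show ?thesis using that by (simp add: nr_def)
    qed
    have "cr e (p - q) = cr e (p - x) - cr e (q - x)" by (simp add: cr_diff_right)
    then have "\<bar>cr e (p - q)\<bar> \<le> 4 * d (Suc j) * D" using le[OF pq(1)] le[OF pq(2)] by linarith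
    also have "\<dots> \<le> 4 * d (16 * m) * D" using dmono[of "Suc j" "16 * m"] j rD r by (intro mult_right_mono) auto
    finally show ?thesis by (simp add: d_def mult_ac)
  qed
  moreover have "norm e = 1" using e u E by auto
  moreover have "nr e x \<subseteq> Y" by (auto simp: nr_def)
  ultimately show ?thesis using big unfolding \<Lambda>_def by blast
qed

lemma powr_neg_small:
  fixes \<nu> \<epsilon> :: real
  assumes "\<nu> > 0" "\<epsilon> > 0"
  shows "\<exists>N0. \<forall>N\<ge>N0. N \<ge> 1 \<and> N powr - \<nu> \<le> \<epsilon>"
proof -
  have "((\<lambda>N. N powr - \<nu>) \<longlongrightarrow> 0) at_top"
    using assms by (intro tendsto_neg_powr) (auto intro: filterlim_ident)
  then have "\<forall>\<^sub>F N in at_top. N powr - \<nu> < \<epsilon>" using assms by (simp add: order_tendsto_iff)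
  then have "\<forall>\<^sub>F N in at_top. N \<ge> 1 \<and> N powr - \<nu> \<le> \<epsilon>"
    using eventually_ge_at_top[of 1] by eventually_elim auto
  then show ?thesis by (simp add: eventually_at_top_linorder)
qed

text \<open>Pairs \<open>x\<close>, \<open>z\<close> are grouped by a colouring of \<open>Y - {x}\<close> for each pin \<open>x\<close>, where points of the same colour lie in nearly
  the same direction; exact directions are the case \<open>\<delta> = 0\<close>.\<close>

definition beck_bound :: "real \<Rightarrow> nat \<Rightarrow> nat \<Rightarrow> bool" where
  "beck_bound k J N0 \<longleftrightarrow> (\<forall>Y r D \<delta> M. finite Y \<longrightarrow> real N0 \<le> card Y \<longrightarrow> r > 0 \<longrightarrow> \<delta> \<ge> 0
    \<longrightarrow> (\<forall>p\<in>Y. \<forall>q\<in>Y. p \<noteq> q \<longrightarrow> r \<le> norm (p - q)) \<longrightarrow> (\<forall>p\<in>Y. \<forall>q\<in>Y. norm (p - q) \<le> D)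
    \<longrightarrow> (\<forall>x\<in>Y. \<exists>c::complex \<Rightarrow> real. card (c ` (Y - {x})) \<le> M \<and>
      (\<forall>z\<in>Y - {x}. \<forall>w\<in>Y - {x}. c z = c w \<longrightarrow> \<bar>cr (z - x) (w - x)\<bar> \<le> \<delta> * norm (z - x) * norm (w - x)))
    \<longrightarrow> 16 * real M \<le> card Y powr (1 - k)
    \<longrightarrow> (\<exists>e Z. norm e = 1 \<and> Z \<subseteq> Y \<and> card Y powr (1 - k) \<le> card Z \<and>
      (\<forall>p\<in>Z. \<forall>q\<in>Z. \<bar>cr e (p - q)\<bar> \<le> 4 * D * (8 * (D / r)\<^sup>2) ^ J * \<delta>)))"

lemma beck_boundD:
  fixes Y :: "complex set"
  assumes "beck_bound k J N0" "finite Y" "real N0 \<le> card Y" "r > 0" "\<delta> \<ge> 0"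
    "\<And>p q. p \<in> Y \<Longrightarrow> q \<in> Y \<Longrightarrow> p \<noteq> q \<Longrightarrow> r \<le> norm (p - q)" "\<And>p q. p \<in> Y \<Longrightarrow> q \<in> Y \<Longrightarrow> norm (p - q) \<le> D"
    "\<And>x. x \<in> Y \<Longrightarrow> \<exists>c::complex \<Rightarrow> real. card (c ` (Y - {x})) \<le> M \<and>
      (\<forall>z\<in>Y - {x}. \<forall>w\<in>Y - {x}. c z = c w \<longrightarrow> \<bar>cr (z - x) (w - x)\<bar> \<le> \<delta> * norm (z - x) * norm (w - x))"
    "16 * real M \<le> card Y powr (1 - k)"
  obtains e Z where "norm e = 1" "Z \<subseteq> Y" "card Y powr (1 - k) \<le> card Z"
    "\<And>p q. p \<in> Z \<Longrightarrow> q \<in> Z \<Longrightarrow> \<bar>cr e (p - q)\<bar> \<le> 4 * D * (8 * (D / r)\<^sup>2) ^ J * \<delta>"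
  using assms(1)[unfolded beck_bound_def, rule_format, of Y r \<delta> D M, OF assms(2-)] by blast

text \<open>Pairs of points are charged to \<open>t \<approx> log N\<close> levels of the weights; both \<open>G\<close> and the
  gain of the weights are then powers of \<open>N\<close>.\<close>

lemma robust_beck:
  fixes k :: real
  assumes k: "0 < k" "k < 1"
  shows "\<exists>J N0. beck_bound k J N0"
proof -
  \<comment> \<open>With \<open>12 ^ t\<close> about \<open>N powr (k / 2)\<close>, the gain
    \<open>(93/100) ^ t\<close> is about \<open>N powr - \<kappa>\<close>.\<close>
  define \<kappa> where "\<kappa> = k * ln (100/93) / (2 * ln 12)"
  have l: "0 < ln (100/93 :: real)" "0 < ln (12::real)" "2 * ln (100/93) \<le> ln (12::real)"
  proof -
    show "0 < ln (100/93 :: real)" "0 < ln (12::real)" by simp_all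
    have "2 * ln (100/93) = ln ((100/93)^2 :: real)" by (subst ln_realpow) auto
    also have "\<dots> \<le> ln 12" by (subst ln_le_cancel_iff) (auto simp: power2_eq_square)
    finally show "2 * ln (100/93) \<le> ln (12::real)" .
  qed
  have \<kappa>: "0 < \<kappa>" "4 * \<kappa> \<le> k" "\<kappa> < 1/4"
  proof -
    show "0 < \<kappa>" using k l by (simp add: \<kappa>_def)
    have "\<kappa> = k / 4 * (2 * ln (100/93) / ln 12)" by (simp add: \<kappa>_def)
    also have "\<dots> \<le> k / 4 * 1" using l k by (intro mult_left_mono) auto
    finally show "4 * \<kappa> \<le> k" "\<kappa> < 1/4" using k by auto
  qed
  \<comment> \<open>With this choice \<open>G\<^sup>2\<close> costs only half of the gain, and the
    error terms in \<open>ineq\<close> all fit into a multiple of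
    \<open>N powr (2 - \<gamma>)\<close>.\<close>
  define \<gamma> where "\<gamma> = \<kappa> / 4"
  have \<gamma>: "\<gamma> > 0" "\<kappa> = 4 * \<gamma>" using \<kappa> by (auto simp: \<gamma>_def)
  define m where "m = nat \<lceil>1 / \<gamma>\<rceil> + 1"
  have m: "\<gamma> * m > 1"
  proof -
    have "1 / \<gamma> < m" unfolding m_def by linarith
    then show ?thesis using \<gamma> by (simp add: field_simps)
  qed
  obtain N1 where N1: "\<And>N. N \<ge> N1 \<Longrightarrow> N \<ge> 1 \<and> N powr - \<gamma> \<le> 1 / 10000"
    using powr_neg_small[OF \<gamma>(1), of "1/10000"] by auto
  show ?thesis
  proof (rule exI[of _ "16 * m"], rule exI[of _ "nat \<lceil>max 16 N1\<rceil>"], unfold beck_bound_def, intro allI impI)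
    fix Y :: "complex set" and r D \<delta> :: real and M :: nat
    assume fin: "finite Y" and N0: "real (nat \<lceil>max 16 N1\<rceil>) \<le> card Y" and r: "r > 0" and \<delta>: "\<delta> \<ge> 0"
      and sep: "\<forall>p\<in>Y. \<forall>q\<in>Y. p \<noteq> q \<longrightarrow> r \<le> norm (p - q)" and diam: "\<forall>p\<in>Y. \<forall>q\<in>Y. norm (p - q) \<le> D"
      and col: "\<forall>x\<in>Y. \<exists>c::complex \<Rightarrow> real. card (c ` (Y - {x})) \<le> M \<and>
      (\<forall>z\<in>Y - {x}. \<forall>w\<in>Y - {x}. c z = c w \<longrightarrow> \<bar>cr (z - x) (w - x)\<bar> \<le> \<delta> * norm (z - x) * norm (w - x))"
      and M: "16 * real M \<le> card Y powr (1 - k)"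
    define N where "N = real (card Y)"
    have N: "N \<ge> 16" "N \<ge> N1" using N0 unfolding N_def by linarith+
    then have N': "N \<ge> 1" "N powr - \<gamma> \<le> 1/10000" "N > 0" using N1 by auto
    define t where "t = nat \<lfloor>k * ln N / (2 * ln 12)\<rfloor>"
    have arg0: "0 \<le> k * ln N / (2 * ln 12)" using k N' l by simp
    have t: "real t \<le> k * ln N / (2 * ln 12)" "k * ln N / (2 * ln 12) - 1 \<le> real t"
      unfolding t_def using arg0 by linarith+
    have t12: "12 ^ t \<le> N powr (k / 2)"
    proof -
      have "(12::real) ^ t = exp (real t * ln 12)" by (simp add: exp_of_nat_mult)
      also have "\<dots> \<le> exp (k / 2 * ln N)" using t(1) l by (simp add: field_simps)
      also have "\<dots> = N powr (k / 2)" using N' by (simp add: powr_def)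
      finally show ?thesis .
    qed
    have t93: "(93/100) ^ t \<le> 2 * N powr - \<kappa>"
    proof -
      have "(93/100::real) ^ t = exp (real t * ln (93/100))" by (simp add: exp_of_nat_mult)
      also have "ln (93/100) = - ln (100/93::real)" by (simp add: ln_div)
      also have "real t * - ln (100/93) \<le> (k * ln N / (2 * ln 12) - 1) * - ln (100/93)"
        using t(2) l by (intro mult_right_mono_neg) auto
      also have "\<dots> = - \<kappa> * ln N + ln (100/93)" by (simp add: \<kappa>_def field_simps)
      finally have "(93/100::real) ^ t \<le> exp (- \<kappa> * ln N + ln (100/93))" by simp
      also have "\<dots> = N powr - \<kappa> * (100/93)" unfolding exp_add using N' by (simp add: powr_def)
      also have "\<dots> \<le> N powr - \<kappa> * 2" by (intro mult_left_mono) auto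
      finally show ?thesis by (simp add: mult.commute)
    qed
    define G where "G = N powr \<gamma>"
    define s where "s = N powr k"
    have pm: "N powr a \<le> N powr b" if "a \<le> b" for a b using that N' by (intro powr_mono) auto
    have NN: "N\<^sup>2 = N powr 2" using N' by simp
    have ineq: "G * (2 * G * ((93/100) ^ t * N\<^sup>2 + 200 * 12 ^ t * N) + 12 ^ t * N\<^sup>2 / s) < N\<^sup>2 / 4"
    proof -
      have "G * (2 * G * ((93/100) ^ t * N\<^sup>2 + 200 * 12 ^ t * N) + 12 ^ t * N\<^sup>2 / s)
        \<le> G * (2 * G * (2 * N powr - \<kappa> * N powr 2 + 200 * N powr (k/2) * N powr 1) + N powr (k/2) * N powr 2 / s)"
        unfolding NN using t12 t93 N'
        by (intro mult_left_mono add_mono divide_right_mono mult_right_mono) (auto simp: G_def s_def)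
      also have "\<dots> = 4 * N powr (2 * \<gamma> - \<kappa> + 2) + 400 * N powr (2 * \<gamma> + k / 2 + 1) + N powr (\<gamma> + k / 2 + 2 - k)"
      proof -
        have "G * (2 * G * (2 * N powr - \<kappa> * N powr 2)) = 4 * (N powr \<gamma> * N powr \<gamma> * N powr - \<kappa> * N powr 2)"
          "G * (2 * G * (200 * N powr (k/2) * N powr 1)) = 400 * (N powr \<gamma> * N powr \<gamma> * N powr (k/2) * N powr 1)"
          "G * (N powr (k/2) * N powr 2 / s) = N powr \<gamma> * N powr (k/2) * N powr 2 / N powr k"
          by (simp_all add: G_def s_def)
        then show ?thesis unfolding distrib_left
          by (simp only: powr_add[symmetric] powr_diff[symmetric] distrib_left) (simp add: algebra_simps)
      qed
      also have "\<dots> \<le> 4 * N powr (2 - \<gamma>) + 400 * N powr (2 - \<gamma>) + N powr (2 - \<gamma>)"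
        using \<gamma> \<kappa> k by (intro add_mono mult_left_mono pm) auto
      also have "\<dots> = 405 * N powr - \<gamma> * N\<^sup>2" 
      proof -
        have "N powr (2 - \<gamma>) = N powr - \<gamma> * N\<^sup>2" unfolding NN powr_add[symmetric] by simp
        then show ?thesis by simp
      qed
      also have "\<dots> \<le> 405 * (1/10000) * N\<^sup>2" using N' by (intro mult_right_mono mult_left_mono) auto
      also have "\<dots> < N\<^sup>2 / 4" using N' by simp
      finally show ?thesis .
    qed
    have s1: "1 \<le> s" and G1: "1 \<le> G" using N' k \<gamma> by (auto simp: s_def G_def ge_one_powr_ge_zero)
    have Ms: "16 * real M * s \<le> N"
    proof -
      have "16 * real M * s \<le> N powr (1 - k) * N powr k" using M by (simp add: s_def N_def mult_right_mono)
      then show ?thesis using N' by (simp flip: powr_add)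
    qed
    have Gm: "N < G ^ m"
    proof -
      have "N powr 1 < N powr (\<gamma> * m)" using m N by (intro powr_less_mono) auto
      then show ?thesis using N' by (simp add: G_def powr_realpow[symmetric] powr_powr)
    qed
    have "\<exists>e Z. norm e = 1 \<and> Z \<subseteq> Y \<and> N \<le> 2 * (5 ^ t + 1) * real (card Z) \<and>
      (\<forall>p\<in>Z. \<forall>q\<in>Z. \<bar>cr e (p - q)\<bar> \<le> 4 * D * (8 * (D / r)\<^sup>2) ^ (16 * m) * \<delta>)"
      using sep diam col
      by (intro robust_beck_core[OF fin N_def N(1) r _ _ \<delta> _ s1 _ G1 Gm ineq, of D M]) (use Ms in auto)
    then obtain e Z where eZ: "norm e = 1" "Z \<subseteq> Y" "N \<le> 2 * (5 ^ t + 1) * real (card Z)"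
      "\<forall>p\<in>Z. \<forall>q\<in>Z. \<bar>cr e (p - q)\<bar> \<le> 4 * D * (8 * (D / r)\<^sup>2) ^ (16 * m) * \<delta>" by blast
    have "N powr (1 - k) \<le> card Z"
    proof -
      have "(5::real) ^ t \<le> 12 ^ t" "(1::real) \<le> 12 ^ t" by (auto intro: power_mono)
      moreover have "2 * (a + 1) \<le> 4 * c" if "a \<le> b" "1 \<le> b" "b \<le> c" for a b c :: real
        using that by argo
      ultimately have "2 * ((5::real) ^ t + 1) \<le> 4 * N powr (k / 2)" using t12 by blast
      then have "N \<le> 4 * N powr (k / 2) * card Z"
        using eZ(3) by (meson mult_right_mono of_nat_0_le_iff order_trans)
      moreover have "4 \<le> N powr (k / 2)"
      proof -
        have "1 \<le> 1/10000 * N powr \<gamma>" using N'(2,3) by (simp add: powr_minus field_simps)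
        moreover have "N powr \<gamma> \<le> N powr (k / 2)" using \<gamma> \<kappa> by (intro pm) auto
        ultimately show ?thesis by linarith
      qed
      then have "4 * N powr (k / 2) * card Z \<le> N powr (k / 2) * N powr (k / 2) * card Z"
        using N' by (intro mult_right_mono) auto
      ultimately have "N \<le> N powr k * card Z" by (simp flip: powr_add)
      then show ?thesis using N' by (simp add: powr_diff field_simps)
    qed
    then show "\<exists>e Z. norm e = 1 \<and> Z \<subseteq> Y \<and> card Y powr (1 - k) \<le> card Z \<and>
      (\<forall>p\<in>Z. \<forall>q\<in>Z. \<bar>cr e (p - q)\<bar> \<le> 4 * D * (8 * (D / r)\<^sup>2) ^ (16 * m) * \<delta>)"
      using eZ unfolding N_def by blast
  qed
qed

section \<open>Directions seen from a pin\<close>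

text \<open>The sine of the angle at \<open>x\<close>; it is \<open>0\<close> if \<open>x\<close> is one of the other two points.\<close>

definition sn :: "complex \<Rightarrow> complex \<Rightarrow> complex \<Rightarrow> real" where
  "sn x y z = \<bar>cr (y - x) (z - x)\<bar> / (norm (y - x) * norm (z - x))"

text \<open>Directions are angles of lines, taken in a window of several periods, so that no reduction modulo \<open>pi\<close> is needed
  when sums of few of them are formed.\<close>

definition dirs :: "complex set \<Rightarrow> complex \<Rightarrow> real set" where
  "dirs P x = {\<phi>. \<bar>\<phi>\<bar> \<le> 4 * pi \<and> (\<exists>z\<in>P - {x}. cr (cis \<phi>) (z - x) = 0)}"

definition angles :: "complex set \<Rightarrow> complex \<Rightarrow> real set" where
  "angles P x = {arccos (Re (cnj (p - x) * (q - x)) / (norm (p - x) * norm (q - x))) |p q.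
     p \<in> P - {x} \<and> q \<in> P - {x} \<and> p \<noteq> q}"

lemma finite_angles: "finite P \<Longrightarrow> finite (angles P x)"
proof -
  assume "finite P"
  have "angles P x \<subseteq> (\<lambda>(p, q). arccos (Re (cnj (p - x) * (q - x)) / (norm (p - x) * norm (q - x)))) ` (P \<times> P)"
    by (auto simp: angles_def)
  then show ?thesis using \<open>finite P\<close> by (meson finite_SigmaI finite_imageI finite_subset)
qed

lemma Arg_in_dirs: "z \<in> P \<Longrightarrow> z \<noteq> x \<Longrightarrow> Arg (z - x) \<in> dirs P x"
proof -
  assume z: "z \<in> P" "z \<noteq> x"
  have "- pi < Arg (z - x)" "Arg (z - x) \<le> pi" using Arg_bounded by auto
  then have "\<bar>Arg (z - x)\<bar> \<le> 4 * pi" by linarith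
  moreover have "cr (cis (Arg (z - x))) (of_real (norm (z - x)) * cis (Arg (z - x))) = 0"
    by (simp only: cr_scale_right cr_self mult_zero_right)
  then have "cr (cis (Arg (z - x))) (z - x) = 0" by (metis rcis_cmod_Arg rcis_def)
  ultimately show ?thesis using z by (auto simp: dirs_def)
qed

lemma parallel_decomp:
  assumes "cr (cis \<phi>) w = 0"
  shows "w = of_real (Re (cnj (cis \<phi>) * w)) * cis \<phi>" "\<bar>Re (cnj (cis \<phi>) * w)\<bar> = norm w"
proof -
  define t where "t = Re (cnj (cis \<phi>) * w)"
  have "cnj (cis \<phi>) * w = of_real t"
    using assms by (simp add: complex_eq_iff cr_def t_def)
  then have "cis \<phi> * (cnj (cis \<phi>) * w) = cis \<phi> * of_real t" by simp
  moreover have "cis \<phi> * (cnj (cis \<phi>) * w) = w"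
    by (simp only: mult.assoc[symmetric] cis_cnj cis_mult) simp
  ultimately have 1: "w = of_real t * cis \<phi>" by (simp only: mult.commute)
  then show "w = of_real (Re (cnj (cis \<phi>) * w)) * cis \<phi>" unfolding t_def .
  have "norm w = norm (of_real t * cis \<phi>)" using 1 by (rule arg_cong)
  then show "\<bar>Re (cnj (cis \<phi>) * w)\<bar> = norm w" unfolding t_def[symmetric] by (simp add: norm_mult)
qed

lemma exists_max_on:
  fixes g :: "'a \<Rightarrow> 'b::linorder"
  assumes "finite C" "C \<noteq> {}"
  shows "\<exists>y\<in>C. \<forall>z\<in>C. g z \<le> g y"
proof -
  have "Max (g ` C) \<in> g ` C" using assms by simp
  then obtain y where "y \<in> C" "g y = Max (g ` C)" by auto
  then show ?thesis using assms by (intro bexI[of _ y]) auto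
qed

text \<open>Directions are those of lines and unsigned angles forget orientation, so the cosines
  agree only up to sign: hence the sign \<open>s\<close> and the multiple of \<open>pi\<close>.
  Differences are at most \<open>8 * pi\<close> and an angle is at most \<open>pi\<close>, which
  leaves the multiples from -9 to 9; the extra 0 serves two directions to the same point.\<close>

lemma dirs_diff_subset:
  "dirs P x + uminus ` dirs P x \<subseteq> (\<lambda>(\<alpha>, s, k). s * \<alpha> + of_int k * pi) ` (insert 0 (angles P x) \<times> {1, -1} \<times> {-9..9})"
proof
  fix \<delta> assume "\<delta> \<in> dirs P x + uminus ` dirs P x"
  then obtain \<phi> \<psi> where \<delta>: "\<delta> = \<phi> - \<psi>" "\<phi> \<in> dirs P x" "\<psi> \<in> dirs P x" by (auto simp: set_plus_def)
  then obtain z w where z: "z \<in> P - {x}" "cr (cis \<phi>) (z - x) = 0" and w: "w \<in> P - {x}" "cr (cis \<psi>) (w - x) = 0"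
    and bd: "\<bar>\<phi>\<bar> \<le> 4 * pi" "\<bar>\<psi>\<bar> \<le> 4 * pi" by (auto simp: dirs_def)
  define c where "c = Re (cnj (z - x) * (w - x)) / (norm (z - x) * norm (w - x))"
  define \<alpha> where "\<alpha> = (if z = w then 0 else arccos c)"
  have \<alpha>: "\<alpha> \<in> insert 0 (angles P x)" using z w unfolding \<alpha>_def c_def angles_def by auto
  define s t where "s = Re (cnj (cis \<phi>) * (z - x))" and "t = Re (cnj (cis \<psi>) * (w - x))"
  have st: "z - x = of_real s * cis \<phi>" "w - x = of_real t * cis \<psi>" "\<bar>s\<bar> = norm (z - x)" "\<bar>t\<bar> = norm (w - x)"
    using parallel_decomp[OF z(2), folded s_def] parallel_decomp[OF w(2), folded t_def] by blast+
  have pos: "norm (z - x) > 0" "norm (w - x) > 0" using z w by auto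
  have re: "Re (cnj (z - x) * (w - x)) = s * t * cos (\<phi> - \<psi>)"
    unfolding st(1,2) by (simp add: cos_diff algebra_simps)
  have c1: "\<bar>c\<bar> \<le> 1"
    using abs_Re_le_cmod[of "cnj (z - x) * (w - x)"] pos unfolding c_def by (simp only: norm_mult complex_mod_cnj abs_divide abs_mult) simp
  have arcrange: "0 \<le> \<alpha>" "\<alpha> \<le> pi"
    using c1 arccos_lbound[of c] arccos_ubound[of c] by (auto simp: \<alpha>_def abs_le_iff)
  have sc: "\<bar>c\<bar> = \<bar>cos \<delta>\<bar>"
    using pos unfolding c_def re \<delta>(1) abs_divide abs_mult st(3,4) by simp
  have cosa: "\<bar>cos \<alpha>\<bar> = \<bar>cos \<delta>\<bar>"
  proof (cases "z = w")
    case True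
    have sq: "Re (cnj v * v) = norm v * norm v" for v by (simp add: power2_eq_square[symmetric] cmod_power2)
    have "c = 1" using pos unfolding c_def True sq by simp
    then show ?thesis using True sc by (simp add: \<alpha>_def)
  next
    case False
    then show ?thesis using sc c1 by (simp add: \<alpha>_def cos_arccos_abs)
  qed
  have "\<exists>s'\<in>{1,-1}. \<exists>k::int. \<delta> = s' * \<alpha> + of_int k * pi"
  proof (cases "cos \<delta> = cos \<alpha>")
    case True
    then obtain n where n: "n \<in> \<int>" "\<delta> = \<alpha> + 2 * n * pi \<or> \<delta> = - \<alpha> + 2 * n * pi" by (auto simp: cos_eq)
    then obtain m :: int where m: "n = of_int m" by (auto elim: Ints_cases)
    then have "\<delta> = 1 * \<alpha> + of_int (2 * m) * pi \<or> \<delta> = -1 * \<alpha> + of_int (2 * m) * pi" using n by simp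
    then show ?thesis by blast
  next
    case False
    then have "cos \<delta> = - cos \<alpha>" using cosa by linarith
    then have "cos \<delta> = cos (\<alpha> + pi)" by simp
    then obtain n where n: "n \<in> \<int>" "\<delta> = \<alpha> + pi + 2 * n * pi \<or> \<delta> = - (\<alpha> + pi) + 2 * n * pi"
      unfolding cos_eq by blast
    then obtain m :: int where m: "n = of_int m" by (auto elim: Ints_cases)
    then have "\<delta> = 1 * \<alpha> + of_int (2 * m + 1) * pi \<or> \<delta> = -1 * \<alpha> + of_int (2 * m - 1) * pi"
      using n by (simp add: algebra_simps)
    then show ?thesis by blast
  qed
  then obtain s' and k :: int where sk: "s' \<in> {1,-1}" "\<delta> = s' * \<alpha> + of_int k * pi" by blast
  have "\<bar>of_int k * pi\<bar> \<le> 9 * pi"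
  proof -
    have "of_int k * pi = \<delta> - s' * \<alpha>" using sk by simp
    moreover have "\<bar>\<delta>\<bar> \<le> 8 * pi" using bd \<delta>(1) by linarith
    moreover have "\<bar>s' * \<alpha>\<bar> \<le> pi" using sk arcrange by auto
    ultimately show ?thesis by linarith
  qed
  then have "\<bar>real_of_int k\<bar> \<le> 9" by (simp add: abs_mult)
  then have "k \<in> {-9..9}" by auto
  then show "\<delta> \<in> (\<lambda>(\<alpha>, s, k). s * \<alpha> + of_int k * pi) ` (insert 0 (angles P x) \<times> {1, -1} \<times> {-9..9})"
    using sk \<alpha> by (auto intro!: image_eqI[of _ _ "(\<alpha>, s', k)"])
qed

text \<open>38 is 2 signs times 19 multiples of \<open>pi\<close>. Finiteness is read off from a
  translate of \<open>dirs P x\<close> inside the difference set.\<close>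

lemma card_dirs_diff:
  assumes "finite P"
  shows "card (dirs P x + uminus ` dirs P x) \<le> 38 * (card (angles P x) + 1)" "finite (dirs P x)"
proof -
  let ?A = "insert 0 (angles P x) \<times> {1, -1 :: real} \<times> {-9..9::int}"
  have fin: "finite ?A" using finite_angles[OF assms] by simp
  have fd: "finite (dirs P x + uminus ` dirs P x)"
    using dirs_diff_subset[of P x] fin by (meson finite_imageI finite_subset)
  have "card (dirs P x + uminus ` dirs P x) \<le> card ?A"
    using dirs_diff_subset[of P x] fin by (meson card_image_le card_mono finite_imageI order_trans)
  also have "card ?A = card (insert 0 (angles P x)) * (2 * 19)" by (simp add: card_cartesian_product)
  also have "\<dots> \<le> (card (angles P x) + 1) * (2 * 19)"
    using finite_angles[OF assms, of x] by (intro mult_right_mono) (auto simp: card_insert_if)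
  finally show "card (dirs P x + uminus ` dirs P x) \<le> 38 * (card (angles P x) + 1)" by simp
  show "finite (dirs P x)"
  proof (cases "dirs P x = {}")
    case False
    then obtain d where "d \<in> dirs P x" by blast
    then have "(\<lambda>\<phi>. \<phi> + - d) ` dirs P x \<subseteq> dirs P x + uminus ` dirs P x"
      by (intro image_subsetI set_plus_intro imageI)
    then have "finite ((\<lambda>\<phi>. \<phi> + - d) ` dirs P x)" using fd finite_subset by blast
    then show ?thesis by (rule finite_imageD) (auto simp: inj_on_def)
  qed simp
qed

text \<open>The ratio 8 exceeds 25/4: passing from sines to angles costs a factor 5/2, and a ratio
  5/2 between angles still makes subset sums distinct.\<close>

definition lac :: "('a \<Rightarrow> real) \<Rightarrow> 'a set \<Rightarrow> bool" where
  "lac s C \<longleftrightarrow> (\<forall>y\<in>C. s y > 0 \<and> (\<forall>z\<in>C. y \<noteq> z \<longrightarrow> 8 * s y \<le> s z \<or> 8 * s z \<le> s y))"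

lemma sum_lacunary_le:
  fixes g :: "'a \<Rightarrow> real"
  assumes "finite C" "\<And>y. y \<in> C \<Longrightarrow> 0 \<le> g y" "\<And>y. y \<in> C \<Longrightarrow> g y \<le> B" "B \<ge> 0"
    and "\<And>y z. y \<in> C \<Longrightarrow> z \<in> C \<Longrightarrow> y \<noteq> z \<Longrightarrow> 5/2 * g y \<le> g z \<or> 5/2 * g z \<le> g y"
  shows "sum g C \<le> 5/3 * B"
  using assms
proof (induction "card C" arbitrary: C B)
  case (Suc n)
  then have "C \<noteq> {}" by auto
  then obtain y where y: "y \<in> C" and max: "\<And>z. z \<in> C \<Longrightarrow> g z \<le> g y"
    using exists_max_on[OF Suc.prems(1), of g] by blast
  have "sum g (C - {y}) \<le> 5/3 * (2/5 * g y)"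
  proof (rule Suc.hyps(1))
    show "n = card (C - {y})" using Suc.hyps(2) y Suc.prems(1) by simp
    show "g z \<le> 2/5 * g y" if "z \<in> C - {y}" for z
    proof -
      have "5/2 * g z \<le> g y \<or> 5/2 * g y \<le> g z" using Suc.prems(5)[of z y] that y by auto
      moreover have "0 \<le> g y" "g z \<le> g y" using Suc.prems(2) y max that by auto
      ultimately show ?thesis by linarith
    qed
  qed (use Suc.prems y in auto)
  moreover have "sum g C = g y + sum g (C - {y})" using y Suc.prems(1) by (simp add: sum.remove)
  ultimately show ?case using Suc.prems(3)[OF y] by simp
qed simp

text \<open>On the symmetric difference of \<open>T\<close> and \<open>U\<close> the largest term
  outweighs all others together, which by a geometric series amount to at most
  \<open>5/3 * 2/5 = 2/3\<close> of it.\<close>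

lemma signed_sums_distinct:
  fixes g :: "'a \<Rightarrow> real"
  assumes C: "finite C" and pos: "\<And>y. y \<in> C \<Longrightarrow> g y \<noteq> 0"
    and lac: "\<And>y z. y \<in> C \<Longrightarrow> z \<in> C \<Longrightarrow> y \<noteq> z \<Longrightarrow> 5/2 * \<bar>g y\<bar> \<le> \<bar>g z\<bar> \<or> 5/2 * \<bar>g z\<bar> \<le> \<bar>g y\<bar>"
    and TU: "T \<subseteq> C" "U \<subseteq> C" and eq: "sum g T = sum g U"
  shows "T = U"
proof (rule ccontr)
  assume ne: "T \<noteq> U"
  define V where "V = (T - U) \<union> (U - T)"
  have fT: "finite T" "finite U" using TU C finite_subset by auto
  then have V: "finite V" "V \<noteq> {}" "V \<subseteq> C" using ne TU by (auto simp: V_def)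
  then obtain y where y: "y \<in> V" and max: "\<And>z. z \<in> V \<Longrightarrow> \<bar>g z\<bar> \<le> \<bar>g y\<bar>"
    using exists_max_on[of V "\<lambda>z. \<bar>g z\<bar>"] by blast
  define h where "h z = (if z \<in> T then g z else - g z)" for z
  have hg: "\<bar>h z\<bar> = \<bar>g z\<bar>" for z by (simp add: h_def)
  have "sum h V = sum g (T - U) + sum (\<lambda>z. - g z) (U - T)"
    unfolding V_def using fT by (subst sum.union_disjoint) (auto simp: h_def intro!: sum.cong)
  also have "\<dots> = sum g (T - U) - sum g (U - T)" by (simp add: sum_negf)
  also have "\<dots> = 0"
  proof -
    have "sum g T = sum g (T - U) + sum g (T \<inter> U)" "sum g U = sum g (U - T) + sum g (T \<inter> U)"
      using fT by (metis sum.Int_Diff add.commute, metis sum.Int_Diff add.commute Int_commute)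
    then show ?thesis using eq by simp
  qed
  finally have "h y + sum h (V - {y}) = 0" using y V by (simp add: sum.remove)
  then have "\<bar>g y\<bar> \<le> \<bar>sum h (V - {y})\<bar>" by (auto simp: h_def split: if_splits)
  also have "\<dots> \<le> (\<Sum>z\<in>V - {y}. \<bar>g z\<bar>)" using sum_abs[of h "V - {y}"] by (simp add: hg)
  also have "\<dots> \<le> 5/3 * (2/5 * \<bar>g y\<bar>)"
  proof (rule sum_lacunary_le)
    show "\<bar>g z\<bar> \<le> 2/5 * \<bar>g y\<bar>" if "z \<in> V - {y}" for z
    proof -
      have "5/2 * \<bar>g z\<bar> \<le> \<bar>g y\<bar> \<or> 5/2 * \<bar>g y\<bar> \<le> \<bar>g z\<bar>" using lac[of z y] that y V by auto
      moreover have "\<bar>g z\<bar> \<le> \<bar>g y\<bar>" using max that by auto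
      ultimately show ?thesis by linarith
    qed
  qed (use V lac in auto)
  finally have "\<bar>g y\<bar> \<le> 0" by linarith
  then show False using pos y V by auto
qed

lemma le_sin_mult:
  assumes "0 \<le> x" "x \<le> pi / 2"
  shows "x \<le> 5/2 * sin x"
proof (cases "x \<le> pi / 3")
  case True
  have "(\<lambda>y. 2 * sin y - y) 0 \<le> (\<lambda>y. 2 * sin y - y) x"
  proof (rule DERIV_nonneg_imp_nondecreasing[OF assms(1)])
    fix y assume y: "0 \<le> y" "y \<le> x"
    have "cos (pi / 3) \<le> cos y" using y True pi_gt_zero by (intro cos_monotone_0_pi_le) auto
    then have "0 \<le> 2 * cos y - 1" by (simp add: cos_60)
    moreover have "((\<lambda>y. 2 * sin y - y) has_real_derivative 2 * cos y - 1) (at y)"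
      by (auto intro!: derivative_eq_intros)
    ultimately show "\<exists>d. ((\<lambda>y. 2 * sin y - y) has_real_derivative d) (at y) \<and> 0 \<le> d" by blast
  qed
  then show ?thesis using assms(1) by simp
next
  case False
  have "sin (pi / 3) \<le> sin x" using False assms pi_gt_zero by (intro sin_monotone_2pi_le) auto
  moreover have "8/5 \<le> sqrt 3" by (rule real_le_rsqrt) (simp add: power2_eq_square)
  ultimately have "4/5 \<le> sin x" by (simp add: sin_60)
  then show ?thesis using assms pi_less_4 by linarith
qed

text \<open>The direction of \<open>y\<close> relative to that of \<open>z\<close> is normalised
  modulo \<open>pi\<close> to lie within \<open>pi / 2\<close> of zero, where an angle is comparable
  to its sine.\<close>

lemma angle_of_sine:
  assumes "z \<in> P - {x}" "y \<in> P - {x}" "sn x z y > 0"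
  shows "\<exists>\<psi>. Arg (z - x) + \<psi> \<in> dirs P x \<and> sn x z y \<le> \<bar>\<psi>\<bar> \<and> \<bar>\<psi>\<bar> \<le> 5/2 * sn x z y"
proof -
  define \<phi> where "\<phi> = Arg (z - x)"
  define w where "w = (y - x) / cis \<phi>"
  define v where "v = (if Re w < 0 then - w else w)"
  define \<psi> where "\<psi> = Arg v"
  have yx: "y - x = cis \<phi> * w" by (simp add: w_def)
  have w0: "w \<noteq> 0" using assms by (auto simp: w_def)
  have v0: "v \<noteq> 0" using w0 by (auto simp: v_def)
  have vpol: "v = of_real (norm v) * cis \<psi>" unfolding \<psi>_def by (metis rcis_cmod_Arg rcis_def)
  have range: "- pi < \<psi>" "\<psi> \<le> pi" using Arg_bounded by (auto simp: \<psi>_def)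
  have "Re v \<ge> 0" by (simp add: v_def)
  then have half: "\<bar>\<psi>\<bar> \<le> pi / 2"
    using Arg_Re_nonneg[of v] by (simp add: \<psi>_def)
  have "z - x = of_real (norm (z - x)) * cis \<phi>" unfolding \<phi>_def by (metis rcis_cmod_Arg rcis_def)
  then have "cr (z - x) (y - x) = norm (z - x) * cr (cis \<phi>) (y - x)" by (metis cr_scale_left)
  also have "cr (cis \<phi>) (y - x) = Im w"
  proof -
    have "cnj (cis \<phi>) * (cis \<phi> * w) = w" by (simp only: mult.assoc[symmetric] cis_cnj cis_mult) simp
    then show ?thesis unfolding cr_def yx by (rule arg_cong)
  qed
  finally have sn1: "sn x z y = \<bar>Im w\<bar> / norm (y - x)" using assms by (simp add: sn_def abs_mult)
  have "norm (y - x) = norm v" by (simp add: yx norm_mult v_def)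
  moreover have "\<bar>Im w\<bar> = \<bar>Im v\<bar>" by (simp add: v_def)
  moreover have "\<bar>Im v\<bar> = norm v * \<bar>sin \<psi>\<bar>" by (subst vpol) (simp add: abs_mult)
  ultimately have sn2: "sn x z y = \<bar>sin \<psi>\<bar>" using sn1 v0 by simp
  have "cr (cis (\<phi> + \<psi>)) (y - x) = 0"
  proof -
    have "w = of_real (if Re w < 0 then - norm v else norm v) * cis \<psi>"
    proof (cases "Re w < 0")
      case True
      then have "- w = v" by (simp add: v_def)
      then have "- w = of_real (norm v) * cis \<psi>" using vpol by (rule trans)
      then have "w = - (of_real (norm v) * cis \<psi>)" by (metis minus_minus)
      then show ?thesis unfolding if_P[OF True] of_real_minus mult_minus_left .
    qed (use vpol in \<open>simp add: v_def\<close>)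
    then have "y - x = of_real (if Re w < 0 then - norm v else norm v) * cis (\<phi> + \<psi>)"
      unfolding yx by (metis cis_mult mult.left_commute)
    then show ?thesis by (metis cr_scale_right cr_self mult_zero_right)
  qed
  moreover have "\<bar>\<phi> + \<psi>\<bar> \<le> 4 * pi"
  proof -
    have "- pi < \<phi>" "\<phi> \<le> pi" using Arg_bounded by (auto simp: \<phi>_def)
    then show ?thesis using range by linarith
  qed
  ultimately have "\<phi> + \<psi> \<in> dirs P x" using assms by (auto simp: dirs_def)
  moreover have "\<bar>sin \<psi>\<bar> \<le> \<bar>\<psi>\<bar>" by (rule abs_sin_x_le_abs_x)
  moreover have "\<bar>\<psi>\<bar> \<le> 5/2 * \<bar>sin \<psi>\<bar>"
  proof -
    have "\<bar>sin \<psi>\<bar> = sin \<bar>\<psi>\<bar>" using half pi_gt_zero sin_ge_zero[of \<psi>] sin_ge_zero[of "- \<psi>"] by (auto simp: abs_if)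
    then show ?thesis using le_sin_mult[of "\<bar>\<psi>\<bar>"] half by simp
  qed
  ultimately show ?thesis using sn2 unfolding \<phi>_def by auto
qed

text \<open>Subset sums of a lacunary set of angles are distinct.\<close>

lemma lac_sines_card:
  assumes P: "finite P" and z: "z \<in> P - {x}" and C: "C \<subseteq> P - {x}" "lac (sn x z) C"
  shows "card C choose m \<le> card (nsum m (dirs P x))"
proof -
  have fC: "finite C" using C P finite_subset by blast
  have pos: "sn x z y > 0" if "y \<in> C" for y using C that by (auto simp: lac_def)
  have "\<forall>y\<in>C. \<exists>\<psi>. Arg (z - x) + \<psi> \<in> dirs P x \<and> sn x z y \<le> \<bar>\<psi>\<bar> \<and> \<bar>\<psi>\<bar> \<le> 5/2 * sn x z y"
    using angle_of_sine[OF z] pos C(1) by blast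
  then obtain \<psi> where \<psi>: "\<And>y. y \<in> C \<Longrightarrow> Arg (z - x) + \<psi> y \<in> dirs P x"
    "\<And>y. y \<in> C \<Longrightarrow> sn x z y \<le> \<bar>\<psi> y\<bar>" "\<And>y. y \<in> C \<Longrightarrow> \<bar>\<psi> y\<bar> \<le> 5/2 * sn x z y" by metis
  define \<Sigma> where "\<Sigma> T = (\<Sum>y\<in>T. Arg (z - x) + \<psi> y)" for T
  have "inj_on \<Sigma> {T. T \<subseteq> C \<and> card T = m}"
  proof (rule inj_onI, clarify)
    fix T U assume TU: "T \<subseteq> C" "U \<subseteq> C" "\<Sigma> T = \<Sigma> U" "card U = card T"
    then have "sum \<psi> T = sum \<psi> U" by (simp add: \<Sigma>_def sum.distrib)
    then show "T = U"
    proof (intro signed_sums_distinct[OF fC _ _ TU(1,2)])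
      fix y assume y: "y \<in> C"
      show "\<psi> y \<noteq> 0" using \<psi>(2)[OF y] pos[OF y] by auto
      fix w assume w: "w \<in> C" "y \<noteq> w"
      have "8 * sn x z y \<le> sn x z w \<or> 8 * sn x z w \<le> sn x z y" using C(2) y w by (auto simp: lac_def)
      then show "5/2 * \<bar>\<psi> y\<bar> \<le> \<bar>\<psi> w\<bar> \<or> 5/2 * \<bar>\<psi> w\<bar> \<le> \<bar>\<psi> y\<bar>"
        using \<psi>(2,3)[OF y] \<psi>(2,3)[OF w(1)] pos[OF y] pos[OF w(1)] by linarith
    qed
  qed
  moreover have "\<Sigma> ` {T. T \<subseteq> C \<and> card T = m} \<subseteq> nsum m (dirs P x)"
  proof clarify
    fix T assume "T \<subseteq> C" "m = card T"
    then show "\<Sigma> T \<in> nsum (card T) (dirs P x)"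
      unfolding \<Sigma>_def using \<psi>(1) fC finite_subset by (intro sum_in_nsum) blast+
  qed
  ultimately have "card {T. T \<subseteq> C \<and> card T = m} \<le> card (nsum m (dirs P x))"
    using finite_nsum[OF card_dirs_diff(2)[OF P]] by (metis card_inj_on_le)
  then show ?thesis using n_subsets[OF fC] by simp
qed

text \<open>What the geometry uses of small sumsets. It will hold with \<open>Q\<close> about
  \<open>n powr (1/500)\<close> at pins with almost \<open>n\<close> directions, by
  \<open>lac_sines_card\<close> for sums of 1000 directions.\<close>

definition scl :: "complex set \<Rightarrow> real \<Rightarrow> complex \<Rightarrow> bool" where
  "scl P Q x \<longleftrightarrow> (\<forall>z\<in>P - {x}. \<forall>C\<subseteq>P - {x}. lac (sn x z) C \<longrightarrow> real (card C) \<le> Q)"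

text \<open>Erdos--Szekeres: label a point by the longest chains above it.\<close>

lemma card_le_mult_chains:
  fixes a b :: "'a \<Rightarrow> real" and Qa Qb :: nat
  assumes Y: "finite Y" and pos: "\<And>y. y \<in> Y \<Longrightarrow> a y > 0 \<and> b y > 0"
    and ab: "\<And>y z. y \<in> Y \<Longrightarrow> z \<in> Y \<Longrightarrow> y \<noteq> z \<Longrightarrow>
      8 * a y \<le> a z \<or> 8 * a z \<le> a y \<or> 8 * b y \<le> b z \<or> 8 * b z \<le> b y"
    and Qa: "\<And>C. C \<subseteq> Y \<Longrightarrow> lac a C \<Longrightarrow> card C \<le> Qa" and Qb: "\<And>C. C \<subseteq> Y \<Longrightarrow> lac b C \<Longrightarrow> card C \<le> Qb"
  shows "card Y \<le> Qa * Qb"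
proof -
  define L where "L s y = Max (card ` {C. C \<subseteq> Y \<and> lac s C \<and> y \<in> C \<and> (\<forall>w\<in>C. s y \<le> s w)})" for s :: "'a \<Rightarrow> real" and y
  have fin: "finite {C. C \<subseteq> Y \<and> lac s C \<and> y \<in> C \<and> (\<forall>w\<in>C. s y \<le> s w)}" for s :: "'a \<Rightarrow> real" and y
    using Y by auto
  have L_in: "\<exists>C. C \<subseteq> Y \<and> lac s C \<and> y \<in> C \<and> (\<forall>w\<in>C. s y \<le> s w) \<and> card C = L s y"
    if "y \<in> Y" "s y > 0" for s y
  proof -
    have "{y} \<in> {C. C \<subseteq> Y \<and> lac s C \<and> y \<in> C \<and> (\<forall>w\<in>C. s y \<le> s w)}" using that by (auto simp: lac_def)
    then have "L s y \<in> card ` {C. C \<subseteq> Y \<and> lac s C \<and> y \<in> C \<and> (\<forall>w\<in>C. s y \<le> s w)}"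
      unfolding L_def using fin by (intro Max_in) auto
    then show ?thesis by auto
  qed
  have less: "L s z < L s y" if yz: "y \<in> Y" "z \<in> Y" "0 < s y" "0 < s z" "8 * s y \<le> s z" for s y z
  proof -
    obtain C where "C \<subseteq> Y \<and> lac s C \<and> z \<in> C \<and> (\<forall>w\<in>C. s z \<le> s w) \<and> card C = L s z"
      using L_in[where s = s and y = z, OF yz(2,4)] by (elim exE)
    then have C: "C \<subseteq> Y" "lac s C" "z \<in> C" "\<forall>w\<in>C. s z \<le> s w" "card C = L s z" by auto
    have fC: "finite C" using C Y finite_subset by blast
    have yC: "y \<notin> C" using C(4) that by force
    have "lac s (insert y C)" unfolding lac_def
    proof (intro ballI conjI impI)
      show "s w > 0" if "w \<in> insert y C" for w using that C(2) \<open>0 < s y\<close> by (auto simp: lac_def)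
      have y8: "8 * s y \<le> s w" if "w \<in> C" for w using C(4) that \<open>8 * s y \<le> s z\<close> by (meson order_trans)
      show "8 * s w \<le> s v \<or> 8 * s v \<le> s w" if "w \<in> insert y C" "v \<in> insert y C" "w \<noteq> v" for w v
        using that y8 C(2) unfolding lac_def by blast
    qed
    then have "card (insert y C) \<in> card ` {C. C \<subseteq> Y \<and> lac s C \<and> y \<in> C \<and> (\<forall>w\<in>C. s y \<le> s w)}"
      using C that by force
    then have "card (insert y C) \<le> L s y" unfolding L_def using fin by (intro Max_ge) auto
    then show ?thesis using C fC yC by simp
  qed
  have "inj_on (\<lambda>y. (L a y, L b y)) Y"
  proof (rule inj_onI)
    fix y z assume yz: "y \<in> Y" "z \<in> Y" "(L a y, L b y) = (L a z, L b z)"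
    show "y = z"
    proof (rule ccontr)
      assume "y \<noteq> z"
      moreover have "L a y = L a z" "L b y = L b z" using yz(3) by auto
      ultimately show False
        using ab[OF yz(1,2)] less[of y z a] less[of z y a] less[of y z b] less[of z y b]
          pos[OF yz(1)] pos[OF yz(2)] yz(1,2) by auto
    qed
  qed
  moreover have "(\<lambda>y. (L a y, L b y)) ` Y \<subseteq> {1..Qa} \<times> {1..Qb}"
  proof (rule image_subsetI)
    fix y assume y: "y \<in> Y"
    have "L a y \<le> Qa" using L_in[of y a] pos[OF y] y Qa by metis
    moreover have "L b y \<le> Qb" using L_in[of y b] pos[OF y] y Qb by metis
    moreover have "1 \<le> L s y" if sp: "s y > 0" for s
    proof -
      obtain C where "C \<subseteq> Y" "y \<in> C" "card C = L s y" using L_in[where s = s and y = y, OF y sp] by blast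
      then show ?thesis using Y by (metis One_nat_def Suc_leI card_gt_0_iff empty_iff finite_subset)
    qed
    ultimately show "(L a y, L b y) \<in> {1..Qa} \<times> {1..Qb}" using pos[OF y] by auto
  qed
  ultimately have "card Y \<le> card ({1..Qa} \<times> {1..Qb})" by (intro card_inj_on_le) auto
  then show ?thesis by (simp add: card_cartesian_product)
qed

text \<open>Both sides are the distance of \<open>y\<close> from the line through \<open>x\<close>
  and \<open>z\<close>.\<close>

lemma sn_mult:
  assumes "x \<noteq> z" "y \<noteq> x" "y \<noteq> z"
  shows "norm (y - z) * sn z x y = norm (y - x) * sn x z y"
proof -
  have "cr (x - z) (y - z) = - cr (z - x) (y - x)" by (simp add: cr_eq algebra_simps)
  then have "\<bar>cr (x - z) (y - z)\<bar> = \<bar>cr (z - x) (y - x)\<bar>" by simp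
  then show ?thesis using assms by (simp add: sn_def norm_minus_commute field_simps)
qed

text \<open>The points of \<open>Y\<close> are at comparable distances from \<open>x\<close>. So, by
  \<open>sn_mult\<close>, a ratio of distances from \<open>z\<close> is, up to a factor 3, a ratio
  of sines at \<open>x\<close> times an inverse ratio of sines at \<open>z\<close>. As 256 exceeds
  \<open>3 * 8 * 8\<close>, one of the two is at least 8, and \<open>card_le_mult_chains\<close>
  applies.\<close>

lemma separated_distances_card:
  fixes Q :: nat
  assumes P: "finite P" and xz: "x \<in> P" "z \<in> P" "x \<noteq> z" and scl: "scl P Q x" "scl P Q z"
    and Y: "Y \<subseteq> P" "\<And>y. y \<in> Y \<Longrightarrow> cr (x - z) (y - z) \<noteq> 0" "\<And>y. y \<in> Y \<Longrightarrow> 2 * norm (y - z) \<le> norm (x - z)"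
    and sep: "\<And>y w. y \<in> Y \<Longrightarrow> w \<in> Y \<Longrightarrow> y \<noteq> w \<Longrightarrow> 256 * norm (y - z) \<le> norm (w - z) \<or> 256 * norm (w - z) \<le> norm (y - z)"
  shows "card Y \<le> Q * Q"
proof (rule card_le_mult_chains[where a = "sn x z" and b = "sn z x"])
  show "finite Y" using Y P finite_subset by blast
  have off: "y \<noteq> x" "y \<noteq> z" if "y \<in> Y" for y using Y(2)[OF that] by auto
  have cr': "cr (z - x) (y - x) = - cr (x - z) (y - z)" for y by (simp add: cr_eq algebra_simps)
  show p: "sn x z y > 0 \<and> sn z x y > 0" if "y \<in> Y" for y
    using off[OF that] Y(2)[OF that] xz(3) by (simp add: sn_def cr')
  show "card C \<le> Q" if "C \<subseteq> Y" "lac (sn x z) C" for C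
  proof -
    have "C \<subseteq> P - {x}" "z \<in> P - {x}" using that(1) Y(1) off xz by auto
    then have "real (card C) \<le> real Q" using scl(1) that(2) unfolding scl_def by blast
    then show ?thesis by simp
  qed
  show "card C \<le> Q" if "C \<subseteq> Y" "lac (sn z x) C" for C
  proof -
    have "C \<subseteq> P - {z}" "x \<in> P - {z}" using that(1) Y(1) off xz by auto
    then have "real (card C) \<le> real Q" using scl(2) that(2) unfolding scl_def by blast
    then show ?thesis by simp
  qed
  fix y w assume yw: "y \<in> Y" "w \<in> Y" "y \<noteq> w"
  have key: "8 * sn x z u \<le> sn x z v \<or> 8 * sn z x v \<le> sn z x u"
    if u: "u \<in> Y" and v: "v \<in> Y" and far: "256 * norm (u - z) \<le> norm (v - z)" for u v
  proof (rule ccontr)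
    assume "\<not> ?thesis"
    then have *: "sn x z v < 8 * sn x z u" "sn z x u < 8 * sn z x v" by auto
    have nx: "norm (x - z) / 2 \<le> norm (u - x)" "norm (v - x) \<le> 3/2 * norm (x - z)"
      using Y(3)[OF u] Y(3)[OF v] norm_triangle_ineq4[of "u - z" "u - x"] norm_triangle_ineq4[of "v - z" "x - z"]
      by (simp_all add: norm_minus_commute)
    have e1: "norm (u - z) * sn z x u = norm (u - x) * sn x z u" "norm (v - z) * sn z x v = norm (v - x) * sn x z v"
      using sn_mult off u v xz(3) by auto
    have pos: "0 < sn x z u" "0 < sn z x u" "0 < sn x z v" "0 < sn z x v" "0 < norm (u - z)" "0 < norm (x - z)"
      using p u v off xz(3) by auto
    have "32 * norm (u - z) * sn z x u \<le> 32 * norm (u - z) * (8 * sn z x v)"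
      using * by (intro mult_left_mono) auto
    also have "\<dots> \<le> norm (v - z) * sn z x v" using far pos by (simp add: mult_right_mono)
    also have "\<dots> = norm (v - x) * sn x z v" by (rule e1)
    also have "\<dots> \<le> (3/2 * norm (x - z)) * sn x z v" using nx pos by (intro mult_right_mono) auto
    also have "\<dots> < (3/2 * norm (x - z)) * (8 * sn x z u)" using * pos by (intro mult_strict_left_mono) auto
    also have "\<dots> = 24 * (norm (x - z) / 2 * sn x z u)" by simp
    also have "\<dots> \<le> 24 * (norm (u - x) * sn x z u)" using nx pos by (intro mult_left_mono mult_right_mono) auto
    also have "\<dots> = 24 * (norm (u - z) * sn z x u)" using e1 by simp
    finally show False using mult_nonneg_nonneg[OF norm_ge_zero[of "u - z"], of "sn z x u"] pos by linarith
  qed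
  show "8 * sn x z y \<le> sn x z w \<or> 8 * sn x z w \<le> sn x z y \<or> 8 * sn z x y \<le> sn z x w \<or> 8 * sn z x w \<le> sn z x y"
    using sep[OF yw] key[OF yw(1,2)] key[OF yw(2,1)] by blast
qed

text \<open>Going inwards from the outermost point, either some shell is populated or the outermost
  points of successive shells are separated, which can happen only a few times.\<close>

lemma populated_shell:
  fixes Q :: nat and M :: real
  assumes P: "finite P" and S: "S \<subseteq> P" and x: "x \<in> S" and z: "z \<in> S" "x \<noteq> z" and scl: "scl P Q x" "scl P Q z"
    and far: "\<And>y. y \<in> S \<Longrightarrow> norm (y - z) \<le> norm (x - z)"
    and S': "S' = {y \<in> S. cr (x - z) (y - z) \<noteq> 0}" and M: "M > 0"
    and big: "(real (Q * Q) + 2) * M < real (card S')"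
  shows "\<exists>R>0. real (card {y \<in> S'. norm (y - z) > R}) \<le> (real (Q * Q) + 1) * M
    \<and> M \<le> real (card {y \<in> S. norm (y - z) \<le> R \<and> R \<le> 256 * norm (y - z)})"
proof (rule ccontr)
  assume none: "\<not> ?thesis"
  have fS: "finite S" "finite S'" using finite_subset[OF S P] by (auto simp: S')
  define d where "d y = norm (y - z)" for y
  have d0: "d y > 0" if "y \<in> S'" for y using that by (auto simp: S' d_def)
  have shell: "real (card {y \<in> S'. d y \<le> R \<and> R < 256 * d y}) < M"
    if "R > 0" "real (card {y \<in> S'. d y > R}) \<le> (real (Q * Q) + 1) * M" for R
  proof -
    have "card {y \<in> S'. d y \<le> R \<and> R < 256 * d y} \<le> card {y \<in> S. d y \<le> R \<and> R \<le> 256 * d y}"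
      using fS by (intro card_mono) (auto simp: S')
    then show ?thesis using none that unfolding d_def by fastforce
  qed
  \<comment> \<open>\<open>Y\<close> is the chain of outermost points chosen so far. The last
    conjunct bounds the points not yet deep inside all of them: one shell of fewer than
    \<open>M\<close> points for each choice, including \<open>x\<close>.\<close>
  have "\<exists>Y. Y \<subseteq> S' \<and> card Y = k \<and> (\<forall>y\<in>Y. 256 * d y \<le> d x) \<and>
     (\<forall>y\<in>Y. \<forall>w\<in>Y. y \<noteq> w \<longrightarrow> 256 * d y \<le> d w \<or> 256 * d w \<le> d y) \<and>
     real (card {y \<in> S'. \<not> (\<forall>w\<in>insert x Y. 256 * d y \<le> d w)}) \<le> (real k + 1) * M" if "k \<le> Q * Q + 1" for k
    using that
  proof (induction k)
    case 0
    have "{y \<in> S'. d y > d x} = {}" using far by (force simp: S' d_def)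
    then have "card {y \<in> S'. d y > d x} = 0" by (simp only: card.empty)
    then have "real (card {y \<in> S'. d y > d x}) \<le> (real (Q * Q) + 1) * M" using M by simp
    moreover have "d x > 0" using z by (simp add: d_def)
    ultimately have "real (card {y \<in> S'. d y \<le> d x \<and> d x < 256 * d y}) < M"
      by (intro shell)
    moreover have "{y \<in> S'. \<not> (\<forall>w\<in>insert x {}. 256 * d y \<le> d w)} = {y \<in> S'. d y \<le> d x \<and> d x < 256 * d y}"
      using far by (auto simp: S' d_def)
    ultimately show ?case by (intro exI[of _ "{}"]) auto
  next
    case (Suc k)
    then obtain Y where Y: "Y \<subseteq> S'" "card Y = k" "\<forall>y\<in>Y. 256 * d y \<le> d x"
      "\<forall>y\<in>Y. \<forall>w\<in>Y. y \<noteq> w \<longrightarrow> 256 * d y \<le> d w \<or> 256 * d w \<le> d y"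
      "real (card {y \<in> S'. \<not> (\<forall>w\<in>insert x Y. 256 * d y \<le> d w)}) \<le> (real k + 1) * M" by auto
    define E where "E = {y \<in> S'. \<not> (\<forall>w\<in>insert x Y. 256 * d y \<le> d w)}"
    have kQ: "(real k + 1) * M \<le> (real (Q * Q) + 1) * M"
      using Suc.prems M by (intro mult_right_mono) (auto simp del: of_nat_mult)
    have fE: "finite E" using fS by (simp add: E_def)
    have "(real (Q * Q) + 1) * M < (real (Q * Q) + 2) * M" using M by (intro mult_strict_right_mono) auto
    then have "real (card E) < real (card S')" using Y(5) kQ big unfolding E_def by linarith
    then have "S' - E \<noteq> {}" using card_mono[OF fE, of S'] by auto
    then obtain y0 where y0: "y0 \<in> S' - E" and max: "\<And>y. y \<in> S' - E \<Longrightarrow> d y \<le> d y0"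
      using exists_max_on[of "S' - E" d] fS by auto
    have sub: "{y \<in> S'. d y > d y0} \<subseteq> E" using max by force
    have cE: "real (card {y \<in> S'. d y > d y0}) \<le> (real k + 1) * M"
      using card_mono[OF fE sub] Y(5) unfolding E_def by linarith
    have sh: "real (card {y \<in> S'. d y \<le> d y0 \<and> d y0 < 256 * d y}) < M"
      using cE kQ d0 y0 by (intro shell) auto
    have "card {y \<in> S'. \<not> (\<forall>w\<in>insert x (insert y0 Y). 256 * d y \<le> d w)}
      \<le> card (E \<union> {y \<in> S'. d y \<le> d y0 \<and> d y0 < 256 * d y})"
    proof (intro card_mono subsetI)
      fix y assume "y \<in> {y \<in> S'. \<not> (\<forall>w\<in>insert x (insert y0 Y). 256 * d y \<le> d w)}"
      then show "y \<in> E \<union> {y \<in> S'. d y \<le> d y0 \<and> d y0 < 256 * d y}" using max[of y] by (auto simp: E_def)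
    qed (use fS in \<open>auto simp: E_def\<close>)
    also have "\<dots> \<le> card E + card {y \<in> S'. d y \<le> d y0 \<and> d y0 < 256 * d y}" by (rule card_Un_le)
    finally have "real (card {y \<in> S'. \<not> (\<forall>w\<in>insert x (insert y0 Y). 256 * d y \<le> d w)}) \<le> (real (Suc k) + 1) * M"
      using Y(5) sh unfolding E_def by (simp add: algebra_simps)
    moreover have y0': "256 * d y0 \<le> d w" if "w \<in> insert x Y" for w using y0 that unfolding E_def by auto
    moreover have "y0 \<notin> Y" using y0'[of y0] d0[of y0] y0 by auto
    moreover have "finite Y" using Y(1) fS finite_subset by blast
    ultimately show ?case using Y y0 by (intro exI[of _ "insert y0 Y"]) auto
  qed
  then obtain Y where Y: "Y \<subseteq> S'" "card Y = Q * Q + 1" "\<forall>y\<in>Y. 256 * d y \<le> d x"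
      "\<forall>y\<in>Y. \<forall>w\<in>Y. y \<noteq> w \<longrightarrow> 256 * d y \<le> d w \<or> 256 * d w \<le> d y" by blast
  have "card Y \<le> Q * Q"
  proof (rule separated_distances_card[OF P _ _ z(2) scl])
    show "2 * norm (y - z) \<le> norm (x - z)" if "y \<in> Y" for y
      using Y(3) that unfolding d_def by (smt (verit) norm_ge_zero)
  qed (use Y S x z in \<open>auto simp: S' d_def\<close>)
  then show False using Y by simp
qed

section \<open>Coincidences of angle sums\<close>

text \<open>Pivoting on a point where the last function is largest, one finds few points that control
  the whole span.\<close>

lemma interpolation_points:
  fixes f :: "nat \<Rightarrow> 'a \<Rightarrow> real"
  assumes "finite X"
  shows "\<exists>T\<subseteq>X. card T \<le> m \<and> (\<forall>c \<tau>. (\<forall>t\<in>T. \<bar>\<Sum>j<m. c j * f j t\<bar> \<le> \<tau>) \<longrightarrow> 0 \<le> \<tau>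
    \<longrightarrow> (\<forall>x\<in>X. \<bar>\<Sum>j<m. c j * f j x\<bar> \<le> (2 ^ m - 1) * \<tau>))"
proof (induction m arbitrary: f)
  case 0
  then show ?case by (intro exI[of _ "{}"]) auto
next
  case (Suc m)
  show ?case
  proof (cases "\<forall>x\<in>X. f m x = 0")
    case True
    obtain T where T: "T \<subseteq> X" "card T \<le> m"
      and le: "\<And>c \<tau> x. (\<forall>t\<in>T. \<bar>\<Sum>j<m. c j * f j t\<bar> \<le> \<tau>) \<Longrightarrow> 0 \<le> \<tau> \<Longrightarrow> x \<in> X \<Longrightarrow> \<bar>\<Sum>j<m. c j * f j x\<bar> \<le> (2 ^ m - 1) * \<tau>"
      using Suc.IH[of f] by blast
    have "\<bar>\<Sum>j<Suc m. c j * f j x\<bar> \<le> (2 ^ Suc m - 1) * \<tau>"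
      if "\<forall>t\<in>T. \<bar>\<Sum>j<Suc m. c j * f j t\<bar> \<le> \<tau>" "0 \<le> \<tau>" "x \<in> X" for c \<tau> x
    proof -
      have "\<forall>t\<in>T. \<bar>\<Sum>j<m. c j * f j t\<bar> \<le> \<tau>"
      proof
        fix t assume t: "t \<in> T"
        then have "f m t = 0" "\<bar>\<Sum>j<Suc m. c j * f j t\<bar> \<le> \<tau>" using True T(1) that(1) by auto
        then show "\<bar>\<Sum>j<m. c j * f j t\<bar> \<le> \<tau>" by simp
      qed
      then have "\<bar>\<Sum>j<m. c j * f j x\<bar> \<le> (2 ^ m - 1) * \<tau>" using le that by blast
      also have "\<dots> \<le> (2 ^ Suc m - 1) * \<tau>" using that(2) by (intro mult_right_mono) auto
      finally show ?thesis using True that(3) by simp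
    qed
    then show ?thesis using T by (intro exI[of _ T]) auto
  next
    case False
    then have "X \<noteq> {}" by auto
    obtain p where p: "p \<in> X" and max: "\<And>x. x \<in> X \<Longrightarrow> \<bar>f m x\<bar> \<le> \<bar>f m p\<bar>"
      using exists_max_on[OF assms \<open>X \<noteq> {}\<close>, of "\<lambda>x. \<bar>f m x\<bar>"] by blast
    have fp: "f m p \<noteq> 0" using False max by force
    \<comment> \<open>Gaussian elimination with pivot \<open>p\<close>. The quotient
      \<open>f m y / f m p\<close> has modulus at most 1, so the reduced functions are bounded by
      \<open>2 * \<tau>\<close> and undoing the step adds \<open>\<tau>\<close>:
      \<open>2 * (2 ^ m - 1) + 1 = 2 ^ Suc m - 1\<close>.\<close>
    define g where "g j x = f j x - f j p / f m p * f m x" for j x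
    obtain T where T: "T \<subseteq> X" "card T \<le> m"
      and le: "\<And>c \<tau> x. (\<forall>t\<in>T. \<bar>\<Sum>j<m. c j * g j t\<bar> \<le> \<tau>) \<Longrightarrow> 0 \<le> \<tau> \<Longrightarrow> x \<in> X \<Longrightarrow> \<bar>\<Sum>j<m. c j * g j x\<bar> \<le> (2 ^ m - 1) * \<tau>"
      using Suc.IH[of g] by blast
    have "\<bar>\<Sum>j<Suc m. c j * f j x\<bar> \<le> (2 ^ Suc m - 1) * \<tau>"
      if small: "\<forall>t\<in>insert p T. \<bar>\<Sum>j<Suc m. c j * f j t\<bar> \<le> \<tau>" and \<tau>: "0 \<le> \<tau>" and x: "x \<in> X" for c \<tau> x
    proof -
      define h where "h y = (\<Sum>j<Suc m. c j * f j y)" for y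
      have decomp: "(\<Sum>j<m. c j * g j y) = h y - h p / f m p * f m y" for y
      proof -
        have "(\<Sum>j<m. c j * g j y) = (\<Sum>j<m. c j * f j y) - (\<Sum>j<m. c j * f j p) / f m p * f m y"
          by (simp add: g_def right_diff_distrib sum_subtractf sum_divide_distrib sum_distrib_right mult.assoc)
        then show ?thesis using fp by (simp add: h_def add_divide_distrib distrib_right)
      qed
      have rest: "\<bar>h p / f m p * f m y\<bar> \<le> \<tau>" if "y \<in> X" for y
      proof -
        have "\<bar>h p / f m p * f m y\<bar> = \<bar>h p\<bar> * (\<bar>f m y\<bar> / \<bar>f m p\<bar>)" by (simp add: abs_mult)
        also have "\<dots> \<le> \<tau> * 1" using small fp max[OF that] \<tau> by (intro mult_mono) (auto simp: h_def)
        finally show ?thesis by simp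
      qed
      have "\<forall>t\<in>T. \<bar>\<Sum>j<m. c j * g j t\<bar> \<le> 2 * \<tau>"
      proof
        fix t assume "t \<in> T"
        then have "\<bar>h t\<bar> \<le> \<tau>" "t \<in> X" using small T(1) by (auto simp: h_def)
        then show "\<bar>\<Sum>j<m. c j * g j t\<bar> \<le> 2 * \<tau>" unfolding decomp using rest[of t] by linarith
      qed
      then have "\<bar>\<Sum>j<m. c j * g j x\<bar> \<le> (2 ^ m - 1) * (2 * \<tau>)" using le \<tau> x by simp
      then have "\<bar>h x\<bar> \<le> (2 ^ m - 1) * (2 * \<tau>) + \<tau>" unfolding decomp using rest[OF x] by linarith
      then show ?thesis by (simp add: h_def algebra_simps)
    qed
    moreover have "card (insert p T) \<le> Suc m"
      using T assms finite_subset by (metis Suc_le_mono card_insert_if le_SucI)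
    ultimately show ?thesis using T p by (intro exI[of _ "insert p T"]) blast
  qed
qed

section \<open>The logarithm series for directions\<close>

lemma abs_Im_power_le:
  assumes "norm (u :: complex) \<le> \<rho>" "\<bar>Im u\<bar> \<le> \<sigma>" "0 \<le> \<sigma>"
  shows "\<bar>Im (u ^ n)\<bar> \<le> n * \<rho> ^ (n - 1) * \<sigma>"
proof (induction n)
  case (Suc n)
  have \<rho>: "0 \<le> \<rho>" using assms(1) norm_ge_zero order_trans by blast
  have "\<bar>Im (u ^ Suc n)\<bar> \<le> \<bar>Re u * Im (u ^ n)\<bar> + \<bar>Im u * Re (u ^ n)\<bar>" by simp
  also have "\<dots> \<le> \<rho> * (n * \<rho> ^ (n - 1) * \<sigma>) + \<sigma> * \<rho> ^ n"
  proof (intro add_mono)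
    show "\<bar>Re u * Im (u ^ n)\<bar> \<le> \<rho> * (n * \<rho> ^ (n - 1) * \<sigma>)"
      unfolding abs_mult using assms(1) abs_Re_le_cmod[of u] Suc \<rho> by (intro mult_mono) auto
    have "\<bar>Re (u ^ n)\<bar> \<le> \<rho> ^ n"
      using abs_Re_le_cmod[of "u ^ n"] power_mono[OF assms(1), of n] by (simp add: norm_power)
    then show "\<bar>Im u * Re (u ^ n)\<bar> \<le> \<sigma> * \<rho> ^ n"
      unfolding abs_mult using assms by (intro mult_mono) auto
  qed
  also have "\<dots> = Suc n * \<rho> ^ (Suc n - 1) * \<sigma>"
    by (cases n) (auto simp: algebra_simps)
  finally show ?case .
qed simp

text \<open>Each term is bounded by a power of \<open>\<rho>\<close> times \<open>\<sigma>\<close>,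
  so that for points in a strip the error is proportional to its width. The factor 2 is the
  geometric tail for \<open>\<rho>\<close> at most 1/2.\<close>

lemma Im_Ln_taylor:
  assumes u: "norm (u :: complex) \<le> \<rho>" "\<bar>Im u\<bar> \<le> \<sigma>" "0 \<le> \<sigma>" "\<rho> \<le> 1/2" and d: "d \<ge> 1"
  shows "\<bar>Im (Ln (1 + u)) - (\<Sum>i<d. Im ((-1) ^ Suc i / of_nat i * u ^ i))\<bar> \<le> 2 * \<rho> ^ (d - 1) * \<sigma>"
proof -
  have \<rho>: "0 \<le> \<rho>" using u(1) norm_ge_zero order_trans by blast
  define s where "s i = Im ((-1) ^ Suc i / of_nat i * u ^ i)" for i :: nat
  \<comment> \<open>The term for \<open>i = 0\<close> is 0, as division by zero gives 0.\<close>
  have "(\<lambda>i. (-1) ^ Suc i / of_nat i * u ^ i) sums Ln (1 + u)"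
    using u by (intro Ln_series) auto
  then have "s sums Im (Ln (1 + u))" unfolding s_def by (rule sums_Im)
  then have tail: "(\<lambda>i. s (i + d)) sums (Im (Ln (1 + u)) - (\<Sum>i<d. s i))" by (simp add: sums_iff_shift)
  have sb: "\<bar>s i\<bar> \<le> \<rho> ^ (i - 1) * \<sigma>" if "i > 0" for i
  proof -
    have c: "(-1) ^ Suc i / of_nat i = (of_real ((-1) ^ Suc i / real i) :: complex)" by simp
    have "s i = (-1) ^ Suc i / real i * Im (u ^ i)" unfolding s_def c by (simp only: times_complex.sel Im_complex_of_real Re_complex_of_real mult_zero_left add_0_right)
    then have "\<bar>s i\<bar> = \<bar>Im (u ^ i)\<bar> / i" using that by (simp add: abs_mult power_abs)
    also have "\<dots> \<le> (i * \<rho> ^ (i - 1) * \<sigma>) / i"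
      using abs_Im_power_le[OF u(1-3), of i] by (intro divide_right_mono) auto
    finally show ?thesis using that by simp
  qed
  have geo: "(\<lambda>i. \<rho> ^ (d - 1) * \<sigma> * (1/2) ^ i) sums (\<rho> ^ (d - 1) * \<sigma> * 2)"
    using sums_mult[OF geometric_sums[of "1/2 :: real"], of "\<rho> ^ (d - 1) * \<sigma>"] by simp
  have le: "\<bar>s (i + d)\<bar> \<le> \<rho> ^ (d - 1) * \<sigma> * (1/2) ^ i" for i
  proof -
    have "\<bar>s (i + d)\<bar> \<le> \<rho> ^ (i + d - 1) * \<sigma>" using d by (intro sb) auto
    also have "\<rho> ^ (i + d - 1) = \<rho> ^ (d - 1) * \<rho> ^ i" using d by (simp add: add.commute flip: power_add)
    also have "\<dots> * \<sigma> \<le> \<rho> ^ (d - 1) * (1/2) ^ i * \<sigma>"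
      using u \<rho> by (intro mult_right_mono mult_left_mono power_mono) auto
    finally show ?thesis by (simp add: mult_ac)
  qed
  have "Im (Ln (1 + u)) - (\<Sum>i<d. s i) \<le> \<rho> ^ (d - 1) * \<sigma> * 2"
    using le by (intro sums_le[OF _ tail geo]) (auto simp: abs_le_iff)
  moreover have "- (Im (Ln (1 + u)) - (\<Sum>i<d. s i)) \<le> \<rho> ^ (d - 1) * \<sigma> * 2"
    using le by (intro sums_le[OF _ sums_minus[OF tail] geo]) (auto simp: abs_le_iff)
  ultimately show ?thesis unfolding s_def by linarith
qed

text \<open>A branch of the direction of \<open>z\<close> from \<open>x\<close> that is analytic
  near \<open>z0\<close>. In its series the pin enters through powers of \<open>1 / (z0 - x)\<close>
  and through a constant that cancels between tuples of equal length.\<close>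

definition phi :: "complex \<Rightarrow> complex \<Rightarrow> complex \<Rightarrow> real" where
  "phi z0 x z = Arg (z0 - x) + Im (Ln (1 + (z - z0) / (z0 - x)))"

lemma phi_polar:
  assumes "z0 \<noteq> x" "norm ((z - z0) / (z0 - x)) \<le> 1/2"
  shows "z - x = of_real (norm (z - x)) * cis (phi z0 x z)" "z \<noteq> x" "\<bar>phi z0 x z\<bar> \<le> 4 * pi"
proof -
  define u where "u = (z - z0) / (z0 - x)"
  have u: "norm u < 1" using assms by (simp add: u_def)
  have nz: "1 + u \<noteq> 0"
  proof
    assume "1 + u = 0"
    then have "u = - 1" by (simp add: eq_neg_iff_add_eq_0 add.commute)
    then show False using u by simp
  qed
  have zx: "z - x = (z0 - x) * (1 + u)" using assms(1) by (simp add: u_def field_simps)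
  then show ne: "z \<noteq> x" using nz assms(1) by auto
  have IL: "Im (Ln (1 + u)) = Arg (1 + u)" using Arg_eq_Im_Ln[OF nz] by simp
  have "z0 - x = of_real (norm (z0 - x)) * cis (Arg (z0 - x))" "1 + u = of_real (norm (1 + u)) * cis (Arg (1 + u))"
    by (metis rcis_cmod_Arg rcis_def)+
  then have "z - x = (of_real (norm (z0 - x)) * cis (Arg (z0 - x))) * (of_real (norm (1 + u)) * cis (Arg (1 + u)))"
    using zx by simp
  also have "\<dots> = of_real (norm (z0 - x) * norm (1 + u)) * (cis (Arg (z0 - x)) * cis (Arg (1 + u)))"
    by (simp add: mult_ac)
  also have "norm (z0 - x) * norm (1 + u) = norm (z - x)" unfolding zx by (simp add: norm_mult)
  finally show "z - x = of_real (norm (z - x)) * cis (phi z0 x z)"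
    unfolding phi_def u_def[symmetric] IL cis_mult .
  have "- pi < Arg (z0 - x)" "Arg (z0 - x) \<le> pi" "- pi < Arg (1 + u)" "Arg (1 + u) \<le> pi" using Arg_bounded by auto
  then show "\<bar>phi z0 x z\<bar> \<le> 4 * pi" unfolding phi_def u_def[symmetric] IL by linarith
qed

lemma phi_in_dirs:
  assumes "z0 \<noteq> x" "norm ((z - z0) / (z0 - x)) \<le> 1/2" "z \<in> P"
  shows "phi z0 x z \<in> dirs P x"
proof -
  have "cr (cis (phi z0 x z)) (z - x) = 0"
    by (subst phi_polar(1)[OF assms(1,2)]) (simp only: cr_scale_right cr_self mult_zero_right)
  then show ?thesis using phi_polar(2,3)[OF assms(1,2)] assms(3) by (auto simp: dirs_def)
qed

definition Phi :: "complex \<Rightarrow> complex set \<Rightarrow> complex \<Rightarrow> real" where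
  "Phi z0 a x = (\<Sum>z\<in>a. phi z0 x z)"

text \<open>Both products are real multiples of the same unit complex number, so one times the
  conjugate of the other is real. This turns a coincidence of angle sums into a polynomial equation
  in \<open>x\<close> and \<open>cnj x\<close>.\<close>

lemma Phi_eq_imp_prod_eq:
  assumes "z0 \<noteq> x" "\<And>z. z \<in> a \<union> b \<Longrightarrow> norm ((z - z0) / (z0 - x)) \<le> 1/2" and eq: "Phi z0 a x = Phi z0 b x"
  shows "(\<Prod>z\<in>a. z - x) * cnj (\<Prod>z\<in>b. z - x) = (\<Prod>z\<in>b. z - x) * cnj (\<Prod>z\<in>a. z - x)"
proof -
  have pol: "(\<Prod>z\<in>s. z - x) = of_real (\<Prod>z\<in>s. norm (z - x)) * cis (Phi z0 s x)" if "s \<subseteq> a \<union> b" for s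
  proof -
    have "(\<Prod>z\<in>s. z - x) = (\<Prod>z\<in>s. of_real (norm (z - x)) * cis (phi z0 x z))"
      using that assms by (intro prod.cong refl phi_polar(1)) auto
    also have "\<dots> = of_real (\<Prod>z\<in>s. norm (z - x)) * (\<Prod>z\<in>s. cis (phi z0 x z))" by (simp add: prod.distrib)
    also have "(\<Prod>z\<in>s. cis (phi z0 x z)) = cis (Phi z0 s x)"
      unfolding Phi_def by (induction s rule: infinite_finite_induct) (auto simp: cis_mult)
    finally show ?thesis .
  qed
  define A B \<theta> where "A = (\<Prod>z\<in>a. norm (z - x))" and "B = (\<Prod>z\<in>b. norm (z - x))" and "\<theta> = cis (Phi z0 b x)"
  have "(\<Prod>z\<in>a. z - x) = of_real A * \<theta>" "(\<Prod>z\<in>b. z - x) = of_real B * \<theta>"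
    using pol[of a] pol[of b] eq by (auto simp: A_def B_def \<theta>_def)
  then show ?thesis by (simp only: complex_cnj_mult complex_cnj_complex_of_real mult_ac)
qed

lemma card_square_le_coincidences:
  assumes "finite C"
  shows "(card C)\<^sup>2 \<le> card (f ` C) * card {(a, b) \<in> C \<times> C. f a = f b}"
proof -
  define g where "g v = {a \<in> C. f a = v}" for v
  have "{(a, b) \<in> C \<times> C. f a = f b} = (\<Union>v\<in>f ` C. g v \<times> g v)" by (auto simp: g_def)
  also have "card \<dots> = (\<Sum>v\<in>f ` C. card (g v \<times> g v))"
    using assms by (intro card_UN_disjoint) (auto simp: g_def)
  finally have e: "real (card {(a, b) \<in> C \<times> C. f a = f b}) = (\<Sum>v\<in>f ` C. (real (card (g v)))\<^sup>2)"
    by (simp add: card_cartesian_product power2_eq_square)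
  have "real (card C) = (\<Sum>x\<in>C. 1)" by simp
  also have "\<dots> = (\<Sum>v\<in>f ` C. \<Sum>x\<in>{x \<in> C. f x = v}. 1)" using assms by (rule sum.image_gen)
  finally have "real (card C) = (\<Sum>v\<in>f ` C. real (card (g v)))" by (simp add: g_def)
  then have "(real (card C))\<^sup>2 \<le> real (card (f ` C)) * real (card {(a, b) \<in> C \<times> C. f a = f b})"
    unfolding e using sum_squared_le_sum_of_squares[of "\<lambda>v. real (card (g v))" "f ` C"] by (simp add: mult.commute)
  then show ?thesis by (simp only: of_nat_le_iff flip: of_nat_mult of_nat_power)
qed

lemma sum_lessThan_add: "sum f {..<m + n} = sum f {..<m} + (\<Sum>i<n. f (m + i :: nat))"
  for f :: "nat \<Rightarrow> 'a::comm_monoid_add"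
  by (induction n) (auto simp: add.assoc)

lemma card_separated_sumset:
  fixes V \<Theta> W :: "real set"
  assumes fin: "finite V" "finite \<Theta>" "finite W" and sub: "\<And>v \<theta>. v \<in> V \<Longrightarrow> \<theta> \<in> \<Theta> \<Longrightarrow> v + \<theta> \<in> W"
    and V: "\<And>v v'. v \<in> V \<Longrightarrow> v' \<in> V \<Longrightarrow> \<bar>v - v'\<bar> \<le> \<delta>"
    and \<Theta>: "\<And>\<theta> \<theta>'. \<theta> \<in> \<Theta> \<Longrightarrow> \<theta>' \<in> \<Theta> \<Longrightarrow> \<theta> \<noteq> \<theta>' \<Longrightarrow> \<delta> < \<bar>\<theta> - \<theta>'\<bar>"
  shows "card V * card \<Theta> \<le> card W"
proof -
  have "inj_on (\<lambda>(v, \<theta>). v + \<theta>) (V \<times> \<Theta>)"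
  proof (rule inj_onI, clarify)
    fix v \<theta> v' \<theta>' assume *: "v \<in> V" "\<theta> \<in> \<Theta>" "v' \<in> V" "\<theta>' \<in> \<Theta>" "v + \<theta> = v' + \<theta>'"
    have "\<theta> = \<theta>'"
    proof (rule ccontr)
      assume "\<theta> \<noteq> \<theta>'"
      then have "\<delta> < \<bar>\<theta> - \<theta>'\<bar>" using \<Theta> * by blast
      moreover have "\<bar>\<theta> - \<theta>'\<bar> = \<bar>v - v'\<bar>" using * by linarith
      ultimately show False using V * by fastforce
    qed
    then show "v = v' \<and> \<theta> = \<theta>'" using * by simp
  qed
  moreover have "(\<lambda>(v, \<theta>). v + \<theta>) ` (V \<times> \<Theta>) \<subseteq> W" using sub by auto
  ultimately have "card (V \<times> \<Theta>) \<le> card W" using fin by (metis card_inj_on_le)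
  then show ?thesis by (simp add: card_cartesian_product)
qed

text \<open>Two tuples whose angle sums agree at the interpolation points of the truncated expansions
  have nearly equal angle sums at all pins; well separated directions at a pin then leave room for
  only few values of the angle sum, so two tuples agree exactly at many pins.\<close>

lemma thue_step:
  fixes P X B :: "complex set" and d l :: nat and \<rho> \<sigma> \<delta> H q :: real
  assumes P: "finite P" "X \<subseteq> P" "B \<subseteq> P" and X: "X \<noteq> {}" and d: "d \<ge> 1"
    and near: "\<And>x. x \<in> X \<Longrightarrow> x \<noteq> z0" "\<And>x z. x \<in> X \<Longrightarrow> z \<in> B \<Longrightarrow> norm ((z - z0) / (z0 - x)) \<le> \<rho>"
      "\<And>x z. x \<in> X \<Longrightarrow> z \<in> B \<Longrightarrow> \<bar>Im ((z - z0) / (z0 - x))\<bar> \<le> \<sigma>" and \<rho>: "0 \<le> \<rho>" "\<rho> \<le> 1/2" and \<sigma>: "0 \<le> \<sigma>"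
    and \<delta>: "4 ^ d * (4 * l * \<rho> ^ (d - 1) * \<sigma>) \<le> \<delta>"
    and H: "\<And>x. x \<in> X \<Longrightarrow> card (nsum l (dirs P x)) \<le> H" "\<And>x. x \<in> X \<Longrightarrow> card (nsum (Suc l) (dirs P x)) \<le> H" "1 \<le> H"
    and sep: "\<And>x. x \<in> X \<Longrightarrow> \<exists>\<Theta>\<subseteq>dirs P x. q \<le> card \<Theta> \<and> (\<forall>\<theta>\<in>\<Theta>. \<forall>\<theta>'\<in>\<Theta>. \<theta> \<noteq> \<theta>' \<longrightarrow> \<delta> < \<bar>\<theta> - \<theta>'\<bar>)"
    and q: "q > 0" and count: "H ^ (2 * d) * (2 * H / q) < card B choose l"
  shows "\<exists>a\<subseteq>B. \<exists>b\<subseteq>B. card a = l \<and> card b = l \<and> a \<noteq> b \<and> card X * q \<le> 2 * H * card {x \<in> X. Phi z0 a x = Phi z0 b x}"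
proof -
  have fin: "finite X" "finite B" using P finite_subset by auto
  define w where "w x = 1 / (z0 - x)" for x
  \<comment> \<open>Up to truncation, a difference of two angle sums is a real combination of these
    \<open>2 * d\<close> functions of the pin, with coefficients that depend on the tuples
    only.\<close>
  define f where "f j x = (if j < d then Im (w x ^ j) else Re (w x ^ (j - d)))" for j x
  obtain T where T: "T \<subseteq> X" "card T \<le> d + d"
    and interp: "\<And>c \<tau> x. (\<forall>t\<in>T. \<bar>\<Sum>j<d + d. c j * f j t\<bar> \<le> \<tau>) \<Longrightarrow> 0 \<le> \<tau> \<Longrightarrow> x \<in> X
      \<Longrightarrow> \<bar>\<Sum>j<d + d. c j * f j x\<bar> \<le> (2 ^ (d + d) - 1) * \<tau>"
    using interpolation_points[OF fin(1), of "d + d" f] by blast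
  have fT: "finite T" using T fin finite_subset by auto
  define \<tau> where "\<tau> = l * (2 * \<rho> ^ (d - 1) * \<sigma>) + l * (2 * \<rho> ^ (d - 1) * \<sigma>)"
  have \<tau>0: "0 \<le> \<tau>" using \<rho> \<sigma> by (simp add: \<tau>_def)
  have close: "\<bar>Phi z0 a x - Phi z0 b x\<bar> \<le> \<delta>"
    if a: "a \<subseteq> B" "card a = l" and b: "b \<subseteq> B" "card b = l" and eq: "\<forall>t\<in>T. Phi z0 a t = Phi z0 b t" and x: "x \<in> X" for a b x
  proof -
    define C where "C i = (-1) ^ Suc i / of_nat i * ((\<Sum>z\<in>a. (z - z0) ^ i) - (\<Sum>z\<in>b. (z - z0) ^ i))" for i :: nat
    define c where "c j = (if j < d then Re (C j) else Im (C (j - d)))" for j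
    have one: "\<bar>Phi z0 s y - l * Arg (z0 - y) - (\<Sum>i<d. Im ((-1) ^ Suc i / of_nat i * (\<Sum>z\<in>s. (z - z0) ^ i) * w y ^ i))\<bar>
        \<le> l * (2 * \<rho> ^ (d - 1) * \<sigma>)" if s: "s \<subseteq> B" "card s = l" and y: "y \<in> X" for s y
    proof -
      have fs: "finite s" using s fin finite_subset by auto
      have "(\<Sum>i<d. Im ((-1) ^ Suc i / of_nat i * (\<Sum>z\<in>s. (z - z0) ^ i) * w y ^ i))
          = (\<Sum>i<d. \<Sum>z\<in>s. Im ((-1) ^ Suc i / of_nat i * ((z - z0) / (z0 - y)) ^ i))"
        by (intro sum.cong refl) (simp only: Im_sum[symmetric] sum_distrib_left sum_distrib_right w_def power_divide power_one mult.assoc times_divide_eq_right mult_1_right sum_divide_distrib)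
      also have "\<dots> = (\<Sum>z\<in>s. \<Sum>i<d. Im ((-1) ^ Suc i / of_nat i * ((z - z0) / (z0 - y)) ^ i))" by (rule sum.swap)
      finally have "Phi z0 s y - l * Arg (z0 - y) - (\<Sum>i<d. Im ((-1) ^ Suc i / of_nat i * (\<Sum>z\<in>s. (z - z0) ^ i) * w y ^ i))
         = (\<Sum>z\<in>s. Im (Ln (1 + (z - z0) / (z0 - y))) - (\<Sum>i<d. Im ((-1) ^ Suc i / of_nat i * ((z - z0) / (z0 - y)) ^ i)))"
        using s(2) by (simp add: Phi_def phi_def sum.distrib sum_subtractf)
      also have "\<bar>\<dots>\<bar> \<le> (\<Sum>z\<in>s. 2 * \<rho> ^ (d - 1) * \<sigma>)"
        by (rule order_trans[OF sum_abs], intro sum_mono Im_Ln_taylor) (use near s y \<rho> \<sigma> d in auto)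
      finally show ?thesis using s(2) by simp
    qed
    have M: "\<bar>Phi z0 a y - Phi z0 b y - (\<Sum>j<d + d. c j * f j y)\<bar> \<le> \<tau>" if y: "y \<in> X" for y
    proof -
      have "(\<Sum>j<d + d. c j * f j y) = (\<Sum>i<d. Re (C i) * Im (w y ^ i) + Im (C i) * Re (w y ^ i))"
        unfolding sum_lessThan_add sum.distrib by (simp add: c_def f_def)
      also have "\<dots> = (\<Sum>i<d. Im (C i * w y ^ i))" by (intro sum.cong) auto
      also have "\<dots> = (\<Sum>i<d. Im ((-1) ^ Suc i / of_nat i * (\<Sum>z\<in>a. (z - z0) ^ i) * w y ^ i))
          - (\<Sum>i<d. Im ((-1) ^ Suc i / of_nat i * (\<Sum>z\<in>b. (z - z0) ^ i) * w y ^ i))"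
        unfolding sum_subtractf[symmetric] C_def by (intro sum.cong refl) (simp only: right_diff_distrib left_diff_distrib minus_complex.sel)
      finally show ?thesis using one[OF a y] one[OF b y] unfolding \<tau>_def by linarith
    qed
    have "\<forall>t\<in>T. \<bar>\<Sum>j<d + d. c j * f j t\<bar> \<le> \<tau>" using M eq T(1) by fastforce
    then have "\<bar>\<Sum>j<d + d. c j * f j x\<bar> \<le> (2 ^ (d + d) - 1) * \<tau>" using interp \<tau>0 x by blast
    then have "\<bar>Phi z0 a x - Phi z0 b x\<bar> \<le> (2 ^ (d + d) - 1) * \<tau> + \<tau>" using M[OF x] by linarith
    also have "\<dots> = 4 ^ d * (4 * l * \<rho> ^ (d - 1) * \<sigma>)"
    proof -
      have "(2::real) ^ (d + d) = 4 ^ d" by (simp add: power_add power_mult_distrib[symmetric])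
      then show ?thesis by (simp add: \<tau>_def algebra_simps)
    qed
    finally show ?thesis using \<delta> by simp
  qed
  have Phi_in: "Phi z0 a x \<in> nsum l (dirs P x)" if "a \<subseteq> B" "card a = l" "x \<in> X" for a x
  proof -
    have "phi z0 x z \<in> dirs P x" if "z \<in> a" for z
    proof (rule phi_in_dirs)
      show "norm ((z - z0) / (z0 - x)) \<le> 1/2" using near(2)[OF \<open>x \<in> X\<close>, of z] that \<open>a \<subseteq> B\<close> \<rho> by auto
      show "z0 \<noteq> x" using near(1)[OF \<open>x \<in> X\<close>] by auto
      show "z \<in> P" using that \<open>a \<subseteq> B\<close> P by auto
    qed
    then show ?thesis unfolding Phi_def using that fin finite_subset sum_in_nsum by blast
  qed
  define \<T> where "\<T> = {a. a \<subseteq> B \<and> card a = l}"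
  have f\<T>: "finite \<T>" using fin by (simp add: \<T>_def)
  have c\<T>: "card \<T> = card B choose l" unfolding \<T>_def using n_subsets[OF fin(2)] by simp
  \<comment> \<open>On the interpolation points at most \<open>H ^ (2 * d)\<close> vectors of angle
    sums occur, so more than \<open>2 * H / q\<close> tuples share one.\<close>
  define vec where "vec a = restrict (\<lambda>t. Phi z0 a t) T" for a
  have "\<exists>a0\<in>\<T>. 2 * H / q < card {a \<in> \<T>. vec a = vec a0}"
  proof (rule ccontr)
    assume "\<not> ?thesis"
    then have "real (card {b \<in> \<T>. vec b = vec a}) \<le> 2 * H / q" if "a \<in> \<T>" for a using that by (auto simp: not_less)
    then have "real (card \<T>) \<le> card (vec ` \<T>) * (2 * H / q)" by (intro card_le_colours f\<T>) auto
    also have "real (card (vec ` \<T>)) \<le> H ^ (2 * d)"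
    proof -
      have fd: "finite (nsum l (dirs P t))" for t using card_dirs_diff(2)[OF P(1)] by (rule finite_nsum)
      have "vec ` \<T> \<subseteq> PiE T (\<lambda>t. nsum l (dirs P t))"
        using Phi_in T(1) by (auto simp: vec_def \<T>_def)
      then have "card (vec ` \<T>) \<le> card (PiE T (\<lambda>t. nsum l (dirs P t)))"
        using fT fd by (intro card_mono finite_PiE) auto
      also have "\<dots> = (\<Prod>t\<in>T. card (nsum l (dirs P t)))" using fT by (rule card_PiE)
      finally have "real (card (vec ` \<T>)) \<le> real (\<Prod>t\<in>T. card (nsum l (dirs P t)))" by (rule of_nat_mono)
      also have "\<dots> = (\<Prod>t\<in>T. real (card (nsum l (dirs P t))))" by simp
      also have "\<dots> \<le> (\<Prod>t\<in>T. H)" using H(1) T(1) by (intro prod_mono) auto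
      also have "\<dots> = H ^ card T" by simp
      also have "\<dots> \<le> H ^ (2 * d)" using H(3) T(2) by (intro power_increasing) auto
      finally show ?thesis .
    qed
    then have "card (vec ` \<T>) * (2 * H / q) \<le> H ^ (2 * d) * (2 * H / q)"
      using q H(3) by (intro mult_right_mono) auto
    finally show False using count c\<T> by linarith
  qed
  then obtain a0 where a0: "a0 \<in> \<T>" "2 * H / q < card {a \<in> \<T>. vec a = vec a0}" by blast
  define \<C> where "\<C> = {a \<in> \<T>. vec a = vec a0}"
  define m where "m = real (card \<C>)"
  have f\<C>: "finite \<C>" using f\<T> by (simp add: \<C>_def)
  have m: "2 * H / q < m" using a0 by (simp add: m_def \<C>_def)
  have mpos: "m > 0" using m q H(3) by (smt (verit) divide_nonneg_pos)
  have agree: "Phi z0 a t = Phi z0 b t" if "a \<in> \<C>" "b \<in> \<C>" "t \<in> T" for a b t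
  proof -
    have "vec a t = vec b t" using that by (simp add: \<C>_def)
    then show ?thesis using that by (simp add: vec_def)
  qed
  define eqs where "eqs x = {(a, b) \<in> \<C> \<times> \<C>. Phi z0 a x = Phi z0 b x}" for x
  \<comment> \<open>On this class all angle sums at \<open>x\<close> are within
    \<open>\<delta>\<close> of each other; adding the \<open>\<delta>\<close>-separated directions
    gives distinct sums of \<open>l + 1\<close> directions, so there are at most
    \<open>H / q\<close> values and hence many coincidences.\<close>
  have many: "m\<^sup>2 * q \<le> H * card (eqs x)" if x: "x \<in> X" for x
  proof -
    obtain \<Theta> where \<Theta>: "\<Theta> \<subseteq> dirs P x" "q \<le> card \<Theta>" "\<forall>\<theta>\<in>\<Theta>. \<forall>\<theta>'\<in>\<Theta>. \<theta> \<noteq> \<theta>' \<longrightarrow> \<delta> < \<bar>\<theta> - \<theta>'\<bar>"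
      using sep[OF x] by blast
    define V where "V = (\<lambda>a. Phi z0 a x) ` \<C>"
    have "card V * card \<Theta> \<le> card (nsum (Suc l) (dirs P x))"
    proof (rule card_separated_sumset[where \<delta> = \<delta>])
      show "finite \<Theta>" using \<Theta>(1) card_dirs_diff(2)[OF P(1)] finite_subset by blast
      show "finite (nsum (Suc l) (dirs P x))" using card_dirs_diff(2)[OF P(1)] by (rule finite_nsum)
      show "v + \<theta> \<in> nsum (Suc l) (dirs P x)" if "v \<in> V" "\<theta> \<in> \<Theta>" for v \<theta>
      proof -
        have "v \<in> nsum l (dirs P x)" using that Phi_in x by (auto simp: V_def \<C>_def \<T>_def)
        then have "\<theta> + v \<in> dirs P x + nsum l (dirs P x)" using that \<Theta>(1) by (intro set_plus_intro) auto
        then show ?thesis by (simp add: add.commute)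
      qed
      show "\<bar>v - v'\<bar> \<le> \<delta>" if vV: "v \<in> V" "v' \<in> V" for v v'
      proof -
        obtain a b where ab: "a \<in> \<C>" "b \<in> \<C>" "v = Phi z0 a x" "v' = Phi z0 b x" using vV by (auto simp: V_def)
        have "a \<subseteq> B" "card a = l" "b \<subseteq> B" "card b = l" using ab by (auto simp: \<C>_def \<T>_def)
        then show ?thesis using close[of a b x] agree[OF ab(1,2)] x unfolding ab(3,4) by blast
      qed
    qed (use \<Theta>(3) f\<C> in \<open>auto simp: V_def\<close>)
    then have "real (card V) * card \<Theta> \<le> card (nsum (Suc l) (dirs P x))"
      by (simp only: of_nat_le_iff flip: of_nat_mult)
    then have "real (card V) * card \<Theta> \<le> H" using H(2)[OF x] by linarith
    moreover have "real (card V) * q \<le> real (card V) * card \<Theta>" using \<Theta>(2) by (intro mult_left_mono) auto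
    ultimately have VH: "real (card V) * q \<le> H" by linarith
    have "(card \<C>)\<^sup>2 \<le> card V * card (eqs x)"
      unfolding V_def eqs_def using card_square_le_coincidences[OF f\<C>, of "\<lambda>a. Phi z0 a x"] by simp
    then have "m\<^sup>2 \<le> real (card V) * card (eqs x)"
      unfolding m_def by (simp only: of_nat_le_iff flip: of_nat_mult of_nat_power)
    then have "m\<^sup>2 * q \<le> real (card V) * card (eqs x) * q" using q by (intro mult_right_mono) auto
    also have "\<dots> = (real (card V) * q) * card (eqs x)" by simp
    also have "\<dots> \<le> H * card (eqs x)" using VH by (intro mult_right_mono) auto
    finally show ?thesis .
  qed
  show ?thesis
  proof (rule ccontr)
    \<comment> \<open>Coincidences are counted over all pins. The diagonal pairs contribute too
      little, because the class has more than \<open>2 * H / q\<close> members, so some pair of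
      distinct tuples must agree at many pins.\<close>
    assume none: "\<not> ?thesis"
    have few: "2 * H * card {x \<in> X. Phi z0 a x = Phi z0 b x} \<le> card X * q" if "a \<in> \<C>" "b \<in> \<C>" "a \<noteq> b" for a b
    proof -
      have "a \<subseteq> B" "b \<subseteq> B" "card a = l" "card b = l" using that by (auto simp: \<C>_def \<T>_def)
      then have "\<not> card X * q \<le> 2 * H * card {x \<in> X. Phi z0 a x = Phi z0 b x}" using none that(3) by blast
      then show ?thesis by linarith
    qed
    have "(\<Sum>x\<in>X. real (card (eqs x))) = (\<Sum>x\<in>X. \<Sum>ab\<in>\<C> \<times> \<C>. of_bool (Phi z0 (fst ab) x = Phi z0 (snd ab) x))"
    proof (intro sum.cong refl)
      fix x
      have "eqs x = (\<C> \<times> \<C>) \<inter> {ab. Phi z0 (fst ab) x = Phi z0 (snd ab) x}" by (auto simp: eqs_def)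
      then show "real (card (eqs x)) = (\<Sum>ab\<in>\<C> \<times> \<C>. of_bool (Phi z0 (fst ab) x = Phi z0 (snd ab) x))"
        using f\<C> by simp
    qed
    also have "\<dots> = (\<Sum>ab\<in>\<C> \<times> \<C>. \<Sum>x\<in>X. of_bool (Phi z0 (fst ab) x = Phi z0 (snd ab) x))" by (rule sum.swap)
    also have "\<dots> = (\<Sum>ab\<in>\<C> \<times> \<C>. real (card {x \<in> X. Phi z0 (fst ab) x = Phi z0 (snd ab) x}))"
      using fin by (simp add: Int_def)
    finally have eq: "(\<Sum>x\<in>X. real (card (eqs x))) = (\<Sum>ab\<in>\<C> \<times> \<C>. real (card {x \<in> X. Phi z0 (fst ab) x = Phi z0 (snd ab) x}))" .
    have "2 * (card X * (m\<^sup>2 * q)) = 2 * (\<Sum>x\<in>X. m\<^sup>2 * q)" by simp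
    also have "\<dots> \<le> 2 * (\<Sum>x\<in>X. H * card (eqs x))" using many by (intro mult_left_mono sum_mono) auto
    also have "\<dots> = (\<Sum>ab\<in>\<C> \<times> \<C>. 2 * H * card {x \<in> X. Phi z0 (fst ab) x = Phi z0 (snd ab) x})"
      using eq by (simp add: sum_distrib_left[symmetric] mult.assoc)
    also have "\<dots> \<le> (\<Sum>ab\<in>\<C> \<times> \<C>. card X * q + of_bool (fst ab = snd ab) * (2 * H * card X))"
    proof (intro sum_mono)
      fix ab assume ab: "ab \<in> \<C> \<times> \<C>"
      show "2 * H * card {x \<in> X. Phi z0 (fst ab) x = Phi z0 (snd ab) x} \<le> card X * q + of_bool (fst ab = snd ab) * (2 * H * card X)"
      proof (cases "fst ab = snd ab")
        case True
        then show ?thesis using q by simp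
      next
        case False
        then show ?thesis using few[of "fst ab" "snd ab"] ab by auto
      qed
    qed
    also have "\<dots> = m\<^sup>2 * (card X * q) + m * (2 * H * card X)"
    proof -
      have "(\<Sum>ab\<in>\<C> \<times> \<C>. of_bool (fst ab = snd ab) :: real) = real (card ((\<C> \<times> \<C>) \<inter> {ab. fst ab = snd ab}))"
        using f\<C> by simp
      also have "(\<C> \<times> \<C>) \<inter> {ab. fst ab = snd ab} = (\<lambda>a. (a, a)) ` \<C>" by auto
      also have "real (card \<dots>) = m" unfolding m_def by (subst card_image) (auto simp: inj_on_def)
      finally show ?thesis by (simp add: sum.distrib sum_distrib_right[symmetric] card_cartesian_product m_def power2_eq_square)
    qed
    finally have "2 * (card X * (m\<^sup>2 * q)) \<le> m\<^sup>2 * (card X * q) + m * (2 * H * card X)" .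
    then have "(card X * m) * (m * q) \<le> (card X * m) * (2 * H)" by (simp add: power2_eq_square algebra_simps)
    moreover have "card X * m > 0" using X fin mpos by (simp add: card_gt_0_iff)
    ultimately have "m * q \<le> 2 * H" by (rule mult_left_le_imp_le)
    then show False using m q by (simp add: divide_less_eq)
  qed
qed

section \<open>Curves through many pins\<close>

text \<open>A polynomial in \<open>X\<close> and \<open>Y\<close> is a polynomial in \<open>Y\<close> with coefficients in \<open>X\<close>; it is evaluated by
  first substituting a constant for \<open>Y\<close>.\<close>

definition poly2 :: "complex poly poly \<Rightarrow> complex \<Rightarrow> complex \<Rightarrow> complex" where
  "poly2 p x y = poly (poly p [:y:]) x"

lemma poly2_mult [simp]: "poly2 (p * q) x y = poly2 p x y * poly2 q x y"
  and poly2_add [simp]: "poly2 (p + q) x y = poly2 p x y + poly2 q x y"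
  and poly2_diff [simp]: "poly2 (p - q) x y = poly2 p x y - poly2 q x y"
  and poly2_power [simp]: "poly2 (p ^ n) x y = poly2 p x y ^ n"
  and poly2_const [simp]: "poly2 [:c:] x y = poly c x"
  and poly2_0 [simp]: "poly2 0 x y = 0"
  and poly2_smult [simp]: "poly2 (smult c p) x y = poly c x * poly2 p x y"
  by (simp_all add: poly2_def)

text \<open>The degree in the first variable, kept apart from \<open>degree\<close>, which is that
  in the second: in the end a polynomial linear in each variable has to be recognised.\<close>

definition xdeg_le :: "complex poly poly \<Rightarrow> nat \<Rightarrow> bool" where
  "xdeg_le p n \<longleftrightarrow> (\<forall>i. degree (coeff p i) \<le> n)"

section \<open>Degree bounds, pseudo-division and common zeros\<close>

lemma xdeg_le_mono: "xdeg_le p m \<Longrightarrow> m \<le> n \<Longrightarrow> xdeg_le p n"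
  by (auto simp: xdeg_le_def intro: le_trans)

lemma xdeg_le_diff: "xdeg_le p n \<Longrightarrow> xdeg_le q n \<Longrightarrow> xdeg_le (p - q) n"
  by (auto simp: xdeg_le_def intro: degree_diff_le)

lemma xdeg_le_mult: "xdeg_le p m \<Longrightarrow> xdeg_le q n \<Longrightarrow> xdeg_le (p * q) (m + n)"
  unfolding xdeg_le_def coeff_mult
  by (intro allI degree_sum_le) (auto intro!: order_trans[OF degree_mult_le] add_mono)

lemma xdeg_le_smult: "xdeg_le p m \<Longrightarrow> degree c \<le> n \<Longrightarrow> xdeg_le (smult c p) (n + m)"
  by (auto simp: xdeg_le_def intro!: order_trans[OF degree_mult_le] add_mono)

lemma xdeg_le_monom: "degree c \<le> n \<Longrightarrow> xdeg_le (monom c k) n"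
  by (auto simp: xdeg_le_def)

lemma xdeg_max:
  fixes p :: "complex poly poly"
  assumes "p \<noteq> 0"
  obtains D i where "xdeg_le p D" "coeff p i \<noteq> 0" "degree (coeff p i) = D" "\<And>j. j > i \<Longrightarrow> coeff p j = 0 \<or> degree (coeff p j) < D"
proof -
  define D where "D = Max ((\<lambda>i. degree (coeff p i)) ` {i. i \<le> degree p})"
  have le: "degree (coeff p j) \<le> D" for j
  proof (cases "j \<le> degree p")
    case True
    then show ?thesis unfolding D_def by (intro Max_ge) auto
  qed (simp add: coeff_eq_0)
  define I where "I = {i. i \<le> degree p \<and> coeff p i \<noteq> 0 \<and> degree (coeff p i) = D}"
  have "I \<noteq> {}"
  proof -
    have "D \<in> (\<lambda>i. degree (coeff p i)) ` {i. i \<le> degree p}" unfolding D_def by (intro Max_in) auto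
    then obtain i where i: "i \<le> degree p" "degree (coeff p i) = D" by auto
    show ?thesis
    proof (cases "coeff p i = 0")
      case True
      then have "D = 0" using i by simp
      then have "degree p \<in> I" using le[of "degree p"] assms by (simp add: I_def)
      then show ?thesis by blast
    next
      case False
      then show ?thesis using i by (auto simp: I_def)
    qed
  qed
  moreover have "finite I" by (auto simp: I_def)
  ultimately have m: "Max I \<in> I" "\<And>j. j \<in> I \<Longrightarrow> j \<le> Max I" by auto
  show thesis
  proof (rule that[of D "Max I"])
    show "xdeg_le p D" using le by (simp add: xdeg_le_def)
    show "coeff p (Max I) \<noteq> 0" "degree (coeff p (Max I)) = D" using m(1) by (auto simp: I_def)
    show "coeff p j = 0 \<or> degree (coeff p j) < D" if "j > Max I" for j
    proof (rule ccontr)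
      assume "\<not> ?thesis"
      then have "coeff p j \<noteq> 0" "degree (coeff p j) = D" using le[of j] by auto
      then have "j \<in> I" by (auto simp: I_def intro: le_degree)
      then show False using m(2) that by fastforce
    qed
  qed
qed

lemma degree_sum_less':
  fixes f :: "'b \<Rightarrow> complex poly"
  assumes "finite S" "\<And>s. s \<in> S \<Longrightarrow> f s = 0 \<or> degree (f s) < D"
  shows "sum f S = 0 \<or> degree (sum f S) < D"
  using assms
proof (induction S rule: finite_induct)
  case (insert x S)
  then have "sum f S = 0 \<or> degree (sum f S) < D" "f x = 0 \<or> degree (f x) < D" by auto
  then show ?case using insert.hyps degree_add_less[of "f x" D "sum f S"] by auto
qed simp

text \<open>Among the terms of largest degree in \<open>X\<close> take the one of highest degree in
  \<open>Y\<close>. In a product these terms multiply, and nothing cancels the result.\<close>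

lemma xdeg_le_factor:
  assumes "xdeg_le (p * q) n" "p * q \<noteq> 0"
  shows "xdeg_le p n"
proof -
  have pq: "p \<noteq> 0" "q \<noteq> 0" using assms(2) by auto
  obtain D i where D: "xdeg_le p D" "coeff p i \<noteq> 0" "degree (coeff p i) = D" "\<And>j. j > i \<Longrightarrow> coeff p j = 0 \<or> degree (coeff p j) < D"
    using xdeg_max[OF pq(1)] by blast
  obtain E k where E: "xdeg_le q E" "coeff q k \<noteq> 0" "degree (coeff q k) = E" "\<And>j. j > k \<Longrightarrow> coeff q j = 0 \<or> degree (coeff q j) < E"
    using xdeg_max[OF pq(2)] by blast
  define t where "t j = coeff p j * coeff q (i + k - j)" for j
  have "coeff (p * q) (i + k) = (\<Sum>j\<le>i + k. t j)" by (simp add: coeff_mult t_def)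
  also have "\<dots> = t i + sum t ({..i + k} - {i})" by (simp add: sum.remove)
  finally have e: "coeff (p * q) (i + k) = t i + sum t ({..i + k} - {i})" .
  have ti: "t i \<noteq> 0" "degree (t i) = D + E" using D E by (auto simp: t_def degree_mult_eq)
  have "sum t ({..i + k} - {i}) = 0 \<or> degree (sum t ({..i + k} - {i})) < D + E"
  proof (rule degree_sum_less')
    fix j assume j: "j \<in> {..i + k} - {i}"
    have le: "degree (coeff p j) \<le> D" "degree (coeff q (i + k - j)) \<le> E" using D(1) E(1) by (auto simp: xdeg_le_def)
    have "j > i \<or> i + k - j > k" using j by auto
    then have "coeff p j = 0 \<or> degree (coeff p j) < D \<or> coeff q (i + k - j) = 0 \<or> degree (coeff q (i + k - j)) < E"
      using D(4) E(4) by blast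
    then show "t j = 0 \<or> degree (t j) < D + E"
      using le degree_mult_le[of "coeff p j" "coeff q (i + k - j)"] unfolding t_def by force
  qed simp
  then have "degree (coeff (p * q) (i + k)) = D + E"
    unfolding e using ti degree_add_eq_left[of "sum t ({..i + k} - {i})" "t i"] by auto
  then have "D \<le> n" using assms(1) unfolding xdeg_le_def by (metis add_leD1)
  then show ?thesis using D(1) xdeg_le_mono by blast
qed

text \<open>Multiplying \<open>f\<close> by the leading coefficient of \<open>g\<close> avoids
  fractions; each of the at most \<open>degree f + 1\<close> steps raises the degree in
  \<open>X\<close> by at most \<open>E\<close>.\<close>

lemma pseudo_division:
  assumes g: "g \<noteq> 0" and "xdeg_le f D" "xdeg_le g E"
  shows "\<exists>k h r. k \<le> degree f + 1 \<and> smult (lead_coeff g ^ k) f = g * h + r \<and> (r = 0 \<or> degree r < degree g) \<and> xdeg_le r (D + k * E)"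
  using assms(2)
proof (induction "degree f" arbitrary: f D rule: less_induct)
  case less
  show ?case
  proof (cases "f = 0 \<or> degree f < degree g")
    case True
    then show ?thesis using less.prems by (intro exI[of _ 0] exI[of _ f]) auto
  next
    case False
    then have f: "f \<noteq> 0" "degree g \<le> degree f" by auto
    define m where "m = monom (lead_coeff f) (degree f - degree g)"
    define f' where "f' = smult (lead_coeff g) f - g * m"
    have lc: "lead_coeff g \<noteq> 0" "lead_coeff f \<noteq> 0" using g f by auto
    have dm: "degree (g * m) = degree f"
      using f g lc by (simp add: m_def degree_mult_eq degree_monom_eq monom_eq_0_iff)
    have dm2: "lead_coeff (g * m) = lead_coeff g * lead_coeff f"
      unfolding lead_coeff_mult using lc(2) by (simp add: m_def degree_monom_eq)
    have ds: "degree (smult (lead_coeff g) f) = degree f" using lc by simp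
    have c0: "coeff f' (degree f) = 0"
      using dm2 unfolding dm by (simp add: f'_def)
    have dle: "degree f' \<le> degree f" unfolding f'_def using dm ds by (intro degree_diff_le) auto
    have xf': "xdeg_le f' (D + E)"
    proof -
      have "degree (lead_coeff g) \<le> E" "degree (lead_coeff f) \<le> D" using assms(3) less.prems by (auto simp: xdeg_le_def)
      then have "xdeg_le (smult (lead_coeff g) f) (E + D)" "xdeg_le (g * m) (E + D)"
        unfolding m_def using less.prems assms(3) by (auto intro!: xdeg_le_smult xdeg_le_mult xdeg_le_monom)
      then show ?thesis unfolding f'_def by (simp add: add.commute xdeg_le_diff)
    qed
    show ?thesis
    proof (cases "f' = 0")
      case True
      then have "smult (lead_coeff g ^ 1) f = g * m + 0" by (simp add: f'_def)
      then show ?thesis by (intro exI[of _ 1] exI[of _ m] exI[of _ 0]) (auto simp: xdeg_le_def)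
    next
      case False
      have less: "degree f' < degree f"
      proof (rule ccontr)
        assume "\<not> ?thesis"
        then have "degree f' = degree f" using dle by simp
        then show False using c0 False by (metis leading_coeff_0_iff)
      qed
      obtain k h r where k: "k \<le> degree f' + 1" "smult (lead_coeff g ^ k) f' = g * h + r"
        "r = 0 \<or> degree r < degree g" "xdeg_le r (D + E + k * E)"
        using less.hyps[OF less xf'] by blast
      have "smult (lead_coeff g ^ Suc k) f = smult (lead_coeff g ^ k) (f' + g * m)" by (simp add: f'_def mult.commute)
      also have "\<dots> = g * (h + smult (lead_coeff g ^ k) m) + r"
        using k(2) by (simp add: smult_add_right algebra_simps)
      finally have "smult (lead_coeff g ^ Suc k) f = g * (h + smult (lead_coeff g ^ k) m) + r" .
      then show ?thesis using k less
        by (intro exI[of _ "Suc k"] exI[of _ "h + smult (lead_coeff g ^ k) m"] exI[of _ r]) (auto simp: add.assoc)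
    qed
  qed
qed

lemma card_roots_le:
  fixes p :: "complex poly"
  assumes "p \<noteq> 0" "\<And>x. x \<in> Z \<Longrightarrow> poly p x = 0"
  shows "finite Z" "card Z \<le> degree p"
proof -
  have sub: "Z \<subseteq> {x. poly p x = 0}" using assms by auto
  have fin: "finite {x. poly p x = 0}" by (rule poly_roots_finite[OF assms(1)])
  show "finite Z" using sub fin finite_subset by blast
  have "card Z \<le> card {x. poly p x = 0}" by (rule card_mono[OF fin sub])
  also have "\<dots> \<le> degree p" by (rule card_poly_roots_bound[OF assms(1)])
  finally show "card Z \<le> degree p" .
qed

text \<open>Weak Bezout: dividing \<open>f\<close> repeatedly by the current remainder, which stays nonzero because \<open>f\<close>
  is prime, ends in a nonzero polynomial in \<open>X\<close> that vanishes at all common zeros.\<close>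

definition zeros_bounded :: "nat \<Rightarrow> nat \<Rightarrow> nat \<Rightarrow> nat \<Rightarrow> bool" where
  "zeros_bounded m D e N \<longleftrightarrow> (\<forall>f r Z. prime_elem f \<longrightarrow> degree f \<le> m \<longrightarrow> xdeg_le f D \<longrightarrow> xdeg_le r D \<longrightarrow> r \<noteq> 0
    \<longrightarrow> degree r < degree f \<longrightarrow> degree r \<le> e \<longrightarrow> finite Z
    \<longrightarrow> (\<forall>x\<in>Z. poly2 f x (cnj x) = 0 \<and> poly2 r x (cnj x) = 0) \<longrightarrow> card Z \<le> N)"

lemma zeros_boundedD:
  assumes "zeros_bounded m D e N" "prime_elem f" "degree f \<le> m" "xdeg_le f D" "xdeg_le r D" "r \<noteq> 0"
    "degree r < degree f" "degree r \<le> e" "finite Z" "\<And>x. x \<in> Z \<Longrightarrow> poly2 f x (cnj x) = 0 \<and> poly2 r x (cnj x) = 0"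
  shows "card Z \<le> N"
  using assms unfolding zeros_bounded_def by blast

lemma zeros_bounded_step:
  assumes N: "e = 0 \<or> zeros_bounded m (D + (m + 1) * D) (e - 1) N"
  shows "zeros_bounded m D e (max N D)"
  unfolding zeros_bounded_def
proof (intro allI impI)
  fix f r Z
  define D' where "D' = D + (m + 1) * D"
  assume f: "prime_elem f" "degree f \<le> m" "xdeg_le f D" and r: "xdeg_le r D" "r \<noteq> 0" "degree r < degree f" "degree r \<le> e"
    and Z: "finite Z" "\<forall>x\<in>Z. poly2 f x (cnj x) = 0 \<and> poly2 r x (cnj x) = 0"
  show "card Z \<le> max N D"
  proof (cases "degree r = 0")
    case True
    then obtain c where c: "r = [:c:]" by (rule degree_eq_zeroE)
    have "degree c \<le> D" using r(1) by (auto simp: c xdeg_le_def coeff_pCons split: nat.split dest: spec[of _ 0])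
    moreover have "card Z \<le> degree c" using r(2) Z(2) by (intro card_roots_le(2)) (auto simp: c)
    ultimately show ?thesis by simp
  next
    case False
    obtain k h s where k: "k \<le> degree f + 1" "smult (lead_coeff r ^ k) f = r * h + s" "s = 0 \<or> degree s < degree r"
      "xdeg_le s (D + k * D)" using pseudo_division[OF r(2) f(3) r(1)] by blast
    \<comment> \<open>Otherwise the prime \<open>f\<close> divides \<open>r * h\<close>, and not
      \<open>r\<close> by degree, hence \<open>h\<close>. Cancelling \<open>f\<close> makes a power
      of the leading coefficient, constant in \<open>Y\<close>, a multiple of \<open>r\<close>,
      which is not constant.\<close>
    have s0: "s \<noteq> 0"
    proof
      assume "s = 0"
      then have e: "[:lead_coeff r ^ k:] * f = r * h" using k(2) by simp
      then have "f dvd r * h" by (metis dvd_triv_right)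
      then have "f dvd r \<or> f dvd h" using f(1) by (simp add: prime_elem_dvd_mult_iff)
      moreover have "\<not> f dvd r" using r by (auto dest: dvd_imp_degree_le)
      ultimately obtain h' where "h = f * h'" by (auto elim: dvdE)
      then have "f * [:lead_coeff r ^ k:] = f * (r * h')" using e by (simp only: mult_ac)
      moreover have "f \<noteq> 0" using f(1) by auto
      ultimately have e2: "[:lead_coeff r ^ k:] = r * h'" by (simp only: mult_cancel_left) auto
      have "lead_coeff r ^ k \<noteq> 0" using r(2) by simp
      then have "h' \<noteq> 0" using e2 by auto
      then have "degree ([:lead_coeff r ^ k:]) = degree r + degree h'" unfolding e2 using r(2) by (simp add: degree_mult_eq)
      then show False using False by simp
    qed
    have "D + k * D \<le> D'" unfolding D'_def using k(1) f(2) by (intro add_mono mult_right_mono) auto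
    then have "xdeg_le s D'" using k(4) xdeg_le_mono by blast
    moreover have "xdeg_le f D'" using f(3) by (rule xdeg_le_mono) (simp add: D'_def)
    moreover have "poly2 s x (cnj x) = 0" if "x \<in> Z" for x
    proof -
      have "poly2 (smult (lead_coeff r ^ k) f) x (cnj x) = poly2 (r * h + s) x (cnj x)" using k(2) by simp
      then show ?thesis using Z(2) that by simp
    qed
    moreover have "zeros_bounded m D' (e - 1) N" using N False r(4) unfolding D'_def by auto
    ultimately have "card Z \<le> N"
      using k(3) s0 r f Z(1) False Z(2) by (intro zeros_boundedD[of m D' "e - 1" N f s Z]) auto
    then show ?thesis by simp
  qed
qed

lemma ex_zeros_bounded: "\<exists>N. zeros_bounded m D e N"
proof (induction e arbitrary: D)
  case 0
  then show ?case using zeros_bounded_step[of 0] by blast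
next
  case (Suc e)
  obtain N where "zeros_bounded m (D + (m + 1) * D) e N" using Suc by blast
  then show ?case using zeros_bounded_step[of "Suc e" m D N] by auto
qed

definition common_zeros_le :: "nat \<Rightarrow> nat \<Rightarrow> nat \<Rightarrow> bool" where
  "common_zeros_le m D N \<longleftrightarrow> (\<forall>f g Z. prime_elem f \<longrightarrow> 1 \<le> degree f \<longrightarrow> degree f \<le> m \<longrightarrow> xdeg_le f D \<longrightarrow> xdeg_le g D \<longrightarrow> degree g \<le> m
    \<longrightarrow> \<not> f dvd g \<longrightarrow> finite Z \<longrightarrow> (\<forall>x\<in>Z. poly2 f x (cnj x) = 0 \<and> poly2 g x (cnj x) = 0) \<longrightarrow> card Z \<le> N)"

lemma common_zeros_leD:
  "common_zeros_le m D N \<Longrightarrow> prime_elem f \<Longrightarrow> 1 \<le> degree f \<Longrightarrow> degree f \<le> m \<Longrightarrow> xdeg_le f D \<Longrightarrow> xdeg_le g D \<Longrightarrow> degree g \<le> m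
    \<Longrightarrow> \<not> f dvd g \<Longrightarrow> finite Z \<Longrightarrow> \<forall>x\<in>Z. poly2 f x (cnj x) = 0 \<and> poly2 g x (cnj x) = 0 \<Longrightarrow> card Z \<le> N"
  unfolding common_zeros_le_def by blast

text \<open>The pseudo-remainder of \<open>g\<close> modulo \<open>f\<close> is nonzero, since
  \<open>f\<close> is prime of positive degree and does not divide \<open>g\<close>. It vanishes at
  the common zeros and has smaller degree than \<open>f\<close>, as \<open>zeros_bounded\<close>
  requires.\<close>

lemma ex_common_zeros_le: "\<exists>N. common_zeros_le m D N"
proof -
  define D' where "D' = D + (m + 1) * D"
  obtain N where N: "zeros_bounded m D' m N" using ex_zeros_bounded by blast
  have "card Z \<le> N"
    if f: "prime_elem f" "1 \<le> degree f" "degree f \<le> m" "xdeg_le f D" and g: "xdeg_le g D" "degree g \<le> m" "\<not> f dvd g"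
      and Z: "finite Z" "\<forall>x\<in>Z. poly2 f x (cnj x) = 0 \<and> poly2 g x (cnj x) = 0" for f g Z
  proof -
    have f0: "f \<noteq> 0" using f(1) by auto
    obtain k h s where k: "k \<le> degree g + 1" "smult (lead_coeff f ^ k) g = f * h + s" "s = 0 \<or> degree s < degree f"
      "xdeg_le s (D + k * D)" using pseudo_division[OF f0 g(1) f(4)] by blast
    have s0: "s \<noteq> 0"
    proof
      assume "s = 0"
      then have "[:lead_coeff f ^ k:] * g = f * h" using k(2) by simp
      then have "f dvd [:lead_coeff f ^ k:] * g" by (metis dvd_triv_left)
      then have "f dvd [:lead_coeff f ^ k:]" using prime_elem_dvd_multD[OF f(1)] g(3) by blast
      moreover have "[:lead_coeff f ^ k:] \<noteq> 0" using f0 by simp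
      ultimately have "degree f \<le> degree [:lead_coeff f ^ k:]" by (rule dvd_imp_degree_le)
      then show False using f(2) by simp
    qed
    have "D + k * D \<le> D'" unfolding D'_def using k(1) g(2) by (intro add_mono mult_right_mono) auto
    then have "xdeg_le s D'" using k(4) xdeg_le_mono by blast
    moreover have "xdeg_le f D'" using f(4) by (rule xdeg_le_mono) (simp add: D'_def)
    moreover have "poly2 s x (cnj x) = 0" if "x \<in> Z" for x
    proof -
      have "poly2 (smult (lead_coeff f ^ k) g) x (cnj x) = poly2 (f * h + s) x (cnj x)" using k(2) by simp
      then show ?thesis using Z(2) that by simp
    qed
    ultimately show ?thesis using k(3) s0 f Z by (intro zeros_boundedD[OF N, of f s Z]) auto
  qed
  then show ?thesis unfolding common_zeros_le_def by blast
qed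

text \<open>Prime factors are split off one by one. Content 1 gives each of them positive degree in
  \<open>Y\<close>, so there are at most \<open>e\<close>, and one of them carries a share
  \<open>1 / e\<close> of the zeros.\<close>

lemma popular_prime_factor_primitive:
  assumes "content g = 1" "degree g \<le> e" "finite Z" "Z \<noteq> {}" "\<And>x. x \<in> Z \<Longrightarrow> poly2 g x (cnj x) = 0"
  shows "\<exists>f. prime_elem f \<and> content f = 1 \<and> 1 \<le> degree f \<and> f dvd g \<and> card Z \<le> e * card {x \<in> Z. poly2 f x (cnj x) = 0}"
  using assms
proof (induction e arbitrary: g Z)
  case 0
  then obtain c where c: "g = [:c:]" by (auto elim: degree_eq_zeroE)
  have "is_unit c" using 0(1) by (simp add: c normalize_1_iff)
  then have "poly c x \<noteq> 0" for x by (auto simp: is_unit_poly_iff)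
  then show ?case using 0(4,5) by (auto simp: c)
next
  case (Suc e)
  have g0: "g \<noteq> 0" using Suc.prems(1) by auto
  have "\<not> is_unit g"
  proof
    assume "is_unit g"
    then obtain h where h: "g * h = 1" by (metis dvd_def)
    obtain x where "x \<in> Z" using Suc.prems(4) by blast
    have "poly2 (g * h) x (cnj x) = 1" unfolding h by (simp add: poly2_def)
    then show False using Suc.prems(5)[OF \<open>x \<in> Z\<close>] by simp
  qed
  then obtain p where p: "p dvd g" "prime p" using prime_divisor_exists[OF g0] by blast
  obtain q where q: "g = p * q" using p(1) by (auto elim: dvdE)
  have pe: "prime_elem p" using p(2) by auto
  have "content p * content q = 1" using Suc.prems(1) unfolding q content_mult .
  then have *: "1 = content p * content q" "1 = content q * content p" by (simp_all add: mult.commute)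
  have "content p dvd 1" "content q dvd 1" using dvdI[OF *(1)] dvdI[OF *(2)] .
  then have cc: "content p = 1" "content q = 1"
    using normalize_1_iff[of "content p"] normalize_1_iff[of "content q"] by simp_all
  have dp: "1 \<le> degree p"
  proof (rule ccontr)
    assume "\<not> ?thesis"
    then obtain c where c: "p = [:c:]" by (metis degree_eq_zeroE less_one not_le)
    then have "is_unit c" using cc(1) by (simp add: normalize_1_iff)
    then have "is_unit p" by (simp add: c is_unit_const_poly_iff)
    then show False using pe by (simp add: prime_elem_def)
  qed
  have "q \<noteq> 0" "p \<noteq> 0" using g0 q by auto
  then have dq: "degree q \<le> e" using dp Suc.prems(2) unfolding q by (simp add: degree_mult_eq)
  define Zp Zq where "Zp = {x \<in> Z. poly2 p x (cnj x) = 0}" and "Zq = {x \<in> Z. poly2 q x (cnj x) = 0}"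
  have "Z = Zp \<union> Zq" using Suc.prems(5) by (auto simp: Zp_def Zq_def q)
  then have cu: "card Z \<le> card Zp + card Zq" by (metis card_Un_le)
  show ?case
  proof (cases "card Z \<le> Suc e * card Zp")
    case True
    then show ?thesis using pe cc dp p(1) unfolding Zp_def by blast
  next
    case False
    then have lt: "Suc e * card Zp < card Z" by simp
    have cq: "card Zq > 0"
    proof (rule ccontr)
      assume "\<not> 0 < card Zq"
      then have "card Z \<le> card Zp" using cu by simp
      then show False using lt by simp
    qed
    then have "Zq \<noteq> {}" "finite Zq" by (auto simp: card_gt_0_iff)
    moreover have "poly2 q x (cnj x) = 0" if "x \<in> Zq" for x using that by (simp add: Zq_def)
    ultimately have "\<exists>f. prime_elem f \<and> content f = 1 \<and> 1 \<le> degree f \<and> f dvd q \<and> card Zq \<le> e * card {x \<in> Zq. poly2 f x (cnj x) = 0}"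
      by (intro Suc.IH[OF cc(2) dq])
    then obtain f where f: "prime_elem f" "content f = 1" "1 \<le> degree f" "f dvd q" "card Zq \<le> e * card {x \<in> Zq. poly2 f x (cnj x) = 0}"
      by blast
    have "card {x \<in> Zq. poly2 f x (cnj x) = 0} \<le> card {x \<in> Z. poly2 f x (cnj x) = 0}"
      using Suc.prems(3) by (intro card_mono) (auto simp: Zq_def)
    then have "card Zq \<le> e * card {x \<in> Z. poly2 f x (cnj x) = 0}" using f(5) by (meson le_trans mult_le_mono2)
    moreover have "card Z \<le> card {x \<in> Z. poly2 f x (cnj x) = 0} + card Zq \<or> e * card Zp < card Zq"
      using lt cu by simp
    moreover have "e * card Zp < card Zq" using lt cu by simp
    then have "card Zp \<le> card {x \<in> Z. poly2 f x (cnj x) = 0}"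
    proof -
      have "e * card Zp < e * card {x \<in> Z. poly2 f x (cnj x) = 0}"
        using \<open>e * card Zp < card Zq\<close> calculation(1) by linarith
      then show ?thesis by (simp add: less_imp_le)
    qed
    ultimately have "card Z \<le> Suc e * card {x \<in> Z. poly2 f x (cnj x) = 0}" using cu by simp
    moreover have "f dvd g" using f(4) by (simp add: q)
    ultimately show ?thesis using f by blast
  qed
qed

text \<open>The content is a polynomial in \<open>X\<close> alone and has at most \<open>D\<close>
  zeros; the other points are zeros of the primitive part.\<close>

lemma popular_prime_factor:
  assumes "g \<noteq> 0" "degree g \<le> e" "xdeg_le g D" "finite Z" "\<And>x. x \<in> Z \<Longrightarrow> poly2 g x (cnj x) = 0" "D < card Z"
  shows "\<exists>f. prime_elem f \<and> content f = 1 \<and> 1 \<le> degree f \<and> degree f \<le> e \<and> xdeg_le f D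
    \<and> card Z \<le> D + e * card {x \<in> Z. poly2 f x (cnj x) = 0}"
proof -
  define c h where "c = content g" and "h = primitive_part g"
  have g: "g = smult c h" by (simp add: c_def h_def)
  have c0: "c \<noteq> 0" using assms(1) by (simp add: c_def)
  have h1: "content h = 1" using assms(1) by (simp add: h_def)
  have dh: "degree h \<le> e" using assms(2) g c0 by simp
  have dc: "degree c \<le> D"
  proof -
    have "c dvd lead_coeff g" by (simp add: c_def)
    then have "degree c \<le> degree (lead_coeff g)" using assms(1) by (intro dvd_imp_degree_le) auto
    also have "\<dots> \<le> D" using assms(3) by (simp add: xdeg_le_def)
    finally show ?thesis .
  qed
  define Z1 where "Z1 = {x \<in> Z. poly2 h x (cnj x) = 0}"
  have "card (Z - Z1) \<le> degree c"
    using assms(5) by (intro card_roots_le(2)[OF c0]) (auto simp: Z1_def g)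
  then have c1: "card Z \<le> D + card Z1"
    using dc assms(4) by (simp add: card_Diff_subset Z1_def)
  then have "card Z1 > 0" using assms(6) by simp
  then have "Z1 \<noteq> {}" "finite Z1" by (auto simp: card_gt_0_iff)
  moreover have "poly2 h x (cnj x) = 0" if "x \<in> Z1" for x using that by (simp add: Z1_def)
  ultimately have "\<exists>f. prime_elem f \<and> content f = 1 \<and> 1 \<le> degree f \<and> f dvd h \<and> card Z1 \<le> e * card {x \<in> Z1. poly2 f x (cnj x) = 0}"
    by (intro popular_prime_factor_primitive[OF h1 dh])
  then obtain f where f: "prime_elem f" "content f = 1" "1 \<le> degree f" "f dvd h" "card Z1 \<le> e * card {x \<in> Z1. poly2 f x (cnj x) = 0}"
    by blast
  have h0: "h \<noteq> 0" using h1 by auto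
  obtain k where k: "h = f * k" using f(4) by (auto elim: dvdE)
  have gk: "g = f * smult c k" by (simp add: g k)
  have "xdeg_le (f * smult c k) D" "f * smult c k \<noteq> 0" using assms(1,3) unfolding gk by blast+
  then have "xdeg_le f D" by (rule xdeg_le_factor)
  moreover have "degree f \<le> e" using dvd_imp_degree_le[OF f(4) h0] dh by simp
  moreover have "card {x \<in> Z1. poly2 f x (cnj x) = 0} \<le> card {x \<in> Z. poly2 f x (cnj x) = 0}"
    using assms(4) by (intro card_mono) (auto simp: Z1_def)
  then have "e * card {x \<in> Z1. poly2 f x (cnj x) = 0} \<le> e * card {x \<in> Z. poly2 f x (cnj x) = 0}" by simp
  then have "card Z \<le> D + e * card {x \<in> Z. poly2 f x (cnj x) = 0}"
    using c1 f(5) by linarith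
  ultimately show ?thesis using f by blast
qed

section \<open>The curve on which two angle sums agree\<close>

definition evx :: "complex \<Rightarrow> complex poly poly \<Rightarrow> complex poly" where
  "evx x p = map_poly (\<lambda>c. poly c x) p"

lemma coeff_evx: "coeff (evx x p) i = poly (coeff p i) x"
  by (simp add: evx_def coeff_map_poly)

lemma evx_mult: "evx x (p * q) = evx x p * evx x q"
  by (rule poly_eqI) (simp add: coeff_evx coeff_mult poly_sum)

lemma evx_diff: "evx x (p - q) = evx x p - evx x q"
  and evx_smult: "evx x (smult c p) = smult (poly c x) (evx x p)"
  by (rule poly_eqI; simp add: coeff_evx)+

lemma evx_1: "evx x 1 = 1"
  by (rule poly_eqI) (simp add: coeff_evx coeff_1)

lemma evx_prod: "evx x (prod f S) = (\<Prod>s\<in>S. evx x (f s))"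
  by (induction S rule: infinite_finite_induct) (simp_all add: evx_1 evx_mult)

lemma evx_linear: "evx x [:c, d:] = [:poly c x, poly d x:]"
  by (rule poly_eqI) (auto simp: coeff_evx coeff_pCons split: nat.split)

lemma poly_evx: "poly (evx x p) y = poly2 p x y"
  unfolding poly2_def by (induction p) (simp_all add: evx_def map_poly_pCons mult.commute)

definition xpoly :: "complex set \<Rightarrow> complex poly" where
  "xpoly a = (\<Prod>z\<in>a. [:z, -1:])"

definition ypoly :: "complex set \<Rightarrow> complex poly poly" where
  "ypoly a = (\<Prod>z\<in>a. [:[:cnj z:], -1:])"

text \<open>At \<open>(x, cnj x)\<close> it vanishes exactly when the equation of
  \<open>Phi_eq_imp_prod_eq\<close> holds; here \<open>cnj x\<close> has become an independent
  variable.\<close>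

definition curve :: "complex set \<Rightarrow> complex set \<Rightarrow> complex poly poly" where
  "curve a b = smult (xpoly a) (ypoly b) - smult (xpoly b) (ypoly a)"

lemma poly_xpoly: "poly (xpoly a) x = (\<Prod>z\<in>a. z - x)"
  by (simp add: xpoly_def poly_prod)

lemma poly_ypoly: "poly (ypoly a) [:y:] = [:\<Prod>z\<in>a. cnj z - y:]"
proof -
  have "poly (ypoly a) [:y:] = (\<Prod>z\<in>a. [:cnj z - y:])" by (simp add: ypoly_def poly_prod)
  also have "\<dots> = [:\<Prod>z\<in>a. cnj z - y:]" by (induction a rule: infinite_finite_induct) (auto simp: one_pCons)
  finally show ?thesis .
qed

lemma poly2_curve:
  "poly2 (curve a b) x (cnj x) = (\<Prod>z\<in>a. z - x) * cnj (\<Prod>z\<in>b. z - x) - (\<Prod>z\<in>b. z - x) * cnj (\<Prod>z\<in>a. z - x)"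
  by (simp add: curve_def poly2_def poly_xpoly poly_ypoly)

lemma degree_prod_linear_le:
  fixes f :: "'a \<Rightarrow> 'b::{comm_semiring_1,semiring_no_zero_divisors} poly"
  assumes "\<And>s. s \<in> S \<Longrightarrow> degree (f s) \<le> 1"
  shows "degree (prod f S) \<le> card S"
  using assms
proof (induction S rule: infinite_finite_induct)
  case (insert x S)
  then have "degree (f x * prod f S) \<le> 1 + card S"
    by (intro order_trans[OF degree_mult_le] add_mono) auto
  then show ?case using insert.hyps by simp
qed auto

lemma curve_degrees:
  assumes "card a = l" "card b = l"
  shows "degree (curve a b) \<le> l" "xdeg_le (curve a b) l"
proof -
  have dx: "degree (xpoly c) \<le> card c" for c unfolding xpoly_def by (rule degree_prod_linear_le) simp
  have dy: "degree (ypoly c) \<le> card c" for c unfolding ypoly_def by (rule degree_prod_linear_le) simp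
  show "degree (curve a b) \<le> l"
    unfolding curve_def using dy[of a] dy[of b] assms
    by (intro degree_diff_le order_trans[OF degree_smult_le]) auto
  have x0: "xdeg_le [:[:c:], -1:] 0" for c :: complex
    by (auto simp: xdeg_le_def coeff_pCons split: nat.split)
  have xy: "xdeg_le (ypoly c) 0" for c
    unfolding ypoly_def
  proof (induction c rule: infinite_finite_induct)
    case (insert z c)
    then show ?case using xdeg_le_mult[OF x0 insert.IH] by simp
  qed (auto simp: xdeg_le_def coeff_1)
  have "xdeg_le (smult (xpoly a) (ypoly b)) (l + 0)" "xdeg_le (smult (xpoly b) (ypoly a)) (l + 0)"
    using dx[of a] dx[of b] assms by (intro xdeg_le_smult xy; simp)+
  then show "xdeg_le (curve a b) l" unfolding curve_def by (simp add: xdeg_le_diff)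
qed

lemma ex_diff_elem:
  assumes "finite a" "finite b" "card a = card b" "a \<noteq> b"
  shows "\<exists>z. z \<in> a - b"
proof (rule ccontr)
  assume "\<not> ?thesis"
  then have "a \<subseteq> b" by auto
  then show False using assms card_subset_eq by metis
qed

text \<open>\<open>\<phi>\<close> has none of the roots \<open>g z\<close> with
  \<open>z \<noteq> z1\<close>, so it is coprime to those linear factors and divides the single
  remaining one.\<close>

lemma linear_factor_degree:
  fixes \<phi> :: "complex poly" and g :: "'a \<Rightarrow> complex"
  assumes dvd: "\<phi> dvd smult c (\<Prod>z\<in>a. [:g z, -1:])" and c: "c \<noteq> 0" and a: "finite a" "z1 \<in> a"
    and nz: "\<And>z. z \<in> a \<Longrightarrow> z \<noteq> z1 \<Longrightarrow> poly \<phi> (g z) \<noteq> 0"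
  shows "degree \<phi> \<le> 1"
proof -
  define R where "R = (\<Prod>z\<in>a - {z1}. [:g z, -1:])"
  have "coprime \<phi> R"
    unfolding R_def
  proof (rule prod_coprime_right)
    fix z assume z: "z \<in> a - {z1}"
    have "\<not> [:g z, -1:] dvd \<phi>"
    proof
      assume "[:g z, -1:] dvd \<phi>"
      then obtain k where "\<phi> = [:g z, -1:] * k" by (auto elim: dvdE)
      then have "poly \<phi> (g z) = 0" by simp
      then show False using nz z by auto
    qed
    moreover have "prime_elem [:g z, -1:]"
      by (intro irreducible_imp_prime_elem irreducible_linear_field_poly) auto
    ultimately have "coprime [:g z, -1:] \<phi>" by (rule prime_elem_imp_coprime[rotated])
    then show "coprime \<phi> [:g z, -1:]" by (simp add: coprime_commute)
  qed
  moreover have "(\<Prod>z\<in>a. [:g z, -1:]) = [:g z1, -1:] * R"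
    unfolding R_def by (rule prod.remove[OF a])
  then have "\<phi> dvd smult c [:g z1, -1:] * R" using dvd by (simp only: mult_smult_left)
  ultimately have "\<phi> dvd smult c [:g z1, -1:]" using coprime_dvd_mult_left_iff by blast
  then have "degree \<phi> \<le> degree (smult c [:g z1, -1:])" using c by (intro dvd_imp_degree_le) auto
  also have "\<dots> \<le> 1" by (intro order_trans[OF degree_smult_le]) simp
  finally show ?thesis .
qed

text \<open>As \<open>z1\<close> lies in \<open>a\<close> but not in \<open>b\<close>, setting
  \<open>X = z1\<close> or \<open>Y = cnj z1\<close> kills one of the two terms of
  \<open>curve a b\<close> and leaves a constant times a product of linear factors. By
  \<open>nz\<close> the specialised \<open>f\<close> can share only the factor belonging to
  \<open>z1\<close>.\<close>

lemma curve_factor_degrees: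
  assumes dvd: "f dvd curve a b" and fin: "finite a" "finite b" and z1: "z1 \<in> a" "z1 \<notin> b"
    and nz: "\<And>z. z \<in> a \<Longrightarrow> z \<noteq> z1 \<Longrightarrow> poly2 f z1 (cnj z) \<noteq> 0 \<and> poly2 f z (cnj z1) \<noteq> 0"
  shows "degree (evx z1 f) \<le> 1" "degree (poly f [:cnj z1:]) \<le> 1"
proof -
  have xa: "poly (xpoly a) z1 = 0" using fin z1 by (auto simp: poly_xpoly)
  have xb: "poly (xpoly b) z1 \<noteq> 0" using fin z1 by (auto simp: poly_xpoly)
  have ey: "evx z1 (ypoly a) = (\<Prod>z\<in>a. [:cnj z, -1:])"
    by (simp add: ypoly_def evx_prod evx_linear)
  obtain k where k: "curve a b = f * k" using dvd by (auto elim: dvdE)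
  have "evx z1 (curve a b) = smult (- poly (xpoly b) z1) (\<Prod>z\<in>a. [:cnj z, -1:])"
    unfolding curve_def evx_diff evx_smult xa ey by simp
  then have "evx z1 f dvd smult (- poly (xpoly b) z1) (\<Prod>z\<in>a. [:cnj z, -1:])"
    unfolding k evx_mult by (metis dvd_triv_left)
  then show "degree (evx z1 f) \<le> 1"
    by (rule linear_factor_degree[where ?z1.0 = z1]) (use xb nz fin z1 in \<open>auto simp: poly_evx\<close>)
  define c where "c = (\<Prod>z\<in>b. cnj z - cnj z1)"
  have c: "c \<noteq> 0" using fin z1 by (auto simp: c_def)
  have "(\<Prod>z\<in>a. cnj z - cnj z1) = 0" using fin z1 by auto
  then have "poly (curve a b) [:cnj z1:] = smult c (\<Prod>z\<in>a. [:z, -1:])"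
    unfolding curve_def by (simp add: poly_ypoly c_def xpoly_def)
  then have "poly f [:cnj z1:] dvd smult c (\<Prod>z\<in>a. [:z, -1:])"
    unfolding k poly_mult by (metis dvd_triv_left)
  then show "degree (poly f [:cnj z1:]) \<le> 1"
    by (rule linear_factor_degree[where ?z1.0 = z1 and g = "\<lambda>z. z"]) (use c nz fin z1 in \<open>auto simp: poly2_def\<close>)
qed

lemma curve_nonzero:
  assumes "finite a" "finite b" "card a = card b" "a \<noteq> b"
  shows "curve a b \<noteq> 0"
proof
  assume 0: "curve a b = 0"
  obtain z1 where z1: "z1 \<in> a" "z1 \<notin> b" using ex_diff_elem[OF assms] by blast
  have xa: "poly (xpoly a) z1 = 0" using assms z1 by (auto simp: poly_xpoly)
  have xb: "poly (xpoly b) z1 \<noteq> 0" using assms z1 by (auto simp: poly_xpoly)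
  have "evx z1 (curve a b) = smult (- poly (xpoly b) z1) (\<Prod>z\<in>a. [:cnj z, -1:])"
    unfolding curve_def evx_diff evx_smult xa by (simp add: ypoly_def evx_prod evx_linear)
  moreover have "evx z1 (curve a b) = 0" unfolding 0 by (simp add: evx_def)
  ultimately have "(\<Prod>z\<in>a. [:cnj z, -1:]) = 0" using xb by simp
  then show False using assms(1) by (auto simp: prod_zero_iff)
qed

definition gencircle :: "complex set \<Rightarrow> bool" where
  "gencircle C \<longleftrightarrow> (\<exists>p e. norm e = 1 \<and> C = {z. cr e (z - p) = 0}) \<or> (\<exists>c \<rho>. \<rho> > 0 \<and> C = {z. norm (z - c) = \<rho>})"

text \<open>Completing the square; the two distinct points of \<open>Z\<close> exclude a circle of
  radius 0.\<close>

lemma real_form_gencircle: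
  fixes \<alpha> \<gamma> :: real and \<beta> :: complex
  assumes Z: "z0 \<in> Z" "z1 \<in> Z" "z0 \<noteq> z1" and form: "\<And>z. z \<in> Z \<Longrightarrow> \<alpha> * (norm z)\<^sup>2 + Re (\<beta> * z) + \<gamma> = 0"
    and nz: "\<alpha> \<noteq> 0 \<or> \<beta> \<noteq> 0 \<or> \<gamma> \<noteq> 0"
  shows "\<exists>C. gencircle C \<and> Z \<subseteq> C"
proof (cases "\<alpha> = 0")
  case True
  have b: "\<beta> \<noteq> 0" using nz form[OF Z(1)] True by auto
  define e where "e = \<i> * cnj \<beta> / of_real (norm \<beta>)"
  have "norm e = 1" using b by (simp add: e_def norm_mult norm_divide)
  moreover have "cr e (z - z0) = 0" if "z \<in> Z" for z
  proof -
    have "Re (\<beta> * (z - z0)) = 0" using form[OF that] form[OF Z(1)] True by (simp add: algebra_simps)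
    then show ?thesis by (simp add: e_def cr_def)
  qed
  ultimately show ?thesis by (intro exI[of _ "{z. cr e (z - z0) = 0}"]) (auto simp: gencircle_def)
next
  case False
  define c where "c = - cnj \<beta> / of_real (2 * \<alpha>)"
  have sq: "(norm (z - c))\<^sup>2 = (norm c)\<^sup>2 - \<gamma> / \<alpha>" if "z \<in> Z" for z
  proof -
    have "Re \<beta> = - 2 * \<alpha> * Re c" "Im \<beta> = 2 * \<alpha> * Im c" using False by (simp_all add: c_def Re_divide_of_real Im_divide_of_real)
    then have "\<alpha> * ((norm z)\<^sup>2 - 2 * (Re c * Re z + Im c * Im z)) = - \<gamma>"
      using form[OF that] by (simp add: algebra_simps)
    then have "(norm z)\<^sup>2 - 2 * (Re c * Re z + Im c * Im z) = - \<gamma> / \<alpha>" using False by (simp add: field_simps)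
    moreover have "(norm (z - c))\<^sup>2 = (norm z)\<^sup>2 - 2 * (Re c * Re z + Im c * Im z) + (norm c)\<^sup>2"
      unfolding cmod_power2 by (simp add: power2_eq_square algebra_simps)
    ultimately show ?thesis by simp
  qed
  have same: "norm (z - c) = norm (z0 - c)" if "z \<in> Z" for z
    using sq[OF that] sq[OF Z(1)] by (metis norm_ge_zero power2_eq_imp_eq)
  have "norm (z0 - c) > 0"
  proof (rule ccontr)
    assume "\<not> ?thesis"
    then have "z0 = c" "z1 = c" using same[OF Z(2)] by auto
    then show False using Z by simp
  qed
  then have "gencircle {z. norm (z - c) = norm (z0 - c)}" unfolding gencircle_def by blast
  then show ?thesis using same by blast
qed

text \<open>The real and the imaginary part of the equation are both of the form treated in
  \<open>real_form_gencircle\<close>, and not both are trivial.\<close>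

lemma bilinear_zeros_gencircle:
  assumes f: "f \<noteq> 0" "degree f \<le> 1" "xdeg_le f 1" and Z: "\<And>x. x \<in> Z \<Longrightarrow> poly2 f x (cnj x) = 0"
    "z0 \<in> Z" "z1 \<in> Z" "z0 \<noteq> z1"
  shows "\<exists>C. gencircle C \<and> Z \<subseteq> C"
proof -
  define p q where "p = coeff f 0" and "q = coeff f 1"
  define p0 p1 q0 q1 where "p0 = coeff p 0" and "p1 = coeff p 1" and "q0 = coeff q 0" and "q1 = coeff q 1"
  have lin: "r = [:coeff r 0, coeff r 1:]" if "degree r \<le> 1" for r :: "'a::zero poly"
  proof (rule poly_eqI)
    fix n
    show "coeff r n = coeff [:coeff r 0, coeff r 1:] n"
      using that by (cases n; cases "n - 1") (auto simp: coeff_pCons coeff_eq_0 split: nat.split)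
  qed
  have fe: "f = [:p, q:]" unfolding p_def q_def by (rule lin[OF f(2)])
  have "degree p \<le> 1" "degree q \<le> 1" using f(3) by (auto simp: p_def q_def xdeg_le_def)
  then have pe: "p = [:p0, p1:]" and qe: "q = [:q0, q1:]"
    unfolding p0_def p1_def q0_def q1_def using lin by blast+
  have eq: "p0 + p1 * x + (q0 + q1 * x) * cnj x = 0" if "x \<in> Z" for x
    using Z(1)[OF that] by (simp add: poly2_def fe pe qe algebra_simps)
  have re: "Re q1 * (norm x)\<^sup>2 + Re ((p1 + cnj q0) * x) + Re p0 = 0"
    and im: "Im q1 * (norm x)\<^sup>2 + Re ((- \<i> * (p1 - cnj q0)) * x) + Im p0 = 0" if "x \<in> Z" for x
  proof -
    have "Re (p0 + p1 * x + (q0 + q1 * x) * cnj x) = 0" "Im (p0 + p1 * x + (q0 + q1 * x) * cnj x) = 0"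
      using eq[OF that] by simp_all
    then show "Re q1 * (norm x)\<^sup>2 + Re ((p1 + cnj q0) * x) + Re p0 = 0"
      "Im q1 * (norm x)\<^sup>2 + Re ((- \<i> * (p1 - cnj q0)) * x) + Im p0 = 0"
      unfolding cmod_power2 by (simp_all add: algebra_simps power2_eq_square)
  qed
  show ?thesis
  proof (cases "Re q1 \<noteq> 0 \<or> p1 + cnj q0 \<noteq> 0 \<or> Re p0 \<noteq> 0")
    case True
    then show ?thesis using real_form_gencircle[OF Z(2-4) re] by blast
  next
    case False
    have "Im q1 \<noteq> 0 \<or> - \<i> * (p1 - cnj q0) \<noteq> 0 \<or> Im p0 \<noteq> 0"
    proof (rule ccontr)
      assume "\<not> ?thesis"
      then have "q1 = 0" "p0 = 0" "p1 = cnj q0" "p1 = - cnj q0" using False by (auto simp: complex_eq_iff eq_neg_iff_add_eq_0)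
      then have "p1 = 0" "q0 = 0" by (auto simp: complex_eq_iff)
      then have "f = 0" using \<open>q1 = 0\<close> \<open>p0 = 0\<close> by (simp add: fe pe qe)
      then show False using f(1) by simp
    qed
    then show ?thesis using real_form_gencircle[OF Z(2-4) im] by blast
  qed
qed

text \<open>By double counting, some vertex of the directed relation \<open>R\<close> also has at
  most \<open>e\<close> incoming edges. It is kept, its at most \<open>2 * e\<close> neighbours are
  removed, and the rest is treated in the same way.\<close>

lemma independent_subset:
  assumes "finite V" "\<And>v. v \<in> V \<Longrightarrow> card {w \<in> V. w \<noteq> v \<and> R v w} \<le> e"
  shows "\<exists>I\<subseteq>V. (\<forall>v\<in>I. \<forall>w\<in>I. v \<noteq> w \<longrightarrow> \<not> R v w) \<and> card V \<le> (2 * e + 1) * card I"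
  using assms
proof (induction "card V" arbitrary: V rule: less_induct)
  case less
  show ?case
  proof (cases "V = {}")
    case True
    then show ?thesis by (intro exI[of _ "{}"]) auto
  next
    case False
    have "\<exists>v\<in>V. card {w \<in> V. w \<noteq> v \<and> R w v} \<le> e"
    proof (rule ccontr)
      assume "\<not> ?thesis"
      then have "(\<Sum>v\<in>V. e) < (\<Sum>v\<in>V. card {w \<in> V. w \<noteq> v \<and> R w v})"
        using less.prems(1) False by (intro sum_strict_mono) (auto simp: not_le)
      also have "\<dots> = (\<Sum>v\<in>V. \<Sum>w\<in>V. of_bool (w \<noteq> v \<and> R w v))"
        using less.prems(1) by (simp add: Int_def)
      also have "\<dots> = (\<Sum>w\<in>V. \<Sum>v\<in>V. of_bool (w \<noteq> v \<and> R w v))" by (rule sum.swap)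
      also have "\<dots> = (\<Sum>w\<in>V. card {v \<in> V. v \<noteq> w \<and> R w v})"
        using less.prems(1) by (simp add: Int_def eq_commute)
      also have "\<dots> \<le> (\<Sum>w\<in>V. e)" using less.prems(2) by (intro sum_mono)
      finally show False by simp
    qed
    then obtain v where v: "v \<in> V" "card {w \<in> V. w \<noteq> v \<and> R w v} \<le> e" by blast
    define W where "W = {w \<in> V. w \<noteq> v \<and> R v w} \<union> {w \<in> V. w \<noteq> v \<and> R w v}"
    have cW: "card W \<le> 2 * e"
      unfolding W_def using card_Un_le[of "{w \<in> V. w \<noteq> v \<and> R v w}" "{w \<in> V. w \<noteq> v \<and> R w v}"] v less.prems(2)[OF v(1)] by linarith
    define V' where "V' = V - insert v W"
    have V': "V' \<subseteq> V" "v \<notin> V'" "finite V'" using less.prems(1) by (auto simp: V'_def)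
    have "card V' < card V" using V' v(1) less.prems(1) by (intro psubset_card_mono) auto
    moreover have "card {w \<in> V'. w \<noteq> u \<and> R u w} \<le> e" if "u \<in> V'" for u
    proof -
      have "card {w \<in> V'. w \<noteq> u \<and> R u w} \<le> card {w \<in> V. w \<noteq> u \<and> R u w}"
        using V' less.prems(1) by (intro card_mono) auto
      then show ?thesis using less.prems(2)[of u] V' that by fastforce
    qed
    ultimately obtain I where I: "I \<subseteq> V'" "\<forall>v\<in>I. \<forall>w\<in>I. v \<noteq> w \<longrightarrow> \<not> R v w" "card V' \<le> (2 * e + 1) * card I"
      using less.hyps[OF _ V'(3)] by blast
    have fI: "finite I" "v \<notin> I" using I V' finite_subset by auto
    have "card V \<le> card (V' \<union> insert v W)" using less.prems(1) by (intro card_mono) (auto simp: V'_def W_def)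
    also have "\<dots> \<le> card V' + card (insert v W)" by (rule card_Un_le)
    also have "card (insert v W) \<le> Suc (card W)" using less.prems(1) by (simp add: card_insert_if W_def)
    finally have "card V \<le> (2 * e + 1) * card I + (2 * e + 1)" using I(3) cW by linarith
    also have "\<dots> = (2 * e + 1) * card (insert v I)" using fI by simp
    finally have "card V \<le> (2 * e + 1) * card (insert v I)" .
    moreover have "\<forall>x\<in>insert v I. \<forall>w\<in>insert v I. x \<noteq> w \<longrightarrow> \<not> R x w"
      using I(1,2) by (auto simp: V'_def W_def)
    moreover have "insert v I \<subseteq> V" using I(1) V'(1) v(1) by auto
    ultimately show ?thesis by blast
  qed
qed

definition many_directions :: "complex set \<Rightarrow> complex \<Rightarrow> real \<Rightarrow> real \<Rightarrow> bool" where
  "many_directions P x \<delta> q \<longleftrightarrow> (\<exists>\<Theta>\<subseteq>dirs P x. q \<le> card \<Theta> \<and> (\<forall>\<theta>\<in>\<Theta>. \<forall>\<theta>'\<in>\<Theta>. \<theta> \<noteq> \<theta>' \<longrightarrow> \<delta> < \<bar>\<theta> - \<theta>'\<bar>))"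

text \<open>A first application of \<open>thue_step\<close> produces an irreducible curve \<open>f\<close> through many pins. In a second
  one the tuples are chosen so that \<open>f(z, cnj w) \<noteq> 0\<close> for distinct \<open>z\<close>, \<open>w\<close> of the tuple; since \<open>f\<close> divides the
  new curve, specialising one variable to a point of the tuple shows that \<open>f\<close> is linear in the other one.\<close>

lemma many_pins_on_gencircle:
  fixes l d N :: nat and H q :: real and P X B :: "complex set"
  assumes N: "common_zeros_le l l N" and P: "finite P" "X \<subseteq> P" "B \<subseteq> P" and d: "d \<ge> 1" and l: "l \<ge> 1"
    and near: "\<forall>x\<in>X. x \<noteq> z0 \<and> (\<forall>z\<in>B. norm ((z - z0) / (z0 - x)) \<le> \<rho> \<and> \<bar>Im ((z - z0) / (z0 - x))\<bar> \<le> \<sigma>)"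
    and \<rho>: "0 \<le> \<rho>" "\<rho> \<le> 1/2" and \<sigma>: "0 \<le> \<sigma>" and \<delta>: "4 ^ d * (4 * real l * \<rho> ^ (d - 1) * \<sigma>) \<le> \<delta>"
    and H: "\<forall>x\<in>X. card (nsum l (dirs P x)) \<le> H \<and> card (nsum (Suc l) (dirs P x)) \<le> H" "1 \<le> H"
    and sep: "\<forall>x\<in>X. many_directions P x \<delta> q" and q: "q > 0"
    and count: "\<forall>i. card B \<le> (2 * l + 1) * i + 2 * l \<longrightarrow> H ^ (2 * d) * (2 * H / q) < real (i choose l)"
    and big: "real N < ((card X * q / (2 * H) - l) / l) * q / (2 * H)" "real l < card X * q / (2 * H)" "2 \<le> (card X * q / (2 * H) - l) / l"
  shows "\<exists>C. gencircle C \<and> (card X * q / (2 * H) - l) / l \<le> card (X \<inter> C)"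
proof -
  define M where "M = (card X * q / (2 * H) - l) / l"
  have step: "\<exists>a\<subseteq>I. \<exists>b\<subseteq>I. card a = l \<and> card b = l \<and> a \<noteq> b \<and> card Y * q \<le> 2 * H * card {x \<in> Y. Phi z0 a x = Phi z0 b x}"
    if Y: "Y \<subseteq> X" "Y \<noteq> {}" and I: "I \<subseteq> B" "card B \<le> (2 * l + 1) * card I + 2 * l" for Y I
  proof -
    have sub: "Y \<subseteq> P" "I \<subseteq> P" using P Y I by auto
    have n: "x \<noteq> z0" "norm ((z - z0) / (z0 - x)) \<le> \<rho>" "\<bar>Im ((z - z0) / (z0 - x))\<bar> \<le> \<sigma>"
      if "x \<in> Y" "z \<in> I" for x z using near that Y(1) I(1) by auto
    have n0: "x \<noteq> z0" if "x \<in> Y" for x using near that Y(1) by auto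
    have h: "card (nsum l (dirs P x)) \<le> H" "card (nsum (Suc l) (dirs P x)) \<le> H" if "x \<in> Y" for x
      using H(1) that Y(1) by auto
    have s: "\<exists>\<Theta>\<subseteq>dirs P x. q \<le> card \<Theta> \<and> (\<forall>\<theta>\<in>\<Theta>. \<forall>\<theta>'\<in>\<Theta>. \<theta> \<noteq> \<theta>' \<longrightarrow> \<delta> < \<bar>\<theta> - \<theta>'\<bar>)" if "x \<in> Y" for x
      using sep that Y(1) unfolding many_directions_def by auto
    have \<delta>': "4 ^ d * (real (4 * l) * \<rho> ^ (d - 1) * \<sigma>) \<le> \<delta>" using \<delta> by simp
    have c: "H ^ (2 * d) * (2 * H / q) < real (card I choose l)" using count I(2) by auto
    show ?thesis by (rule thue_step[OF P(1) sub Y(2) d n0 n(2,3) \<rho> \<sigma> \<delta>' h H(2) s q c])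
  qed
  have vanish: "poly2 (curve a b) x (cnj x) = 0" if "a \<subseteq> B" "b \<subseteq> B" "x \<in> X" "Phi z0 a x = Phi z0 b x" for a b x
  proof -
    have "z0 \<noteq> x" using near that(3) by auto
    moreover have "norm ((z - z0) / (z0 - x)) \<le> 1/2" if "z \<in> a \<union> b" for z
      using near \<open>x \<in> X\<close> \<open>a \<subseteq> B\<close> \<open>b \<subseteq> B\<close> that \<rho> by (meson UnE order_trans subsetD)
    ultimately show ?thesis using Phi_eq_imp_prod_eq[of z0 x a b] that(4) unfolding poly2_curve by simp
  qed
  have fin: "finite X" "finite B" using P finite_subset by auto
  have "card X * q / (2 * H) > 0" using big(2) by linarith
  then have X0: "X \<noteq> {}" by auto
  obtain a b where ab: "a \<subseteq> B" "b \<subseteq> B" "card a = l" "card b = l" "a \<noteq> b"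
      "card X * q \<le> 2 * H * card {x \<in> X. Phi z0 a x = Phi z0 b x}"
    using step[OF order_refl X0 order_refl] by auto
  define Z where "Z = {x \<in> X. Phi z0 a x = Phi z0 b x}"
  have fab: "finite a" "finite b" using ab fin finite_subset by blast+
  have cZ: "card X * q / (2 * H) \<le> card Z" using ab(6) H(2) by (simp add: Z_def divide_le_eq mult_ac)
  obtain f where f: "prime_elem f" "content f = 1" "1 \<le> degree f" "degree f \<le> l" "xdeg_le f l"
      "card Z \<le> l + l * card {x \<in> Z. poly2 f x (cnj x) = 0}"
  proof -
    have "finite Z" "l < card Z" using fin cZ big(2) by (auto simp: Z_def)
    moreover have "poly2 (curve a b) x (cnj x) = 0" if "x \<in> Z" for x using vanish[OF ab(1,2)] that by (simp add: Z_def)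
    moreover have "curve a b \<noteq> 0" using ab(3-5) fab by (intro curve_nonzero) auto
    ultimately show thesis using popular_prime_factor[of "curve a b" l l Z] curve_degrees[OF ab(3,4)] that by blast
  qed
  define X2 where "X2 = {x \<in> X. poly2 f x (cnj x) = 0}"
  have "card {x \<in> Z. poly2 f x (cnj x) = 0} \<le> card X2" using fin by (intro card_mono) (auto simp: X2_def Z_def)
  then have "card Z \<le> l + l * card X2" using f(6) by (elim order_trans) (simp add: mult_le_mono2)
  then have "real (card Z) \<le> real (l + l * card X2)" by (rule of_nat_mono)
  then have "card X * q / (2 * H) - l \<le> l * real (card X2)" using cZ by simp
  then have cX2: "M \<le> card X2" using l unfolding M_def by (simp add: divide_le_eq mult.commute)
  have f0: "f \<noteq> 0" using f(1) by auto
  obtain D i where D: "xdeg_le f D" "coeff f i \<noteq> 0" "degree (coeff f i) = D" using xdeg_max[OF f0] by metis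
  \<comment> \<open>The counterpart of \<open>lead_coeff f\<close> for the other variable: the
    leading coefficient of \<open>f\<close> read as a polynomial in \<open>X\<close>.\<close>
  define top where "top = map_poly (\<lambda>c. coeff c D) f"
  have ctop: "coeff top j = coeff (coeff f j) D" for j by (simp add: top_def coeff_map_poly)
  have "coeff top i \<noteq> 0" using D(2,3) unfolding ctop by auto
  then have top0: "top \<noteq> 0" by auto
  have dtop: "degree top \<le> l" using f(4) by (intro degree_le) (auto simp: ctop coeff_eq_0)
  have topD: "coeff (poly f [:y:]) D = poly top y" for y
    unfolding top_def by (induction f) (simp_all add: map_poly_pCons coeff_pCons split: nat.split)
  \<comment> \<open>Away from the at most \<open>2 * l\<close> points where a leading coefficient
    vanishes, specialising one variable does not lower the degree in the other. This is the
    \<open>2 * l\<close> in the hypothesis \<open>count\<close>.\<close>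
  define B' where "B' = {u \<in> B. poly (lead_coeff f) u \<noteq> 0 \<and> poly top (cnj u) \<noteq> 0}"
  have "card {u \<in> B. poly (lead_coeff f) u = 0} \<le> l"
  proof -
    have "card {u \<in> B. poly (lead_coeff f) u = 0} \<le> degree (lead_coeff f)" using f0 by (intro card_roots_le) auto
    also have "\<dots> \<le> l" using f(5) by (simp add: xdeg_le_def)
    finally show ?thesis .
  qed
  moreover have "card {u \<in> B. poly top (cnj u) = 0} \<le> l"
  proof -
    have "card (cnj ` {u \<in> B. poly top (cnj u) = 0}) \<le> degree top" using top0 by (intro card_roots_le) auto
    then show ?thesis using dtop by (subst (asm) card_image) (auto simp: inj_on_def)
  qed
  moreover have "card B \<le> card B' + (card {u \<in> B. poly (lead_coeff f) u = 0} + card {u \<in> B. poly top (cnj u) = 0})"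
  proof -
    have "B = B' \<union> ({u \<in> B. poly (lead_coeff f) u = 0} \<union> {u \<in> B. poly top (cnj u) = 0})" by (auto simp: B'_def)
    then have "card B \<le> card B' + card ({u \<in> B. poly (lead_coeff f) u = 0} \<union> {u \<in> B. poly top (cnj u) = 0})" by (metis card_Un_le)
    then show ?thesis using card_Un_le[of "{u \<in> B. poly (lead_coeff f) u = 0}" "{u \<in> B. poly top (cnj u) = 0}"] by linarith
  qed
  ultimately have cB': "card B \<le> card B' + 2 * l" by linarith
  have fB': "finite B'" using fin by (simp add: B'_def)
  have devx: "degree (evx u f) = degree f" if "u \<in> B'" for u
  proof (rule antisym)
    show "degree (evx u f) \<le> degree f" by (rule degree_le) (simp add: coeff_evx coeff_eq_0)
    show "degree f \<le> degree (evx u f)" using that by (intro le_degree) (simp add: coeff_evx B'_def)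
  qed
  have outdeg: "card {w \<in> B'. w \<noteq> u \<and> poly2 f u (cnj w) = 0} \<le> l" if u: "u \<in> B'" for u
  proof -
    have e0: "evx u f \<noteq> 0" using devx[OF u] f(3) by auto
    have "card (cnj ` {w \<in> B'. w \<noteq> u \<and> poly2 f u (cnj w) = 0}) \<le> degree (evx u f)"
      using e0 by (intro card_roots_le) (auto simp: poly_evx)
    then show ?thesis using devx[OF u] f(4) by (subst (asm) card_image) (auto simp: inj_on_def)
  qed
  \<comment> \<open>Each \<open>u\<close> has at most \<open>l\<close> partners \<open>w\<close> at
    which \<open>f\<close> vanishes, so a share \<open>1 / (2 * l + 1)\<close> of the points is free
    of such pairs.\<close>
  obtain I where I: "I \<subseteq> B'" "\<forall>v\<in>I. \<forall>w\<in>I. v \<noteq> w \<longrightarrow> poly2 f v (cnj w) \<noteq> 0" "card B' \<le> (2 * l + 1) * card I"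
    using independent_subset[OF fB' outdeg] by blast
  have IB: "I \<subseteq> B" "card B \<le> (2 * l + 1) * card I + 2 * l" using I cB' by (auto simp: B'_def)
  have "2 \<le> real (card X2)" using cX2 big(3) by (simp only: M_def)
  then have "X2 \<noteq> {}" by auto
  moreover have "X2 \<subseteq> X" by (auto simp: X2_def)
  ultimately have X2: "X2 \<subseteq> X" "X2 \<noteq> {}" by blast+
  obtain a b where ab: "a \<subseteq> I" "b \<subseteq> I" "card a = l" "card b = l" "a \<noteq> b"
      "card X2 * q \<le> 2 * H * card {x \<in> X2. Phi z0 a x = Phi z0 b x}"
    using step[OF X2 IB] by blast
  have abB: "a \<subseteq> B" "b \<subseteq> B" using ab(1,2) IB(1) by auto
  have fab: "finite a" "finite b" using finite_subset[OF abB(1) fin(2)] finite_subset[OF abB(2) fin(2)] .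
  \<comment> \<open>Otherwise weak Bezout would allow at most \<open>N\<close> pins of
    \<open>X2\<close> at which the second pair of tuples agrees.\<close>
  have dvd: "f dvd curve a b"
  proof (rule ccontr)
    assume "\<not> f dvd curve a b"
    moreover have "\<forall>x\<in>{x \<in> X2. Phi z0 a x = Phi z0 b x}. poly2 f x (cnj x) = 0 \<and> poly2 (curve a b) x (cnj x) = 0"
      using vanish[OF abB] by (simp add: X2_def)
    moreover have "finite {x \<in> X2. Phi z0 a x = Phi z0 b x}" using fin by (simp add: X2_def)
    ultimately have "card {x \<in> X2. Phi z0 a x = Phi z0 b x} \<le> N"
      using common_zeros_leD[OF N f(1,3,4,5) curve_degrees(2)[OF ab(3,4)] curve_degrees(1)[OF ab(3,4)]] by blast
    then have "2 * H * card {x \<in> X2. Phi z0 a x = Phi z0 b x} \<le> 2 * H * N" using H(2) by (intro mult_left_mono) auto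
    then have "card X2 * q \<le> 2 * H * N" using ab(6) by linarith
    moreover have "M * q \<le> card X2 * q" using cX2 q by (intro mult_right_mono) auto
    ultimately have "M * q \<le> 2 * H * N" by linarith
    then have "M * q / (2 * H) \<le> N" using H(2) by (simp add: divide_le_eq mult_ac)
    then show False using big(1) by (simp add: M_def)
  qed
  obtain u where u: "u \<in> a" "u \<notin> b" using ex_diff_elem[OF fab _ ab(5)] ab(3,4) by auto
  have uB': "u \<in> B'" using u ab(1) I(1) by auto
  have deg: "degree (evx u f) \<le> 1" "degree (poly f [:cnj u:]) \<le> 1"
  proof -
    have nz: "poly2 f u (cnj z) \<noteq> 0 \<and> poly2 f z (cnj u) \<noteq> 0" if "z \<in> a" "z \<noteq> u" for z
      using I(2) ab(1) u(1) that by (simp add: subset_iff)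
    show "degree (evx u f) \<le> 1" by (rule curve_factor_degrees(1)[OF dvd fab u nz])
    show "degree (poly f [:cnj u:]) \<le> 1" by (rule curve_factor_degrees(2)[OF dvd fab u nz])
  qed
  have "D \<le> 1"
  proof -
    have "coeff (poly f [:cnj u:]) D \<noteq> 0" using uB' unfolding topD by (simp add: B'_def)
    then have "D \<le> degree (poly f [:cnj u:])" by (rule le_degree)
    then show ?thesis using deg(2) by linarith
  qed
  then have xf: "xdeg_le f 1" using D(1) xdeg_le_mono by blast
  have df: "degree f \<le> 1" using deg(1) devx[OF uB'] by simp
  have "2 \<le> card X2" using \<open>2 \<le> real (card X2)\<close> by simp
  then have "\<not> card X2 \<le> Suc 0" by simp
  then obtain z1 z2 where z: "z1 \<in> X2" "z2 \<in> X2" "z1 \<noteq> z2"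
    using card_le_Suc0_iff_eq[OF finite_subset[OF X2(1) fin(1)]] by blast
  have "\<exists>C. gencircle C \<and> X2 \<subseteq> C"
    by (rule bilinear_zeros_gencircle[OF f0 df xf _ z]) (auto simp: X2_def)
  then obtain C where C: "gencircle C" "X2 \<subseteq> C" by blast
  have "card X2 \<le> card (X \<inter> C)" using fin C X2 by (intro card_mono) auto
  then have "M \<le> card (X \<inter> C)" using cX2 by linarith
  then show ?thesis using C unfolding M_def by blast
qed

section \<open>Thin strips\<close>

lemma maximal_unrelated_subset:
  assumes "finite A"
  shows "\<exists>F\<subseteq>A. (\<forall>p\<in>F. \<forall>q\<in>F. p \<noteq> q \<longrightarrow> \<not> R p q) \<and> (\<forall>a\<in>A. a \<in> F \<or> (\<exists>f\<in>F. R a f \<or> R f a))"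
proof -
  define \<F> where "\<F> = {F. F \<subseteq> A \<and> (\<forall>p\<in>F. \<forall>q\<in>F. p \<noteq> q \<longrightarrow> \<not> R p q)}"
  have "finite \<F>" using assms by (auto simp: \<F>_def)
  moreover have "{} \<in> \<F>" by (auto simp: \<F>_def)
  ultimately obtain F where F: "F \<in> \<F>" and max: "\<And>G. G \<in> \<F> \<Longrightarrow> F \<subseteq> G \<Longrightarrow> F = G"
    using finite_has_maximal[of \<F>] by blast
  have "a \<in> F \<or> (\<exists>f\<in>F. R a f \<or> R f a)" if a: "a \<in> A" for a
  proof (rule ccontr)
    assume *: "\<not> ?thesis"
    then have "insert a F \<in> \<F>" using F a by (auto simp: \<F>_def)
    then show False using max[of "insert a F"] * by auto
  qed
  then show ?thesis using F by (auto simp: \<F>_def)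
qed

text \<open>A point is coloured by a member, within \<open>\<delta>\<close> of its direction, of a
  maximal \<open>\<delta>\<close>-separated set of directions; equal colours then mean directions
  within \<open>2 * \<delta>\<close>.\<close>

lemma few_directions_colouring:
  assumes P: "finite P" and \<delta>: "\<delta> \<ge> 0" and few: "\<not> many_directions P x \<delta> q"
  shows "\<exists>c::complex \<Rightarrow> real. real (card (c ` (P - {x}))) < q \<and>
    (\<forall>z\<in>P - {x}. \<forall>w\<in>P - {x}. c z = c w \<longrightarrow> \<bar>cr (z - x) (w - x)\<bar> \<le> 2 * \<delta> * norm (z - x) * norm (w - x))"
proof -
  obtain \<Theta> where \<Theta>: "\<Theta> \<subseteq> dirs P x" "\<forall>p\<in>\<Theta>. \<forall>q\<in>\<Theta>. p \<noteq> q \<longrightarrow> \<not> \<bar>p - q\<bar> \<le> \<delta>"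
    "\<forall>a\<in>dirs P x. a \<in> \<Theta> \<or> (\<exists>f\<in>\<Theta>. \<bar>a - f\<bar> \<le> \<delta> \<or> \<bar>f - a\<bar> \<le> \<delta>)"
    using maximal_unrelated_subset[OF card_dirs_diff(2)[OF P], of x "\<lambda>p q. \<bar>p - q\<bar> \<le> \<delta>"] by blast
  have fin: "finite \<Theta>" using \<Theta>(1) card_dirs_diff(2)[OF P] finite_subset by blast
  have cq: "real (card \<Theta>) < q"
    using few \<Theta>(1,2) unfolding many_directions_def by (meson not_le)
  have "\<forall>z\<in>P - {x}. \<exists>\<theta>\<in>\<Theta>. \<bar>Arg (z - x) - \<theta>\<bar> \<le> \<delta>"
  proof
    fix z assume "z \<in> P - {x}"
    then have "Arg (z - x) \<in> dirs P x" by (intro Arg_in_dirs) auto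
    then have "Arg (z - x) \<in> \<Theta> \<or> (\<exists>f\<in>\<Theta>. \<bar>Arg (z - x) - f\<bar> \<le> \<delta> \<or> \<bar>f - Arg (z - x)\<bar> \<le> \<delta>)" using \<Theta>(3) by blast
    then show "\<exists>\<theta>\<in>\<Theta>. \<bar>Arg (z - x) - \<theta>\<bar> \<le> \<delta>"
    proof
      assume "Arg (z - x) \<in> \<Theta>"
      then show ?thesis using \<delta> by (intro bexI[of _ "Arg (z - x)"]) auto
    next
      assume "\<exists>f\<in>\<Theta>. \<bar>Arg (z - x) - f\<bar> \<le> \<delta> \<or> \<bar>f - Arg (z - x)\<bar> \<le> \<delta>"
      then show ?thesis by (metis abs_minus_commute)
    qed
  qed
  then obtain c where c: "\<And>z. z \<in> P - {x} \<Longrightarrow> c z \<in> \<Theta> \<and> \<bar>Arg (z - x) - c z\<bar> \<le> \<delta>" by metis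
  have "card (c ` (P - {x})) \<le> card \<Theta>" using c fin by (intro card_mono) auto
  moreover have "\<bar>cr (z - x) (w - x)\<bar> \<le> 2 * \<delta> * norm (z - x) * norm (w - x)"
    if zw: "z \<in> P - {x}" "w \<in> P - {x}" "c z = c w" for z w
  proof -
    define \<phi> \<psi> where "\<phi> = Arg (z - x)" and "\<psi> = Arg (w - x)"
    have pol: "z - x = of_real (norm (z - x)) * cis \<phi>" "w - x = of_real (norm (w - x)) * cis \<psi>"
      unfolding \<phi>_def \<psi>_def by (metis rcis_cmod_Arg rcis_def)+
    have "cr (z - x) (w - x) = norm (z - x) * (norm (w - x) * cr (cis \<phi>) (cis \<psi>))"
      by (metis pol cr_scale_left cr_scale_right)
    also have "cr (cis \<phi>) (cis \<psi>) = sin (\<psi> - \<phi>)" by (simp add: cr_eq sin_diff)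
    finally have "\<bar>cr (z - x) (w - x)\<bar> = norm (z - x) * (norm (w - x) * \<bar>sin (\<psi> - \<phi>)\<bar>)" by (simp add: abs_mult)
    also have "\<dots> \<le> norm (z - x) * (norm (w - x) * (2 * \<delta>))"
    proof (intro mult_left_mono)
      have "\<bar>\<psi> - \<phi>\<bar> \<le> 2 * \<delta>" using c[OF zw(1), THEN conjunct2] c[OF zw(2), THEN conjunct2] zw(3) unfolding \<phi>_def \<psi>_def by linarith
      then show "\<bar>sin (\<psi> - \<phi>)\<bar> \<le> 2 * \<delta>" using abs_sin_x_le_abs_x[of "\<psi> - \<phi>"] by linarith
    qed auto
    finally show ?thesis by (simp add: mult_ac)
  qed
  ultimately show ?thesis using cq by (intro exI[of _ c]) auto
qed

text \<open>A pair of far points spans a line transversal to the strip, so at most one of the separated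
  points in the strip can see the pair under a small angle.\<close>

lemma pins_in_strip_absorb:
  fixes q b :: nat
  assumes S: "finite S" and Y: "finite Y" "y0 \<in> Y" and r: "r > 0" and \<delta>: "\<delta> \<ge> 0" and w: "w \<ge> 0" and e: "norm e = 1"
    and sep: "\<And>p p'. p \<in> Y \<Longrightarrow> p' \<in> Y \<Longrightarrow> p \<noteq> p' \<Longrightarrow> r \<le> norm (p - p')"
    and strip: "\<And>p p'. p \<in> Y \<Longrightarrow> p' \<in> Y \<Longrightarrow> \<bar>cr e (p - p')\<bar> \<le> w"
    and diam: "\<And>p s. p \<in> Y \<Longrightarrow> s \<in> S \<Longrightarrow> norm (s - p) \<le> D" and D: "r \<le> D"
    and col: "\<And>y. y \<in> Y \<Longrightarrow> \<exists>c::complex \<Rightarrow> real. card (c ` (S - {y})) \<le> q \<and>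
      (\<forall>z\<in>S - {y}. \<forall>v\<in>S - {y}. c z = c v \<longrightarrow> \<bar>cr (z - y) (v - y)\<bar> \<le> \<delta> * norm (z - y) * norm (v - y))"
    and big: "2 * q < card Y" and balls: "\<And>s. s \<in> S \<Longrightarrow> card {t \<in> S. norm (t - s) < r} \<le> b"
  shows "card {s \<in> S. \<bar>cr e (s - y0)\<bar> > 3 * \<delta> * D ^ 3 / r\<^sup>2 + w * D / r + w} \<le> 2 * q * b"
proof -
  define Fr where "Fr = {s \<in> S. \<bar>cr e (s - y0)\<bar> > 3 * \<delta> * D ^ 3 / r\<^sup>2 + w * D / r + w}"
  have fFr: "finite Fr" using S by (simp add: Fr_def)
  have offset: "\<bar>cr e (s - y)\<bar> > 3 * \<delta> * D ^ 3 / r\<^sup>2 + w * D / r" if "s \<in> Fr" "y \<in> Y" for s y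
  proof -
    have "cr e (s - y0) = cr e (s - y) + cr e (y - y0)" by (simp add: cr_diff_right)
    then show ?thesis using strip[OF that(2) Y(2)] that(1) unfolding Fr_def by auto
  qed
  have D0: "D > 0" using r D by linarith
  have notY: "s \<noteq> y" if "s \<in> Fr" "y \<in> Y" for s y
  proof
    assume "s = y"
    then have "3 * \<delta> * D ^ 3 / r\<^sup>2 + w * D / r < 0" using offset[OF that] by simp
    moreover have "0 \<le> 3 * \<delta> * D ^ 3 / r\<^sup>2" "0 \<le> w * D / r" using \<delta> w r D0 by auto
    ultimately show False by linarith
  qed
  \<comment> \<open>If \<open>s\<close> and \<open>s'\<close> were seen almost aligned from both
    \<open>y\<close> and \<open>y'\<close>, their line would be close to that of \<open>y\<close>
    and \<open>y'\<close>, hence along the strip and close to it, against the large offset of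
    \<open>s\<close>.\<close>
  have unique: "y = y'"
    if s: "s \<in> Fr" "s' \<in> Fr" "r \<le> norm (s' - s)" and y: "y \<in> Y" "y' \<in> Y"
      and c: "\<bar>cr (s - y) (s' - y)\<bar> \<le> \<delta> * norm (s - y) * norm (s' - y)" "\<bar>cr (s - y') (s' - y')\<bar> \<le> \<delta> * norm (s - y') * norm (s' - y')"
    for s s' y y'
  proof (rule ccontr)
    assume "y \<noteq> y'"
    define h where "h = s' - s"
    have h: "r \<le> norm h" "norm h > 0" using s(3) r by (auto simp: h_def)
    have sS: "s \<in> S" "s' \<in> S" using s by (auto simp: Fr_def)
    have cD: "\<bar>cr h (p - s)\<bar> \<le> \<delta> * D\<^sup>2" if "p \<in> Y" "\<bar>cr (s - p) (s' - p)\<bar> \<le> \<delta> * norm (s - p) * norm (s' - p)" for p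
    proof -
      have "cr h (p - s) = cr (s - p) (s' - p)" by (simp add: h_def cr_eq algebra_simps)
      also have "\<bar>\<dots>\<bar> \<le> \<delta> * norm (s - p) * norm (s' - p)" by (rule that(2))
      also have "\<dots> \<le> \<delta> * D * D" using diam[OF that(1) sS(1)] diam[OF that(1) sS(2)] \<delta> D0 by (intro mult_mono) auto
      finally show ?thesis by (simp add: power2_eq_square mult.assoc)
    qed
    have c1: "\<bar>cr h (y - s)\<bar> \<le> \<delta> * D\<^sup>2" and c2: "\<bar>cr h (y' - s)\<bar> \<le> \<delta> * D\<^sup>2" using cD y c by auto
    have yy: "r \<le> norm (y - y')" using sep y \<open>y \<noteq> y'\<close> by auto
    have "norm (y - y') * \<bar>cr h e\<bar> \<le> \<bar>cr h (y - y')\<bar> * norm e + norm h * \<bar>cr (y - y') e\<bar>" by (rule norm_mult_abs_cr_le)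
    also have "\<dots> \<le> 2 * (\<delta> * D\<^sup>2) + norm h * w"
    proof (intro add_mono mult_left_mono)
      have "cr h (y - y') = cr h (y - s) - cr h (y' - s)" by (simp add: cr_diff_right)
      then show "\<bar>cr h (y - y')\<bar> * norm e \<le> 2 * (\<delta> * D\<^sup>2)" using c1 c2 e by simp
      show "\<bar>cr (y - y') e\<bar> \<le> w" using strip[OF y] by (metis cr_commute abs_minus_cancel)
    qed simp
    finally have "r * \<bar>cr h e\<bar> \<le> 2 * (\<delta> * D\<^sup>2) + norm h * w"
      using yy by (meson abs_ge_zero mult_right_mono order_trans)
    then have he: "\<bar>cr e h\<bar> \<le> (2 * (\<delta> * D\<^sup>2) + norm h * w) / r"
      using r by (simp add: pos_le_divide_eq mult.commute) (metis cr_commute abs_minus_cancel mult.commute)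
    have "norm h * \<bar>cr e (y - s)\<bar> \<le> \<bar>cr e h\<bar> * norm (y - s) + norm e * \<bar>cr h (y - s)\<bar>" by (rule norm_mult_abs_cr_le)
    also have "\<dots> \<le> (2 * (\<delta> * D\<^sup>2) + norm h * w) / r * D + 1 * (\<delta> * D\<^sup>2)"
      using he c1 e diam[OF y(1) sS(1)] \<delta> w r D0 by (intro add_mono mult_mono) (auto simp: norm_minus_commute)
    also have "\<dots> \<le> (2 * (\<delta> * D\<^sup>2) + norm h * w) / r * D + \<delta> * D\<^sup>2 * (D / r)"
    proof -
      have "\<delta> * D\<^sup>2 * 1 \<le> \<delta> * D\<^sup>2 * (D / r)" using \<delta> r D by (intro mult_left_mono) auto
      then show ?thesis by simp
    qed
    also have "\<dots> = 3 * \<delta> * D ^ 3 / r + norm h * (w * D / r)"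
      using r by (simp add: field_simps power2_eq_square power3_eq_cube)
    also have "\<dots> \<le> norm h * (3 * \<delta> * D ^ 3 / r\<^sup>2) + norm h * (w * D / r)"
    proof -
      have "r * (3 * \<delta> * D ^ 3 / r\<^sup>2) \<le> norm h * (3 * \<delta> * D ^ 3 / r\<^sup>2)" using h \<delta> D0 by (intro mult_right_mono) auto
      moreover have "r * (3 * \<delta> * D ^ 3 / r\<^sup>2) = 3 * \<delta> * D ^ 3 / r" using r by (simp add: power2_eq_square)
      ultimately show ?thesis by linarith
    qed
    also have "\<dots> = norm h * (3 * \<delta> * D ^ 3 / r\<^sup>2 + w * D / r)" by (simp add: distrib_left)
    finally have "\<bar>cr e (y - s)\<bar> \<le> 3 * \<delta> * D ^ 3 / r\<^sup>2 + w * D / r" using h(2) by simp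
    moreover have "\<bar>cr e (y - s)\<bar> = \<bar>cr e (s - y)\<bar>" by (metis cr_minus_right abs_minus_cancel minus_diff_eq)
    ultimately show False using offset[OF s(1) y(1)] by linarith
  qed
  obtain F where F: "F \<subseteq> Fr" "\<forall>p\<in>F. \<forall>q\<in>F. p \<noteq> q \<longrightarrow> \<not> norm (p - q) < r"
    "\<forall>a\<in>Fr. a \<in> F \<or> (\<exists>f\<in>F. norm (a - f) < r \<or> norm (f - a) < r)"
    using maximal_unrelated_subset[OF fFr, of "\<lambda>p q. norm (p - q) < r"] by blast
  have fF: "finite F" using F(1) fFr finite_subset by blast
  have FS: "F \<subseteq> S" using F(1) by (auto simp: Fr_def)
  have "card F \<le> 2 * q"
  proof (rule ccontr)
    assume "\<not> ?thesis"
    then have m: "2 * q < card F" by simp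
    obtain c :: "complex \<Rightarrow> complex \<Rightarrow> real" where c: "\<And>y. y \<in> Y \<Longrightarrow> card (c y ` (S - {y})) \<le> q"
      "\<And>y z v. y \<in> Y \<Longrightarrow> z \<in> S - {y} \<Longrightarrow> v \<in> S - {y} \<Longrightarrow> c y z = c y v \<Longrightarrow> \<bar>cr (z - y) (v - y)\<bar> \<le> \<delta> * norm (z - y) * norm (v - y)"
      using col by metis
    \<comment> \<open>Pairs of equal colour. By \<open>unique\<close> no pair serves two pins, while
      by Cauchy--Schwarz each pin has about \<open>(card F)\<^sup>2 / q\<close> of them; so
      \<open>card F > 2 * q\<close> would force \<open>card Y \<le> 2 * q\<close>.\<close>
    define E where "E y = {(s, s') \<in> F \<times> F. s \<noteq> s' \<and> c y s = c y s'}" for y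
    have fE: "finite (E y)" for y using fF by (auto simp: E_def intro: finite_subset[of _ "F \<times> F"])
    have Ebig: "(card F)\<^sup>2 \<le> q * (card (E y) + card F)" if y: "y \<in> Y" for y
    proof -
      have "(card F)\<^sup>2 \<le> card (c y ` F) * card {(s, s') \<in> F \<times> F. c y s = c y s'}" by (rule card_square_le_coincidences[OF fF])
      also have "\<dots> \<le> q * card {(s, s') \<in> F \<times> F. c y s = c y s'}"
      proof (intro mult_right_mono)
        have "card (c y ` F) \<le> card (c y ` (S - {y}))"
          using S FS F(1) notY y by (intro card_mono image_mono) auto
        then show "card (c y ` F) \<le> q" using c(1)[OF y] by linarith
      qed simp
      also have "card {(s, s') \<in> F \<times> F. c y s = c y s'} \<le> card (E y \<union> (\<lambda>s. (s, s)) ` F)"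
        using fE fF by (intro card_mono) (auto simp: E_def)
      then have "q * card {(s, s') \<in> F \<times> F. c y s = c y s'} \<le> q * (card (E y) + card F)"
        using card_Un_le[of "E y" "(\<lambda>s. (s, s)) ` F"] card_image_le[OF fF, of "\<lambda>s. (s, s)"] by (intro mult_left_mono) linarith+
      finally show ?thesis .
    qed
    have "(\<Sum>y\<in>Y. card (E y)) = card (\<Union>y\<in>Y. E y)"
    proof (rule card_UN_disjoint[symmetric])
      show "\<forall>y\<in>Y. \<forall>y'\<in>Y. y \<noteq> y' \<longrightarrow> E y \<inter> E y' = {}"
      proof (intro ballI impI, rule ccontr)
        fix y y' assume y: "y \<in> Y" "y' \<in> Y" "y \<noteq> y'" and "E y \<inter> E y' \<noteq> {}"
        then obtain s s' where s: "s \<in> F" "s' \<in> F" "s \<noteq> s'" "c y s = c y s'" "c y' s = c y' s'" by (auto simp: E_def)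
        have "y = y'"
        proof (rule unique)
          show "s \<in> Fr" "s' \<in> Fr" "r \<le> norm (s' - s)" using s F by (auto simp: not_less)
          show "\<bar>cr (s - y) (s' - y)\<bar> \<le> \<delta> * norm (s - y) * norm (s' - y)" "\<bar>cr (s - y') (s' - y')\<bar> \<le> \<delta> * norm (s - y') * norm (s' - y')"
            using s F(1) FS y notY by (auto intro!: c(2))
        qed (use y in auto)
        then show False using y by simp
      qed
    qed (use Y fE in auto)
    also have "\<dots> \<le> card (F \<times> F)" using fF by (intro card_mono) (auto simp: E_def)
    finally have Esum: "(\<Sum>y\<in>Y. card (E y)) \<le> (card F)\<^sup>2" by (simp add: card_cartesian_product power2_eq_square)
    have "card Y * (card F)\<^sup>2 = (\<Sum>y\<in>Y. (card F)\<^sup>2)" by simp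
    also have "\<dots> \<le> (\<Sum>y\<in>Y. q * (card (E y) + card F))" using Ebig by (intro sum_mono)
    also have "\<dots> = q * (\<Sum>y\<in>Y. card (E y)) + card Y * (q * card F)" by (simp add: sum.distrib sum_distrib_left distrib_left)
    also have "\<dots> \<le> q * (card F)\<^sup>2 + card Y * (q * card F)" using Esum by (intro add_mono mult_left_mono) auto
    finally have "card Y * (card F)\<^sup>2 \<le> q * (card F)\<^sup>2 + card Y * (q * card F)" .
    then have "real (card Y * (card F)\<^sup>2) \<le> real (q * (card F)\<^sup>2 + card Y * (q * card F))" by (rule of_nat_mono)
    then have i1: "real (card Y) * (real (card F))\<^sup>2 \<le> q * (real (card F))\<^sup>2 + card Y * (q * real (card F))" by simp
    have "card Y * (2 * q * real (card F)) \<le> card Y * (real (card F) * real (card F))"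
      using m by (intro mult_left_mono mult_right_mono) auto
    then have "real (card Y) * (real (card F))\<^sup>2 \<le> (2 * q) * (real (card F))\<^sup>2" using i1 by (simp add: power2_eq_square)
    moreover have "(real (card F))\<^sup>2 > 0" using m by (intro zero_less_power) auto
    ultimately have "real (card Y) \<le> 2 * q" by (metis mult_right_le_imp_le)
    then have "card Y \<le> 2 * q" by linarith
    then show False using big by simp
  qed
  have "Fr \<subseteq> (\<Union>f\<in>F. {t \<in> S. norm (t - f) < r})"
  proof
    fix a assume a: "a \<in> Fr"
    then have "\<exists>f\<in>F. norm (a - f) < r" using F(3) r by (metis norm_minus_commute cancel_comm_monoid_add_class.diff_cancel norm_zero)
    then show "a \<in> (\<Union>f\<in>F. {t \<in> S. norm (t - f) < r})" using a by (auto simp: Fr_def)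
  qed
  then have "card Fr \<le> card (\<Union>f\<in>F. {t \<in> S. norm (t - f) < r})" using fF S by (intro card_mono) auto
  also have "\<dots> \<le> (\<Sum>f\<in>F. card {t \<in> S. norm (t - f) < r})" by (rule card_UN_le[OF fF])
  also have "\<dots> \<le> (\<Sum>f\<in>F. b)" using balls FS by (intro sum_mono) auto
  also have "\<dots> \<le> 2 * q * b" using \<open>card F \<le> 2 * q\<close> by simp
  finally show ?thesis unfolding Fr_def .
qed

text \<open>The cells of a grid of side \<open>r / 2\<close> have diameter below \<open>r\<close>
  and so hold at most \<open>b\<close> points each.\<close>

lemma packing:
  fixes b :: nat and S :: "complex set"
  assumes S: "finite S" and r: "r > 0" and R: "\<And>s. s \<in> S \<Longrightarrow> norm (s - z0) \<le> R"
    and balls: "\<And>s. s \<in> S \<Longrightarrow> card {t \<in> S. norm (t - s) < r} \<le> b"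
  shows "real (card S) \<le> b * (4 * R / r + 3)\<^sup>2"
proof (cases "S = {}")
  case False
  then have R0: "0 \<le> R" using R norm_ge_zero order_trans by (metis all_not_in_conv)
  define g where "g s = (\<lfloor>2 * Re (s - z0) / r\<rfloor>, \<lfloor>2 * Im (s - z0) / r\<rfloor>)" for s
  have "real (card {t \<in> S. g t = g s}) \<le> b" if s: "s \<in> S" for s
  proof -
    have "{t \<in> S. g t = g s} \<subseteq> {t \<in> S. norm (t - s) < r}"
    proof clarify
      fix t assume t: "t \<in> S" "g t = g s"
      have close: "\<bar>a - a'\<bar> < r / 2" if "\<lfloor>2 * a / r\<rfloor> = \<lfloor>2 * a' / r\<rfloor>" for a a' :: real
      proof -
        have "\<bar>2 * a / r - 2 * a' / r\<bar> < 1" using that by linarith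
        then have "\<bar>2 * (a - a') / r\<bar> < 1" by (simp add: diff_divide_distrib right_diff_distrib)
        then have "\<bar>2 * (a - a')\<bar> < r" using r by (simp add: abs_divide)
        then have "\<bar>2 :: real\<bar> * \<bar>a - a'\<bar> < r" by (simp only: abs_mult)
        then show ?thesis by simp
      qed
      have "\<bar>Re (t - z0) - Re (s - z0)\<bar> < r / 2" "\<bar>Im (t - z0) - Im (s - z0)\<bar> < r / 2"
        using t(2) close[of "Re (t - z0)" "Re (s - z0)"] close[of "Im (t - z0)" "Im (s - z0)"]
        unfolding g_def Pair_inject by blast+
      then have "\<bar>Re (t - s)\<bar> < r / 2" "\<bar>Im (t - s)\<bar> < r / 2" by auto
      then show "norm (t - s) < r" using cmod_le[of "t - s"] by linarith
    qed
    then have "card {t \<in> S. g t = g s} \<le> card {t \<in> S. norm (t - s) < r}" using S by (intro card_mono) auto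
    then show ?thesis using balls[OF s] by linarith
  qed
  then have c: "real (card S) \<le> card (g ` S) * real b" by (rule card_le_colours[OF S])
  define I where "I = {- \<lceil>2 * R / r\<rceil> .. \<lceil>2 * R / r\<rceil>}"
  have "g ` S \<subseteq> I \<times> I"
  proof (rule image_subsetI)
    fix s assume s: "s \<in> S"
    have in1: "\<lfloor>2 * a / r\<rfloor> \<in> I" if "\<bar>a\<bar> \<le> R" for a
    proof -
      have "2 * a / r \<le> 2 * R / r" "- (2 * R / r) \<le> 2 * a / r" using that r by (auto simp: divide_simps)
      then show ?thesis unfolding I_def by auto linarith+
    qed
    have "\<bar>Re (s - z0)\<bar> \<le> R" "\<bar>Im (s - z0)\<bar> \<le> R"
      using R[OF s] abs_Re_le_cmod[of "s - z0"] abs_Im_le_cmod[of "s - z0"] by linarith+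
    then show "g s \<in> I \<times> I" using in1 unfolding g_def by blast
  qed
  then have "card (g ` S) \<le> card (I \<times> I)" by (intro card_mono) (auto simp: I_def)
  also have "\<dots> = (card I)\<^sup>2" by (simp add: card_cartesian_product power2_eq_square)
  finally have "real (card (g ` S)) \<le> (real (card I))\<^sup>2" by (metis of_nat_le_iff of_nat_power)
  also have "\<dots> \<le> (4 * R / r + 3)\<^sup>2"
  proof (intro power_mono)
    have "0 \<le> 2 * R / r" using R0 r by simp
    moreover have "\<lceil>2 * R / r\<rceil> < 2 * R / r + 1" by linarith
    ultimately show "real (card I) \<le> 4 * R / r + 3" unfolding I_def by simp
  qed simp
  finally have "real (card (g ` S)) * b \<le> (4 * R / r + 3)\<^sup>2 * b" by (intro mult_right_mono) auto
  then show ?thesis using c by (simp add: mult.commute)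
qed simp

text \<open>Among the closed discs centred in \<open>S\<close>, with a point of \<open>S\<close> on
  the boundary and more than \<open>b\<close> points of \<open>S\<close>, one of least radius is
  taken; an open disc of that radius with more than \<open>b\<close> points would contain a smaller
  one.\<close>

lemma min_ball:
  fixes S :: "complex set"
  assumes S: "finite S" and b: "1 \<le> b" "b < card S"
  shows "\<exists>z0\<in>S. \<exists>r>0. b < card {t \<in> S. norm (t - z0) \<le> r} \<and> (\<forall>s\<in>S. card {t \<in> S. norm (t - s) < r} \<le> b)"
proof -
  define A where "A = {(s, t) \<in> S \<times> S. b < card {u \<in> S. norm (u - s) \<le> norm (t - s)}}"
  have fA: "finite A" using S by (auto simp: A_def intro: finite_subset[of _ "S \<times> S"])
  have "S \<noteq> {}" using b by auto
  then obtain s where s: "s \<in> S" by blast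
  obtain t where t: "t \<in> S" "\<forall>u\<in>S. norm (u - s) \<le> norm (t - s)"
    using exists_max_on[OF S \<open>S \<noteq> {}\<close>, of "\<lambda>u. norm (u - s)"] by blast
  have "{u \<in> S. norm (u - s) \<le> norm (t - s)} = S" using t by auto
  then have "(s, t) \<in> A" using s t b by (simp add: A_def)
  then have A0: "A \<noteq> {}" by auto
  obtain a where a: "a \<in> A" "\<forall>c\<in>A. - norm (snd c - fst c) \<le> - norm (snd a - fst a)"
    using exists_max_on[OF fA A0, of "\<lambda>c. - norm (snd c - fst c)"] by blast
  obtain z0 t0 where zt: "a = (z0, t0)" by (cases a)
  define r where "r = norm (t0 - z0)"
  have z0: "z0 \<in> S" "b < card {t \<in> S. norm (t - z0) \<le> r}" using a(1) zt by (auto simp: A_def r_def)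
  have "r > 0"
  proof (rule ccontr)
    assume "\<not> r > 0"
    then have "{t \<in> S. norm (t - z0) \<le> r} \<subseteq> {z0}" by (auto simp: r_def)
    then have "card {t \<in> S. norm (t - z0) \<le> r} \<le> card {z0}" by (intro card_mono) auto
    then show False using z0(2) b by simp
  qed
  moreover have "card {t \<in> S. norm (t - s) < r} \<le> b" if s: "s \<in> S" for s
  proof (rule ccontr)
    assume gt: "\<not> ?thesis"
    define E where "E = {t \<in> S. norm (t - s) < r}"
    have "finite E" using S by (simp add: E_def)
    have "E \<noteq> {}" using gt unfolding E_def by (metis card.empty le0)
    note \<open>finite E\<close> this
    then obtain t where t: "t \<in> E" "\<forall>u\<in>E. norm (u - s) \<le> norm (t - s)"
      using exists_max_on[of E "\<lambda>u. norm (u - s)"] by blast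
    have "E \<subseteq> {u \<in> S. norm (u - s) \<le> norm (t - s)}" using t by (auto simp: E_def)
    then have "card E \<le> card {u \<in> S. norm (u - s) \<le> norm (t - s)}" using S by (intro card_mono) auto
    then have "(s, t) \<in> A" using gt s t by (auto simp: A_def E_def)
    then have "norm (t0 - z0) \<le> norm (t - s)" using a(2) zt by fastforce
    then show False using t by (auto simp: E_def r_def)
  qed
  ultimately show ?thesis using z0 by blast
qed

text \<open>A pair is chosen for which the farthest point from its line is as near as possible, and
  \<open>W\<close> is that distance. It serves as the width of \<open>S\<close>: a strip contains
  \<open>S\<close>, and every pair has a point at least \<open>W\<close> off its line.\<close>

lemma min_width:
  fixes S :: "complex set"
  assumes S: "finite S" "2 \<le> card S"
  shows "\<exists>e W p. norm e = 1 \<and> p \<in> S \<and> (\<forall>z\<in>S. \<bar>cr e (z - p)\<bar> \<le> W)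
    \<and> (\<forall>x\<in>S. \<forall>y\<in>S. x \<noteq> y \<longrightarrow> (\<exists>z\<in>S. W * norm (y - x) \<le> \<bar>cr (y - x) (z - x)\<bar>))"
proof -
  define A where "A = {(x, y) \<in> S \<times> S. x \<noteq> y}"
  have fA: "finite A" using S by (auto simp: A_def intro: finite_subset[of _ "S \<times> S"])
  have "\<not> card S \<le> Suc 0" using S by simp
  then obtain x y where "x \<in> S" "y \<in> S" "x \<noteq> y" using card_le_Suc0_iff_eq[OF S(1)] by blast
  then have A0: "A \<noteq> {}" and S0: "S \<noteq> {}" by (auto simp: A_def)
  have ex: "\<exists>z\<in>S. \<forall>u\<in>S. \<bar>cr (y - x) (u - x)\<bar> \<le> \<bar>cr (y - x) (z - x)\<bar>" for x y
    by (rule exists_max_on[OF S(1) S0])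
  define m where "m x y = (SOME z. z \<in> S \<and> (\<forall>u\<in>S. \<bar>cr (y - x) (u - x)\<bar> \<le> \<bar>cr (y - x) (z - x)\<bar>))" for x y
  have "m x y \<in> S \<and> (\<forall>u\<in>S. \<bar>cr (y - x) (u - x)\<bar> \<le> \<bar>cr (y - x) (m x y - x)\<bar>)" for x y
    unfolding m_def by (rule someI_ex) (use ex[of y x] in \<open>unfold Bex_def\<close>)
  then have m: "\<And>x y. m x y \<in> S" "\<And>x y u. u \<in> S \<Longrightarrow> \<bar>cr (y - x) (u - x)\<bar> \<le> \<bar>cr (y - x) (m x y - x)\<bar>"
    by blast+
  define h where "h x y = \<bar>cr (y - x) (m x y - x)\<bar> / norm (y - x)" for x y
  obtain a where a: "a \<in> A" "\<forall>c\<in>A. - h (fst c) (snd c) \<le> - h (fst a) (snd a)"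
    using exists_max_on[OF fA A0, of "\<lambda>c. - h (fst c) (snd c)"] by blast
  obtain p q where pq: "a = (p, q)" by (cases a)
  have pqS: "p \<in> S" "q \<in> S" "p \<noteq> q" using a(1) pq by (auto simp: A_def)
  define e where "e = of_real (1 / norm (q - p)) * (q - p)"
  have "norm e = 1" using pqS by (simp add: e_def norm_divide)
  moreover have "\<bar>cr e (z - p)\<bar> \<le> h p q" if "z \<in> S" for z
  proof -
    have "\<bar>cr e (z - p)\<bar> = \<bar>cr (q - p) (z - p)\<bar> / norm (q - p)" unfolding e_def cr_scale_left by (simp add: abs_mult)
    also have "\<dots> \<le> h p q" unfolding h_def using m(2)[OF that] by (intro divide_right_mono) auto
    finally show ?thesis .
  qed
  moreover have "\<exists>z\<in>S. h p q * norm (y - x) \<le> \<bar>cr (y - x) (z - x)\<bar>" if "x \<in> S" "y \<in> S" "x \<noteq> y" for x y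
  proof -
    have "(x, y) \<in> A" using that by (simp add: A_def)
    then have "h p q \<le> h x y" using a(2) pq by fastforce
    then have "h p q * norm (y - x) \<le> h x y * norm (y - x)" by (intro mult_right_mono) auto
    also have "\<dots> = \<bar>cr (y - x) (m x y - x)\<bar>" using that by (simp add: h_def)
    finally show ?thesis using m(1) by blast
  qed
  ultimately show ?thesis using pqS by blast
qed

text \<open>The set \<open>S2\<close> lies in a strip so thin that, seen from a pin \<open>x\<close>, its points have much smaller
  angles with a line \<open>xy\<close> than some point of \<open>S\<close>.\<close>

definition thins :: "complex set \<Rightarrow> complex set \<Rightarrow> nat \<Rightarrow> real \<Rightarrow> bool" where
  "thins S S2 b r \<longleftrightarrow> S2 \<subseteq> S \<and> r > 0 \<and> (\<forall>s\<in>S. card {t \<in> S. norm (t - s) < r} \<le> b) \<and>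
    (\<forall>x\<in>S2. \<forall>y\<in>S2. r \<le> norm (x - y) \<longrightarrow> (\<exists>z\<in>S. 0 < sn x y z \<and> 0 < sn y x z \<and>
      (\<forall>v\<in>S2. (norm (v - y) \<le> norm (v - x) \<longrightarrow> 8 * sn x y v \<le> sn x y z) \<and>
              (norm (v - x) \<le> norm (v - y) \<longrightarrow> 8 * sn y x v \<le> sn y x z))))"

text \<open>The width \<open>W\<close> of \<open>S1\<close> supplies a witness \<open>z\<close> with
  sine at least \<open>W / (2 * R)\<close>, whereas a point of the strip at distance at least
  \<open>r / 2\<close> from the pin is seen under a sine of at most
  \<open>16 * w * R / r\<^sup>2\<close>. That distance is guaranteed only for the farther of
  \<open>x\<close> and \<open>y\<close>, which explains the case distinction in
  \<open>thins\<close>.\<close>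

lemma thinsI:
  fixes S1 :: "complex set"
  assumes r: "r > 0" and balls: "\<And>s. s \<in> S \<Longrightarrow> card {t \<in> S. norm (t - s) < r} \<le> b"
    and sub: "S2 \<subseteq> S1" "S1 \<subseteq> S" and R: "R > 0" "\<And>s. s \<in> S1 \<Longrightarrow> norm (s - z0) \<le> R"
    and W: "W > 0" "\<And>x y. x \<in> S1 \<Longrightarrow> y \<in> S1 \<Longrightarrow> x \<noteq> y \<Longrightarrow> \<exists>z\<in>S1. W * norm (y - x) \<le> \<bar>cr (y - x) (z - x)\<bar>"
    and strip: "norm e = 1" "\<And>s. s \<in> S2 \<Longrightarrow> \<bar>cr e (s - y0)\<bar> \<le> w" and w: "256 * w * R\<^sup>2 \<le> W * r\<^sup>2"
  shows "thins S S2 b r"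
  unfolding thins_def
proof (intro conjI ballI impI)
  fix x y assume xy: "x \<in> S2" "y \<in> S2" "r \<le> norm (x - y)"
  then have ne: "x \<noteq> y" using r by auto
  have xy1: "x \<in> S1" "y \<in> S1" using xy sub by auto
  have dist: "norm (s - s') \<le> 2 * R" if "s \<in> S1" "s' \<in> S1" for s s'
    using R(2)[OF that(1)] R(2)[OF that(2)] norm_triangle_ineq4[of "s - z0" "s' - z0"] by simp
  obtain z where z: "z \<in> S1" "W * norm (y - x) \<le> \<bar>cr (y - x) (z - x)\<bar>" using W(2)[OF xy1 ne] by blast
  have yx: "norm (y - x) > 0" using ne by simp
  then have crp: "\<bar>cr (y - x) (z - x)\<bar> > 0" using z(2) W(1) by (smt (verit) mult_pos_pos)
  have zne: "z \<noteq> x" "z \<noteq> y" using crp by auto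
  have crxy: "\<bar>cr (x - y) (v - y)\<bar> = \<bar>cr (y - x) (v - x)\<bar>" for v
  proof -
    have "cr (x - y) (v - y) = - cr (y - x) (v - x)" by (simp add: cr_eq algebra_simps)
    then show ?thesis by simp
  qed
  have zl: "W / (2 * R) \<le> \<bar>cr (y - x) (z - x)\<bar> / (norm (y - x) * norm (z - u))" if "u \<in> S1" "z \<noteq> u" for u
  proof -
    have "W * (norm (y - x) * norm (z - u)) \<le> \<bar>cr (y - x) (z - x)\<bar> * (2 * R)"
      using mult_mono[OF z(2) dist[OF z(1) that(1)]] by (simp add: mult_ac)
    then show ?thesis using R(1) yx that(2) by (simp add: divide_simps mult_ac)
  qed
  have low: "W / (2 * R) \<le> sn x y z" "W / (2 * R) \<le> sn y x z"
    using zl[OF xy1(1) zne(1)] zl[OF xy1(2) zne(2)] by (auto simp: sn_def crxy norm_minus_commute[of x y])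
  have up: "8 * (\<bar>cr (y - x) (v - x)\<bar> / (norm (y - x) * norm (v - u))) \<le> W / (2 * R)"
    if v: "v \<in> S2" and u: "norm (y - x) / 2 \<le> norm (v - u)" for v u
  proof -
    have v1: "v \<in> S1" using v sub by auto
    have st: "\<bar>cr e (s - s')\<bar> \<le> 2 * w" if "s \<in> S2" "s' \<in> S2" for s s'
    proof -
      have "cr e (s - s') = cr e (s - y0) - cr e (s' - y0)" by (simp add: cr_diff_right)
      then show ?thesis using strip(2)[OF that(1)] strip(2)[OF that(2)] by linarith
    qed
    have "norm e * \<bar>cr (y - x) (v - x)\<bar> \<le> \<bar>cr (y - x) e\<bar> * norm (v - x) + norm (y - x) * \<bar>cr e (v - x)\<bar>"
      by (rule norm_mult_abs_cr_le)
    also have "\<dots> \<le> 2 * w * (2 * R) + (2 * R) * (2 * w)"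
      using st[OF xy(2,1)] st[OF v xy(1)] dist[OF v1 xy1(1)] dist[OF xy1(2,1)] R(1)
      by (intro add_mono mult_mono) (auto simp: cr_commute[of e "y - x"])
    finally have c: "\<bar>cr (y - x) (v - x)\<bar> \<le> 8 * w * R" using strip(1) by (simp add: mult_ac)
    have ryx: "r \<le> norm (y - x)" using xy(3) by (simp add: norm_minus_commute)
    have "r * (r / 2) \<le> norm (y - x) * norm (v - u)" using ryx u r by (intro mult_mono) auto
    then have "W * (r * (r / 2)) \<le> W * (norm (y - x) * norm (v - u))" using W by (intro mult_left_mono) auto
    moreover have "8 * (8 * w * R) * (2 * R) \<le> W * (r * (r / 2))" using w by (simp add: power2_eq_square)
    moreover have "8 * \<bar>cr (y - x) (v - x)\<bar> * (2 * R) \<le> 8 * (8 * w * R) * (2 * R)" using c R(1) by (intro mult_right_mono mult_left_mono) auto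
    ultimately have "8 * \<bar>cr (y - x) (v - x)\<bar> * (2 * R) \<le> W * (norm (y - x) * norm (v - u))" by linarith
    moreover have "norm (v - u) > 0" using u yx by linarith
    ultimately show ?thesis using R(1) yx by (simp add: divide_simps mult_ac)
  qed
  have tri: "norm (y - x) \<le> norm (v - x) + norm (v - y)" for v
    using norm_triangle_ineq4[of "v - x" "v - y"] by simp
  show "\<exists>z\<in>S. 0 < sn x y z \<and> 0 < sn y x z \<and>
      (\<forall>v\<in>S2. (norm (v - y) \<le> norm (v - x) \<longrightarrow> 8 * sn x y v \<le> sn x y z) \<and>
              (norm (v - x) \<le> norm (v - y) \<longrightarrow> 8 * sn y x v \<le> sn y x z))"
  proof (intro bexI[of _ z] conjI ballI impI)
    have "0 < W / (2 * R)" using W(1) R(1) by simp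
    then show "0 < sn x y z" "0 < sn y x z" using low by linarith+
    show "z \<in> S" using z(1) sub by auto
    fix v assume v: "v \<in> S2"
    show "8 * sn x y v \<le> sn x y z" if "norm (v - y) \<le> norm (v - x)"
      using up[OF v, of x] tri[of v] that low(1) by (simp add: sn_def)
    show "8 * sn y x v \<le> sn y x z" if "norm (v - x) \<le> norm (v - y)"
      using up[OF v, of y] tri[of v] that low(2) by (simp add: sn_def crxy norm_minus_commute[of x y])
  qed
qed (use r balls sub in auto)

text \<open>With \<open>t = R / r\<close>, \<open>R * \<delta>\<close> is of order
  \<open>W / t ^ (2 * J + 9)\<close>, and the robust Beck theorem followed by
  \<open>pins_in_strip_absorb\<close> costs \<open>t ^ (2 * J + 2)\<close>. What is left,
  \<open>W / t ^ 7\<close>, is smaller by \<open>t ^ 5\<close> than the required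
  \<open>W / t ^ 2\<close>, enough for the constants.\<close>

lemma strip_width_bound:
  fixes r R W \<delta> :: real and J l :: nat
  assumes r: "r > 0" and W: "W > 0"
    and \<delta>: "\<delta> = 4 ^ (2 * J + 10) * (4 * real l * (256 * r / R) ^ (2 * J + 9) * (262144 * W / R))"
    and t: "1 \<le> R / r" "256 * (96 * 32 ^ J * 4 ^ (2 * J + 10) * (4 * real l) * 256 ^ (2 * J + 9) * 262144) \<le> R / r"
    and w: "w = 4 * (2 * R) * (8 * (2 * R / r)\<^sup>2) ^ J * (2 * \<delta>)"
  shows "256 * (3 * (2 * \<delta>) * (2 * R) ^ 3 / r\<^sup>2 + w * (2 * R) / r + w) * R\<^sup>2 \<le> W * r\<^sup>2"
proof -
  define t where "t = R / r"
  have R: "R = t * r" using r by (simp add: t_def)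
  have t1: "1 \<le> t" using assms by (simp add: t_def)
  have R0: "R > 0" using t1 r by (simp add: R)
  have \<delta>0: "\<delta> \<ge> 0" using r W R0 by (simp add: \<delta>)
  have w': "w = 16 * R * \<delta> * (32 * t\<^sup>2) ^ J"
    using r by (simp add: w R power2_eq_square)
  have w0: "w \<ge> 0" using R0 \<delta>0 by (simp add: w')
  have tp: "t ^ i \<le> t ^ j" if "i \<le> j" for i j using t1 that by (rule power_increasing[rotated])
  have "3 * (2 * \<delta>) * (2 * R) ^ 3 / r\<^sup>2 = 48 * R * \<delta> * t ^ 2"
    using r by (simp add: R power2_eq_square power3_eq_cube field_simps)
  also have "\<dots> \<le> 48 * R * \<delta> * (32 ^ J * t ^ (2 * J + 2))"
  proof -
    have "t ^ 2 \<le> 1 * t ^ (2 * J + 2)" using tp[of 2 "2 * J + 2"] by simp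
    also have "\<dots> \<le> 32 ^ J * t ^ (2 * J + 2)" using t1 by (intro mult_right_mono) auto
    finally show ?thesis using R0 \<delta>0 by (intro mult_left_mono) auto
  qed
  finally have a: "3 * (2 * \<delta>) * (2 * R) ^ 3 / r\<^sup>2 \<le> 48 * R * \<delta> * (32 ^ J * t ^ (2 * J + 2))" .
  have "w * (2 * R) / r + w = w * (2 * t + 1)" using r by (simp add: R field_simps)
  also have "\<dots> \<le> w * (3 * t)" using t1 w0 by (intro mult_left_mono) auto
  also have "\<dots> = 48 * R * \<delta> * (32 ^ J * t ^ (2 * J + 1))" by (simp add: w' power_mult_distrib power_mult)
  also have "\<dots> \<le> 48 * R * \<delta> * (32 ^ J * t ^ (2 * J + 2))" using tp[of "2 * J + 1" "2 * J + 2"] R0 \<delta>0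
    by (intro mult_left_mono) auto
  finally have b: "w * (2 * R) / r + w \<le> 48 * R * \<delta> * (32 ^ J * t ^ (2 * J + 2))" .
  define C where "C = 96 * 32 ^ J * 4 ^ (2 * J + 10) * (4 * real l) * 256 ^ (2 * J + 9) * (262144::real)"
  have "3 * (2 * \<delta>) * (2 * R) ^ 3 / r\<^sup>2 + w * (2 * R) / r + w \<le> 96 * R * \<delta> * (32 ^ J * t ^ (2 * J + 2))"
    using a b by linarith
  also have "\<dots> = C * W / t ^ 7"
  proof -
    have "256 * r / R = 256 / t" using r by (simp add: R)
    then have "R * \<delta> = 4 ^ (2 * J + 10) * (4 * real l * (256 / t) ^ (2 * J + 9) * (262144 * W))"
      using R0 unfolding \<delta> by (simp add: field_simps)
    also have "\<dots> = 4 ^ (2 * J + 10) * (4 * real l) * 256 ^ (2 * J + 9) * 262144 * W / t ^ (2 * J + 9)"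
      by (simp add: power_divide)
    finally have R\<delta>: "R * \<delta> = 4 ^ (2 * J + 10) * (4 * real l) * 256 ^ (2 * J + 9) * 262144 * W / t ^ (2 * J + 9)" .
    have "96 * R * \<delta> * (32 ^ J * t ^ (2 * J + 2)) = 96 * (32 ^ J * t ^ (2 * J + 2)) * (R * \<delta>)" by (simp only: mult_ac)
    also have "\<dots> = C * W * (t ^ (2 * J + 2) / t ^ (2 * J + 9))"
      unfolding R\<delta> C_def by (simp only: times_divide_eq_right mult_ac)
    finally have "96 * R * \<delta> * (32 ^ J * t ^ (2 * J + 2)) = C * W * (t ^ (2 * J + 2) / t ^ (2 * J + 9))" .
    moreover have "t ^ (2 * J + 2) / t ^ (2 * J + 9) = 1 / t ^ 7"
    proof -
      have "t ^ (2 * J + 9) = t ^ (2 * J + 2) * t ^ 7" by (subst power_add[symmetric]) (rule arg_cong[of _ _ "power t"], simp)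
      then show ?thesis using t1 by simp
    qed
    ultimately show ?thesis by (simp only: times_divide_eq_right mult_1_right)
  qed
  finally have w'': "3 * (2 * \<delta>) * (2 * R) ^ 3 / r\<^sup>2 + w * (2 * R) / r + w \<le> C * W / t ^ 7" .
  have "256 * (3 * (2 * \<delta>) * (2 * R) ^ 3 / r\<^sup>2 + w * (2 * R) / r + w) * R\<^sup>2 \<le> 256 * (C * W / t ^ 7) * R\<^sup>2"
    using w'' by (intro mult_right_mono mult_left_mono) auto
  also have "\<dots> = 256 * C * W * r\<^sup>2 / t ^ 5"
    using t1 by (simp add: R power_mult_distrib field_simps power2_eq_square eval_nat_numeral)
  also have "\<dots> \<le> W * r\<^sup>2"
  proof -
    have "256 * C \<le> t" using t(2) by (simp add: C_def t_def)
    also have "\<dots> \<le> t ^ 5" using tp[of 1 5] by simp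
    finally have "256 * C * (W * r\<^sup>2) \<le> t ^ 5 * (W * r\<^sup>2)" using W by (intro mult_right_mono) auto
    then show ?thesis using t1 by (simp add: divide_simps mult_ac)
  qed
  finally show ?thesis .
qed

text \<open>With \<open>n\<close> points one takes \<open>M = n powr 0.98\<close> for the size of a populated shell, \<open>b\<close> about \<open>n powr 0.001\<close> for the number of
  points in a smallest ball, \<open>q = n powr 0.95\<close> for the number of separated directions, \<open>C = n powr 0.92\<close> for the points of a rich
  line or circle, \<open>H = n powr 1.005\<close> for the size of the sumsets and \<open>T = n powr 0.4\<close> for the ratio of the radii of shell and ball.\<close>

definition scales :: "nat \<Rightarrow> nat \<Rightarrow> nat \<Rightarrow> nat \<Rightarrow> real \<Rightarrow> nat \<Rightarrow> real \<Rightarrow> real \<Rightarrow> real \<Rightarrow> real \<Rightarrow> bool" where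
  "scales J N0 l N M b q C H T \<longleftrightarrow> 1 \<le> b \<and> 0 < q \<and> 1 \<le> H \<and> 512 \<le> T
    \<and> 256 * (96 * 32 ^ J * 4 ^ (2 * J + 10) * (4 * real l) * 256 ^ (2 * J + 9) * 262144) \<le> T
    \<and> real b * (7 * T)\<^sup>2 < M \<and> 0 < C \<and> C \<le> M
    \<and> (\<forall>i. b < (2 * l + 1) * i + 2 * l \<longrightarrow> H ^ (2 * (2 * J + 10)) * (2 * H / q) < real (i choose l))
    \<and> 2 \<le> (M * q / (4 * H) - l) / l \<and> real N < (M * q / (4 * H) - l) / l * q / (2 * H)
    \<and> C \<le> (M * q / (4 * H) - l) / l
    \<and> real N0 \<le> M / (2 * b) \<and> 16 * q \<le> (M / (2 * b)) powr (49/50)"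

text \<open>Pins in a shell of radius \<open>R\<close> around a ball of radius \<open>r\<close> either have many well separated directions, and then many of them
  lie on a line or circle, or few. In the latter case the pins concentrate in a strip by the robust Beck theorem, and they force
  almost all points into a slightly wider strip.\<close>

lemma thin_step:
  fixes P S :: "complex set" and Q b :: nat and M q C H T :: real
  assumes beck: "beck_bound (1/50) J N0" and N: "common_zeros_le l l N" and l: "l \<ge> 1"
    and sc: "scales J N0 l N M b q C H T" and P: "finite P" and SP: "S \<subseteq> P" and scl: "\<forall>x\<in>S. scl P Q x"
    and few: "\<forall>x\<in>S. real (card (nsum l (dirs P x))) \<le> H \<and> real (card (nsum (Suc l) (dirs P x))) \<le> H"
    and gen: "\<forall>G. gencircle G \<longrightarrow> real (card (P \<inter> G)) < C" and large: "(real (Q * Q) + 2) * M + C < real (card S)"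
  shows "\<exists>S2 r. thins S S2 b r \<and> real (card S) - real (card S2) \<le> C + (real (Q * Q) + 1) * M + 2 * q * b"
proof -
  have b1: "1 \<le> b" and q0: "0 < q" and H1: "1 \<le> H" and T: "512 \<le> T"
    "256 * (96 * 32 ^ J * 4 ^ (2 * J + 10) * (4 * real l) * 256 ^ (2 * J + 9) * 262144) \<le> T"
    and bTM: "real b * (7 * T)\<^sup>2 < M" and C: "0 < C" "C \<le> M"
    and count: "\<forall>i. b < (2 * l + 1) * i + 2 * l \<longrightarrow> H ^ (2 * (2 * J + 10)) * (2 * H / q) < real (i choose l)"
    and nu: "2 \<le> (M * q / (4 * H) - l) / l" "real N < (M * q / (4 * H) - l) / l * q / (2 * H)" "C \<le> (M * q / (4 * H) - l) / l"
    and beckn: "real N0 \<le> M / (2 * b)" "16 * q \<le> (M / (2 * b)) powr (49/50)"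
    using sc unfolding scales_def by simp_all
  have fS: "finite S" using SP P by (rule finite_subset)
  have onG: "real (card (A \<inter> G)) < C" if "gencircle G" "A \<subseteq> P" for A G
  proof -
    have "card (A \<inter> G) \<le> card (P \<inter> G)" using P that by (intro card_mono) auto
    then show ?thesis using gen that by (meson le_less_trans of_nat_le_iff)
  qed
  have bM: "real b < M"
  proof -
    have "1 \<le> (7 * T)\<^sup>2" using T(1) by (intro one_le_power) auto
    then have "real b * 1 \<le> real b * (7 * T)\<^sup>2" by (intro mult_left_mono) auto
    then show ?thesis using bTM by linarith
  qed
  have M0: "M > 0" using C by simp
  have QM: "2 * M \<le> (real (Q * Q) + 2) * M" using M0 by (intro mult_right_mono) auto
  have "real b < real (card S)" using bM large QM C M0 by linarith
  then have bS: "b < card S" by simp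
  obtain z0 r where z0: "z0 \<in> S" and r: "r > 0" and B0: "b < card {t \<in> S. norm (t - z0) \<le> r}"
    and balls: "\<And>s. s \<in> S \<Longrightarrow> card {t \<in> S. norm (t - s) < r} \<le> b"
    using min_ball[OF fS b1 bS] by blast
  define B where "B = {t \<in> S. norm (t - z0) \<le> r}"
  obtain x where x: "x \<in> S" "\<forall>y\<in>S. norm (y - z0) \<le> norm (x - z0)"
    using exists_max_on[OF fS, of "\<lambda>y. norm (y - z0)"] z0 by blast
  have xz: "x \<noteq> z0"
  proof
    assume "x = z0"
    then have "S \<subseteq> {z0}" using x(2) by auto
    then have "card S \<le> card {z0}" by (intro card_mono) auto
    then show False using bS b1 by simp
  qed
  \<comment> \<open>Points on the line through \<open>x\<close> and \<open>z0\<close> have sine 0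
    and are dropped; there are fewer than \<open>C\<close> of them.\<close>
  define S' where "S' = {y \<in> S. cr (x - z0) (y - z0) \<noteq> 0}"
  define e0 where "e0 = of_real (1 / norm (x - z0)) * (x - z0)"
  have e0: "norm e0 = 1" using xz by (simp add: e0_def norm_divide)
  have S'L: "S - S' \<subseteq> S \<inter> {z. cr e0 (z - z0) = 0}" unfolding e0_def cr_scale_left by (auto simp: S'_def)
  have "gencircle {z. cr e0 (z - z0) = 0}" using e0 unfolding gencircle_def by blast
  then have "real (card (S \<inter> {z. cr e0 (z - z0) = 0})) < C" using SP by (rule onG)
  moreover have "card (S - S') \<le> card (S \<inter> {z. cr e0 (z - z0) = 0})" using S'L fS by (intro card_mono) auto
  moreover have "card (S - S') = card S - card S'" "card S' \<le> card S"
    using fS by (auto simp: S'_def intro!: card_Diff_subset card_mono)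
  ultimately have cS': "real (card S) - C < real (card S')" by linarith
  obtain R where R: "R > 0" "real (card {y \<in> S'. norm (y - z0) > R}) \<le> (real (Q * Q) + 1) * M"
    "M \<le> real (card {y \<in> S. norm (y - z0) \<le> R \<and> R \<le> 256 * norm (y - z0)})"
    using populated_shell[OF P SP x(1) z0 xz, of Q S' M] scl x z0 S'_def M0 large cS' by auto
  define X0 where "X0 = {y \<in> S. norm (y - z0) \<le> R \<and> R \<le> 256 * norm (y - z0)}"
  define S1 where "S1 = {y \<in> S. norm (y - z0) \<le> R}"
  have S1S: "S1 \<subseteq> S" and fS1: "finite S1" and X0S: "X0 \<subseteq> S1" and z01: "z0 \<in> S1"
    using fS R(1) z0 by (auto simp: S1_def X0_def)
  have MX: "M \<le> card X0" using R(3) by (simp add: X0_def)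
  have MS1: "M \<le> card S1" using MX card_mono[OF fS1 X0S] by linarith
  have S1R: "norm (s - z0) \<le> R" if "s \<in> S1" for s using that by (simp add: S1_def)
  have cS1: "real (card S) - real (card S1) \<le> C + (real (Q * Q) + 1) * M"
  proof -
    have "S' \<subseteq> S1 \<union> {y \<in> S'. norm (y - z0) > R}" by (auto simp: S1_def S'_def)
    then have "card S' \<le> card (S1 \<union> {y \<in> S'. norm (y - z0) > R})" using fS fS1 by (intro card_mono) (auto simp: S'_def)
    also have "\<dots> \<le> card S1 + card {y \<in> S'. norm (y - z0) > R}" by (rule card_Un_le)
    finally show ?thesis using R(2) cS' by linarith
  qed
  have balls1: "card {t \<in> S1. norm (t - s) < r} \<le> b" if "s \<in> S1" for s
  proof -
    have "card {t \<in> S1. norm (t - s) < r} \<le> card {t \<in> S. norm (t - s) < r}" using S1S fS by (intro card_mono) auto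
    then show ?thesis using balls that S1S by (meson order_trans subsetD)
  qed
  \<comment> \<open>Otherwise \<open>packing\<close> would leave fewer than \<open>M\<close> points
    in \<open>S1\<close>, since small discs hold at most \<open>b\<close> each.\<close>
  have Tt: "T \<le> R / r"
  proof (rule ccontr)
    assume "\<not> ?thesis"
    then have "4 * (R / r) + 3 \<le> 7 * T" using T(1) by argo
    then have "4 * R / r + 3 \<le> 7 * T" by simp
    then have "(4 * R / r + 3)\<^sup>2 \<le> (7 * T)\<^sup>2" using R(1) r by (intro power_mono) auto
    then have "real b * (4 * R / r + 3)\<^sup>2 \<le> real b * (7 * T)\<^sup>2" by (intro mult_left_mono) auto
    moreover have "real (card S1) \<le> real b * (4 * R / r + 3)\<^sup>2" by (rule packing[OF fS1 r S1R balls1])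
    ultimately show False using bTM MS1 by linarith
  qed
  have rR: "512 * r \<le> R" using order_trans[OF T(1) Tt] r by (simp add: divide_simps)
  have "real 1 < real (card S1)" using MS1 bM b1 by simp
  then have "2 \<le> card S1" by linarith
  then obtain e1 W p where W: "norm e1 = 1" "p \<in> S1" "\<forall>z\<in>S1. \<bar>cr e1 (z - p)\<bar> \<le> W"
    "\<forall>x\<in>S1. \<forall>y\<in>S1. x \<noteq> y \<longrightarrow> (\<exists>z\<in>S1. W * norm (y - x) \<le> \<bar>cr (y - x) (z - x)\<bar>)"
    using min_width[OF fS1] by blast
  have W0: "W > 0"
  proof (rule ccontr)
    assume "\<not> W > 0"
    then have "S1 \<subseteq> S1 \<inter> {z. cr e1 (z - p) = 0}" using W(3) by fastforce
    then have "card S1 \<le> card (S1 \<inter> {z. cr e1 (z - p) = 0})" using fS1 by (intro card_mono) auto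
    moreover have "gencircle {z. cr e1 (z - p) = 0}" using W(1) unfolding gencircle_def by blast
    then have "real (card (S1 \<inter> {z. cr e1 (z - p) = 0})) < C" using onG S1S SP by blast
    ultimately show False using MS1 C by linarith
  qed
  \<comment> \<open>The shell is at distance at least \<open>R / 256\<close> from \<open>z0\<close>.
    This gives \<open>256 * r / R\<close> here and \<open>4 * 256\<^sup>2 = 262144\<close> in
    \<open>\<sigma>\<close>, where \<open>4 * W * R\<close> bounds the cross product.\<close>
  define \<rho> where "\<rho> = 256 * r / R"
  define \<sigma> where "\<sigma> = 262144 * W / R"
  define \<delta> where "\<delta> = 4 ^ (2 * J + 10) * (4 * real l * \<rho> ^ (2 * J + 9) * \<sigma>)"
  have \<rho>: "0 \<le> \<rho>" "\<rho> \<le> 1/2" using rR R(1) r by (auto simp: \<rho>_def divide_simps)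
  have \<sigma>: "0 \<le> \<sigma>" using W0 R(1) by (simp add: \<sigma>_def)
  have \<delta>0: "0 \<le> \<delta>" using \<rho> \<sigma> by (simp add: \<delta>_def)
  have BS1: "B \<subseteq> S1" using rR r by (auto simp: B_def S1_def)
  have near: "v \<noteq> z0 \<and> (\<forall>z\<in>B. norm ((z - z0) / (z0 - v)) \<le> \<rho> \<and> \<bar>Im ((z - z0) / (z0 - v))\<bar> \<le> \<sigma>)" if v: "v \<in> X0" for v
  proof (intro conjI ballI)
    have vn: "R \<le> 256 * norm (z0 - v)" "norm (z0 - v) \<le> R" using v by (auto simp: X0_def norm_minus_commute)
    then have v0: "norm (z0 - v) > 0" using R(1) by linarith
    then show "v \<noteq> z0" by auto
    fix z assume z: "z \<in> B"
    have zr: "norm (z - z0) \<le> r" using z by (simp add: B_def)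
    have "norm (z - z0) * R \<le> r * (256 * norm (z0 - v))" using zr vn r R(1) by (intro mult_mono) auto
    then show "norm ((z - z0) / (z0 - v)) \<le> \<rho>" using v0 R(1) by (simp add: \<rho>_def norm_divide divide_simps mult_ac)
    have st: "\<bar>cr e1 (s - s')\<bar> \<le> 2 * W" if "s \<in> S1" "s' \<in> S1" for s s'
    proof -
      have "cr e1 (s - s') = cr e1 (s - p) - cr e1 (s' - p)" by (simp add: cr_diff_right)
      then show ?thesis using W(3) that by (smt (verit))
    qed
    have zS: "z \<in> S1" and vS: "v \<in> S1" using z BS1 v X0S by auto
    have "norm e1 * \<bar>cr (z0 - v) (z - z0)\<bar> \<le> \<bar>cr (z0 - v) e1\<bar> * norm (z - z0) + norm (z0 - v) * \<bar>cr e1 (z - z0)\<bar>"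
      by (rule norm_mult_abs_cr_le)
    also have "\<dots> \<le> (2 * W) * R + R * (2 * W)"
      using st[OF z01 vS] st[OF zS z01] S1R[OF zS] vn W0 R(1)
      by (intro add_mono mult_mono) (auto simp: cr_commute[of e1 "z0 - v"])
    finally have c: "\<bar>cr (z0 - v) (z - z0)\<bar> \<le> 4 * W * R" using W(1) by (simp add: mult_ac)
    have "(R / 256)\<^sup>2 \<le> (norm (z0 - v))\<^sup>2" using vn R(1) by (intro power_mono) auto
    then have nv: "R\<^sup>2 \<le> 65536 * (norm (z0 - v))\<^sup>2" by (simp add: power_divide)
    have "Im ((z - z0) / (z0 - v)) = cr (z0 - v) (z - z0) / (norm (z0 - v))\<^sup>2"
      unfolding complex_div_cnj[of "z - z0"] by (simp add: cr_def mult.commute flip: of_real_power)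
    then have "\<bar>Im ((z - z0) / (z0 - v))\<bar> = \<bar>cr (z0 - v) (z - z0)\<bar> / (norm (z0 - v))\<^sup>2" by simp
    also have "\<dots> \<le> 4 * W * R / (norm (z0 - v))\<^sup>2" using c by (intro divide_right_mono) auto
    also have "\<dots> \<le> \<sigma>"
    proof -
      have "4 * W * R\<^sup>2 \<le> 4 * W * (65536 * (norm (z0 - v))\<^sup>2)" using nv W0 by (intro mult_left_mono) auto
      then show ?thesis using v0 R(1) by (simp add: \<sigma>_def divide_simps power2_eq_square mult_ac)
    qed
    finally show "\<bar>Im ((z - z0) / (z0 - v))\<bar> \<le> \<sigma>" .
  qed
  define X where "X = {v \<in> X0. many_directions P v \<delta> q}"
  have fX0: "finite X0" using X0S fS1 by (rule finite_subset)
  \<comment> \<open>Otherwise \<open>many_pins_on_gencircle\<close> would put at least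
    \<open>C\<close> points of \<open>P\<close> on a line or circle.\<close>
  have "real (card X) < M / 2"
  proof (rule ccontr)
    assume "\<not> ?thesis"
    then have "M / 2 * q / (2 * H) \<le> card X * q / (2 * H)" using q0 H1 by (intro divide_right_mono mult_right_mono) auto
    then have XM: "M * q / (4 * H) \<le> card X * q / (2 * H)" by simp
    define m where "m = (card X * q / (2 * H) - l) / l"
    have m: "(M * q / (4 * H) - l) / l \<le> m" unfolding m_def using XM l by (intro divide_right_mono) auto
    have "real N < m * q / (2 * H)"
    proof -
      have "(M * q / (4 * H) - l) / l * q / (2 * H) \<le> m * q / (2 * H)" using m q0 H1 by (intro divide_right_mono mult_right_mono) auto
      then show ?thesis using nu by linarith
    qed
    note bigN = this
    have m2: "2 \<le> m" using m nu by linarith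
    have lX: "real l < card X * q / (2 * H)"
    proof -
      have "2 * real l \<le> card X * q / (2 * H) - l" using m2 l unfolding m_def by (simp add: le_divide_eq)
      then show ?thesis using l by linarith
    qed
    have countB: "\<forall>i. card B \<le> (2 * l + 1) * i + 2 * l \<longrightarrow> H ^ (2 * (2 * J + 10)) * (2 * H / q) < real (i choose l)"
      using count B0 unfolding B_def by (meson less_le_trans)
    have "X \<subseteq> P" "B \<subseteq> P" "X \<subseteq> S" using X0S S1S SP BS1 by (auto simp: X_def)
    have "\<exists>C. gencircle C \<and> m \<le> card (X \<inter> C)"
      unfolding m_def
    proof (rule many_pins_on_gencircle[where d = "2 * J + 10", OF N P \<open>X \<subseteq> P\<close> \<open>B \<subseteq> P\<close> _ l _ \<rho> \<sigma> _ _ H1 _ q0 countB bigN[unfolded m_def] lX m2[unfolded m_def]])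
      show "\<forall>x\<in>X. x \<noteq> z0 \<and> (\<forall>z\<in>B. norm ((z - z0) / (z0 - x)) \<le> \<rho> \<and> \<bar>Im ((z - z0) / (z0 - x))\<bar> \<le> \<sigma>)"
        using near by (simp add: X_def)
      show "4 ^ (2 * J + 10) * (4 * real l * \<rho> ^ (2 * J + 10 - 1) * \<sigma>) \<le> \<delta>" by (simp add: \<delta>_def add.commute[of 9])
      show "\<forall>x\<in>X. real (card (nsum l (dirs P x))) \<le> H \<and> real (card (nsum (Suc l) (dirs P x))) \<le> H"
        using few \<open>X \<subseteq> S\<close> by blast
      show "\<forall>x\<in>X. many_directions P x \<delta> q" by (simp add: X_def)
    qed simp
    then obtain G where G: "gencircle G" "m \<le> card (X \<inter> G)" by blast
    have "real (card (X \<inter> G)) < C" using onG[OF G(1) \<open>X \<subseteq> P\<close>] .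
    then show False using G(2) m nu by linarith
  qed
  define Xb where "Xb = X0 - X"
  have "card Xb = card X0 - card X" "card X \<le> card X0" unfolding Xb_def
    using fX0 by (auto simp: X_def intro!: card_Diff_subset card_mono)
  then have cXb: "M / 2 \<le> card Xb" using MX \<open>real (card X) < M / 2\<close> by linarith
  have fXb: "finite Xb" using fX0 by (simp add: Xb_def)
  \<comment> \<open>An \<open>r\<close>-separated net of the remaining pins; as discs of radius
    \<open>r\<close> hold at most \<open>b\<close> points, at least \<open>M / (2 * b)\<close> of
    them survive.\<close>
  obtain Y where Y: "Y \<subseteq> Xb" "\<forall>p\<in>Y. \<forall>q\<in>Y. p \<noteq> q \<longrightarrow> \<not> norm (p - q) < r"
    "\<forall>a\<in>Xb. a \<in> Y \<or> (\<exists>f\<in>Y. norm (a - f) < r \<or> norm (f - a) < r)"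
    using maximal_unrelated_subset[OF fXb, of "\<lambda>p q. norm (p - q) < r"] by blast
  have fY: "finite Y" using Y(1) fXb by (rule finite_subset)
  have YS1: "Y \<subseteq> S1" using Y(1) X0S by (auto simp: Xb_def)
  have "card Xb \<le> card (\<Union>f\<in>Y. {t \<in> S1. norm (t - f) < r})"
  proof (intro card_mono subsetI)
    fix a assume a: "a \<in> Xb"
    then have "\<exists>f\<in>Y. norm (a - f) < r" using Y(3) r by (metis diff_self norm_minus_commute norm_zero)
    then show "a \<in> (\<Union>f\<in>Y. {t \<in> S1. norm (t - f) < r})" using a X0S by (auto simp: Xb_def)
  qed (use fY fS1 in auto)
  also have "\<dots> \<le> (\<Sum>f\<in>Y. card {t \<in> S1. norm (t - f) < r})" by (rule card_UN_le[OF fY])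
  also have "\<dots> \<le> (\<Sum>f\<in>Y. b)" using balls1 YS1 by (intro sum_mono) auto
  finally have "real (card Xb) \<le> real (card Y) * real b" by (simp flip: of_nat_mult)
  then have "M / 2 \<le> real (card Y) * real b" using cXb by linarith
  then have cY: "M / (2 * b) \<le> card Y" using b1 by (simp add: divide_simps mult_ac)
  have D: "norm (s - s') \<le> 2 * R" if "s \<in> S1" "s' \<in> S1" for s s'
    using S1R[OF that(1)] S1R[OF that(2)] norm_triangle_ineq4[of "s - z0" "s' - z0"] by simp
  define qn where "qn = nat \<lfloor>q\<rfloor>"
  have qn: "real qn \<le> q" using q0 by (simp add: qn_def)
  have col: "\<exists>c::complex \<Rightarrow> real. card (c ` (A - {v})) \<le> qn \<and>
      (\<forall>z\<in>A - {v}. \<forall>w\<in>A - {v}. c z = c w \<longrightarrow> \<bar>cr (z - v) (w - v)\<bar> \<le> 2 * \<delta> * norm (z - v) * norm (w - v))"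
    if v: "v \<in> Y" and A: "A \<subseteq> P" for v A
  proof -
    have "\<not> many_directions P v \<delta> q" using v Y(1) by (auto simp: Xb_def X_def)
    then obtain c :: "complex \<Rightarrow> real" where c: "real (card (c ` (P - {v}))) < q"
      "\<forall>z\<in>P - {v}. \<forall>w\<in>P - {v}. c z = c w \<longrightarrow> \<bar>cr (z - v) (w - v)\<bar> \<le> 2 * \<delta> * norm (z - v) * norm (w - v)"
      using few_directions_colouring[OF P \<delta>0] by blast
    have "card (c ` (A - {v})) \<le> card (c ` (P - {v}))" using A P by (intro card_mono) auto
    moreover have "card (c ` (P - {v})) \<le> qn" using c(1) by (simp add: qn_def le_nat_floor)
    ultimately show ?thesis using c(2) A by (intro exI[of _ c]) (meson DiffE DiffI le_trans subsetD)
  qed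
  have SP1: "S1 \<subseteq> P" "Y \<subseteq> P" using S1S SP YS1 by auto
  have Ybig: "(M / (2 * b)) powr (49/50) \<le> card Y powr (49/50)" using cY M0 by (intro powr_mono2) auto
  obtain e Z where e: "norm e = 1" and Z: "Z \<subseteq> Y" "card Y powr (1 - 1/50) \<le> card Z"
    "\<And>p q. p \<in> Z \<Longrightarrow> q \<in> Z \<Longrightarrow> \<bar>cr e (p - q)\<bar> \<le> 4 * (2 * R) * (8 * (2 * R / r)\<^sup>2) ^ J * (2 * \<delta>)"
  proof (rule beck_boundD[OF beck fY _ r, of "2 * \<delta>" "2 * R" qn])
    show "real N0 \<le> card Y" using cY beckn by linarith
    show "r \<le> norm (p - q)" if "p \<in> Y" "q \<in> Y" "p \<noteq> q" for p q using Y(2) that by (simp add: not_less)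
    show "norm (p - q) \<le> 2 * R" if "p \<in> Y" "q \<in> Y" for p q using D YS1 that by blast
    show "\<exists>c::complex \<Rightarrow> real. card (c ` (Y - {x})) \<le> qn \<and>
      (\<forall>z\<in>Y - {x}. \<forall>w\<in>Y - {x}. c z = c w \<longrightarrow> \<bar>cr (z - x) (w - x)\<bar> \<le> 2 * \<delta> * norm (z - x) * norm (w - x))"
      if "x \<in> Y" for x using col[OF that SP1(2)] .
    show "16 * real qn \<le> card Y powr (1 - 1/50)" using qn beckn Ybig by simp
  qed (use \<delta>0 in auto)
  define w where "w = 4 * (2 * R) * (8 * (2 * R / r)\<^sup>2) ^ J * (2 * \<delta>)"
  have w0: "w \<ge> 0" using R(1) \<delta>0 by (simp add: w_def)
  have Zq: "16 * q \<le> card Z" using Z(2) Ybig beckn by simp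
  then have "Z \<noteq> {}" using q0 by auto
  then obtain y0 where y0: "y0 \<in> Z" by blast
  have fZ: "finite Z" using Z(1) fY by (rule finite_subset)
  define w' where "w' = 3 * (2 * \<delta>) * (2 * R) ^ 3 / r\<^sup>2 + w * (2 * R) / r + w"
  have "card {s \<in> S1. \<bar>cr e (s - y0)\<bar> > w'} \<le> 2 * qn * b"
    unfolding w'_def
  proof (rule pins_in_strip_absorb[OF fS1 fZ y0 r _ w0 e])
    show "r \<le> norm (p - p')" if "p \<in> Z" "p' \<in> Z" "p \<noteq> p'" for p p' using that Y(2) Z(1) by (meson not_less subsetD)
    show "\<bar>cr e (p - p')\<bar> \<le> w" if "p \<in> Z" "p' \<in> Z" for p p' using Z(3)[OF that] by (simp add: w_def)
    show "norm (s - p) \<le> 2 * R" if "p \<in> Z" "s \<in> S1" for p s using D that Z(1) YS1 by blast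
    show "r \<le> 2 * R" using rR r by linarith
    show "\<exists>c::complex \<Rightarrow> real. card (c ` (S1 - {y})) \<le> qn \<and>
      (\<forall>z\<in>S1 - {y}. \<forall>v\<in>S1 - {y}. c z = c v \<longrightarrow> \<bar>cr (z - y) (v - y)\<bar> \<le> 2 * \<delta> * norm (z - y) * norm (v - y))"
      if "y \<in> Z" for y using col[of y S1] that Z(1) SP1 by blast
    have "2 * real qn < real (card Z)" using Zq qn q0 by linarith
    then show "2 * qn < card Z" by linarith
    show "card {t \<in> S1. norm (t - s) < r} \<le> b" if "s \<in> S1" for s by (rule balls1[OF that])
  qed (use \<delta>0 in auto)
  then have "real (card {s \<in> S1. \<bar>cr e (s - y0)\<bar> > w'}) \<le> real (2 * qn * b)" by (rule of_nat_mono)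
  also have "\<dots> \<le> 2 * q * b" using qn by (simp add: mult_right_mono)
  finally have lost: "real (card {s \<in> S1. \<bar>cr e (s - y0)\<bar> > w'}) \<le> 2 * q * b" .
  define S2 where "S2 = {s \<in> S1. \<bar>cr e (s - y0)\<bar> \<le> w'}"
  have "S2 = S1 - {s \<in> S1. \<bar>cr e (s - y0)\<bar> > w'}" by (auto simp: S2_def)
  then have "card S2 = card S1 - card {s \<in> S1. \<bar>cr e (s - y0)\<bar> > w'}" using fS1 by (simp add: card_Diff_subset)
  then have "real (card S1) - real (card S2) \<le> 2 * q * b" using lost by linarith
  then have loss: "real (card S) - real (card S2) \<le> C + (real (Q * Q) + 1) * M + 2 * q * b" using cS1 by linarith
  have "256 * w' * R\<^sup>2 \<le> W * r\<^sup>2"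
    unfolding w'_def
    by (rule strip_width_bound[OF r W0 _ _ _ w_def, of l]) (use Tt T in \<open>auto simp: \<delta>_def \<rho>_def \<sigma>_def\<close>)
  then have "thins S S2 b r"
    by (intro thinsI[OF r _ _ S1S R(1) _ W0 _ e, of b S2 z0 y0 w'])
      (use balls S1R W(4) in \<open>auto simp: S2_def\<close>)
  then show ?thesis using loss by blast
qed

lemma lac_image_decreasing:
  fixes z :: "nat \<Rightarrow> 'a"
  assumes pos: "\<And>i. i \<in> I \<Longrightarrow> s (z i) > 0" and dec: "\<And>i j. i \<in> I \<Longrightarrow> j \<in> I \<Longrightarrow> i < j \<Longrightarrow> 8 * s (z j) \<le> s (z i)"
  shows "lac s (z ` I)" "inj_on z I"
proof -
  show "lac s (z ` I)"
    unfolding lac_def ball_simps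
  proof (intro ballI conjI impI)
    fix i j assume "i \<in> I" "j \<in> I" "z i \<noteq> z j"
    then show "8 * s (z i) \<le> s (z j) \<or> 8 * s (z j) \<le> s (z i)" using dec[of i j] dec[of j i] by (metis nat_neq_iff)
  qed (rule pos)
  show "inj_on z I"
  proof (rule inj_onI, rule ccontr)
    fix i j assume ij: "i \<in> I" "j \<in> I" "z i = z j" "i \<noteq> j"
    then consider "i < j" | "j < i" by linarith
    then show False using dec[of i j] dec[of j i] pos[of i] pos[of j] ij by cases fastforce+
  qed
qed

text \<open>Two points \<open>x\<close>, \<open>y\<close> of the innermost set see the witnesses of all steps under lacunary angles with the line \<open>xy\<close>.\<close>

lemma no_long_thinning:
  fixes Q b :: nat and loss L :: real
  assumes P: "finite P" "S0 \<subseteq> P" and scl: "\<And>x. x \<in> S0 \<Longrightarrow> scl P Q x"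
    and step: "\<And>S. S \<subseteq> S0 \<Longrightarrow> L < real (card S) \<Longrightarrow> \<exists>S2 r. thins S S2 b r \<and> real (card S) - real (card S2) \<le> loss"
    and loss: "loss \<ge> 0" and L: "real b \<le> L"
  shows "real (card S0) \<le> L + (2 * real Q + 2) * loss"
proof (rule ccontr)
  assume gt: "\<not> ?thesis"
  \<comment> \<open>More than \<open>Q + Q\<close> steps, so that one of \<open>x\<close> and
    \<open>y\<close> collects more than \<open>Q\<close> witnesses.\<close>
  define T where "T = 2 * Q + 2"
  have fS0: "finite S0" using P finite_subset by blast
  have big: "L < real (card S)" if "S \<subseteq> S0" "real (card S0) - real (card S) \<le> real i * loss" "i \<le> T" for S i
  proof -
    have "real i * loss \<le> real T * loss" using that loss by (intro mult_right_mono) auto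
    moreover have "real T * loss = (2 * real Q + 2) * loss" by (simp add: T_def)
    ultimately show ?thesis using gt that by linarith
  qed
  have "\<exists>f::nat \<Rightarrow> complex set. \<forall>i. (i \<le> T \<longrightarrow> f i \<subseteq> S0 \<and> real (card S0) - real (card (f i)) \<le> real i * loss) \<and>
    (i < T \<longrightarrow> (\<exists>r. thins (f i) (f (Suc i)) b r))"
  proof (rule dependent_nat_choice)
    show "\<exists>S. 0 \<le> T \<longrightarrow> S \<subseteq> S0 \<and> real (card S0) - real (card S) \<le> real 0 * loss" by (rule exI[of _ S0]) simp
    fix S :: "complex set" and i
    assume S: "i \<le> T \<longrightarrow> S \<subseteq> S0 \<and> real (card S0) - real (card S) \<le> real i * loss"
    show "\<exists>S2. (Suc i \<le> T \<longrightarrow> S2 \<subseteq> S0 \<and> real (card S0) - real (card S2) \<le> real (Suc i) * loss) \<and>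
      (i < T \<longrightarrow> (\<exists>r. thins S S2 b r))"
    proof (cases "i < T")
      case True
      then have "S \<subseteq> S0" "L < real (card S)" "real (card S0) - real (card S) \<le> real i * loss" using S big[of S i] by auto
      moreover from this obtain S2 r where "thins S S2 b r" "real (card S) - real (card S2) \<le> loss" using step by blast
      moreover from this have "S2 \<subseteq> S" by (simp add: thins_def)
      moreover have "real (Suc i) * loss = real i * loss + loss" by (simp add: algebra_simps)
      ultimately show ?thesis by (intro exI[of _ S2]) auto
    qed simp
  qed
  then obtain f :: "nat \<Rightarrow> complex set" where f: "\<And>i. i \<le> T \<Longrightarrow> f i \<subseteq> S0"
    "\<And>i. i \<le> T \<Longrightarrow> real (card S0) - real (card (f i)) \<le> real i * loss" "\<And>i. i < T \<Longrightarrow> \<exists>r. thins (f i) (f (Suc i)) b r"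
    by auto
  define r where "r i = (SOME r. thins (f i) (f (Suc i)) b r)" for i
  have r: "thins (f i) (f (Suc i)) b (r i)" if "i < T" for i unfolding r_def using f(3)[OF that] by (rule someI_ex)
  have mono: "f j \<subseteq> f i" if "i \<le> j" "j \<le> T" for i j
    using that
  proof (induction j rule: dec_induct)
    case (step n)
    then have "f (Suc n) \<subseteq> f n" using r[of n] by (simp add: thins_def)
    then show ?case using step by auto
  qed simp
  have "T > 0" by (simp add: T_def)
  \<comment> \<open>Choosing \<open>x\<close> and \<open>y\<close> at least the largest radius
    \<open>r k\<close> apart makes the pair admissible at every step.\<close>
  then obtain k where k: "k < T" "\<And>i. i < T \<Longrightarrow> r i \<le> r k"
    using exists_max_on[of "{..<T}" r] by blast
  have cT: "L < real (card (f T))" using big[of "f T" T] f by simp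
  then have "f T \<noteq> {}" using L by auto
  then obtain x where x: "x \<in> f T" by blast
  have "\<exists>y\<in>f T. r k \<le> norm (x - y)"
  proof (rule ccontr)
    assume "\<not> ?thesis"
    then have "f T \<subseteq> {t \<in> f k. norm (t - x) < r k}" using mono[of k T] k by (force simp: norm_minus_commute)
    then have "card (f T) \<le> card {t \<in> f k. norm (t - x) < r k}"
      using finite_subset[OF f(1)[of k] fS0] k by (intro card_mono) auto
    also have "\<dots> \<le> b" using r[OF k(1)] mono[of k T] k(1) x unfolding thins_def by auto
    finally show False using cT L by linarith
  qed
  then obtain y where y: "y \<in> f T" "r k \<le> norm (x - y)" by blast
  have "r k > 0" using r[OF k(1)] by (simp add: thins_def)
  then have xy: "x \<noteq> y" using y by auto
  have "\<forall>i\<in>{..<T}. \<exists>z. z \<in> f i \<and> 0 < sn x y z \<and> 0 < sn y x z \<and>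
      (\<forall>v\<in>f (Suc i). (norm (v - y) \<le> norm (v - x) \<longrightarrow> 8 * sn x y v \<le> sn x y z) \<and>
              (norm (v - x) \<le> norm (v - y) \<longrightarrow> 8 * sn y x v \<le> sn y x z))"
  proof
    fix i assume "i \<in> {..<T}"
    then have i: "i < T" by simp
    have "x \<in> f (Suc i)" "y \<in> f (Suc i)" using mono[of "Suc i" T] i x y by auto
    moreover have "r i \<le> norm (x - y)" using k(2)[OF i] y(2) by linarith
    ultimately show "\<exists>z. z \<in> f i \<and> 0 < sn x y z \<and> 0 < sn y x z \<and>
      (\<forall>v\<in>f (Suc i). (norm (v - y) \<le> norm (v - x) \<longrightarrow> 8 * sn x y v \<le> sn x y z) \<and>
              (norm (v - x) \<le> norm (v - y) \<longrightarrow> 8 * sn y x v \<le> sn y x z))"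
      using r[OF i] unfolding thins_def by blast
  qed
  from bchoice[OF this] obtain z where z: "\<And>i. i < T \<Longrightarrow> z i \<in> f i" "\<And>i. i < T \<Longrightarrow> 0 < sn x y (z i)" "\<And>i. i < T \<Longrightarrow> 0 < sn y x (z i)"
    and zx: "\<And>i v. i < T \<Longrightarrow> v \<in> f (Suc i) \<Longrightarrow> norm (v - y) \<le> norm (v - x) \<Longrightarrow> 8 * sn x y v \<le> sn x y (z i)"
    and zy: "\<And>i v. i < T \<Longrightarrow> v \<in> f (Suc i) \<Longrightarrow> norm (v - x) \<le> norm (v - y) \<Longrightarrow> 8 * sn y x v \<le> sn y x (z i)"
    by auto
  have zin: "z j \<in> f (Suc i)" if "i < j" "j < T" for i j using z(1)[OF that(2)] mono[of "Suc i" j] that by auto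
  have zP: "z i \<in> P" if "i < T" for i using z(1)[OF that] f(1)[of i] that P(2) by auto
  have xyS: "x \<in> S0" "y \<in> S0" using x y f(1)[of T] by auto
  \<comment> \<open>A witness is recorded at the endpoint from which it is farther, since there its
    sine is small compared with those of the earlier witnesses.\<close>
  define I where "I = {i. i < T \<and> norm (z i - y) \<le> norm (z i - x)}"
  define I' where "I' = {i. i < T \<and> \<not> norm (z i - y) \<le> norm (z i - x)}"
  have sn0: "sn x y x = 0" "sn y x y = 0" by (simp_all add: sn_def)
  have "lac (sn x y) (z ` I)" "inj_on z I"
    by (rule lac_image_decreasing[of I "sn x y" z]; use z zx zin in \<open>simp add: I_def\<close>)+
  moreover have "z ` I \<subseteq> P - {x}" using zP z(2) sn0 by (fastforce simp: I_def)
  ultimately have "real (card I) \<le> Q"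
    using scl[OF xyS(1)] xyS(2) P(2) xy card_image[of z I] unfolding scl_def by (metis DiffI empty_iff insert_iff subsetD)
  have "lac (sn y x) (z ` I')" "inj_on z I'"
    by (rule lac_image_decreasing[of I' "sn y x" z]; use z zy zin in \<open>simp add: I'_def\<close>)+
  moreover have "z ` I' \<subseteq> P - {y}" using zP z(3) sn0 by (fastforce simp: I'_def)
  ultimately have "real (card I') \<le> Q"
    using scl[OF xyS(2)] xyS(1) P(2) xy card_image[of z I'] unfolding scl_def by (metis DiffI empty_iff insert_iff subsetD)
  moreover have "I \<union> I' = {..<T}" "I \<inter> I' = {}" by (auto simp: I_def I'_def)
  then have "card I + card I' = T" by (metis card_Un_disjoint card_lessThan finite_Un finite_lessThan)
  ultimately show False using \<open>real (card I) \<le> Q\<close> by (simp add: T_def)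
qed

section \<open>Rich lines and circles\<close>

text \<open>The value of \<open>l\<close> comes from the count of tuples: as \<open>H\<close> is at
  most \<open>x ^ 2\<close>, \<open>H ^ (4 * J + 21)\<close> is at most
  \<open>x ^ (8 * J + 42)\<close>, while \<open>i\<close> of order \<open>x powr (1/1000)\<close>
  gives at least a constant times \<open>x ^ (8 * J + 44)\<close> subsets of size
  \<open>l\<close>.\<close>

lemma eventually_scales:
  fixes J N0 l N :: nat
  assumes l: "l = 1000 * (8 * J + 44)"
  shows "eventually (\<lambda>x::real. scales J N0 l N (x powr (49/50)) (nat \<lfloor>x powr (1/1000)\<rfloor>) (x powr (19/20)) (x powr (23/25))
    (x powr (201/200)) (x powr (2/5))) at_top"
proof -
  define K where "K = 256 * (96 * 32 ^ J * 4 ^ (2 * J + 10) * (4 * real l) * 256 ^ (2 * J + 9) * (262144::real))"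
  define U where "U = (6 * (real l)\<^sup>2) ^ l"
  have l1: "1 \<le> real l" and l0: "real l > 0" using l by simp_all
  have U0: "U > 0" using l1 by (simp add: U_def)
  have e1: "eventually (\<lambda>x::real. 512 \<le> x powr (2/5)) at_top" by real_asymp
  have e2: "eventually (\<lambda>x::real. K \<le> x powr (2/5)) at_top" by real_asymp
  have e3: "eventually (\<lambda>x::real. x powr (1/1000) * (7 * x powr (2/5))\<^sup>2 < x powr (49/50)) at_top" by real_asymp
  have e4: "eventually (\<lambda>x::real. x powr (23/25) \<le> x powr (49/50)) at_top" by real_asymp
  have e5: "eventually (\<lambda>x::real. 6 * (real l)\<^sup>2 \<le> x powr (1/1000)) at_top" by real_asymp
  have e6: "eventually (\<lambda>x::real. 2 * U < x ^ 2) at_top" by real_asymp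
  have e7: "eventually (\<lambda>x::real. 2 * l + l \<le> x powr (49/50) * x powr (19/20) / (4 * x powr (201/200))) at_top" by real_asymp
  have e8: "eventually (\<lambda>x::real. real N * l < (x powr (49/50) * x powr (19/20) / (4 * x powr (201/200)) - l) * (x powr (19/20) / (2 * x powr (201/200)))) at_top"
    by real_asymp
  have e9: "eventually (\<lambda>x::real. x powr (23/25) * l + l \<le> x powr (49/50) * x powr (19/20) / (4 * x powr (201/200))) at_top"
    using l1 by real_asymp
  have e10: "eventually (\<lambda>x::real. real N0 \<le> x powr (49/50) / (2 * x powr (1/1000))) at_top" by real_asymp
  have e11: "eventually (\<lambda>x::real. 16 * x powr (19/20) \<le> (x powr (49/50) / (2 * x powr (1/1000))) powr (49/50)) at_top" by real_asymp
  have e12: "eventually (\<lambda>x::real. 1 \<le> x) at_top" by real_asymp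
  show ?thesis
    using e1 e2 e3 e4 e5 e6 e7 e8 e9 e10 e11 e12
  proof eventually_elim
    case (elim x)
    define b where "b = nat \<lfloor>x powr (1/1000)\<rfloor>"
    define H where "H = x powr (201/200)"
    define q where "q = x powr (19/20)"
    have x0: "x > 0" using elim by simp
    have "1 \<le> x powr (1/1000)" using elim(12) by (simp add: ge_one_powr_ge_zero)
    then have b: "1 \<le> b" "real b \<le> x powr (1/1000)" "x powr (1/1000) < real b + 1" unfolding b_def by linarith+
    have H: "1 \<le> H" "H \<le> x ^ 2" and q: "1 \<le> q"
    proof -
      show "1 \<le> H" "1 \<le> q" using elim(12) by (simp_all add: H_def q_def ge_one_powr_ge_zero)
      have "H \<le> x powr 2" unfolding H_def using elim(12) by (intro powr_mono) auto
      then show "H \<le> x ^ 2" using x0 by (simp add: powr_numeral)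
    qed
    have count: "H ^ (2 * (2 * J + 10)) * (2 * H / q) < real (i choose l)" if i: "b < (2 * l + 1) * i + 2 * l" for i
    proof -
      have "b + 1 \<le> (2 * l + 1) * i + 2 * l" using i by simp
      then have "real (b + 1) \<le> real ((2 * l + 1) * i + 2 * l)" by (rule of_nat_mono)
      then have "x powr (1/1000) \<le> (2 * real l + 1) * real i + 2 * real l" using b(3) by (simp add: algebra_simps)
      moreover have "(2 * real l + 1) * real i \<le> 3 * real l * real i" using l1 by (intro mult_right_mono) auto
      moreover have "6 * real l \<le> 6 * (real l)\<^sup>2" using l1 by (simp add: power2_eq_square)
      ultimately have i1: "x powr (1/1000) / 2 \<le> 3 * real l * real i" using elim(5) by linarith
      then have "3 * (real l)\<^sup>2 \<le> 3 * real l * real i" using elim(5) by linarith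
      then have "l \<le> i" using l1 by (simp add: power2_eq_square)
      have "x powr (1/1000) / (6 * (real l)\<^sup>2) \<le> real i / real l"
        using i1 l1 by (simp add: divide_simps power2_eq_square mult_ac)
      then have "(x powr (1/1000) / (6 * (real l)\<^sup>2)) ^ l \<le> (real i / real l) ^ l" by (intro power_mono) auto
      also have "\<dots> \<le> real (i choose l)" using binomial_ge_n_over_k_pow_k[OF \<open>l \<le> i\<close>, where 'a=real] by simp
      finally have c: "(x powr (1/1000)) ^ l / U \<le> real (i choose l)" by (simp add: power_divide U_def)
      have "(x powr (1/1000)) ^ l = (x powr (1/1000)) powr real l" using x0 by (simp add: powr_realpow)
      also have "\<dots> = x powr (real (8 * J + 44))" 
      proof -
        have "1 / 1000 * real l = real (8 * J + 44)" by (simp add: l)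
        then show ?thesis by (simp only: powr_powr)
      qed
      also have "\<dots> = x ^ (8 * J + 44)" by (rule powr_realpow[OF x0])
      finally have e: "(x powr (1/1000)) ^ l = x ^ (8 * J + 42) * x ^ 2" by (simp add: add.commute flip: power_add)
      have "H ^ (2 * (2 * J + 10)) * (2 * H / q) \<le> H ^ (2 * (2 * J + 10)) * (2 * H)"
        using H(1) q by (intro mult_left_mono) (auto simp: divide_simps)
      also have "\<dots> = 2 * H ^ Suc (2 * (2 * J + 10))" by (simp only: power_Suc mult_ac)
      also have "\<dots> = 2 * H ^ (4 * J + 21)" by (simp add: add.commute)
      also have "\<dots> \<le> 2 * (x ^ 2) ^ (4 * J + 21)" using H by (intro mult_left_mono power_mono) auto
      also have "\<dots> = x ^ (8 * J + 42) * (2 * U) / U" using U0 by (simp add: power_mult[symmetric])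
      also have "\<dots> < x ^ (8 * J + 42) * x ^ 2 / U"
        using elim(6) U0 x0 by (intro divide_strict_right_mono mult_strict_left_mono) auto
      finally show ?thesis using c unfolding e by (rule less_le_trans)
    qed
    have b1: "real b * (7 * x powr (2/5))\<^sup>2 < x powr (49/50)"
    proof -
      have "real b * (7 * x powr (2/5))\<^sup>2 \<le> x powr (1/1000) * (7 * x powr (2/5))\<^sup>2" using b by (intro mult_right_mono) auto
      then show ?thesis using elim(3) by linarith
    qed
    have b2: "x powr (49/50) / (2 * x powr (1/1000)) \<le> x powr (49/50) / (2 * b)"
      using b x0 by (intro divide_left_mono mult_pos_pos) auto
    have n1: "2 \<le> (x powr (49/50) * q / (4 * H) - l) / l" "x powr (23/25) \<le> (x powr (49/50) * q / (4 * H) - l) / l"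
    proof -
      have "2 * real l + real l \<le> x powr (49/50) * q / (4 * H)" "x powr (23/25) * l + l \<le> x powr (49/50) * q / (4 * H)"
        using elim(7,9) by (simp_all only: H_def q_def of_nat_add of_nat_mult of_nat_numeral)
      then have "2 * real l \<le> x powr (49/50) * q / (4 * H) - l" "x powr (23/25) * l \<le> x powr (49/50) * q / (4 * H) - l" by linarith+
      then show "2 \<le> (x powr (49/50) * q / (4 * H) - l) / l" "x powr (23/25) \<le> (x powr (49/50) * q / (4 * H) - l) / l"
        by (simp_all only: pos_le_divide_eq[OF l0])
    qed
    have n2: "real N < (x powr (49/50) * q / (4 * H) - l) / l * q / (2 * H)"
    proof -
      have "real N < (x powr (49/50) * q / (4 * H) - l) * (q / (2 * H)) / l"
        using elim(8) unfolding pos_less_divide_eq[OF l0] H_def q_def .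
      then show ?thesis by (simp add: mult_ac)
    qed
    have b3: "(x powr (49/50) / (2 * x powr (1/1000))) powr (49/50) \<le> (x powr (49/50) / (2 * b)) powr (49/50)"
      using b2 by (intro powr_mono2) auto
    show "scales J N0 l N (x powr (49/50)) b q (x powr (23/25)) H (x powr (2/5))"
      unfolding scales_def K_def[symmetric]
    proof (intro conjI allI impI)
      show "real N0 \<le> x powr (49/50) / (2 * b)" using elim(10) b2 by linarith
      show "16 * q \<le> (x powr (49/50) / (2 * b)) powr (49/50)" using elim(11) b3 unfolding q_def by linarith
    qed (use elim b b1 H q n1 n2 count x0 in auto)
  qed
qed

text \<open>The robust Beck theorem with \<open>\<delta> = 0\<close>: points are coloured by their
  exact directions, and a strip of width 0 is a line. The smaller exponent \<open>k'\<close> absorbs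
  the constants.\<close>

lemma degenerate_pins_on_line:
  fixes k k' :: real
  assumes k: "0 < k'" "k' < k" "k < 1"
  shows "\<exists>n0::nat. \<forall>P. finite P \<longrightarrow> n0 \<le> card P \<longrightarrow> real (card P) / 2 \<le> card {x \<in> P. real (card (dirs P x)) < real (card P) powr (1 - k)}
    \<longrightarrow> (\<exists>G. gencircle G \<and> real (card P) powr (1 - k) \<le> card (P \<inter> G))"
proof -
  have k1: "k' < 1" using k by simp
  obtain J N0 where beck: "beck_bound k' J N0" using robust_beck[OF k(1) k1] by blast
  have "eventually (\<lambda>n::nat. 2 * real N0 \<le> real n \<and> 2 \<le> real n \<and> 16 * real n powr (1 - k) \<le> (real n / 2) powr (1 - k')) at_top"
    using k by (intro eventually_conj; real_asymp)
  then obtain n0 where n0: "\<And>n. n0 \<le> n \<Longrightarrow> 2 * real N0 \<le> real n \<and> 2 \<le> real n \<and> 16 * real n powr (1 - k) \<le> (real n / 2) powr (1 - k')"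
    unfolding eventually_at_top_linorder by blast
  show ?thesis
  proof (rule exI[of _ n0], intro allI impI)
    fix P :: "complex set"
    define n where "n = real (card P)"
    define Y where "Y = {x \<in> P. real (card (dirs P x)) < n powr (1 - k)}"
    assume P: "finite P" and n: "n0 \<le> card P" and "real (card P) / 2 \<le> card {x \<in> P. real (card (dirs P x)) < real (card P) powr (1 - k)}"
    then have Y: "n / 2 \<le> card Y" by (simp add: n_def Y_def)
    have N: "2 * real N0 \<le> n" "2 \<le> n" "16 * n powr (1 - k) \<le> (n / 2) powr (1 - k')" using n0[OF n] by (auto simp: n_def)
    have fY: "finite Y" and YP: "Y \<subseteq> P" using P by (auto simp: Y_def)
    have ne: "Y \<noteq> {}" using Y N(2) by auto
    define ds where "ds = (\<lambda>(p, q). norm (p - q)) ` {(p, q) \<in> Y \<times> Y. p \<noteq> q}"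
    have fds: "finite ds" unfolding ds_def by (intro finite_imageI finite_subset[OF _ finite_cartesian_product[OF fY fY]]) auto
    define r where "r = Min (insert 1 ds)"
    define D where "D = Max (insert 0 ds)"
    have r: "r > 0" using fds by (auto simp: r_def ds_def)
    have dsI: "norm (p - q) \<in> ds" if "p \<in> Y" "q \<in> Y" "p \<noteq> q" for p q using that unfolding ds_def by force
    have rle: "r \<le> norm (p - q)" if "p \<in> Y" "q \<in> Y" "p \<noteq> q" for p q
      unfolding r_def using dsI[OF that] fds by (intro Min_le) auto
    have leD: "norm (p - q) \<le> D" if "p \<in> Y" "q \<in> Y" for p q
      unfolding D_def using dsI[OF that] fds by (cases "p = q"; intro Max_ge) auto
    define M where "M = nat \<lfloor>n powr (1 - k)\<rfloor>"
    have M: "real M \<le> n powr (1 - k)" by (simp add: M_def)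
    have col: "\<exists>c::complex \<Rightarrow> real. card (c ` (Y - {x})) \<le> M \<and>
      (\<forall>z\<in>Y - {x}. \<forall>w\<in>Y - {x}. c z = c w \<longrightarrow> \<bar>cr (z - x) (w - x)\<bar> \<le> 0 * norm (z - x) * norm (w - x))" if x: "x \<in> Y" for x
    proof (intro exI[of _ "\<lambda>z. Arg (z - x)"] conjI ballI impI)
      have "(\<lambda>z. Arg (z - x)) ` (Y - {x}) \<subseteq> dirs P x" using Arg_in_dirs YP by blast
      then have "card ((\<lambda>z. Arg (z - x)) ` (Y - {x})) \<le> card (dirs P x)" by (intro card_mono card_dirs_diff(2)[OF P])
      also have "\<dots> \<le> M" using x by (simp add: Y_def M_def le_nat_floor)
      finally show "card ((\<lambda>z. Arg (z - x)) ` (Y - {x})) \<le> M" .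
      fix z w assume a: "Arg (z - x) = Arg (w - x)"
      have "cr (z - x) (w - x) = cr (of_real (norm (z - x)) * cis (Arg (z - x))) (of_real (norm (w - x)) * cis (Arg (w - x)))"
        by (simp only: rcis_cmod_Arg flip: rcis_def)
      also have "\<dots> = 0" unfolding a cr_scale_left cr_scale_right cr_self by simp
      finally show "\<bar>cr (z - x) (w - x)\<bar> \<le> 0 * norm (z - x) * norm (w - x)" by simp
    qed
    have grow: "(n / 2) powr (1 - k') \<le> card Y powr (1 - k')" using Y N(2) k1 by (intro powr_mono2) auto
    obtain e Z where e: "norm e = 1" and Z: "Z \<subseteq> Y" "card Y powr (1 - k') \<le> card Z"
      "\<And>p q. p \<in> Z \<Longrightarrow> q \<in> Z \<Longrightarrow> \<bar>cr e (p - q)\<bar> \<le> 4 * D * (8 * (D / r)\<^sup>2) ^ J * 0"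
    proof (rule beck_boundD[OF beck fY _ r order_refl rle leD col])
      show "real N0 \<le> card Y" using Y N(1) by linarith
      show "16 * real M \<le> card Y powr (1 - k')" using M N(3) grow by linarith
    qed auto
    have big: "16 * n powr (1 - k) \<le> card Z" using N(3) grow Z(2) by linarith
    have "n powr (1 - k) > 0" using N(2) by simp
    then have "Z \<noteq> {}" using big by auto
    then obtain p where p: "p \<in> Z" by blast
    define G where "G = {z. cr e (z - p) = 0}"
    have "gencircle G" using e unfolding gencircle_def G_def by blast
    moreover have "Z \<subseteq> P \<inter> G" using Z p YP by (auto simp: G_def)
    then have "card Z \<le> card (P \<inter> G)" using P by (intro card_mono) auto
    then have "n powr (1 - k) \<le> card (P \<inter> G)" using big \<open>n powr (1 - k) > 0\<close> by linarith
    ultimately show "\<exists>G. gencircle G \<and> real (card P) powr (1 - k) \<le> card (P \<inter> G)" unfolding n_def by blast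
  qed
qed

theorem rich_gencircle:
  "\<exists>c>0. \<exists>n0::nat. \<forall>P. finite P \<longrightarrow> n0 \<le> card P \<longrightarrow> (\<forall>x\<in>P. card (angles P x) < real (card P) powr (1 + c))
    \<longrightarrow> (\<exists>G. gencircle G \<and> real (card P) powr (23/25) \<le> card (P \<inter> G))"
proof -
  obtain J N0 where beck: "beck_bound (1/50) J N0" using robust_beck[of "1/50"] by auto
  define l where "l = 1000 * (8 * J + 44)"
  have l1: "1 \<le> l" by (simp add: l_def)
  obtain N where N: "common_zeros_le l l N" using ex_common_zeros_le by blast
  note step = thin_step[OF beck N l1]
  \<comment> \<open>Sums of up to \<open>l + 1\<close> directions grow by factors \<open>K\<close>
    of order \<open>x powr (2 * c)\<close>; this \<open>c\<close> keeps the total exponent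
    \<open>1 + 2 * c * (l + 1) + c\<close> at most 1.003, so that the sumsets stay below
    \<open>H\<close>.\<close>
  define c where "c = 1 / (1000 * (real l + 1))"
  have c: "0 < c" "c / 2 < c" "c < 1" "c < 1/50" by (auto simp: c_def l_def divide_simps)
  obtain n1 where line: "\<And>P. finite P \<Longrightarrow> n1 \<le> card P \<Longrightarrow> real (card P) / 2 \<le> card {x \<in> P. real (card (dirs P x)) < real (card P) powr (1 - c)}
    \<Longrightarrow> \<exists>G. gencircle G \<and> real (card P) powr (1 - c) \<le> card (P \<inter> G)"
    using degenerate_pins_on_line[of "c / 2" c] c by auto
  have l0: "real l > 0" using l1 by simp
  have c2: "2 * c * (real l + 1) + c \<le> 3/1000"
  proof -
    have "c * (real l + 1) = 1/1000" by (simp add: c_def)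
    moreover have "c * 1 \<le> c * (real l + 1)" using c by (intro mult_left_mono) auto
    ultimately show ?thesis by argo
  qed
  have "eventually (\<lambda>x::real. 76 * (76 ^ Suc l) * x powr (1 + 3/1000) \<le> x powr (201/200)) at_top" by real_asymp
  moreover have "eventually (\<lambda>x::real. x powr (201/200) < (x powr (1/500) / 1000) ^ 1000) at_top"
  proof -
    define V :: real where "V = 1000 ^ 1000"
    have V0: "V > 0" unfolding V_def by (rule zero_less_power) simp
    have "eventually (\<lambda>x::real. x powr (201/200) * V < x ^ 2 \<and> x > 0) at_top"
      by (intro eventually_conj; real_asymp)
    then show ?thesis
    proof eventually_elim
      case (elim x)
      have "(x powr (1/500)) ^ 1000 = (x powr (1/500)) powr real 1000" using elim by (subst powr_realpow) auto
      also have "\<dots> = x ^ 2" using elim by (simp add: powr_powr powr_numeral)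
      finally have "(x powr (1/500) / 1000) ^ 1000 = x ^ 2 / V" unfolding V_def by (simp only: power_divide)
      then show ?case using elim by (simp only: pos_less_divide_eq[OF V0])
    qed
  qed
  moreover have "eventually (\<lambda>x::real. 1000 \<le> x powr (1/500)) at_top" by real_asymp
  moreover have "eventually (\<lambda>x::real. x powr (1/1000) \<le> ((x powr (1/500))\<^sup>2 + 2) * x powr (49/50)) at_top" by real_asymp
  moreover have "eventually (\<lambda>x::real. ((x powr (1/500))\<^sup>2 + 2) * x powr (49/50) + x powr (23/25) + (2 * x powr (1/500) + 2) *
    (x powr (23/25) + ((x powr (1/500))\<^sup>2 + 1) * x powr (49/50) + 2 * x powr (19/20) * x powr (1/1000)) < x / 2) at_top" by real_asymp
  moreover have "eventually (\<lambda>x::real. 1 \<le> x) at_top" by real_asymp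
  moreover note eventually_scales[OF l_def, of N0 N]
  ultimately have "eventually (\<lambda>x::real. 76 * (76 ^ Suc l) * x powr (1 + 3/1000) \<le> x powr (201/200) \<and>
      x powr (201/200) < (x powr (1/500) / 1000) ^ 1000 \<and> 1000 \<le> x powr (1/500) \<and>
      x powr (1/1000) \<le> ((x powr (1/500))\<^sup>2 + 2) * x powr (49/50) \<and>
      ((x powr (1/500))\<^sup>2 + 2) * x powr (49/50) + x powr (23/25) + (2 * x powr (1/500) + 2) *
      (x powr (23/25) + ((x powr (1/500))\<^sup>2 + 1) * x powr (49/50) + 2 * x powr (19/20) * x powr (1/1000)) < x / 2 \<and>
      1 \<le> x \<and> scales J N0 l N (x powr (49/50)) (nat \<lfloor>x powr (1/1000)\<rfloor>) (x powr (19/20)) (x powr (23/25))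
    (x powr (201/200)) (x powr (2/5))) at_top" by (intro eventually_conj)
  from eventually_compose_filterlim[OF this filterlim_real_sequentially]
  obtain n2 :: nat where n2: "\<And>n. n2 \<le> n \<Longrightarrow> 76 * (76 ^ Suc l) * real n powr (1 + 3/1000) \<le> real n powr (201/200) \<and>
      real n powr (201/200) < (real n powr (1/500) / 1000) ^ 1000 \<and> 1000 \<le> real n powr (1/500) \<and>
      real n powr (1/1000) \<le> ((real n powr (1/500))\<^sup>2 + 2) * real n powr (49/50) \<and>
      ((real n powr (1/500))\<^sup>2 + 2) * real n powr (49/50) + real n powr (23/25) + (2 * real n powr (1/500) + 2) *
      (real n powr (23/25) + ((real n powr (1/500))\<^sup>2 + 1) * real n powr (49/50) + 2 * real n powr (19/20) * real n powr (1/1000)) < real n / 2 \<and>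
      1 \<le> real n \<and> scales J N0 l N (real n powr (49/50)) (nat \<lfloor>real n powr (1/1000)\<rfloor>) (real n powr (19/20)) (real n powr (23/25))
    (real n powr (201/200)) (real n powr (2/5))"
    unfolding eventually_at_top_linorder by blast
  have "\<exists>G. gencircle G \<and> real (card P) powr (23/25) \<le> card (P \<inter> G)"
    if P: "finite P" and n: "max n1 n2 \<le> card P" and ang: "\<forall>x\<in>P. card (angles P x) < real (card P) powr (1 + c)" for P
  proof (rule ccontr)
    assume none: "\<not> ?thesis"
    define x where "x = real (card P)"
    define Q where "Q = nat \<lfloor>x powr (1/500)\<rfloor>"
    define b where "b = nat \<lfloor>x powr (1/1000)\<rfloor>"
    define M where "M = x powr (49/50)"
    define q where "q = x powr (19/20)"
    define C where "C = x powr (23/25)"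
    define H where "H = x powr (201/200)"
    have N: "76 * (76 ^ Suc l) * x powr (1 + 3/1000) \<le> H" "H < (x powr (1/500) / 1000) ^ 1000" "1000 \<le> x powr (1/500)"
      "x powr (1/1000) \<le> ((x powr (1/500))\<^sup>2 + 2) * M"
      "((x powr (1/500))\<^sup>2 + 2) * M + C + (2 * x powr (1/500) + 2) * (C + ((x powr (1/500))\<^sup>2 + 1) * M + 2 * q * x powr (1/1000)) < x / 2"
      "1 \<le> x" "scales J N0 l N M b q C H (x powr (2/5))"
      using n2[of "card P"] n unfolding x_def b_def M_def q_def C_def H_def by (simp_all only: max.bounded_iff)
    have Qb: "real Q \<le> x powr (1/500)" "x powr (1/500) \<le> real (Suc Q)" "real b \<le> x powr (1/1000)" "0 \<le> M" "0 \<le> q" "0 \<le> C"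
      unfolding Q_def b_def M_def q_def C_def by (auto; linarith)+
    have gen: "\<forall>G. gencircle G \<longrightarrow> real (card (P \<inter> G)) < C"
      using none by (auto simp: not_le C_def x_def)
    \<comment> \<open>Pins with nearly \<open>n\<close> directions: only for them is the difference
      set small relative to the set of directions.\<close>
    define S0 where "S0 = {v \<in> P. x powr (1 - c) \<le> real (card (dirs P v))}"
    have S0P: "S0 \<subseteq> P" by (auto simp: S0_def)
    have sums: "real (card (nsum m (dirs P v))) \<le> H" if v: "v \<in> S0" and m: "m \<le> Suc l" for v m
    proof -
      define D where "D = dirs P v"
      have fD: "finite D" unfolding D_def by (rule card_dirs_diff(2)[OF P])
      have xc: "x powr (1 - c) \<le> card D" using v by (simp add: S0_def D_def)
      have xp: "x powr (1 - c) > 0" using N(6) by simp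
      then have D0: "D \<noteq> {}" using xc by auto
      have x1: "1 \<le> x powr (1 + c)" using N(6) c by (intro ge_one_powr_ge_zero) auto
      have "real (card (angles P v)) < x powr (1 + c)" using ang v S0P unfolding x_def by blast
      moreover have "real (card (D + uminus ` D)) \<le> real (38 * (card (angles P v) + 1))"
        unfolding D_def by (rule of_nat_mono[OF card_dirs_diff(1)[OF P]])
      ultimately have DD: "real (card (D + uminus ` D)) \<le> 76 * x powr (1 + c)" using x1 by simp
      define K where "K = 76 * x powr (2 * c)"
      have "x powr (1 + c) = x powr (2 * c) * x powr (1 - c)" by (simp add: add.commute flip: powr_add)
      also have "\<dots> \<le> x powr (2 * c) * card D" using xc by (intro mult_left_mono) auto
      finally have "real (card (D + uminus ` D)) \<le> K * card D" using DD by (simp add: K_def)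
      then have "real (card (nsum m D)) \<le> K ^ m * card D" by (rule small_doubling_nsum(1)[OF fD D0])
      also have "\<dots> \<le> K ^ Suc l * (76 * x powr (1 + c))"
      proof (intro mult_mono)
        have "1 \<le> x powr (2 * c)" using N(6) c by (intro ge_one_powr_ge_zero) auto
        then have "1 \<le> K" by (simp add: K_def)
        then show "K ^ m \<le> K ^ Suc l" using m by (intro power_increasing)
        obtain a where "a \<in> D" using D0 by blast
        have "finite (D + uminus ` D)" using fD by (simp add: finite_set_plus)
        then have "card ((\<lambda>d. d + - a) ` D) \<le> card (D + uminus ` D)" using \<open>a \<in> D\<close> by (intro card_mono image_subsetI set_plus_intro) auto
        moreover have "card ((\<lambda>d. d + - a) ` D) = card D" by (intro card_image) (auto simp: inj_on_def)
        ultimately show "real (card D) \<le> 76 * x powr (1 + c)" using DD by linarith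
      qed (auto simp: K_def)
      also have "\<dots> = 76 * 76 ^ Suc l * x powr (1 + (2 * c * (real l + 1) + c))"
      proof -
        have "(x powr (2 * c)) ^ Suc l = x powr (2 * c * (real l + 1))"
          using N(6) by (subst powr_realpow[symmetric]) (auto simp: powr_powr algebra_simps)
        then have "K ^ Suc l * (76 * x powr (1 + c)) = 76 * 76 ^ Suc l * (x powr (2 * c * (real l + 1)) * x powr (1 + c))"
          unfolding K_def power_mult_distrib by (simp only: mult_ac)
        then show ?thesis by (simp add: add_ac flip: powr_add)
      qed
      also have "\<dots> \<le> 76 * 76 ^ Suc l * x powr (1 + 3/1000)" using c2 N(6) by (intro mult_left_mono powr_mono) auto
      finally show ?thesis using N(1) unfolding D_def by linarith
    qed
    \<comment> \<open>A longer chain would yield, up to a constant factor, \<open>x ^ 2\<close> sums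
      of 1000 directions, which is more than \<open>H\<close>.\<close>
    have scl: "scl P Q v" if v: "v \<in> S0" for v
      unfolding scl_def
    proof (intro ballI allI impI, rule ccontr)
      fix z A assume z: "z \<in> P - {v}" and A: "A \<subseteq> P - {v}" "lac (sn v z) A" and gt: "\<not> real (card A) \<le> real Q"
      then have "real (Suc Q) \<le> real (card A)" by simp
      then have xA: "x powr (1/500) \<le> real (card A)" using Qb by linarith
      have A1000: "1000 \<le> card A" using xA N(3) by linarith
      have "H < (x powr (1/500) / 1000) ^ 1000" by (rule N(2))
      also have "\<dots> \<le> (real (card A) / real 1000) ^ 1000" using xA by (intro power_mono) auto
      also have "\<dots> \<le> real (card A choose 1000)" using binomial_ge_n_over_k_pow_k[OF A1000, where 'a=real] by simp
      also have "\<dots> \<le> real (card (nsum 1000 (dirs P v)))" by (rule of_nat_mono[OF lac_sines_card[OF P z A]])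
      also have "\<dots> \<le> H" using v by (rule sums) (simp add: l_def)
      finally show False by simp
    qed
    have cS0: "x / 2 \<le> card S0"
    proof (rule ccontr)
      assume "\<not> ?thesis"
      moreover have "P - S0 = {v \<in> P. real (card (dirs P v)) < x powr (1 - c)}" by (auto simp: S0_def)
      moreover have "real (card (P - S0)) = x - card S0"
        using P S0P card_mono[OF P S0P] finite_subset[OF S0P P] by (simp add: card_Diff_subset x_def of_nat_diff)
      ultimately have "x / 2 \<le> card {v \<in> P. real (card (dirs P v)) < x powr (1 - c)}" by simp
      then obtain G where "gencircle G" "x powr (1 - c) \<le> card (P \<inter> G)" using line[OF P] n unfolding x_def by auto
      moreover have "C \<le> x powr (1 - c)" unfolding C_def using N(6) c by (intro powr_mono) auto
      ultimately show False using gen by fastforce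
    qed
    \<comment> \<open>About \<open>x powr (0.98 + 0.004)\<close> points per step; even
      \<open>2 * Q + 2\<close> steps, a further \<open>x powr 0.002\<close>, lose less than half of
      the points.\<close>
    define loss where "loss = C + (real (Q * Q) + 1) * M + 2 * q * b"
    define L where "L = (real (Q * Q) + 2) * M + C"
    have Q2: "real (Q * Q) \<le> (x powr (1/500))\<^sup>2" using Qb(1) by (simp add: power2_eq_square mult_mono)
    have "real (card S0) \<le> max L (real b) + (2 * real Q + 2) * loss"
    proof (rule no_long_thinning[OF P S0P scl])
      fix S assume S: "S \<subseteq> S0" "max L (real b) < real (card S)"
      show "\<exists>S2 r. thins S S2 b r \<and> real (card S) - real (card S2) \<le> loss"
        unfolding loss_def
      proof (rule step[OF N(7) P])
        show "(real (Q * Q) + 2) * M + C < real (card S)" using S(2) by (simp add: L_def)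
        show "\<forall>x\<in>S. scl P (real Q) x" using scl S(1) by blast
        show "\<forall>x\<in>S. real (card (nsum l (dirs P x))) \<le> H \<and> real (card (nsum (Suc l) (dirs P x))) \<le> H"
          using sums[of _ l] sums[of _ "Suc l"] S(1) by auto
      qed (use S0P S(1) gen in auto)
    qed (use Qb in \<open>auto simp: loss_def\<close>)
    also have "\<dots> \<le> (((x powr (1/500))\<^sup>2 + 2) * M + C) + (2 * x powr (1/500) + 2) * (C + ((x powr (1/500))\<^sup>2 + 1) * M + 2 * q * x powr (1/1000))"
    proof (intro add_mono mult_mono max.boundedI)
      show "L \<le> ((x powr (1/500))\<^sup>2 + 2) * M + C" unfolding L_def using Q2 Qb by (intro add_mono mult_right_mono) auto
      show "real b \<le> ((x powr (1/500))\<^sup>2 + 2) * M + C" using Qb N(4) by linarith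
      show "loss \<le> C + ((x powr (1/500))\<^sup>2 + 1) * M + 2 * q * x powr (1/1000)"
        unfolding loss_def using Q2 Qb by (intro add_mono mult_mono) auto
      show "0 \<le> loss" using Qb by (simp add: loss_def)
    qed (use Qb in auto)
    also have "\<dots> < x / 2" using N(5) by linarith
    finally show False using cS0 by linarith
  qed
  then show ?thesis using c(1) by blast
qed

section \<open>Points off a rich line or circle\<close>

text \<open>Translated by \<open>a i\<close>, the positive differences not exceeding the gap after
  \<open>a i\<close> lie above \<open>a i\<close> and up to \<open>a (Suc i)\<close>. For different
  \<open>i\<close> these sets are disjoint, and all are contained in
  \<open>A + A - A\<close>.\<close>

lemma gap_rank_sum:
  fixes a :: "nat \<Rightarrow> real"
  assumes inc: "\<And>i j. i < j \<Longrightarrow> j \<le> m \<Longrightarrow> a i < a j" and A: "A = a ` {..m}"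
  shows "(\<Sum>i<m. card {d \<in> A + uminus ` A. 0 < d \<and> d \<le> a (Suc i) - a i}) \<le> card (A + A + uminus ` A)"
proof -
  define E where "E i = (+) (a i) ` {d \<in> A + uminus ` A. 0 < d \<and> d \<le> a (Suc i) - a i}" for i
  have fA: "finite A" using A by simp
  have fin: "finite (A + uminus ` A)" "finite (A + A + uminus ` A)" using fA by (auto simp: finite_set_plus)
  have disj: "E i \<inter> E j = {}" if "i < j" "j < m" for i j
  proof -
    have "a (Suc i) \<le> a j" using inc[of "Suc i" j] that by (cases "Suc i = j") (auto simp: less_imp_le)
    then show ?thesis by (auto simp: E_def)
  qed
  have "(\<Sum>i<m. card {d \<in> A + uminus ` A. 0 < d \<and> d \<le> a (Suc i) - a i}) = (\<Sum>i<m. card (E i))"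
    unfolding E_def by (intro sum.cong refl card_image[symmetric]) (auto simp: inj_on_def)
  also have "\<dots> = card (\<Union>i<m. E i)"
  proof (rule card_UN_disjoint[symmetric])
    show "\<forall>i\<in>{..<m}. \<forall>j\<in>{..<m}. i \<noteq> j \<longrightarrow> E i \<inter> E j = {}" using disj by (metis Int_commute lessThan_iff nat_neq_iff)
  qed (use fin in \<open>auto simp: E_def\<close>)
  also have "\<dots> \<le> card (A + A + uminus ` A)"
  proof (intro card_mono UN_least fin)
    fix i assume "i \<in> {..<m}"
    then have "a i \<in> A" by (simp add: A)
    then show "E i \<subseteq> A + A + uminus ` A" unfolding E_def add.assoc by (intro image_subsetI set_plus_intro) auto
  qed
  finally show ?thesis .
qed

lemma gap_rank_inj:
  fixes g h :: real
  assumes fin: "finite B" and gh: "g \<in> B" "h \<in> B" "0 < g" "0 < h"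
    and eq: "card {d \<in> B. 0 < d \<and> d \<le> g} = card {d \<in> B. 0 < d \<and> d \<le> h}"
  shows "g = h"
proof -
  have lt: False if "p < q" "q \<in> B" "0 < p" "card {d \<in> B. 0 < d \<and> d \<le> p} = card {d \<in> B. 0 < d \<and> d \<le> q}" for p q
  proof -
    have "q \<in> {d \<in> B. 0 < d \<and> d \<le> q} - {d \<in> B. 0 < d \<and> d \<le> p}" using that by auto
    moreover have "{d \<in> B. 0 < d \<and> d \<le> p} \<subseteq> {d \<in> B. 0 < d \<and> d \<le> q}" using that(1) by auto
    ultimately have "{d \<in> B. 0 < d \<and> d \<le> p} \<subset> {d \<in> B. 0 < d \<and> d \<le> q}" by blast
    then have "card {d \<in> B. 0 < d \<and> d \<le> p} < card {d \<in> B. 0 < d \<and> d \<le> q}" using fin by (intro psubset_card_mono) auto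
    then show False using that(4) by simp
  qed
  show ?thesis using lt[of g h] lt[of h g] gh eq by fastforce
qed

lemma few_large:
  fixes N :: "nat \<Rightarrow> nat"
  assumes "(\<Sum>i<m. N i) \<le> L" "L > 0"
  shows "4 * card {i. i < m \<and> 4 * L < N i * m} \<le> m"
proof -
  let ?B = "{i. i < m \<and> 4 * L < N i * m}"
  have "card ?B * (4 * L) = (\<Sum>i\<in>?B. 4 * L)" by simp
  also have "\<dots> \<le> (\<Sum>i\<in>?B. N i * m)" by (intro sum_mono) auto
  also have "\<dots> \<le> (\<Sum>i<m. N i * m)" by (intro sum_mono2) auto
  also have "\<dots> \<le> L * m" using assms(1) by (simp flip: sum_distrib_right)
  finally show ?thesis using assms(2) by (simp add: mult_ac)
qed

text \<open>Translates of the positive differences of \<open>A\<close> fill the gaps of \<open>A\<close>, so a typical gap of \<open>A\<close> is one of the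
  \<open>O(card (A + A - A) / m)\<close> smallest positive differences; the same holds for \<open>B\<close>, and a pair of gaps occurs at most twice.\<close>

lemma squeeze_sequences:
  fixes a b :: "nat \<Rightarrow> real"
  assumes a: "\<And>i j. i < j \<Longrightarrow> j \<le> m \<Longrightarrow> a i < a j" and b: "\<And>i j. i < j \<Longrightarrow> j \<le> m \<Longrightarrow> b i < b j"
    and A: "A = a ` {..m}" and B: "B = b ` {..m}"
    and mult: "\<And>i j k. i < j \<Longrightarrow> j < k \<Longrightarrow> k < m \<Longrightarrow> a (Suc i) - a i = a (Suc j) - a j \<Longrightarrow> a (Suc i) - a i = a (Suc k) - a k
      \<Longrightarrow> b (Suc i) - b i = b (Suc j) - b j \<Longrightarrow> b (Suc i) - b i = b (Suc k) - b k \<Longrightarrow> False"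
  shows "real m ^ 3 \<le> 64 * real (card (A + A + uminus ` A)) * real (card (B + B + uminus ` B))"
proof (cases "m = 0")
  case False
  define Na where "Na i = card {d \<in> A + uminus ` A. 0 < d \<and> d \<le> a (Suc i) - a i}" for i
  define Nb where "Nb i = card {d \<in> B + uminus ` B. 0 < d \<and> d \<le> b (Suc i) - b i}" for i
  define La where "La = card (A + A + uminus ` A)"
  define Lb where "Lb = card (B + B + uminus ` B)"
  have fA: "finite A" "finite B" using A B by auto
  have fin: "finite (A + uminus ` A)" "finite (A + A + uminus ` A)" "finite (B + uminus ` B)" "finite (B + B + uminus ` B)"
    using fA by (auto simp: finite_set_plus)
  have "a 0 + a 0 + - a 0 \<in> A + A + uminus ` A" "b 0 + b 0 + - b 0 \<in> B + B + uminus ` B"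
    using A B by (intro set_plus_intro; simp)+
  then have L0: "La > 0" "Lb > 0" unfolding La_def Lb_def using fin card_gt_0_iff by blast+
  have gap: "a (Suc i) - a i \<in> A + uminus ` A" "b (Suc i) - b i \<in> B + uminus ` B" if "i < m" for i
    unfolding diff_conv_add_uminus using A B that by (intro set_plus_intro; simp)+
  have pos: "0 < a (Suc i) - a i" "0 < b (Suc i) - b i" if "i < m" for i using a[of i "Suc i"] b[of i "Suc i"] that by auto
  define bad where "bad = {i. i < m \<and> 4 * La < Na i * m} \<union> {i. i < m \<and> 4 * Lb < Nb i * m}"
  define I where "I = {..<m} - bad"
  have "4 * card {i. i < m \<and> 4 * La < Na i * m} \<le> m" "4 * card {i. i < m \<and> 4 * Lb < Nb i * m} \<le> m"
    by (rule few_large; use gap_rank_sum[OF a A] gap_rank_sum[OF b B] L0 in \<open>simp add: Na_def Nb_def La_def Lb_def\<close>)+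
  moreover have "card bad \<le> card {i. i < m \<and> 4 * La < Na i * m} + card {i. i < m \<and> 4 * Lb < Nb i * m}"
    unfolding bad_def by (rule card_Un_le)
  moreover have "card I = m - card bad" unfolding I_def by (subst card_Diff_subset) (auto simp: bad_def)
  ultimately have I: "m \<le> 2 * card I" by linarith
  \<comment> \<open>A pair of ranks determines the pair of gaps, and by \<open>mult\<close> three
    indices cannot share it; so the at least \<open>m / 2\<close> good indices produce at least
    \<open>m / 4\<close> pairs of ranks.\<close>
  define f where "f i = (Na i, Nb i)" for i
  have fI: "finite I" by (simp add: I_def)
  have fib: "real (card {j \<in> I. f j = f i}) \<le> 2" if "i \<in> I" for i
  proof (rule ccontr)
    assume "\<not> ?thesis"
    then have three: "3 \<le> card {j \<in> I. f j = f i}" by linarith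
    obtain F where F: "F \<subseteq> {j \<in> I. f j = f i}" "card F = 3" "finite F" 
      by (rule obtain_subset_with_card_n[OF three])
    obtain h where h: "bij_betw h {..<card F} F" "strict_mono_on {..<card F} h"
      by (rule ex_bij_betw_strict_mono_card[OF F(3)])
    have hF: "h 0 \<in> F" "h 1 \<in> F" "h 2 \<in> F" using h(1) F(2) by (auto simp: bij_betw_def)
    have lt: "h 0 < h 1" "h 1 < h 2" using h(2) F(2) by (auto intro: strict_mono_onD)
    have sub: "h 0 < m" "h 1 < m" "h 2 < m" using hF F(1) by (auto simp: I_def)
    have N: "Na (h 0) = Na (h 1)" "Na (h 0) = Na (h 2)" "Nb (h 0) = Nb (h 1)" "Nb (h 0) = Nb (h 2)"
    proof -
      have "f (h 0) = f i" "f (h 1) = f i" "f (h 2) = f i" using hF F(1) by blast+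
      then show "Na (h 0) = Na (h 1)" "Na (h 0) = Na (h 2)" "Nb (h 0) = Nb (h 1)" "Nb (h 0) = Nb (h 2)" by (simp_all add: f_def)
    qed
    have eqa: "a (Suc i) - a i = a (Suc j) - a j" if "i < m" "j < m" "Na i = Na j" for i j
      using gap_rank_inj[OF fin(1) gap(1)[OF that(1)] gap(1)[OF that(2)]] pos that by (simp add: Na_def)
    have eqb: "b (Suc i) - b i = b (Suc j) - b j" if "i < m" "j < m" "Nb i = Nb j" for i j
      using gap_rank_inj[OF fin(3) gap(2)[OF that(1)] gap(2)[OF that(2)]] pos that by (simp add: Nb_def)
    show False by (rule mult[OF lt sub(3)]) (use eqa eqb sub N in blast)+
  qed
  have "real (card I) \<le> real (card (f ` I)) * 2" by (rule card_le_colours[OF fI fib])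
  moreover have "f ` I \<subseteq> {1..4 * La div m} \<times> {1..4 * Lb div m}"
  proof (rule image_subsetI)
    have ne: "card S > 0" if "x \<in> S" "S \<subseteq> B" "finite B" for x :: real and S B
      using that finite_subset card_gt_0_iff by (metis empty_iff)
    fix i assume i: "i \<in> I"
    then have im: "i < m" "Na i * m \<le> 4 * La" "Nb i * m \<le> 4 * Lb" by (auto simp: I_def bad_def)
    have "a (Suc i) - a i \<in> {d \<in> A + uminus ` A. 0 < d \<and> d \<le> a (Suc i) - a i}"
      "b (Suc i) - b i \<in> {d \<in> B + uminus ` B. 0 < d \<and> d \<le> b (Suc i) - b i}"
      using gap[OF im(1)] pos[OF im(1)] by simp_all
    then have "Na i > 0" "Nb i > 0" unfolding Na_def Nb_def by - (erule ne[OF _ Collect_restrict fin(1)], erule ne[OF _ Collect_restrict fin(3)])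
    then show "f i \<in> {1..4 * La div m} \<times> {1..4 * Lb div m}"
      using im False by (simp add: f_def less_eq_div_iff_mult_less_eq)
  qed
  then have "card (f ` I) \<le> card ({1..4 * La div m} \<times> {1..4 * Lb div m})" by (intro card_mono) auto
  moreover have "real (card (f ` I)) \<le> real ((4 * La div m) * (4 * Lb div m))" if "card (f ` I) \<le> card ({1..4 * La div m} \<times> {1..4 * Lb div m})"
    using that by (simp only: card_cartesian_product card_atLeastAtMost of_nat_le_iff) simp
  ultimately have "real m \<le> 4 * real ((4 * La div m) * (4 * Lb div m))" using I by linarith
  also have "\<dots> \<le> 4 * ((4 * La / m) * (4 * Lb / m))"
    unfolding of_nat_mult by (intro mult_left_mono mult_mono of_nat_div_le_of_nat[THEN order_trans]) auto
  finally show ?thesis using False unfolding La_def Lb_def by (simp add: field_simps power3_eq_cube)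
qed simp

lemma affine_image_tripling:
  fixes A D :: "real set"
  assumes D: "finite D" and \<sigma>: "\<sigma> \<noteq> 0" and AD: "\<And>a. a \<in> A \<Longrightarrow> \<sigma> * a + \<beta> \<in> D"
  shows "card (A + A + uminus ` A) \<le> card (D + D + uminus ` D)" "card A \<le> card D"
proof -
  have inj: "inj_on (\<lambda>a. \<sigma> * a + \<beta>) S" for S using \<sigma> by (auto simp: inj_on_def)
  have fin: "finite (D + D + uminus ` D)" using D by (auto simp: finite_set_plus)
  show "card (A + A + uminus ` A) \<le> card (D + D + uminus ` D)"
  proof (rule card_inj_on_le[OF inj _ fin], rule image_subsetI)
    fix s assume "s \<in> A + A + uminus ` A"
    then obtain a b c where s: "a \<in> A" "b \<in> A" "c \<in> A" "s = a + b + - c" by (auto elim!: set_plus_elim)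
    have "\<sigma> * s + \<beta> = (\<sigma> * a + \<beta>) + (\<sigma> * b + \<beta>) + - (\<sigma> * c + \<beta>)" by (simp add: s(4) algebra_simps)
    also have "\<dots> \<in> D + D + uminus ` D" using AD s by (intro set_plus_intro imageI) auto
    finally show "\<sigma> * s + \<beta> \<in> D + D + uminus ` D" .
  qed
  show "card A \<le> card D" by (rule card_inj_on_le[OF inj _ D]) (use AD in auto)
qed

text \<open>By Cauchy's mean value theorem a repeated pair of gaps repeats a value of \<open>\<phi>' / \<psi>'\<close>.\<close>

lemma two_pin_bound:
  fixes \<phi> \<psi> \<phi>' \<psi>' :: "real \<Rightarrow> real"
  assumes T: "finite T" "T \<noteq> {}" and D: "finite D1" "finite D2" and \<sigma>: "\<sigma>1 \<noteq> 0" "\<sigma>2 \<noteq> 0"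
    and dir: "\<And>x. x \<in> T \<Longrightarrow> \<sigma>1 * \<phi> x + \<beta>1 \<in> D1" "\<And>x. x \<in> T \<Longrightarrow> \<sigma>2 * \<psi> x + \<beta>2 \<in> D2"
    and deriv: "\<And>x. (\<phi> has_real_derivative \<phi>' x) (at x)" "\<And>x. (\<psi> has_real_derivative \<psi>' x) (at x)"
    and pos: "\<And>s x t. s \<in> T \<Longrightarrow> t \<in> T \<Longrightarrow> s < x \<Longrightarrow> x < t \<Longrightarrow> 0 < \<phi>' x \<and> 0 < \<psi>' x"
    and two: "\<And>x y z g h. x < y \<Longrightarrow> y < z \<Longrightarrow> 0 < g \<Longrightarrow> 0 < h \<Longrightarrow> g * \<psi>' x = h * \<phi>' x \<Longrightarrow> g * \<psi>' y = h * \<phi>' y \<Longrightarrow> g * \<psi>' z = h * \<phi>' z \<Longrightarrow> False"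
    and X: "real (card (D1 + uminus ` D1)) \<le> X" "real (card (D2 + uminus ` D2)) \<le> X"
  shows "(real (card T) - 1) ^ 7 \<le> 64 * X ^ 6"
proof -
  define m where "m = card T - 1"
  have cT: "card T = Suc m" using T by (simp add: m_def card_gt_0_iff)
  define t where "t i = sorted_list_of_set T ! i" for i
  have len: "length (sorted_list_of_set T) = Suc m" using T cT by simp
  have "T = set (sorted_list_of_set T)" using T by simp
  then have tT: "T = t ` {..m}" by (subst (asm) set_conv_nth) (auto simp: cT t_def less_Suc_eq_le image_def)
  have tlt: "t i < t j" if "i < j" "j \<le> m" for i j
    unfolding t_def using that len by (intro sorted_wrt_nth_less[OF strict_sorted_list_of_set]) auto
  have tin: "t i \<in> T" if "i \<le> m" for i using that by (auto simp: tT)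
  have inc: "\<phi> (t i) < \<phi> (t j)" "\<psi> (t i) < \<psi> (t j)" if ij: "i < j" "j \<le> m" for i j
  proof -
    have "t i \<in> T" "t j \<in> T" using tin ij by auto
    then show "\<phi> (t i) < \<phi> (t j)" "\<psi> (t i) < \<psi> (t j)"
      using deriv pos
      by (intro DERIV_pos_imp_increasing_open[OF tlt[OF ij]]; meson DERIV_isCont continuous_at_imp_continuous_on)+
  qed
  define A where "A = (\<lambda>i. \<phi> (t i)) ` {..m}"
  define B where "B = (\<lambda>i. \<psi> (t i)) ` {..m}"
  have cont: "isCont \<phi> x" "isCont \<psi> x" for x using deriv DERIV_isCont by blast+
  have mvt: "\<exists>x. t i < x \<and> x < t (Suc i) \<and> (\<phi> (t (Suc i)) - \<phi> (t i)) * \<psi>' x = (\<psi> (t (Suc i)) - \<psi> (t i)) * \<phi>' x" if "i < m" for i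
    by (rule GMVT') (use tlt[of i "Suc i"] that deriv cont in auto)
  have "real m ^ 3 \<le> 64 * real (card (A + A + uminus ` A)) * real (card (B + B + uminus ` B))"
  proof (rule squeeze_sequences[OF inc A_def B_def])
    fix i j k assume ijk: "i < j" "j < k" "k < m"
    assume eq: "\<phi> (t (Suc i)) - \<phi> (t i) = \<phi> (t (Suc j)) - \<phi> (t j)" "\<phi> (t (Suc i)) - \<phi> (t i) = \<phi> (t (Suc k)) - \<phi> (t k)"
      "\<psi> (t (Suc i)) - \<psi> (t i) = \<psi> (t (Suc j)) - \<psi> (t j)" "\<psi> (t (Suc i)) - \<psi> (t i) = \<psi> (t (Suc k)) - \<psi> (t k)"
    have ijk': "i < m" "j < m" using ijk by auto
    obtain x where x: "t i < x" "x < t (Suc i)" "(\<phi> (t (Suc i)) - \<phi> (t i)) * \<psi>' x = (\<psi> (t (Suc i)) - \<psi> (t i)) * \<phi>' x"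
      using mvt[OF ijk'(1)] by blast
    obtain y where y: "t j < y" "y < t (Suc j)" "(\<phi> (t (Suc j)) - \<phi> (t j)) * \<psi>' y = (\<psi> (t (Suc j)) - \<psi> (t j)) * \<phi>' y"
      using mvt[OF ijk'(2)] by blast
    obtain z where z: "t k < z" "z < t (Suc k)" "(\<phi> (t (Suc k)) - \<phi> (t k)) * \<psi>' z = (\<psi> (t (Suc k)) - \<psi> (t k)) * \<phi>' z"
      using mvt[OF ijk(3)] by blast
    have le: "t (Suc p) \<le> t q" if "p < q" "q < m" for p q using tlt[of "Suc p" q] that by (cases "Suc p = q") (auto simp: less_imp_le)
    have "x < y" "y < z" using x(2) y(1,2) z(1) le[of i j] le[of j k] ijk by auto
    moreover have "0 < \<phi> (t (Suc i)) - \<phi> (t i)" "0 < \<psi> (t (Suc i)) - \<psi> (t i)" using inc[of i "Suc i"] ijk' by auto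
    ultimately show False using two x(3) y(3) z(3) unfolding eq[symmetric] by blast
  qed auto
  also have "\<dots> \<le> 64 * (X ^ 3 / real m ^ 2) * (X ^ 3 / real m ^ 2)" if "m > 0"
  proof -
    \<comment> \<open>With \<open>K = X / card D\<close>, \<open>D + D - D\<close> has at most
      \<open>K ^ 3 * card D = X ^ 3 / (card D)\<^sup>2\<close> elements; inserted into
      \<open>squeeze_sequences\<close> this gives \<open>m ^ 7 \<le> 64 * X ^ 6\<close>.\<close>
    have trip: "real (card (C + C + uminus ` C)) \<le> X ^ 3 / real m ^ 2"
      if D: "finite D" and C: "\<And>a. a \<in> C \<Longrightarrow> \<sigma> * a + \<beta> \<in> D" "\<sigma> \<noteq> 0" "m \<le> card C" and X: "real (card (D + uminus ` D)) \<le> X" for C D :: "real set" and \<sigma> \<beta>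
    proof -
      have mD: "m \<le> card D" using C(3) affine_image_tripling(2)[of D \<sigma> C \<beta>, OF D C(2,1)] by linarith
      then have D0: "D \<noteq> {}" "real (card D) > 0" using \<open>m > 0\<close> by auto
      have "card (C + C + uminus ` C) \<le> card (D + D + uminus ` D)" by (rule affine_image_tripling(1)[of D \<sigma> C \<beta>, OF D C(2,1)])
      moreover have "real (card (D + D + uminus ` D)) \<le> (X / card D) ^ 3 * card D"
        using X D0 by (intro small_doubling_nsum(2)[OF D]) auto
      moreover have "(X / card D) ^ 3 * card D = X ^ 3 / real (card D) ^ 2" using D0 by (simp add: field_simps eval_nat_numeral)
      moreover have "X ^ 3 / real (card D) ^ 2 \<le> X ^ 3 / real m ^ 2"
        using mD \<open>m > 0\<close> order_trans[OF of_nat_0_le_iff X] by (intro divide_left_mono power_mono mult_pos_pos zero_le_power) auto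
      ultimately show ?thesis by linarith
    qed
    have "inj_on (\<lambda>i. \<phi> (t i)) {..m}" "inj_on (\<lambda>i. \<psi> (t i)) {..m}"
      by (rule linorder_inj_onI; use inc in fastforce)+
    then have c: "m \<le> card A" "m \<le> card B" unfolding A_def B_def by (simp_all add: card_image)
    have X0: "0 \<le> X ^ 3 / real m ^ 2" using order_trans[OF of_nat_0_le_iff X(1)] by simp
    show ?thesis unfolding mult.assoc
    proof (intro mult_left_mono mult_mono X0)
      show "real (card (A + A + uminus ` A)) \<le> X ^ 3 / real m ^ 2"
        by (rule trip[OF D(1) _ \<sigma>(1) c(1) X(1), of \<beta>1]) (use dir tin in \<open>auto simp: A_def\<close>)
      show "real (card (B + B + uminus ` B)) \<le> X ^ 3 / real m ^ 2"
        by (rule trip[OF D(2) _ \<sigma>(2) c(2) X(2), of \<beta>2]) (use dir tin in \<open>auto simp: B_def\<close>)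
    qed auto
  qed
  finally have "real m ^ 3 \<le> 64 * (X ^ 3 / real m ^ 2) * (X ^ 3 / real m ^ 2)" if "m > 0" using that .
  then have "real m ^ 7 \<le> 64 * X ^ 6" if "m > 0" using that by (simp add: field_simps eval_nat_numeral)
  moreover have "0 \<le> 64 * X ^ 6" by simp
  ultimately show ?thesis using cT by (cases "m = 0") auto
qed

section \<open>Directions to points of a line or circle as functions of a parameter\<close>

lemma one_plus_ii_arctan: "1 + \<i> * of_real y = of_real (sqrt (1 + y\<^sup>2)) * cis (arctan y)"
proof -
  have "sqrt (1 + y\<^sup>2) \<noteq> 0" by (simp add: add_nonneg_eq_0_iff)
  then show ?thesis by (simp add: complex_eq_iff cos_arctan sin_arctan)
qed

lemma in_dirsI: "z \<in> P \<Longrightarrow> z \<noteq> u \<Longrightarrow> \<bar>\<phi>\<bar> \<le> 4 * pi \<Longrightarrow> z - u = of_real r * cis \<phi> \<Longrightarrow> \<phi> \<in> dirs P u"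
  unfolding dirs_def by (auto intro!: bexI[of _ z] simp: cr_scale_right cr_self)

lemma quadratic_three_roots:
  fixes a b c x y z :: real
  assumes "x < y" "y < z" and r: "a * x\<^sup>2 + b * x + c = 0" "a * y\<^sup>2 + b * y + c = 0" "a * z\<^sup>2 + b * z + c = 0"
  shows "a = 0 \<and> b = 0 \<and> c = 0"
proof -
  have "(y - x) * (a * (x + y) + b) = 0" "(z - y) * (a * (y + z) + b) = 0"
    using r by (auto simp: algebra_simps power2_eq_square)
  then have e: "a * (x + y) + b = 0" "a * (y + z) + b = 0" using assms(1,2) by auto
  have "a * (z - x) = (a * (y + z) + b) - (a * (x + y) + b)" by (simp add: algebra_simps)
  then have "a * (z - x) = 0" using e by simp
  then have "a = 0" using assms(1,2) by simp
  then show ?thesis using e r by simp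
qed

text \<open>With \<open>pos\<close> along and \<open>ht\<close> across the line, \<open>w\<close>
  sees the point at position \<open>s\<close> in the direction
  \<open>arctan ((s - pos w) / ht w)\<close> up to a constant. A ratio of derivatives taken three
  times makes two quadratics proportional, hence \<open>pos\<close> equal and \<open>ht\<close>
  opposite: only a mirror pair escapes.\<close>

lemma off_line_pins:
  assumes P: "finite P" and e: "norm e = 1" and uv: "u \<in> P" "v \<in> P" "u \<noteq> v" "cr e (u - p) \<noteq> 0" "cr e (v - p) \<noteq> 0"
    and few: "\<And>x. x \<in> P \<Longrightarrow> real (card (dirs P x + uminus ` dirs P x)) \<le> X"
    and m: "m = card (P \<inter> {z. cr e (z - p) = 0})" "1 \<le> m" "64 * X ^ 6 < (real m - 1) ^ 7"
  shows "cr e (v - p) = - cr e (u - p) \<and> Re (cnj e * (v - u)) = 0"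
proof -
  define pos where "pos z = Re (cnj e * (z - p))" for z
  have ee: "e * cnj e = 1" using e by (metis complex_norm_square mult_1 of_real_1 power_one)
  define ht where "ht z = cr e (z - p)" for z
  have coord: "z = p + e * (of_real (pos z) + \<i> * of_real (ht z))" for z
  proof -
    have "cnj e * (z - p) = of_real (pos z) + \<i> * of_real (ht z)" by (simp add: complex_eq_iff pos_def ht_def cr_def)
    then have "e * (of_real (pos z) + \<i> * of_real (ht z)) = (e * cnj e) * (z - p)" by (simp only: mult.assoc)
    then show ?thesis using ee by simp
  qed
  define S where "S = P \<inter> {z. cr e (z - p) = 0}"
  define T where "T = pos ` S"
  have "inj_on pos S"
  proof (rule inj_onI)
    fix y z assume "y \<in> S" "z \<in> S" "pos y = pos z"
    moreover from this have "ht y = ht z" by (simp add: S_def ht_def)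
    ultimately show "y = z" using coord[of y] coord[of z] by metis
  qed
  then have cT: "card T = m" by (simp add: T_def card_image S_def m(1))
  have fT: "finite T" using P by (simp add: T_def S_def)
  have T0: "T \<noteq> {}" using cT m(2) by auto
  \<comment> \<open>The absolute value makes both functions increasing; the sign returns as the
    factors \<open>\<sigma>1\<close> and \<open>\<sigma>2\<close> of
    \<open>two_pin_bound\<close>.\<close>
  define k where "k w = \<bar>ht w\<bar>" for w
  define \<beta> where "\<beta> = Arg e - pi / 2"
  have "e \<noteq> 0" using e by auto
  then have eA: "cis (Arg e) = e" using e by (simp add: cis_Arg sgn_eq)
  have ci: "cis (- (pi / 2)) = - \<i>" by (simp add: complex_eq_iff)
  define \<phi> where "\<phi> w s = arctan ((s - pos w) / k w)" for w s
  define \<phi>' where "\<phi>' w s = k w / ((k w)\<^sup>2 + (s - pos w)\<^sup>2)" for w s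
  have kp: "k u > 0" "k v > 0" using uv by (auto simp: k_def ht_def)
  have dir: "sgn (ht w) * \<phi> w s + \<beta> \<in> dirs P w" if w: "ht w \<noteq> 0" and s: "s \<in> T" for w s
  proof -
    obtain z where z: "z \<in> S" "s = pos z" using s by (auto simp: T_def)
    define h where "h = ht w"
    have hz: "ht z = 0" using z by (simp add: S_def ht_def)
    define y where "y = (s - pos w) / h"
    have "z - w = (p + e * (of_real (pos z) + \<i> * of_real (ht z))) - (p + e * (of_real (pos w) + \<i> * of_real (ht w)))"
      using coord[of z] coord[of w] by (rule arg_cong2)
    also have "\<dots> = e * (of_real (s - pos w) - \<i> * of_real h)"
      by (simp add: z(2) hz h_def algebra_simps)
    also have "of_real (s - pos w) - \<i> * of_real h = of_real h * (- \<i> * (1 + \<i> * of_real y))"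
      using w by (simp add: complex_eq_iff y_def h_def)
    also have "e * \<dots> = of_real (h * sqrt (1 + y\<^sup>2)) * (cis (Arg e) * cis (- (pi / 2)) * cis (arctan y))"
      unfolding one_plus_ii_arctan eA ci of_real_mult by (simp only: mult_ac)
    also have "\<dots> = of_real (h * sqrt (1 + y\<^sup>2)) * cis (arctan y + \<beta>)" by (simp only: cis_mult \<beta>_def diff_conv_add_uminus add_ac)
    finally have zw: "z - w = of_real (h * sqrt (1 + y\<^sup>2)) * cis (arctan y + \<beta>)" .
    have ar: "sgn (ht w) * \<phi> w s = arctan y"
      using w by (cases "h > 0") (auto simp: \<phi>_def k_def y_def h_def sgn_if arctan_minus[symmetric])
    have "z \<noteq> w" using hz w by auto
    moreover have "\<bar>arctan y + \<beta>\<bar> \<le> 4 * pi" using arctan_bounded[of y] Arg_bounded[of e] unfolding \<beta>_def by linarith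
    ultimately show ?thesis unfolding ar using z by (intro in_dirsI[OF _ _ _ zw]) (auto simp: S_def)
  qed
  have "(real (card T) - 1) ^ 7 \<le> 64 * X ^ 6" if neg: "\<not> ?thesis"
  proof (rule two_pin_bound[OF fT T0 _ _ _ _ dir dir, where \<phi>' = "\<phi>' u" and \<psi>' = "\<phi>' v"])
    show "finite (dirs P u)" "finite (dirs P v)" by (rule card_dirs_diff(2)[OF P])+
    have "(\<phi> w has_real_derivative \<phi>' w x) (at x)" if "k w > 0" for w x
      unfolding \<phi>_def \<phi>'_def using that
      by (auto intro!: derivative_eq_intros simp: divide_simps power2_eq_square)
    then show "(\<phi> u has_real_derivative \<phi>' u x) (at x)" "(\<phi> v has_real_derivative \<phi>' v x) (at x)" for x using kp by auto
    have q: "0 < (k w)\<^sup>2 + (x - pos w)\<^sup>2" if "k w > 0" for w x using that by (simp add: add_pos_nonneg)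
    show "0 < \<phi>' u x \<and> 0 < \<phi>' v x" for x using kp q by (simp add: \<phi>'_def)
    fix x y z g h :: real
    assume xyz: "x < y" "y < z" and gh: "0 < g" "0 < h"
      and eq: "g * \<phi>' v x = h * \<phi>' u x" "g * \<phi>' v y = h * \<phi>' u y" "g * \<phi>' v z = h * \<phi>' u z"
    have "(g * k v - h * k u) * x\<^sup>2 + 2 * (h * k u * pos v - g * k v * pos u) * x
      + (g * k v * ((k u)\<^sup>2 + (pos u)\<^sup>2) - h * k u * ((k v)\<^sup>2 + (pos v)\<^sup>2)) = 0" if "g * \<phi>' v x = h * \<phi>' u x" for x
    proof -
      have ne: "(k u)\<^sup>2 + (x - pos u)\<^sup>2 \<noteq> 0" "(k v)\<^sup>2 + (x - pos v)\<^sup>2 \<noteq> 0"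
        using q[OF kp(1), of x] q[OF kp(2), of x] by linarith+
      have "g * k v * ((k u)\<^sup>2 + (x - pos u)\<^sup>2) = h * k u * ((k v)\<^sup>2 + (x - pos v)\<^sup>2)"
        using that unfolding \<phi>'_def times_divide_eq_right frac_eq_eq[OF ne(2,1)] .
      then show ?thesis by (simp add: power2_eq_square algebra_simps)
    qed
    from quadratic_three_roots[OF xyz this[OF eq(1)] this[OF eq(2)] this[OF eq(3)]]
    have a: "g * k v = h * k u" and b: "g * k v * pos u = h * k u * pos v"
      and c: "g * k v * ((k u)\<^sup>2 + (pos u)\<^sup>2) = h * k u * ((k v)\<^sup>2 + (pos v)\<^sup>2)" by auto
    have hk: "h * k u \<noteq> 0" using gh kp by simp
    have puv: "pos u = pos v" using b hk unfolding a by simp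
    then have "(k u)\<^sup>2 = (k v)\<^sup>2" using c hk unfolding a by simp
    then have "ht u = ht v \<or> ht v = - ht u" using kp by (auto simp: k_def power2_eq_iff)
    moreover have "ht u \<noteq> ht v" using coord[of u] coord[of v] puv uv(3) by metis
    moreover have "cnj e * (v - u) = cnj e * (v - p) - cnj e * (u - p)" by (simp add: algebra_simps)
    then have "Re (cnj e * (v - u)) = 0" using puv by (simp add: pos_def)
    ultimately show False using neg by (simp add: ht_def)
  qed (use uv few in \<open>auto simp: sgn_if ht_def\<close>)
  then show ?thesis using m cT by fastforce
qed

text \<open>The derivative of \<open>arctan x + arctan (l * x)\<close> has the sign of
  \<open>(1 + l) * (1 + l * x\<^sup>2)\<close>, which is constant for positive \<open>l\<close> and
  changes at two points for negative \<open>l \<noteq> -1\<close>.\<close>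

lemma arctan_sum_deriv_eq:
  fixes l x :: real
  shows "1 / (1 + x\<^sup>2) + l / (1 + (l * x)\<^sup>2) = (1 + l) * (1 + l * x\<^sup>2) / ((1 + x\<^sup>2) * (1 + (l * x)\<^sup>2))"
proof -
  have "1 + x\<^sup>2 \<noteq> 0" "1 + (l * x)\<^sup>2 \<noteq> 0" by (simp_all add: add_nonneg_eq_0_iff)
  then have "1 / (1 + x\<^sup>2) + l / (1 + (l * x)\<^sup>2) = (1 * (1 + (l * x)\<^sup>2) + l * (1 + x\<^sup>2)) / ((1 + x\<^sup>2) * (1 + (l * x)\<^sup>2))"
    by (rule add_frac_eq)
  also have "1 * (1 + (l * x)\<^sup>2) + l * (1 + x\<^sup>2) = (1 + l) * (1 + l * x\<^sup>2)" by (simp add: power2_eq_square algebra_simps)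
  finally show ?thesis .
qed

text \<open>Half-angle parametrization of the circle: seen from a point of the circle the direction is \<open>arctan x\<close> up to a constant,
  seen from \<open>c + \<kappa> \<rho> cis \<alpha>\<close> it is \<open>arctan x + arctan (\<lambda> x)\<close> with \<open>\<lambda> = (1 + \<kappa>) / (1 - \<kappa>)\<close>.\<close>

lemma off_circle_pin_is_centre:
  assumes P: "finite P" and \<rho>: "\<rho> > 0" and u: "u \<in> P" "norm (u - c) \<noteq> \<rho>"
    and few: "\<And>x. x \<in> P \<Longrightarrow> real (card (dirs P x + uminus ` dirs P x)) \<le> X"
    and m: "m = card (P \<inter> {z. norm (z - c) = \<rho>})" "5 \<le> m" "64 * X ^ 6 < ((real m - 2) / 3 - 1) ^ 7"
  shows "u = c"
proof (rule ccontr)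
  assume uc: "u \<noteq> c"
  define \<alpha> where "\<alpha> = Arg (u - c)"
  define \<kappa> where "\<kappa> = norm (u - c) / \<rho>"
  define l where "l = (1 + \<kappa>) / (1 - \<kappa>)"
  have \<kappa>: "\<kappa> > 0" "\<kappa> \<noteq> 1" using uc u(2) \<rho> by (auto simp: \<kappa>_def)
  have l1: "(1 + l > 0 \<and> l > 0) \<or> (1 + l < 0 \<and> l < 0)" "l\<^sup>2 \<noteq> 1"
  proof -
    have l2: "1 + l = 2 / (1 - \<kappa>)" using \<kappa> by (simp add: l_def divide_simps)
    then show "(1 + l > 0 \<and> l > 0) \<or> (1 + l < 0 \<and> l < 0)"
      using \<kappa> by (cases "\<kappa> < 1") (auto simp: l_def divide_simps)
    \<comment> \<open>This is where the centre is exceptional: equality would mean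
      \<open>\<kappa> = 0\<close>.\<close>
    show "l\<^sup>2 \<noteq> 1" unfolding power2_eq_1_iff using \<kappa> by (auto simp: l_def divide_simps)
  qed
  have uc': "u - c = of_real (\<rho> * \<kappa>) * cis \<alpha>"
    using \<rho> rcis_cmod_Arg[of "u - c"] by (simp add: \<kappa>_def \<alpha>_def rcis_def)
  define S0 where "S0 = P \<inter> {z. norm (z - c) = \<rho>}"
  have fS0: "finite S0" using P by (simp add: S0_def)
  have "S0 \<noteq> {}" using m by (auto simp: S0_def)
  then obtain w where w: "w \<in> S0" by blast
  \<comment> \<open>Besides the pin \<open>w\<close>, the point with \<open>arg z = pi\<close> is
    left out, where the half-angle parametrization breaks down.\<close>
  define S where "S = S0 - {w, c - of_real \<rho> * cis \<alpha>}"
  have "card S0 - card {w, c - of_real \<rho> * cis \<alpha>} \<le> card S" unfolding S_def by (rule diff_card_le_card_Diff) simp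
  moreover have "card {w, c - of_real \<rho> * cis \<alpha>} \<le> 2" by (simp add: card_insert_if)
  ultimately have cS: "m - 2 \<le> card S" using m by (simp add: S0_def)
  define arg where "arg z = Arg ((z - c) / (of_real \<rho> * cis \<alpha>))" for z
  have zarg: "z = c + of_real \<rho> * cis (\<alpha> + arg z)" if "z \<in> S0" for z
  proof -
    have "norm ((z - c) / (of_real \<rho> * cis \<alpha>)) = 1" using that \<rho> by (simp add: S0_def norm_divide norm_mult)
    then have "(z - c) / (of_real \<rho> * cis \<alpha>) = cis (arg z)" using rcis_cmod_Arg[of "(z - c) / (of_real \<rho> * cis \<alpha>)"]
      by (simp add: arg_def rcis_def)
    then show ?thesis using \<rho> by (simp add: field_simps flip: cis_mult)
  qed
  define t where "t z = tan (arg z / 2)" for z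
  have zt: "arg z = 2 * arctan (t z)" if z: "z \<in> S" for z
  proof -
    have "arg z \<noteq> pi" using zarg[of z] z by (auto simp: S_def cis_mult[symmetric])
    then have "- (pi / 2) < arg z / 2" "arg z / 2 < pi / 2" using Arg_bounded[of "(z - c) / (of_real \<rho> * cis \<alpha>)"] by (auto simp: arg_def)
    then show ?thesis unfolding t_def by (simp add: arctan_tan)
  qed
  define T where "T = t ` S"
  have "inj_on t S"
  proof (rule inj_onI)
    fix y z assume "y \<in> S" "z \<in> S" "t y = t z"
    then show "y = z" using zarg[of y] zarg[of z] zt[of y] zt[of z] by (simp add: S_def)
  qed
  then have "card T = card S" by (simp add: T_def card_image)
  then have cT: "real m - 2 \<le> real (card T)" using cS by simp
  have fT: "finite T" using fS0 by (simp add: T_def S_def)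
  have ab: "\<bar>\<alpha>\<bar> \<le> pi" "\<bar>arg w\<bar> \<le> pi" "\<bar>arctan x\<bar> \<le> pi / 2" for x
    using Arg_bounded[of "u - c"] Arg_bounded[of "(w - c) / (of_real \<rho> * cis \<alpha>)"] arctan_bounded[of x]
    unfolding \<alpha>_def arg_def by linarith+
  have dirw: "1 * arctan x + (\<alpha> + arg w / 2 + pi / 2) \<in> dirs P w" if x: "x \<in> T" for x
  proof -
    obtain z where z: "z \<in> S" "x = t z" using x by (auto simp: T_def)
    \<comment> \<open>\<open>A\<close> and \<open>B\<close> are half the sum and half the difference
      of the arguments of \<open>z\<close> and \<open>w\<close>; the chord has direction
      \<open>A + pi / 2\<close>.\<close>
    define A where "A = \<alpha> + (arctan x + arg w / 2)"
    define B where "B = arctan x - arg w / 2"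
    have zS: "z \<in> S0" using z by (simp add: S_def)
    have AB: "\<alpha> + arg z = A + B" "\<alpha> + arg w = A - B" using zt[OF z(1)] z(2) by (simp_all add: A_def B_def)
    have "z - w = (c + of_real \<rho> * cis (A + B)) - (c + of_real \<rho> * cis (A - B))"
      using zarg[OF zS] zarg[OF w] unfolding AB by (rule arg_cong2)
    also have "\<dots> = of_real \<rho> * (cis (A + B) - cis (A - B))" by (simp add: algebra_simps)
    also have "\<dots> = of_real (2 * \<rho> * sin B) * cis (A + pi / 2)"
      by (simp add: complex_eq_iff cos_add sin_add cos_diff sin_diff algebra_simps)
    finally have zw: "z - w = of_real (2 * \<rho> * sin B) * cis (A + pi / 2)" .
    have "\<bar>A + pi / 2\<bar> \<le> 4 * pi" using ab(1,2) ab(3)[of x] unfolding A_def by linarith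
    then have "A + pi / 2 \<in> dirs P w" using z w by (intro in_dirsI[OF _ _ _ zw]) (auto simp: S_def S0_def)
    then show ?thesis by (simp add: A_def add_ac)
  qed
  have diru: "arctan x + arctan (l * x) + \<alpha> \<in> dirs P u" if x: "x \<in> T" for x
  proof -
    obtain z where z: "z \<in> S" "x = t z" using x by (auto simp: T_def)
    define E where "E = cis \<alpha>"
    have az: "arg z = arctan x + arctan x" using zt[OF z(1)] z(2) by simp
    have "z \<in> S0" using z by (simp add: S_def)
    from zarg[OF this] have zc: "z = c + of_real \<rho> * (E * (cis (arctan x) * cis (arctan x)))"
      unfolding az E_def cis_mult .
    then have "z - c = of_real \<rho> * (E * (cis (arctan x) * cis (arctan x)))" by (subst zc) simp
    moreover have "z - u = (z - c) - (u - c)" by simp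
    ultimately have "z - u = of_real \<rho> * E * (cis (arctan x) * cis (arctan x) - of_real \<kappa>)"
      unfolding uc' E_def by (simp add: algebra_simps)
    moreover have "cis (arctan x) * cis (arctan x) - of_real \<kappa> =
      of_real ((1 - \<kappa>) * sqrt (1 + (l * x)\<^sup>2) / sqrt (1 + x\<^sup>2)) * (cis (arctan x) * cis (arctan (l * x)))"
    proof -
      have r0: "of_real (sqrt (1 + x\<^sup>2)) \<noteq> (0 :: complex)" by (simp add: add_nonneg_eq_0_iff)
      have r2: "of_real (sqrt (1 + x\<^sup>2)) * of_real (sqrt (1 + x\<^sup>2)) = (1 + of_real x * of_real x :: complex)"
        by (simp flip: of_real_mult add: power2_eq_square)
      have c1: "cis (arctan x) = (1 + \<i> * of_real x) / of_real (sqrt (1 + x\<^sup>2))"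
        using one_plus_ii_arctan[of x] r0 by (simp add: field_simps)
      have lk: "of_real (1 - \<kappa>) * (1 + \<i> * of_real (l * x)) = of_real (1 - \<kappa>) + \<i> * of_real ((1 + \<kappa>) * x)"
        using \<kappa> by (simp add: complex_eq_iff l_def)
      have "(1 + \<i> * of_real x) * (1 + \<i> * of_real x) - of_real \<kappa> * (1 + of_real x * of_real x) =
        (1 + \<i> * of_real x) * (of_real (1 - \<kappa>) * (1 + \<i> * of_real (l * x)))"
        unfolding lk by (simp add: complex_eq_iff algebra_simps)
      then have e: "(1 + \<i> * of_real x) * (1 + \<i> * of_real x) - of_real \<kappa> * (of_real (sqrt (1 + x\<^sup>2)) * of_real (sqrt (1 + x\<^sup>2))) =
        (1 + \<i> * of_real x) * (of_real (1 - \<kappa>) * (of_real (sqrt (1 + (l * x)\<^sup>2)) * cis (arctan (l * x))))"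
        unfolding r2 one_plus_ii_arctan[of "l * x"] .
      have "N / s * (N / s) - k = q * t / s * (N / s * C)" if "s \<noteq> 0" "N * N - k * (s * s) = N * (q * (t * C))" for N s k q t C :: complex
      proof -
        have "N / s * (N / s) - k = (N * N - k * (s * s)) / (s * s)" using that(1) by (simp add: diff_divide_distrib)
        then show ?thesis unfolding that(2) by simp
      qed
      from this[OF r0 e] show ?thesis unfolding c1 of_real_mult of_real_divide .
    qed
    ultimately have zu: "z - u = of_real (\<rho> * ((1 - \<kappa>) * sqrt (1 + (l * x)\<^sup>2) / sqrt (1 + x\<^sup>2))) * cis (arctan x + arctan (l * x) + \<alpha>)"
      by (simp only: E_def cis_mult[symmetric] of_real_mult mult_ac)
    have "\<bar>arctan x + arctan (l * x) + \<alpha>\<bar> \<le> 4 * pi" using ab(1) ab(3)[of x] ab(3)[of "l * x"] by linarith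
    then show ?thesis using z u by (intro in_dirsI[OF _ _ _ zu]) (auto simp: S_def S0_def)
  qed
  \<comment> \<open>\<open>two_pin_bound\<close> wants increasing functions, so it is applied to a
    part \<open>U\<close> of \<open>T\<close> across which the derivative of the sum of arctangents
    has the constant sign \<open>\<sigma>\<close>.\<close>
  have bound: "real (card U) < (real m - 2) / 3" if U: "U \<subseteq> T" and \<sigma>: "\<sigma> = 1 \<or> \<sigma> = - 1"
    and sign: "\<And>s x t. s \<in> U \<Longrightarrow> t \<in> U \<Longrightarrow> s < x \<Longrightarrow> x < t \<Longrightarrow> 0 < \<sigma> * ((1 + l) * (1 + l * x\<^sup>2))" for U and \<sigma> :: real
  proof (cases "U = {}")
    case False
    define \<psi>' where "\<psi>' x = \<sigma> * (1 / (1 + x\<^sup>2) + l / (1 + (l * x)\<^sup>2))" for x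
    have ss: "\<sigma> * (\<sigma> * a) = a" for a using \<sigma> by auto
    have pp: "0 < 1 + x\<^sup>2" for x :: real by (simp add: add_pos_nonneg)
    have psi_pos: "0 < 1 / (1 + x\<^sup>2)" "0 < \<psi>' x" if "s \<in> U" "t \<in> U" "s < x" "x < t" for s x t
    proof -
      show "0 < 1 / (1 + x\<^sup>2)" by (intro divide_pos_pos pp) simp
      have "\<psi>' x = \<sigma> * ((1 + l) * (1 + l * x\<^sup>2)) / ((1 + x\<^sup>2) * (1 + (l * x)\<^sup>2))"
        unfolding \<psi>'_def using arctan_sum_deriv_eq[of x l] by (simp only: times_divide_eq_right)
      also have "\<dots> > 0" by (intro divide_pos_pos mult_pos_pos pp sign[OF that])
      finally show "0 < \<psi>' x" .
    qed
    have psi_pos': "0 < 1 / (1 + x\<^sup>2) \<and> 0 < \<psi>' x" if "s \<in> U" "t \<in> U" "s < x" "x < t" for s x t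
      using psi_pos[OF that] by (rule conjI)
    have d1: "(arctan has_real_derivative 1 / (1 + x\<^sup>2)) (at x)" for x by (auto intro!: derivative_eq_intros simp: field_simps)
    have d2: "((\<lambda>x. \<sigma> * (arctan x + arctan (l * x))) has_real_derivative \<psi>' x) (at x)" for x
      unfolding \<psi>'_def by (auto intro!: derivative_eq_intros simp: divide_inverse)
    have in_w: "1 * arctan x + (\<alpha> + arg w / 2 + pi / 2) \<in> dirs P w" if "x \<in> U" for x by (rule dirw[OF subsetD[OF U that]])
    have in_u: "\<sigma> * (\<sigma> * (arctan x + arctan (l * x))) + \<alpha> \<in> dirs P u" if "x \<in> U" for x unfolding ss by (rule diru[OF subsetD[OF U that]])
    have two: False if xyz: "x < y" "y < z" and gh: "0 < g" "0 < h"
        and eq: "g * \<psi>' x = h * (1 / (1 + x\<^sup>2))" "g * \<psi>' y = h * (1 / (1 + y\<^sup>2))" "g * \<psi>' z = h * (1 / (1 + z\<^sup>2))" for x y z g h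
    proof -
      have "(g * \<sigma> * l + (g * \<sigma> - h) * l\<^sup>2) * x\<^sup>2 + 0 * x + (g * \<sigma> * l + (g * \<sigma> - h)) = 0"
        if "g * \<psi>' x = h * (1 / (1 + x\<^sup>2))" for x
      proof -
        have clear: "g * \<sigma> * (B + l * A) = h * B" if "g * (\<sigma> * (1 / A + l / B)) = h * (1 / A)" "A > 0" "B > 0" for A B :: real
        proof -
          have "(1 / A + l / B) * (A * B) = B + l * A" using that(2,3) by (simp add: distrib_right)
          then have "g * (\<sigma> * (1 / A + l / B)) * (A * B) = g * \<sigma> * (B + l * A)" by (simp only: mult.assoc)
          moreover have "h * (1 / A) * (A * B) = h * B" using that(2) by simp
          ultimately show ?thesis unfolding that(1) by simp
        qed
        have "g * \<sigma> * ((1 + (l * x)\<^sup>2) + l * (1 + x\<^sup>2)) = h * (1 + (l * x)\<^sup>2)"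
          using that unfolding \<psi>'_def by (rule clear[OF _ pp pp])
        then show ?thesis by (simp add: power2_eq_square algebra_simps)
      qed
      from quadratic_three_roots[OF xyz this[OF eq(1)] this[OF eq(2)] this[OF eq(3)]]
      have a: "g * \<sigma> * l + (g * \<sigma> - h) * l\<^sup>2 = 0" and b: "g * \<sigma> - h = - (g * \<sigma> * l)" by auto
      have "g * \<sigma> * l * (1 - l\<^sup>2) = 0" using a unfolding b by (simp add: algebra_simps)
      then show False using gh \<sigma> l1 by auto
    qed
    have fU: "finite U" using U fT finite_subset by blast
    have \<sigma>0: "\<sigma> \<noteq> 0" and wP: "w \<in> P" using \<sigma> w by (auto simp: S0_def)
    have "(real (card U) - 1) ^ 7 \<le> 64 * X ^ 6"
    proof (rule two_pin_bound[where \<phi> = arctan and \<psi> = "\<lambda>x. \<sigma> * (arctan x + arctan (l * x))" and \<phi>' = "\<lambda>x. 1 / (1 + x\<^sup>2)"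
        and \<psi>' = \<psi>' and ?D1.0 = "dirs P w" and ?D2.0 = "dirs P u" and ?\<sigma>1.0 = 1 and ?\<sigma>2.0 = \<sigma>
        and ?\<beta>1.0 = "\<alpha> + arg w / 2 + pi / 2" and ?\<beta>2.0 = \<alpha> and T = U])
    qed (fact fU False card_dirs_diff(2)[OF P] one_neq_zero \<sigma>0 in_w in_u d1 d2 psi_pos' two few[OF wP] few[OF u(1)])+
    then have lt: "(real (card U) - 1) ^ 7 < ((real m - 2) / 3 - 1) ^ 7" using m by linarith
    show ?thesis
    proof (rule ccontr)
      assume "\<not> ?thesis"
      then have "((real m - 2) / 3 - 1) ^ 7 \<le> (real (card U) - 1) ^ 7" using m(2) by (intro power_mono) auto
      then show False using lt by linarith
    qed
  qed (use m in auto)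
  show False
  proof (cases "l > 0")
    case True
    have "0 < 1 * ((1 + l) * (1 + l * x\<^sup>2))" for x using True l1 by (simp add: add_pos_nonneg)
    then have "real (card T) < (real m - 2) / 3" by (intro bound[of T 1]) auto
    moreover have "5 \<le> real m" using m(2) by simp
    ultimately show False using cT by argo
  next
    case False
    then have l: "1 + l < 0" "l < 0" using l1 by auto
    \<comment> \<open>For negative \<open>l\<close> the derivative changes sign at \<open>x0\<close>
      and \<open>- x0\<close>; one of the three pieces has at least a third of the points.\<close>
    define x0 where "x0 = 1 / sqrt (- l)"
    have x0: "x0 > 0" "l * x0\<^sup>2 = - 1" using l by (auto simp: x0_def power_divide)
    have sq: "1 + l * x\<^sup>2 = l * (x\<^sup>2 - x0\<^sup>2)" for x using x0 by (simp add: algebra_simps)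
    have far: "0 < 1 * ((1 + l) * (1 + l * x\<^sup>2))" if "x0 < \<bar>x\<bar>" for x
    proof -
      have "x0\<^sup>2 < x\<^sup>2" using power_strict_mono[OF that, of 2] x0 by simp
      then show ?thesis unfolding sq using l by (simp add: mult_neg_pos mult_neg_neg)
    qed
    have near: "0 < - 1 * ((1 + l) * (1 + l * x\<^sup>2))" if "\<bar>x\<bar> < x0" for x
    proof -
      have "x\<^sup>2 < x0\<^sup>2" using power_strict_mono[OF that, of 2] by simp
      then have "0 < l * (x\<^sup>2 - x0\<^sup>2)" using l by (intro mult_neg_neg) auto
      then show ?thesis unfolding sq using mult_neg_pos[OF l(1)] by simp
    qed
    have "real (card {x \<in> T. x < - x0}) < (real m - 2) / 3" by (rule bound[of _ 1]) (use far in auto)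
    moreover have "real (card {x \<in> T. \<bar>x\<bar> \<le> x0}) < (real m - 2) / 3"
    proof (rule bound[of _ "- 1"])
      fix s x t assume "s \<in> {x \<in> T. \<bar>x\<bar> \<le> x0}" "t \<in> {x \<in> T. \<bar>x\<bar> \<le> x0}" "s < x" "x < t"
      then have "\<bar>x\<bar> < x0" by auto
      then show "0 < - 1 * ((1 + l) * (1 + l * x\<^sup>2))" by (rule near)
    qed auto
    moreover have "real (card {x \<in> T. x0 < x}) < (real m - 2) / 3" by (rule bound[of _ 1]) (use far in auto)
    moreover have "card T \<le> card {x \<in> T. x < - x0} + card {x \<in> T. \<bar>x\<bar> \<le> x0} + card {x \<in> T. x0 < x}"
    proof -
      have "card T \<le> card (({x \<in> T. x < - x0} \<union> {x \<in> T. \<bar>x\<bar> \<le> x0}) \<union> {x \<in> T. x0 < x})"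
        using fT by (intro card_mono) auto
      also have "\<dots> \<le> card ({x \<in> T. x < - x0} \<union> {x \<in> T. \<bar>x\<bar> \<le> x0}) + card {x \<in> T. x0 < x}" by (rule card_Un_le)
      finally show ?thesis using card_Un_le[of "{x \<in> T. x < - x0}" "{x \<in> T. \<bar>x\<bar> \<le> x0}"] by linarith
    qed
    then have "real (card T) \<le> real (card {x \<in> T. x < - x0} + card {x \<in> T. \<bar>x\<bar> \<le> x0} + card {x \<in> T. x0 < x})" by (rule of_nat_mono)
    ultimately show False using cT unfolding of_nat_add by argo
  qed
qed

lemma few_angles_classification:
  "\<exists>c>0. \<exists>n0::nat. \<forall>P. finite P \<longrightarrow> n0 \<le> card P \<longrightarrow> (\<forall>x\<in>P. card (angles P x) < real (card P) powr (1 + c))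
    \<longrightarrow> (\<exists>e p. norm e = 1 \<and> (P - {z. cr e (z - p) = 0} = {} \<or> (\<exists>u. P - {z. cr e (z - p) = 0} = {u})
        \<or> (\<exists>u v. P - {z. cr e (z - p) = 0} = {u, v} \<and> u \<noteq> v \<and> cr e (v - p) = - cr e (u - p) \<and> Re (cnj e * (v - u)) = 0)))
      \<or> (\<exists>z \<rho>. \<rho> > 0 \<and> P - {w. norm (w - z) = \<rho>} \<subseteq> {z})"
proof -
  obtain c0 n0 where c0: "c0 > 0" and rich: "\<And>P. finite P \<Longrightarrow> n0 \<le> card P \<Longrightarrow> (\<forall>x\<in>P. card (angles P x) < real (card P) powr (1 + c0))
    \<Longrightarrow> (\<exists>G. gencircle G \<and> real (card P) powr (23/25) \<le> card (P \<inter> G))" using rich_gencircle by blast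
  define c where "c = min c0 (1/100)"
  have c: "c > 0" "c \<le> c0" "c \<le> 1/100" using c0 by (auto simp: c_def)
  \<comment> \<open>The exponents are \<open>6 * 1.01 = 6.06\<close> against
    \<open>7 * 0.92 = 6.44\<close>; the division by 3 allows for the three pieces in the circle
    case.\<close>
  have "eventually (\<lambda>n::nat. 5 \<le> real n powr (23/25) \<and> 1 \<le> real n
    \<and> 64 * (76 * real n powr (101/100)) ^ 6 < ((real n powr (23/25) - 2) / 3 - 1) ^ 7) at_top"
    by (intro eventually_conj; real_asymp)
  then obtain n1 where n1: "\<And>n. n1 \<le> n \<Longrightarrow> 5 \<le> real n powr (23/25) \<and> 1 \<le> real n
    \<and> 64 * (76 * real n powr (101/100)) ^ 6 < ((real n powr (23/25) - 2) / 3 - 1) ^ 7"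
    unfolding eventually_at_top_linorder by blast
  show ?thesis
  proof (rule exI[of _ c], intro conjI c(1), rule exI[of _ "max n0 n1"], intro allI impI)
    fix P :: "complex set"
    assume P: "finite P" and n: "max n0 n1 \<le> card P" and ang: "\<forall>x\<in>P. card (angles P x) < real (card P) powr (1 + c)"
    define x where "x = real (card P)"
    define X where "X = 76 * x powr (101/100)"
    have N: "5 \<le> x powr (23/25)" "1 \<le> x" "64 * X ^ 6 < ((x powr (23/25) - 2) / 3 - 1) ^ 7"
      using n1[of "card P"] n by (auto simp: x_def X_def)
    have pw: "x powr (1 + c) \<le> x powr (1 + c0)" "x powr (1 + c) \<le> x powr (101/100)" using N(2) c by (auto intro!: powr_mono)
    have few: "real (card (dirs P q + uminus ` dirs P q)) \<le> X" if q: "q \<in> P" for q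
    proof -
      have "1 \<le> x powr (101/100)" using N(2) by (intro ge_one_powr_ge_zero) auto
      moreover have "real (card (angles P q)) \<le> x powr (101/100)" using ang q pw by (fastforce simp: x_def)
      moreover have "real (card (dirs P q + uminus ` dirs P q)) \<le> real (38 * (card (angles P q) + 1))"
        by (rule of_nat_mono[OF card_dirs_diff(1)[OF P]])
      ultimately show ?thesis unfolding X_def by simp
    qed
    have "\<forall>q\<in>P. card (angles P q) < real (card P) powr (1 + c0)" using ang pw(1) by (fastforce simp: x_def)
    then obtain G where G: "gencircle G" "x powr (23/25) \<le> card (P \<inter> G)" using rich[OF P] n by (auto simp: x_def)
    define m where "m = card (P \<inter> G)"
    have "((x powr (23/25) - 2) / 3 - 1) ^ 7 \<le> ((real m - 2) / 3 - 1) ^ 7" using G(2) N(1) by (intro power_mono) (auto simp: m_def)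
    then have big: "64 * X ^ 6 < ((real m - 2) / 3 - 1) ^ 7" using N(3) by linarith
    have "5 \<le> real m" using N(1) G(2) by (simp add: m_def)
    then have m5: "5 \<le> m" by simp
    have "((real m - 2) / 3 - 1) ^ 7 \<le> (real m - 1) ^ 7" using \<open>5 \<le> real m\<close> by (intro power_mono) auto
    then have big': "64 * X ^ 6 < (real m - 1) ^ 7" using big by linarith
    from G(1) consider (line) p e where "norm e = 1" "G = {z. cr e (z - p) = 0}"
      | (circle) z \<rho> where "\<rho> > 0" "G = {w. norm (w - z) = \<rho>}" unfolding gencircle_def by blast
    then show "(\<exists>e p. norm e = 1 \<and> (P - {z. cr e (z - p) = 0} = {} \<or> (\<exists>u. P - {z. cr e (z - p) = 0} = {u})
        \<or> (\<exists>u v. P - {z. cr e (z - p) = 0} = {u, v} \<and> u \<noteq> v \<and> cr e (v - p) = - cr e (u - p) \<and> Re (cnj e * (v - u)) = 0)))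
      \<or> (\<exists>z \<rho>. \<rho> > 0 \<and> P - {w. norm (w - z) = \<rho>} \<subseteq> {z})"
    proof cases
      case line
      have mirror: "cr e (v - p) = - cr e (u - p) \<and> Re (cnj e * (v - u)) = 0" if "u \<in> P - G" "v \<in> P - G" "u \<noteq> v" for u v
        using that m5 big' line by (intro off_line_pins[OF P line(1) _ _ _ _ _ few]) (auto simp: m_def)
      have "P - G = {} \<or> (\<exists>u. P - G = {u}) \<or> (\<exists>u v. P - G = {u, v} \<and> u \<noteq> v)"
      proof (rule ccontr)
        assume none: "\<not> ?thesis"
        then obtain u where u: "u \<in> P - G" by blast
        then obtain v where v: "v \<in> P - G" "u \<noteq> v" using none by blast
        then obtain w where w: "w \<in> P - G" "w \<noteq> u" "w \<noteq> v" using none u by blast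
        \<comment> \<open>Three points off the line would have pairwise opposite heights, hence
          height 0.\<close>
        have "cr e (v - p) = - cr e (u - p)" "cr e (w - p) = - cr e (u - p)" "cr e (w - p) = - cr e (v - p)"
          using mirror[of u v] mirror[of u w] mirror[of v w] u v w by auto
        then have "cr e (v - p) = 0" by linarith
        then show False using v line by simp
      qed
      moreover have "cr e (v - p) = - cr e (u - p) \<and> Re (cnj e * (v - u)) = 0" if "P - G = {u, v}" "u \<noteq> v" for u v
        using mirror[of u v] that by simp
      ultimately have "P - G = {} \<or> (\<exists>u. P - G = {u}) \<or>
        (\<exists>u v. P - G = {u, v} \<and> u \<noteq> v \<and> cr e (v - p) = - cr e (u - p) \<and> Re (cnj e * (v - u)) = 0)" by metis
      with line(1) show ?thesis unfolding line(2) 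
        by - (rule disjI1, rule exI[of _ e], rule exI[of _ p], rule conjI)
    next
      case circle
      have "u = z" if u: "u \<in> P - G" for u
        using u m5 big circle by (intro off_circle_pin_is_centre[OF P circle(1) _ _ few, of u z m]) (auto simp: m_def)
      then show ?thesis using circle by blast
    qed
  qed
qed

section \<open>The real plane\<close>

definition to_complex :: "real^2 \<Rightarrow> complex" where
  "to_complex x = Complex (x $ 1) (x $ 2)"

lemma to_complex_inj: "inj to_complex"
  by (auto simp: inj_def to_complex_def vec_eq_iff forall_2)

lemma to_complex_surj: "\<exists>x. to_complex x = z"
  by (rule exI[of _ "vector [Re z, Im z]"]) (simp add: to_complex_def complex_eq_iff)

lemma to_complex_diff: "to_complex (x - y) = to_complex x - to_complex y"
  by (simp add: to_complex_def complex_eq_iff)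

lemma norm_to_complex: "norm (to_complex x) = norm x"
  by (simp add: to_complex_def norm_eq_sqrt_inner inner_vec_def sum_2 cmod_def inner_complex_def power2_eq_square)

lemma pinned_angles_eq: "pinned_angles q P = angles (to_complex ` P) (to_complex q)"
proof -
  define g where "g p r = arccos (Re (cnj (p - to_complex q) * (r - to_complex q)) / (norm (p - to_complex q) * norm (r - to_complex q)))" for p r
  have "(x \<bullet> y) = Re (cnj (to_complex x) * to_complex y)" for x y
    by (simp add: to_complex_def inner_vec_def sum_2)
  then have eq: "angle_at p q r = g (to_complex p) (to_complex r)" for p r
    unfolding angle_at_def g_def by (simp add: norm_to_complex flip: to_complex_diff)
  note ij = inj_eq[OF to_complex_inj]
  show ?thesis unfolding pinned_angles_def angles_def g_def[symmetric]
  proof (intro equalityI subsetI)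
    fix t assume "t \<in> {angle_at p q r |p r. p \<in> P - {q} \<and> r \<in> P - {q} \<and> p \<noteq> r}"
    then obtain p r where "p \<in> P - {q} \<and> r \<in> P - {q} \<and> p \<noteq> r" "t = angle_at p q r" by blast
    then show "t \<in> {g p r |p r. p \<in> to_complex ` P - {to_complex q} \<and> r \<in> to_complex ` P - {to_complex q} \<and> p \<noteq> r}"
      by (intro CollectI exI[of _ "to_complex p"] exI[of _ "to_complex r"]) (auto simp: ij eq)
  qed (auto simp: ij eq)
qed

lemma closest_point_hyperplane:
  fixes a :: "'a::euclidean_space"
  assumes "norm a = 1"
  shows "closest_point {x. a \<bullet> x = b} x = x - (a \<bullet> x - b) *\<^sub>R a"
proof (rule closest_point_unique[symmetric])
  have aa: "a \<bullet> a = 1" using assms by (simp add: norm_eq_1)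
  show "x - (a \<bullet> x - b) *\<^sub>R a \<in> {x. a \<bullet> x = b}" by (simp add: inner_diff_right aa)
  show "\<forall>z\<in>{x. a \<bullet> x = b}. dist x (x - (a \<bullet> x - b) *\<^sub>R a) \<le> dist x z"
  proof
    fix z assume "z \<in> {x. a \<bullet> x = b}"
    then have "\<bar>a \<bullet> x - b\<bar> = \<bar>a \<bullet> (x - z)\<bar>" by (simp add: inner_diff_right)
    also have "\<dots> \<le> norm (x - z)" using Cauchy_Schwarz_ineq2[of a "x - z"] assms by simp
    finally show "dist x (x - (a \<bullet> x - b) *\<^sub>R a) \<le> dist x z" using assms by (simp add: dist_norm)
  qed
qed (auto simp: convex_hyperplane closed_hyperplane)

theorem theorem1:
  shows "\<exists>c::real. c > 0 \<and> (\<exists>n0::nat. \<forall>n\<ge>n0. \<forall>P::(real^2) set. finite P \<and> card P = n \<longrightarrow>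
    (\<exists>q\<in>P. real (card (pinned_angles q P)) \<ge> real n powr (1 + c))
    \<or> (\<exists>L. is_line L \<and> P \<subseteq> L)
    \<or> (\<exists>L. is_line L \<and> card (P \<inter> L) = n - 1)
    \<or> (\<exists>L x y. is_line L \<and> card (P \<inter> L) = n - 2 \<and> P - L = {x, y} \<and> x \<noteq> y \<and> y = reflection_in L x)
    \<or> (\<exists>z r. r > 0 \<and> P \<subseteq> sphere z r)
    \<or> (\<exists>z r. r > 0 \<and> card (P \<inter> sphere z r) = n - 1 \<and> z \<in> P))"
proof -
  obtain c :: real and n0 :: nat where c: "c > 0" and cls: "\<And>P. finite P \<Longrightarrow> n0 \<le> card P \<Longrightarrow> (\<forall>x\<in>P. card (angles P x) < real (card P) powr (1 + c))
    \<Longrightarrow> (\<exists>e p. norm e = 1 \<and> (P - {z. cr e (z - p) = 0} = {} \<or> (\<exists>u. P - {z. cr e (z - p) = 0} = {u})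
        \<or> (\<exists>u v. P - {z. cr e (z - p) = 0} = {u, v} \<and> u \<noteq> v \<and> cr e (v - p) = - cr e (u - p) \<and> Re (cnj e * (v - u)) = 0)))
      \<or> (\<exists>z \<rho>. \<rho> > 0 \<and> P - {w. norm (w - z) = \<rho>} \<subseteq> {z})"
    using few_angles_classification by blast
  show ?thesis
  proof (rule exI[of _ c], intro conjI c, rule exI[of _ n0], intro allI impI)
    fix n :: nat and P :: "(real^2) set"
    assume n: "n0 \<le> n" and P: "finite P \<and> card P = n"
    have fP: "finite P" and cP: "card P = n" using P by auto
    define F where "F = to_complex"
    have inj: "inj F" unfolding F_def by (rule to_complex_inj)
    have pre: "P - {x. F x \<in> G} = F -` (F ` P - G)" for G using inj by (auto simp: inj_eq)
    have one: "F -` {F a} = {a}" "F -` {F a, F b} = {a, b}" for a b using inj by (auto simp: inj_eq)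
    have cd: "card (P \<inter> L) = n - card (P - L)" for L
      using card_Int_Diff[OF fP, of L] cP by simp
    consider (rich) q where "q \<in> P" "real n powr (1 + c) \<le> real (card (pinned_angles q P))"
      | (poor) "\<forall>q\<in>P. real (card (pinned_angles q P)) < real n powr (1 + c)" by (meson not_le)
    then show "(\<exists>q\<in>P. real (card (pinned_angles q P)) \<ge> real n powr (1 + c))
      \<or> (\<exists>L. is_line L \<and> P \<subseteq> L)
      \<or> (\<exists>L. is_line L \<and> card (P \<inter> L) = n - 1)
      \<or> (\<exists>L x y. is_line L \<and> card (P \<inter> L) = n - 2 \<and> P - L = {x, y} \<and> x \<noteq> y \<and> y = reflection_in L x)
      \<or> (\<exists>z r. r > 0 \<and> P \<subseteq> sphere z r)
      \<or> (\<exists>z r. r > 0 \<and> card (P \<inter> sphere z r) = n - 1 \<and> z \<in> P)"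
    proof cases
      case poor
      have cF: "card (F ` P) = n" using cP inj by (simp add: card_image inj_on_subset)
      have "\<forall>x\<in>F ` P. card (angles (F ` P) x) < real (card (F ` P)) powr (1 + c)"
        using poor unfolding cF by (auto simp: pinned_angles_eq F_def)
      then consider (line) e p where "norm e = 1"
          "F ` P - {z. cr e (z - p) = 0} = {} \<or> (\<exists>u. F ` P - {z. cr e (z - p) = 0} = {u})
          \<or> (\<exists>u v. F ` P - {z. cr e (z - p) = 0} = {u, v} \<and> u \<noteq> v \<and> cr e (v - p) = - cr e (u - p) \<and> Re (cnj e * (v - u)) = 0)"
        | (circle) z \<rho> where "\<rho> > 0" "F ` P - {w. norm (w - z) = \<rho>} \<subseteq> {z}"
        using cls[of "F ` P"] fP n cF by blast
      then show ?thesis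
      proof cases
        case line
        \<comment> \<open>The unit normal \<open>\<i> * e\<close> as a vector, so that
          \<open>a \<bullet> x - b\<close> is the signed distance
          \<open>cr e (F x - p)\<close>.\<close>
        define a :: "real^2" where "a = vector [- Im e, Re e]"
        define b where "b = Re e * Im p - Im e * Re p"
        define L where "L = {x. a \<bullet> x = b}"
        have e2: "(Re e)\<^sup>2 + (Im e)\<^sup>2 = 1" using line(1) by (metis cmod_power2 power_one)
        then have na: "norm a = 1" by (simp add: a_def norm_eq_1 inner_vec_def sum_2 power2_eq_square)
        then have "a \<noteq> 0" by auto
        then have "is_line L" unfolding is_line_def L_def
          by (auto simp: affine_hyperplane aff_dim_hyperplane)
        have h: "a \<bullet> x - b = cr e (F x - p)" for x
          by (simp add: a_def b_def F_def to_complex_def cr_eq inner_vec_def sum_2 algebra_simps)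
        have L: "L = {x. F x \<in> {z. cr e (z - p) = 0}}" unfolding L_def mem_Collect_eq h[symmetric] by simp
        from line(2) consider (none) "F ` P - {z. cr e (z - p) = 0} = {}" | (single) u where "F ` P - {z. cr e (z - p) = 0} = {u}"
          | (double) u v where "F ` P - {z. cr e (z - p) = 0} = {u, v}" "u \<noteq> v" "cr e (v - p) = - cr e (u - p)" "Re (cnj e * (v - u)) = 0"
          by blast
        then show ?thesis
        proof cases
          case none
          then have "P \<subseteq> L" unfolding L by blast
          then show ?thesis using \<open>is_line L\<close> by blast
        next
          case single
          then obtain x where "u = F x" by blast
          then have "P - L = {x}" unfolding L pre single by (simp add: one)
          then have "card (P \<inter> L) = n - 1" using cd[of L] by simp
          then show ?thesis using \<open>is_line L\<close> by blast
        next
          case double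
          then obtain x y where xy: "u = F x" "v = F y" by blast
          then have PL: "P - L = {x, y}" unfolding L pre double(1) by (simp add: one)
          have ne: "x \<noteq> y" using double(2) xy by auto
          have "card (P \<inter> L) = n - 2" using cd[of L] PL ne by simp
          moreover have "y = reflection_in L x"
          proof -
            define s where "s = cr e (F x - p)"
            \<comment> \<open>\<open>d\<close> has component 0 along \<open>e\<close> and
              \<open>- 2 * s\<close> across it, which determines it as \<open>e\<close> is a unit
              vector.\<close>
            define d where "d = F y - F x"
            have "cr e (F y - p) = cr e (F x - p) + cr e d" by (simp add: d_def cr_add_right[symmetric])
            then have d: "Re e * Im d - Im e * Re d = - 2 * s" "Re e * Re d + Im e * Im d = 0"
              using double(3,4) xy by (simp_all add: s_def d_def cr_eq)
            have "Re d = ((Re e)\<^sup>2 + (Im e)\<^sup>2) * Re d" "Im d = ((Re e)\<^sup>2 + (Im e)\<^sup>2) * Im d" using e2 by simp_all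
            then have "Re d = Re e * (Re e * Re d + Im e * Im d) - Im e * (Re e * Im d - Im e * Re d)"
              "Im d = Im e * (Re e * Re d + Im e * Im d) + Re e * (Re e * Im d - Im e * Re d)"
              by (simp_all add: algebra_simps power2_eq_square)
            then have "Re d = 2 * s * Im e" "Im d = - 2 * s * Re e" unfolding d by simp_all
            then have "y $ 1 = x $ 1 + 2 * s * Im e" "y $ 2 = x $ 2 - 2 * s * Re e"
              by (simp_all add: d_def F_def to_complex_def)
            moreover have "reflection_in L x = x - (2 * s) *\<^sub>R a"
              unfolding reflection_in_def L_def closest_point_hyperplane[OF na] h s_def[symmetric]
              by (simp add: scaleR_2 algebra_simps)
            ultimately show ?thesis by (simp add: vec_eq_iff forall_2 a_def)
          qed
          ultimately show ?thesis using \<open>is_line L\<close> PL ne by blast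
        qed
      next
        case circle
        obtain z' where z': "F z' = z" using to_complex_surj unfolding F_def by blast
        have sph: "sphere z' \<rho> = {x. F x \<in> {w. norm (w - z) = \<rho>}}"
          unfolding z'[symmetric] F_def mem_Collect_eq to_complex_diff[symmetric] norm_to_complex
          by (auto simp: dist_norm norm_minus_commute)
        have PS: "P - sphere z' \<rho> \<subseteq> {z'}" unfolding sph pre using circle(2) inj by (auto simp: z'[symmetric] inj_eq)
        show ?thesis
        proof (cases "P \<subseteq> sphere z' \<rho>")
          case False
          then have "P - sphere z' \<rho> = {z'}" using PS by blast
          then have "z' \<in> P" "card (P \<inter> sphere z' \<rho>) = n - 1" using cd[of "sphere z' \<rho>"] by auto
          then show ?thesis using circle(1) by blast
        qed (use circle(1) in blast)
      qed
    qed blast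
  qed
qed

end
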